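(* Let $v_h,u_h$ be the numerical solutions of the semi-discrete discontinuous Galerkin scheme described in the context for the one-dimensional stochastic Maxwell system $dv=-u_x\,dt+f(x,t,u,v)\,dW_t$, $du=-v_x\,dt+g(x,t,u,v)\,dW_t$ with periodic boundary conditions, with numerical fluxes $$\widehat u_h=\{u_h\}+\alpha[u_h]-\beta_1[v_h],\qquad \widehat v_h=\{v_h\}-\alpha[v_h]-\beta_2[u_h],$$ where $\alpha\in\mathbb R$ and $\beta_1,\beta_2\ge 0$. Let $\mathcal P(f)$ and $\mathcal P(g)$ be the $L^2$ projections of $f$ and $g$ (evaluated at the numerical solution, i.e. of $f(\cdot,s,u_h,v_h)$ and $g(\cdot,s,u_h,v_h)$) onto $V_h^k$. Then $$\mathbb E\Big(\|u_h(x,t)\|^2+\|v_h(x,t)\|^2\Big)\le \|u_h(x,0)\|^2+\|v_h(x,0)\|^2+\int_0^t\mathbb E\Big(\|\mathcal P(f)\|^2+\|\mathcal P(g)\|^2\Big)ds .$$ Moreover, equality holds when $\beta_1=\beta_2=0$.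
   Context: $W_t$ is a standard one-dimensional Brownian motion on a probability space $(\Omega,\mathcal F,\mathbb P)$ with its filtration; stochastic integrals are Itô integrals. The real-valued functions $f,g$ of $(x,t,u,v)$ satisfy, for some constant $C$ and all arguments, $|f(x,t,u_1,v)-f(x,t,u_2,v)|+|g(x,t,u_1,v)-g(x,t,u_2,v)|\le C|u_1-u_2|$, $|f(x,t,u,v_1)-f(x,t,u,v_2)|+|g(x,t,u,v_1)-g(x,t,u,v_2)|\le C|v_1-v_2|$, $|f(x,t,u,v)|+|g(x,t,u,v)|\le C(1+|u|+|v|)$. Mesh and space: the bounded interval $I$ is partitioned into cells $I_j=[x_{j-1/2},x_{j+1/2}]$, $j=1,\dots,N$, with $h_j=x_{j+1/2}-x_{j-1/2}$, $h=\max_j h_j$, and $h/h_j$ bounded over all $j$ during mesh refinement. $V_h^k=\{w_h: w_h|_{I_j}\in P^k(I_j),\ j=1,\dots,N\}$, where $P^k(I_j)$ is the space of polynomials of degree at most $k$ on $I_j$. At cell interfaces $w_h^+$ and $w_h^-$ are the limits from the right and left, $\{w_h\}=(w_h^++w_h^-)/2$, $[w_h]=w_h^+-w_h^-$; the endpoints of $I$ are identified by periodicity. $\|\cdot\|$ is the $L^2(I)$ norm. Scheme: $u_h(\omega,x,t),v_h(\omega,x,t)$ are adapted processes with values in $V_h^k$, with deterministic initial data in $V_h^k$, such that for all $\varphi,\widetilde\varphi\in V_h^k$ and all $j$, $$\int_{I_j}dv_h\,\varphi\,dx=\Big(\int_{I_j}u_h\varphi_x\,dx-(\widehat u_h\varphi^-)_{j+\frac12}+(\widehat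 u_h\varphi^+)_{j-\frac12}\Big)dt+\int_{I_j}f(x,t,u_h,v_h)\varphi\,dx\,dW_t,$$ $$\int_{I_j}du_h\,\widetilde\varphi\,dx=\Big(\int_{I_j}v_h\widetilde\varphi_x\,dx-(\widehat v_h\widetilde\varphi^-)_{j+\frac12}+(\widehat v_h\widetilde\varphi^+)_{j-\frac12}\Big)dt+\int_{I_j}g(x,t,u_h,v_h)\widetilde\varphi\,dx\,dW_t,$$ understood in integrated Itô form. *)

theory Defs
  imports "HOL-Probability.Probability" "HOL-Computational_Algebra.Polynomial"
begin

section \<open>Brownian motion and the Ito integral\<close>

text \<open>Time is the half-line \<open>t \<ge> 0\<close>; a filtration indexed by all reals is only used there
  (for \<open>t < 0\<close> one may take \<open>F t = F 0\<close>).\<close>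

definition brownian_motion ::
  "'w measure \<Rightarrow> (real \<Rightarrow> 'w measure) \<Rightarrow> (real \<Rightarrow> 'w \<Rightarrow> real) \<Rightarrow> bool" where
  "brownian_motion M F W \<longleftrightarrow>
     prob_space M \<and>
     filtration (space M) F \<and>
     (\<forall>t\<ge>0. subalgebra M (F t)) \<and>
     (\<forall>t\<ge>0. W t \<in> borel_measurable (F t)) \<and>
     (AE \<omega> in M. W 0 \<omega> = 0) \<and>
     (AE \<omega> in M. continuous_on {0..} (\<lambda>t. W t \<omega>)) \<and>
     (\<forall>s t. 0 \<le> s \<longrightarrow> s < t \<longrightarrow>
        distributed M lborel (\<lambda>\<omega>. W t \<omega> - W s \<omega>) (normal_density 0 (sqrt (t - s))) \<and>
        prob_space.indep_set M (sets (F s))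
          (sets (vimage_algebra (space M) (\<lambda>\<omega>. W t \<omega> - W s \<omega>) borel)))"

definition progressive :: "(real \<Rightarrow> 'w measure) \<Rightarrow> (real \<Rightarrow> 'w \<Rightarrow> real) \<Rightarrow> bool" where
  "progressive F H \<longleftrightarrow>
     (\<forall>t\<ge>0. (\<lambda>(s, \<omega>). H s \<omega>) \<in> borel_measurable (restrict_space borel {0..t} \<Otimes>\<^sub>M F t))"

definition tendsto_in_probability ::
  "'w measure \<Rightarrow> (nat \<Rightarrow> 'w \<Rightarrow> real) \<Rightarrow> ('w \<Rightarrow> real) \<Rightarrow> bool" where
  "tendsto_in_probability M X Z \<longleftrightarrow>
     (\<forall>e>0. (\<lambda>n. measure M {\<omega> \<in> space M. \<bar>X n \<omega> - Z \<omega>\<bar> > e}) \<longlonglongrightarrow> 0)"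

text \<open>The triple \<open>(m, \<tau>, \<xi>)\<close> stands for the simple process on \<open>[0, t]\<close> that takes the value
  \<open>\<xi> i\<close> on \<open>(\<tau> i, \<tau> (i + 1)]\<close>, where \<open>0 = \<tau> 0 < \<dots> < \<tau> m = t\<close>.\<close>

definition simple_process ::
  "(real \<Rightarrow> 'w measure) \<Rightarrow> real \<Rightarrow> nat \<Rightarrow> (nat \<Rightarrow> real) \<Rightarrow> (nat \<Rightarrow> 'w \<Rightarrow> real) \<Rightarrow> bool" where
  "simple_process F t m \<tau> \<xi> \<longleftrightarrow>
     \<tau> 0 = 0 \<and> \<tau> m = t \<and> (\<forall>i<m. \<tau> i < \<tau> (Suc i)) \<and>
     (\<forall>i<m. \<xi> i \<in> borel_measurable (F (\<tau> i)) \<and> (\<exists>B. \<forall>\<omega>\<in>space (F (\<tau> i)). \<bar>\<xi> i \<omega>\<bar> \<le> B))"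

definition simple_value ::
  "nat \<Rightarrow> (nat \<Rightarrow> real) \<Rightarrow> (nat \<Rightarrow> 'w \<Rightarrow> real) \<Rightarrow> real \<Rightarrow> 'w \<Rightarrow> real" where
  "simple_value m \<tau> \<xi> s \<omega> = (\<Sum>i<m. \<xi> i \<omega> * indicator {\<tau> i<..\<tau> (Suc i)} s)"

definition simple_integral ::
  "(real \<Rightarrow> 'w \<Rightarrow> real) \<Rightarrow> nat \<Rightarrow> (nat \<Rightarrow> real) \<Rightarrow> (nat \<Rightarrow> 'w \<Rightarrow> real) \<Rightarrow> 'w \<Rightarrow> real" where
  "simple_integral W m \<tau> \<xi> \<omega> = (\<Sum>i<m. \<xi> i \<omega> * (W (\<tau> (Suc i)) \<omega> - W (\<tau> i) \<omega>))"

text \<open>\<open>has_ito_integral M F W H t Z\<close>: almost surely, \<open>Z\<close> is the integral of \<open>H\<close> against \<open>W\<close>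
  over \<open>[0, t]\<close>. This is the integral for all progressively measurable \<open>H\<close> whose square is
  almost surely integrable over \<open>[0, t]\<close>; no moment of \<open>H\<close> is assumed to be finite.\<close>

definition has_ito_integral ::
  "'w measure \<Rightarrow> (real \<Rightarrow> 'w measure) \<Rightarrow> (real \<Rightarrow> 'w \<Rightarrow> real) \<Rightarrow>
   (real \<Rightarrow> 'w \<Rightarrow> real) \<Rightarrow> real \<Rightarrow> ('w \<Rightarrow> real) \<Rightarrow> bool" where
  "has_ito_integral M F W H t Z \<longleftrightarrow>
     progressive F H \<and>
     (AE \<omega> in M. set_integrable lborel {0..t} (\<lambda>s. (H s \<omega>)\<^sup>2)) \<and>
     Z \<in> borel_measurable M \<and>
     (\<exists>m \<tau> \<xi>.
        (\<forall>n. simple_process F t (m n) (\<tau> n) (\<xi> n)) \<and>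
        tendsto_in_probability M
          (\<lambda>n \<omega>. LINT s:{0..t}|lborel. (simple_value (m n) (\<tau> n) (\<xi> n) s \<omega> - H s \<omega>)\<^sup>2) (\<lambda>_. 0) \<and>
        tendsto_in_probability M (\<lambda>n. simple_integral W (m n) (\<tau> n) (\<xi> n)) Z)"

section \<open>Meshes and the discontinuous Galerkin space\<close>

text \<open>The node \<open>xs j\<close> is \<open>x\<^bsub>j+1/2\<^esub>\<close>, so the \<open>j\<close>-th cell is \<open>[xs (j - 1), xs j]\<close> with
  \<open>1 \<le> j \<le> N\<close>, and the interval \<open>I\<close> is \<open>[xs 0, xs N]\<close>. The number \<open>\<rho>\<close> is the bound on
  \<open>h / h\<^sub>j\<close> that is kept fixed during mesh refinement.\<close>

definition cell :: "(nat \<Rightarrow> real) \<Rightarrow> nat \<Rightarrow> real set" where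
  "cell xs j = {xs (j - 1)..xs j}"

definition cell_length :: "(nat \<Rightarrow> real) \<Rightarrow> nat \<Rightarrow> real" where
  "cell_length xs j = xs j - xs (j - 1)"

definition mesh_size :: "nat \<Rightarrow> (nat \<Rightarrow> real) \<Rightarrow> real" where
  "mesh_size N xs = Max (cell_length xs ` {1..N})"

definition regular_mesh :: "real \<Rightarrow> nat \<Rightarrow> (nat \<Rightarrow> real) \<Rightarrow> bool" where
  "regular_mesh \<rho> N xs \<longleftrightarrow>
     N \<ge> 1 \<and> (\<forall>j\<in>{1..N}. xs (j - 1) < xs j) \<and>
     (\<forall>j\<in>{1..N}. mesh_size N xs / cell_length xs j \<le> \<rho>)"

definition off_nodes :: "nat \<Rightarrow> (nat \<Rightarrow> real) \<Rightarrow> real set" where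
  "off_nodes N xs = (\<Union>j\<in>{1..N}. interior (cell xs j))"

text \<open>Elements of \<open>V\<^sub>h\<^sup>k\<close> are double-valued at the nodes. They are represented by functions whose
  values at the nodes (and outside \<open>I\<close>) are arbitrary and play no role: at the nodes only the
  one-sided limits are used.\<close>

definition Vh :: "nat \<Rightarrow> (nat \<Rightarrow> real) \<Rightarrow> nat \<Rightarrow> (real \<Rightarrow> real) set" where
  "Vh N xs k =
     {w. \<forall>j\<in>{1..N}. \<exists>p. degree p \<le> k \<and> (\<forall>x\<in>interior (cell xs j). w x = poly p x)}"

text \<open>One-sided limits at the node \<open>xs j\<close>, \<open>0 \<le> j \<le> N\<close>, with \<open>xs 0\<close> and \<open>xs N\<close> identified.\<close>

definition trace_minus :: "nat \<Rightarrow> (nat \<Rightarrow> real) \<Rightarrow> (real \<Rightarrow> real) \<Rightarrow> nat \<Rightarrow> real" where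
  "trace_minus N xs w j = Lim (at_left (xs (if j = 0 then N else j))) w"

definition trace_plus :: "nat \<Rightarrow> (nat \<Rightarrow> real) \<Rightarrow> (real \<Rightarrow> real) \<Rightarrow> nat \<Rightarrow> real" where
  "trace_plus N xs w j = Lim (at_right (xs (if j = N then 0 else j))) w"

definition avg :: "nat \<Rightarrow> (nat \<Rightarrow> real) \<Rightarrow> (real \<Rightarrow> real) \<Rightarrow> nat \<Rightarrow> real" where
  "avg N xs w j = (trace_plus N xs w j + trace_minus N xs w j) / 2"

definition jump :: "nat \<Rightarrow> (nat \<Rightarrow> real) \<Rightarrow> (real \<Rightarrow> real) \<Rightarrow> nat \<Rightarrow> real" where
  "jump N xs w j = trace_plus N xs w j - trace_minus N xs w j"

definition L2_norm :: "nat \<Rightarrow> (nat \<Rightarrow> real) \<Rightarrow> (real \<Rightarrow> real) \<Rightarrow> real" where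
  "L2_norm N xs w = sqrt (LINT x:{xs 0..xs N}|lborel. (w x)\<^sup>2)"

text \<open>The projection is determined up to the irrelevant values described at \<open>Vh\<close>.\<close>

definition L2_proj :: "nat \<Rightarrow> (nat \<Rightarrow> real) \<Rightarrow> nat \<Rightarrow> (real \<Rightarrow> real) \<Rightarrow> real \<Rightarrow> real" where
  "L2_proj N xs k w =
     (SOME q. q \<in> Vh N xs k \<and>
        (\<forall>\<phi>\<in>Vh N xs k. (LINT x:{xs 0..xs N}|lborel. q x * \<phi> x)
                       = (LINT x:{xs 0..xs N}|lborel. w x * \<phi> x)))"

section \<open>The semi-discrete scheme\<close>

definition flux_u ::
  "nat \<Rightarrow> (nat \<Rightarrow> real) \<Rightarrow> real \<Rightarrow> real \<Rightarrow> (real \<Rightarrow> real) \<Rightarrow> (real \<Rightarrow> real) \<Rightarrow> nat \<Rightarrow> real" where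
  "flux_u N xs \<alpha> \<beta>1 u v j = avg N xs u j + \<alpha> * jump N xs u j - \<beta>1 * jump N xs v j"

definition flux_v ::
  "nat \<Rightarrow> (nat \<Rightarrow> real) \<Rightarrow> real \<Rightarrow> real \<Rightarrow> (real \<Rightarrow> real) \<Rightarrow> (real \<Rightarrow> real) \<Rightarrow> nat \<Rightarrow> real" where
  "flux_v N xs \<alpha> \<beta>2 u v j = avg N xs v j - \<alpha> * jump N xs v j - \<beta>2 * jump N xs u j"

text \<open>The drift of the scheme on cell \<open>j\<close>, for a state \<open>w\<close> with numerical flux \<open>w_hat\<close>.\<close>

definition dg_drift ::
  "nat \<Rightarrow> (nat \<Rightarrow> real) \<Rightarrow> (real \<Rightarrow> real) \<Rightarrow> (nat \<Rightarrow> real) \<Rightarrow> (real \<Rightarrow> real) \<Rightarrow> nat \<Rightarrow> real" where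
  "dg_drift N xs w w_hat \<phi> j =
     (LINT x:cell xs j|lborel. w x * deriv \<phi> x)
     - w_hat j * trace_minus N xs \<phi> j
     + w_hat (j - 1) * trace_plus N xs \<phi> (j - 1)"

text \<open>\<open>y\<close> satisfies \<open>dy = b dt + H dW\<close> in integrated form.\<close>

definition ito_equation ::
  "'w measure \<Rightarrow> (real \<Rightarrow> 'w measure) \<Rightarrow> (real \<Rightarrow> 'w \<Rightarrow> real) \<Rightarrow>
   (real \<Rightarrow> 'w \<Rightarrow> real) \<Rightarrow> (real \<Rightarrow> 'w \<Rightarrow> real) \<Rightarrow> (real \<Rightarrow> 'w \<Rightarrow> real) \<Rightarrow> bool" where
  "ito_equation M F W y b H \<longleftrightarrow>
     (\<forall>t\<ge>0.
        (AE \<omega> in M. set_integrable lborel {0..t} (\<lambda>s. b s \<omega>)) \<and>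
        (\<exists>Z. has_ito_integral M F W H t Z \<and>
           (AE \<omega> in M. y t \<omega> - y 0 \<omega> = (LINT s:{0..t}|lborel. b s \<omega>) + Z \<omega>)))"

text \<open>A process is written \<open>u \<omega> x t\<close>. Measurability in \<open>(t, \<omega>)\<close> is required pointwise off the
  nodes, which for a process with values in \<open>V\<^sub>h\<^sup>k\<close> amounts to measurability of its coefficients.\<close>

definition Vh_process ::
  "'w measure \<Rightarrow> (real \<Rightarrow> 'w measure) \<Rightarrow> nat \<Rightarrow> (nat \<Rightarrow> real) \<Rightarrow> nat \<Rightarrow>
   ('w \<Rightarrow> real \<Rightarrow> real \<Rightarrow> real) \<Rightarrow> bool" where
  "Vh_process M F N xs k u \<longleftrightarrow>
     (\<forall>\<omega>\<in>space M. \<forall>t\<ge>0. (\<lambda>x. u \<omega> x t) \<in> Vh N xs k) \<and>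
     (\<forall>x\<in>off_nodes N xs. progressive F (\<lambda>t \<omega>. u \<omega> x t))"

definition dg_solution ::
  "'w measure \<Rightarrow> (real \<Rightarrow> 'w measure) \<Rightarrow> (real \<Rightarrow> 'w \<Rightarrow> real) \<Rightarrow>
   nat \<Rightarrow> (nat \<Rightarrow> real) \<Rightarrow> nat \<Rightarrow> real \<Rightarrow> real \<Rightarrow> real \<Rightarrow>
   (real \<Rightarrow> real \<Rightarrow> real \<Rightarrow> real \<Rightarrow> real) \<Rightarrow> (real \<Rightarrow> real \<Rightarrow> real \<Rightarrow> real \<Rightarrow> real) \<Rightarrow>
   (real \<Rightarrow> real) \<Rightarrow> (real \<Rightarrow> real) \<Rightarrow>
   ('w \<Rightarrow> real \<Rightarrow> real \<Rightarrow> real) \<Rightarrow> ('w \<Rightarrow> real \<Rightarrow> real \<Rightarrow> real) \<Rightarrow> bool" where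
  "dg_solution M F W N xs k \<alpha> \<beta>1 \<beta>2 f g u0 v0 u v \<longleftrightarrow>
     Vh_process M F N xs k u \<and> Vh_process M F N xs k v \<and>
     u0 \<in> Vh N xs k \<and> v0 \<in> Vh N xs k \<and>
     (AE \<omega> in M. \<forall>x\<in>off_nodes N xs. u \<omega> x 0 = u0 x \<and> v \<omega> x 0 = v0 x) \<and>
     (\<forall>\<phi>\<in>Vh N xs k. \<forall>j\<in>{1..N}.
        ito_equation M F W
          (\<lambda>t \<omega>. LINT x:cell xs j|lborel. v \<omega> x t * \<phi> x)
          (\<lambda>t \<omega>. dg_drift N xs (\<lambda>x. u \<omega> x t)
                    (flux_u N xs \<alpha> \<beta>1 (\<lambda>x. u \<omega> x t) (\<lambda>x. v \<omega> x t)) \<phi> j)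
          (\<lambda>t \<omega>. LINT x:cell xs j|lborel. f x t (u \<omega> x t) (v \<omega> x t) * \<phi> x)) \<and>
     (\<forall>\<phi>\<in>Vh N xs k. \<forall>j\<in>{1..N}.
        ito_equation M F W
          (\<lambda>t \<omega>. LINT x:cell xs j|lborel. u \<omega> x t * \<phi> x)
          (\<lambda>t \<omega>. dg_drift N xs (\<lambda>x. v \<omega> x t)
                    (flux_v N xs \<alpha> \<beta>2 (\<lambda>x. u \<omega> x t) (\<lambda>x. v \<omega> x t)) \<phi> j)
          (\<lambda>t \<omega>. LINT x:cell xs j|lborel. g x t (u \<omega> x t) (v \<omega> x t) * \<phi> x))"

text \<open>Borel measurability of the coefficients is what makes the integrals of the scheme meaningful.\<close>

definition admissible_coefficients ::
  "real \<Rightarrow> real set \<Rightarrow> (real \<Rightarrow> real \<Rightarrow> real \<Rightarrow> real \<Rightarrow> real) \<Rightarrow>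
   (real \<Rightarrow> real \<Rightarrow> real \<Rightarrow> real \<Rightarrow> real) \<Rightarrow> bool" where
  "admissible_coefficients C I f g \<longleftrightarrow>
     (\<lambda>(x, t, u, v). f x t u v) \<in> borel_measurable (restrict_space borel (I \<times> {0..} \<times> UNIV \<times> UNIV)) \<and>
     (\<lambda>(x, t, u, v). g x t u v) \<in> borel_measurable (restrict_space borel (I \<times> {0..} \<times> UNIV \<times> UNIV)) \<and>
     (\<forall>x\<in>I. \<forall>t\<ge>0. \<forall>u1 u2 v.
        \<bar>f x t u1 v - f x t u2 v\<bar> + \<bar>g x t u1 v - g x t u2 v\<bar> \<le> C * \<bar>u1 - u2\<bar>) \<and>
     (\<forall>x\<in>I. \<forall>t\<ge>0. \<forall>u v1 v2.
        \<bar>f x t u v1 - f x t u v2\<bar> + \<bar>g x t u v1 - g x t u v2\<bar> \<le> C * \<bar>v1 - v2\<bar>) \<and>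
     (\<forall>x\<in>I. \<forall>t\<ge>0. \<forall>u v. \<bar>f x t u v\<bar> + \<bar>g x t u v\<bar> \<le> C * (1 + \<bar>u\<bar> + \<bar>v\<bar>))"

end

theory Submission
  imports Defs
begin

text \<open>In an orthonormal basis of \<open>V\<^sub>h\<^sup>k\<close> the scheme is a finite system \<open>dX = A X dt + H dW\<close> with
  \<open>\<bar>H\<bar>\<^sup>2 \<le> K (1 + \<bar>X\<bar>\<^sup>2)\<close>. Integration by parts on the cells and periodicity give
  \<open>X \<bullet> A X = - \<Sum>\<^sub>j (\<beta>1 [v]\<^sub>j\<^sup>2 + \<beta>2 [u]\<^sub>j\<^sup>2)\<close>, and \<open>\<bar>H\<bar>\<^sup>2\<close> is the squared norm of the projected
  noise, so everything follows from \<open>E \<bar>X t\<bar>\<^sup>2 = \<bar>x0\<bar>\<^sup>2 + 2 \<integral> E (X \<bullet> A X) ds + \<integral> E \<bar>H\<bar>\<^sup>2 ds\<close>.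

  No moment of \<open>X\<close> or \<open>H\<close> is assumed. Second moments come from the estimate
  \<open>E (exp (- l S) \<bar>N\<bar>\<^sup>2) \<le> E ((1 - exp (- l S)) / l)\<close> for the stochastic integral \<open>N\<close> and
  \<open>S = \<integral> \<bar>H\<bar>\<^sup>2 ds\<close>, which replaces stopping times: it holds for step integrands by independence of
  the increments and \<open>1 + x \<le> exp x\<close>, passes to limits in probability, and together with Gronwall's
  inequality bounds the moments uniformly in \<open>l\<close>. The identity itself needs the isometry and the
  martingale property of \<open>N\<close> only.\<close>

section \<open>Step integrands\<close>

text \<open>The obstacle is a circle: the isometry presupposes that \<open>S\<close> has finite
  mean, the growth bound controls \<open>S\<close> by the second moment of \<open>X\<close>, and
  that moment in turn needs the noise. Localization would break it, but
  \<open>has_ito_integral\<close> describes one random variable for each fixed time, up to a null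
  set, so there is no continuous version to stop. The weight \<open>exp (- l S)\<close> does the
  same work at a fixed time: the weighted second moment of the noise is at most
  \<open>1 / l\<close>, which is the a priori finiteness that Gronwall's inequality asks for, while
  the resulting constant does not depend on \<open>l\<close>, so that \<open>l\<close> can tend to
  \<open>0\<close>. Once second moments exist, the energy identity comes from expanding the square
  of \<open>x0 + B + N\<close>, with \<open>B\<close> the drift integral; only pairs of fixed times
  occur in this. Orthonormality on each cell makes the squared norm of a function, and of a
  projection, a plain sum of squares.\<close>

locale brownian =
  fixes M :: "'w measure" and F :: "real \<Rightarrow> 'w measure" and W :: "real \<Rightarrow> 'w \<Rightarrow> real"
  assumes bm: "brownian_motion M F W"
begin

sublocale prob_space M
  using bm by (simp add: brownian_motion_def)

lemma space_F [simp]: "space (F t) = space M"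
proof -
  interpret f: filtration "space M" F using bm by (simp add: brownian_motion_def)
  show ?thesis by (rule f.space_F)
qed

lemma measurable_F_mono: "s \<le> t \<Longrightarrow> f \<in> measurable (F s) N \<Longrightarrow> f \<in> measurable (F t) N"
proof -
  assume st: "s \<le> t" and f: "f \<in> measurable (F s) N"
  interpret f: filtration "space M" F using bm by (simp add: brownian_motion_def)
  show ?thesis
    using measurable_from_subalg[of "F t" "F s" f N] f f.sets_F_mono[OF st] by (simp add: subalgebra_def)
qed

lemma subalgebra_F: "0 \<le> t \<Longrightarrow> subalgebra M (F t)"
  using bm by (auto simp: brownian_motion_def)

lemma measurable_F_M: "0 \<le> t \<Longrightarrow> f \<in> measurable (F t) N \<Longrightarrow> f \<in> measurable M N"
  using measurable_from_subalg subalgebra_F by blast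

lemma W_adapted: "0 \<le> t \<Longrightarrow> W t \<in> borel_measurable (F t)"
  using bm by (auto simp: brownian_motion_def)

lemma W_incr_measurable: "0 \<le> s \<Longrightarrow> s \<le> t \<Longrightarrow> (\<lambda>\<omega>. W t \<omega> - W s \<omega>) \<in> borel_measurable (F t)"
  by (intro borel_measurable_diff W_adapted measurable_F_mono[OF _ W_adapted]) auto

text \<open>\<open>indep_var\<close> speaks of the sigma-algebras generated by the two variables;
  the one generated by \<open>\<xi>\<close> is contained in \<open>F s\<close>.\<close>

lemma indep_incr:
  assumes "0 \<le> s" "s < t" and \<xi>: "\<xi> \<in> borel_measurable (F s)"
  shows "indep_var borel \<xi> borel (\<lambda>\<omega>. W t \<omega> - W s \<omega>)"
proof -
  let ?D = "\<lambda>\<omega>. W t \<omega> - W s \<omega>"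
  have ind: "indep_set (sets (F s)) (sets (vimage_algebra (space M) ?D borel))"
    using bm assms by (auto simp: brownian_motion_def)
  have 1: "sigma_sets (space M) {\<xi> -` A \<inter> space M |A. A \<in> sets borel} \<subseteq> sets (F s)"
    using measurable_sets[OF \<xi>] by (intro sets.sigma_sets_subset[of _ "F s", simplified]) auto
  have 2: "sigma_sets (space M) {?D -` A \<inter> space M |A. A \<in> sets borel}
      \<subseteq> sets (vimage_algebra (space M) ?D borel)"
    by (simp add: sets_vimage_algebra)
  have "indep_set (sigma_sets (space M) {\<xi> -` A \<inter> space M |A. A \<in> sets borel})
      (sigma_sets (space M) {?D -` A \<inter> space M |A. A \<in> sets borel})"
    using ind unfolding indep_set_def
    by (rule indep_sets_mono_sets) (use 1 2 in \<open>auto split: bool.splits\<close>)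
  then show ?thesis
    using assms measurable_F_M[OF _ \<xi>] measurable_F_M[OF _ W_incr_measurable[of s t]]
    by (auto simp: indep_var_eq)
qed

lemma incr_moments:
  assumes "0 \<le> s" "s < t"
  shows "integrable M (\<lambda>\<omega>. W t \<omega> - W s \<omega>)" "expectation (\<lambda>\<omega>. W t \<omega> - W s \<omega>) = 0"
    "integrable M (\<lambda>\<omega>. (W t \<omega> - W s \<omega>)\<^sup>2)" "expectation (\<lambda>\<omega>. (W t \<omega> - W s \<omega>)\<^sup>2) = t - s"
proof -
  let ?D = "\<lambda>\<omega>. W t \<omega> - W s \<omega>" and ?\<sigma> = "sqrt (t - s)"
  have D: "distributed M lborel ?D (normal_density 0 ?\<sigma>)"
    using bm assms by (auto simp: brownian_motion_def)
  have pos: "0 < ?\<sigma>" using assms by simp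
  show "integrable M ?D"
    using integrable_normal_moment_nz_1[OF pos, of 0] distributed_integrable[OF D, of "\<lambda>x. x"] by simp
  show E: "expectation ?D = 0"
    using normal_distributed_expectation[OF pos D] by simp
  show "integrable M (\<lambda>\<omega>. (?D \<omega>)\<^sup>2)"
    using integrable_normal_moment[OF pos, of 0 2] distributed_integrable[OF D, of "\<lambda>x. x\<^sup>2"] by simp
  show "expectation (\<lambda>\<omega>. (?D \<omega>)\<^sup>2) = t - s"
    using normal_distributed_variance[OF pos D] E assms by simp
qed

text \<open>Independence of the increment from \<open>F s\<close> makes every expectation factor.
  The law of \<open>W\<close> enters the later estimates only through these four facts.\<close>

lemma mult_incr:
  assumes "0 \<le> s" "s < t" and \<xi>: "\<xi> \<in> borel_measurable (F s)" "integrable M \<xi>"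
  shows "integrable M (\<lambda>\<omega>. \<xi> \<omega> * (W t \<omega> - W s \<omega>))"
    "expectation (\<lambda>\<omega>. \<xi> \<omega> * (W t \<omega> - W s \<omega>)) = 0"
    "integrable M (\<lambda>\<omega>. \<xi> \<omega> * (W t \<omega> - W s \<omega>)\<^sup>2)"
    "expectation (\<lambda>\<omega>. \<xi> \<omega> * (W t \<omega> - W s \<omega>)\<^sup>2) = (t - s) * expectation \<xi>"
proof -
  let ?D = "\<lambda>\<omega>. W t \<omega> - W s \<omega>"
  have ind: "indep_var borel \<xi> borel ?D" by (rule indep_incr) fact+
  have ind2: "indep_var borel \<xi> borel (\<lambda>\<omega>. (?D \<omega>)\<^sup>2)"
    using indep_var_compose[OF ind, of "\<lambda>x. x" borel "\<lambda>x. x\<^sup>2" borel] by (simp add: comp_def)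
  note m = incr_moments[OF assms(1,2)]
  show "integrable M (\<lambda>\<omega>. \<xi> \<omega> * ?D \<omega>)"
    using indep_var_integrable[OF ind \<xi>(2) m(1)] .
  show "expectation (\<lambda>\<omega>. \<xi> \<omega> * ?D \<omega>) = 0"
    using indep_var_lebesgue_integral[OF ind \<xi>(2) m(1)] m(2) by simp
  show "integrable M (\<lambda>\<omega>. \<xi> \<omega> * (?D \<omega>)\<^sup>2)"
    using indep_var_integrable[OF ind2 \<xi>(2) m(3)] .
  show "expectation (\<lambda>\<omega>. \<xi> \<omega> * (?D \<omega>)\<^sup>2) = (t - s) * expectation \<xi>"
    using indep_var_lebesgue_integral[OF ind2 \<xi>(2) m(3)] m(4) by simp
qed

lemma integrable_mult_L2:
  fixes X Y :: "'w \<Rightarrow> real"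
  assumes [measurable]: "X \<in> borel_measurable M" "Y \<in> borel_measurable M"
    and "integrable M (\<lambda>\<omega>. (X \<omega>)\<^sup>2)" "integrable M (\<lambda>\<omega>. (Y \<omega>)\<^sup>2)"
  shows "integrable M (\<lambda>\<omega>. X \<omega> * Y \<omega>)"
proof (rule Bochner_Integration.integrable_bound)
  show "integrable M (\<lambda>\<omega>. (X \<omega>)\<^sup>2 + (Y \<omega>)\<^sup>2)" using assms by simp
  have "\<bar>x * y\<bar> \<le> x\<^sup>2 + y\<^sup>2" for x y :: real
    using sum_squares_bound[of "\<bar>x\<bar>" "\<bar>y\<bar>"] zero_le_power2[of x] zero_le_power2[of y]
    unfolding abs_mult power2_abs by linarith
  then show "AE \<omega> in M. norm (X \<omega> * Y \<omega>) \<le> norm ((X \<omega>)\<^sup>2 + (Y \<omega>)\<^sup>2)" by auto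
qed simp

lemma integrable_bounded_mult:
  fixes X Y :: "'w \<Rightarrow> real"
  assumes [measurable]: "X \<in> borel_measurable M" and "integrable M Y"
    and B: "\<And>\<omega>. \<omega> \<in> space M \<Longrightarrow> \<bar>X \<omega>\<bar> \<le> B"
  shows "integrable M (\<lambda>\<omega>. X \<omega> * Y \<omega>)"
proof (rule Bochner_Integration.integrable_bound)
  show "integrable M (\<lambda>\<omega>. B * Y \<omega>)" using assms by simp
  have "\<bar>X \<omega>\<bar> * \<bar>Y \<omega>\<bar> \<le> \<bar>B\<bar> * \<bar>Y \<omega>\<bar>" if "\<omega> \<in> space M" for \<omega>
    using B[OF that] by (intro mult_right_mono) auto
  then show "AE \<omega> in M. norm (X \<omega> * Y \<omega>) \<le> norm (B * Y \<omega>)" by (auto simp: abs_mult)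
  show "(\<lambda>\<omega>. X \<omega> * Y \<omega>) \<in> borel_measurable M" using assms(2) by measurable
qed

lemma L2_imp_L1:
  fixes X :: "'w \<Rightarrow> real"
  assumes "X \<in> borel_measurable M" "integrable M (\<lambda>\<omega>. (X \<omega>)\<^sup>2)"
  shows "integrable M X"
  using integrable_mult_L2[OF assms(1) _ assms(2), of "\<lambda>_. 1"] by simp

text \<open>\<open>J\<close> is the running integral of \<open>h\<close>, and \<open>P\<close>
  contains the times where \<open>h\<close> may change. Prescribing the behaviour on every interval
  that avoids \<open>P\<close>, instead of listing a partition, makes the notion stable: such
  intervals may start and end anywhere, a difference only requires the union of the two sets
  \<open>P\<close>, and \<open>T\<close> can be lowered. The value \<open>\<eta>\<close> is known at
  the left end \<open>p\<close>, which is predictability.\<close>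

definition step_on ::
  "real \<Rightarrow> real set \<Rightarrow> (real \<Rightarrow> 'w \<Rightarrow> real) \<Rightarrow> (real \<Rightarrow> 'w \<Rightarrow> real) \<Rightarrow> bool" where
  "step_on T P h J \<longleftrightarrow> finite P \<and> (\<forall>\<omega>\<in>space M. J 0 \<omega> = 0) \<and>
     (\<lambda>z. indicator {0..T} (fst z) * h (fst z) (snd z)) \<in> borel_measurable (lborel \<Otimes>\<^sub>M M) \<and>
     (\<forall>p q. 0 \<le> p \<longrightarrow> p < q \<longrightarrow> q \<le> T \<longrightarrow> {p<..<q} \<inter> P = {} \<longrightarrow>
       (\<exists>\<eta> B. \<eta> \<in> borel_measurable (F p) \<and> (\<forall>\<omega>\<in>space M. \<bar>\<eta> \<omega>\<bar> \<le> B \<and>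
          (\<forall>s\<in>{p<..q}. h s \<omega> = \<eta> \<omega>) \<and> J q \<omega> = J p \<omega> + \<eta> \<omega> * (W q \<omega> - W p \<omega>))))"

lemma step_onE:
  assumes "step_on T P h J" "0 \<le> p" "p < q" "q \<le> T" "{p<..<q} \<inter> P = {}"
  obtains \<eta> B where "\<eta> \<in> borel_measurable (F p)" "\<And>\<omega>. \<omega> \<in> space M \<Longrightarrow> \<bar>\<eta> \<omega>\<bar> \<le> B"
    "\<And>\<omega> s. \<omega> \<in> space M \<Longrightarrow> s \<in> {p<..q} \<Longrightarrow> h s \<omega> = \<eta> \<omega>"
    "\<And>\<omega>. \<omega> \<in> space M \<Longrightarrow> J q \<omega> = J p \<omega> + \<eta> \<omega> * (W q \<omega> - W p \<omega>)"
proof -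
  have "\<exists>\<eta> B. \<eta> \<in> borel_measurable (F p) \<and> (\<forall>\<omega>\<in>space M. \<bar>\<eta> \<omega>\<bar> \<le> B \<and>
      (\<forall>s\<in>{p<..q}. h s \<omega> = \<eta> \<omega>) \<and> J q \<omega> = J p \<omega> + \<eta> \<omega> * (W q \<omega> - W p \<omega>))"
    using assms unfolding step_on_def by blast
  then show ?thesis using that by blast
qed

text \<open>Turns a statement about a whole time interval into one step across a single gap. The
  proof goes by the number of points of \<open>P\<close> strictly between \<open>s\<close> and
  \<open>q\<close>: the largest of them begins the last gap and has fewer points before it.\<close>

lemma gap_induct [consumes 2, case_names start gap]:
  fixes P :: "real set" and s r :: real
  assumes "finite P" "s \<le> r" "\<Phi> s"
    and step: "\<And>p q. s \<le> p \<Longrightarrow> p < q \<Longrightarrow> q \<le> r \<Longrightarrow> {p<..<q} \<inter> P = {} \<Longrightarrow> \<Phi> p \<Longrightarrow> \<Phi> q"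
  shows "\<Phi> r"
proof -
  have "s \<le> q \<Longrightarrow> q \<le> r \<Longrightarrow> \<Phi> q" for q
  proof (induction "card (P \<inter> {s<..<q})" arbitrary: q rule: less_induct)
    case less
    let ?A = "P \<inter> {s<..<q}"
    have fin: "finite ?A" using \<open>finite P\<close> by simp
    show ?case
    proof (cases "q = s")
      case True then show ?thesis using \<open>\<Phi> s\<close> by simp
    next
      case False
      then have "s < q" using less by simp
      show ?thesis
      proof (cases "?A = {}")
        case True
        show ?thesis by (rule step[of s q]) (use True \<open>s < q\<close> less \<open>\<Phi> s\<close> in auto)
      next
        case nonempty: False
        define p where "p = Max ?A"
        have p: "p \<in> ?A" unfolding p_def using fin nonempty by (rule Max_in)
        have pmax: "x \<le> p" if "x \<in> ?A" for x unfolding p_def using fin that by simp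
        have "P \<inter> {s<..<p} \<subset> ?A" using p by auto
        then have "card (P \<inter> {s<..<p}) < card ?A" using fin by (rule psubset_card_mono[rotated])
        then have "\<Phi> p" using less p by auto
        moreover have "{p<..<q} \<inter> P = {}" using pmax p by force
        ultimately show ?thesis using step[of p q] p less by auto
      qed
    qed
  qed
  then show ?thesis using assms by simp
qed

text \<open>The quadratic variation of the integral of \<open>h\<close>. As a Lebesgue integral it
  is \<open>0\<close> on paths where the square is not integrable, so bounds on it carry information
  only together with \<open>set_integrable\<close>.\<close>

definition quad_var :: "(real \<Rightarrow> 'w \<Rightarrow> real) \<Rightarrow> real \<Rightarrow> 'w \<Rightarrow> real" where
  "quad_var h r \<omega> = (LINT s:{0..r}|lborel. (h s \<omega>)\<^sup>2)"

lemma quad_var_0 [simp]: "quad_var h 0 \<omega> = 0"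
proof -
  have "(\<lambda>s. indicator {0..0} s *\<^sub>R (h s \<omega>)\<^sup>2) = (\<lambda>s. indicator {0::real} s *\<^sub>R (h 0 \<omega>)\<^sup>2)"
    by (auto simp: indicator_def)
  then show ?thesis
    by (simp add: quad_var_def set_lebesgue_integral_def)
qed

lemma quad_var_gap:
  assumes "0 \<le> p" "p < q" and i: "set_integrable lborel {0..p} (\<lambda>s. (h s \<omega>)\<^sup>2)"
    and c: "\<And>s. s \<in> {p<..q} \<Longrightarrow> h s \<omega> = e"
  shows "set_integrable lborel {0..q} (\<lambda>s. (h s \<omega>)\<^sup>2)"
    "quad_var h q \<omega> = quad_var h p \<omega> + e\<^sup>2 * (q - p)"
proof -
  have U: "{0..q} = {0..p} \<union> {p<..q}" "{0..p} \<inter> {p<..q} = {}" using assms by auto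
  have eq: "set_integrable lborel {p<..q} (\<lambda>s. (h s \<omega>)\<^sup>2) = set_integrable lborel {p<..q} (\<lambda>s. e\<^sup>2)"
    by (rule set_integrable_cong) (auto simp: c)
  have i2: "set_integrable lborel {p<..q} (\<lambda>s. (h s \<omega>)\<^sup>2)"
    unfolding eq using assms
    by (simp add: set_integrable_def integrable_real_indicator)
  show "set_integrable lborel {0..q} (\<lambda>s. (h s \<omega>)\<^sup>2)"
    unfolding U(1) by (rule set_integrable_Un[OF i i2]) auto
  have "(LINT s:{p<..q}|lborel. (h s \<omega>)\<^sup>2) = (LINT s:{p<..q}|lborel. e\<^sup>2)"
    by (rule set_lebesgue_integral_cong) (auto simp: c)
  also have "\<dots> = e\<^sup>2 * (q - p)" using assms by (simp add: set_lebesgue_integral_def)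
  finally show "quad_var h q \<omega> = quad_var h p \<omega> + e\<^sup>2 * (q - p)"
    unfolding quad_var_def U(1) by (subst set_integral_Un[OF U(2) i i2]) simp
qed

lemma quad_var_nonneg: "0 \<le> quad_var h r \<omega>"
  unfolding quad_var_def set_lebesgue_integral_def by (rule integral_nonneg_AE) auto

text \<open>All claims are proved in one induction because they feed each other: square
  integrability of \<open>J p\<close> and boundedness of \<open>\<eta>\<close> make the mixed term
  integrable, independence gives it mean zero, and the squared increment contributes
  \<open>(q - p) E \<eta>\<^sup>2\<close>, which is exactly the growth of the mean quadratic
  variation.\<close>

lemma step_basic:
  assumes st: "step_on T P h J" and "0 \<le> r" "r \<le> T"
  shows "J r \<in> borel_measurable (F r) \<and> integrable M (\<lambda>\<omega>. (J r \<omega>)\<^sup>2) \<and>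
    quad_var h r \<in> borel_measurable (F r) \<and>
    (\<forall>\<omega>\<in>space M. set_integrable lborel {0..r} (\<lambda>s. (h s \<omega>)\<^sup>2)) \<and>
    (\<exists>B. \<forall>\<omega>\<in>space M. quad_var h r \<omega> \<le> B) \<and>
    expectation (\<lambda>\<omega>. (J r \<omega>)\<^sup>2) = expectation (quad_var h r)"
proof -
  have fin: "finite P" and J0: "\<And>\<omega>. \<omega> \<in> space M \<Longrightarrow> J 0 \<omega> = 0"
    using st by (auto simp: step_on_def)
  show ?thesis
    using fin \<open>0 \<le> r\<close>
  proof (induction rule: gap_induct)
    case start
    have "J 0 \<in> borel_measurable (F 0)"
      using J0 by (subst measurable_cong[of _ _ "\<lambda>_. 0"]) auto
    moreover have "integrable M (\<lambda>\<omega>. (J 0 \<omega>)\<^sup>2)"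
      using J0 by (subst Bochner_Integration.integrable_cong[of M M _ "\<lambda>_. 0"]) auto
    moreover have "expectation (\<lambda>\<omega>. (J 0 \<omega>)\<^sup>2) = expectation (\<lambda>\<omega>. 0)"
      using J0 by (intro Bochner_Integration.integral_cong) auto
    moreover have "set_integrable lborel {0::real..0} f" for f :: "real \<Rightarrow> real"
    proof -
      have "(\<lambda>s. indicator {0..0} s *\<^sub>R f s) = (\<lambda>s. indicator {0::real} s *\<^sub>R f 0)"
        by (auto simp: indicator_def)
      then show ?thesis by (simp add: set_integrable_def)
    qed
    moreover have "quad_var h 0 = (\<lambda>_. 0)" by auto
    ultimately show ?case by auto
  next
    case (gap p q)
    obtain \<eta> B where \<eta>: "\<eta> \<in> borel_measurable (F p)"
      and B: "\<And>\<omega>. \<omega> \<in> space M \<Longrightarrow> \<bar>\<eta> \<omega>\<bar> \<le> B"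
      and h: "\<And>\<omega> s. \<omega> \<in> space M \<Longrightarrow> s \<in> {p<..q} \<Longrightarrow> h s \<omega> = \<eta> \<omega>"
      and J: "\<And>\<omega>. \<omega> \<in> space M \<Longrightarrow> J q \<omega> = J p \<omega> + \<eta> \<omega> * (W q \<omega> - W p \<omega>)"
      by (rule step_onE[OF st \<open>0 \<le> p\<close> \<open>p < q\<close> _ gap(4)]) (use gap \<open>r \<le> T\<close> in auto)
    let ?D = "\<lambda>\<omega>. W q \<omega> - W p \<omega>"
    have pq: "p \<le> q" "0 \<le> q" using gap by auto
    have Jp: "J p \<in> borel_measurable (F p)" and Jpi: "integrable M (\<lambda>\<omega>. (J p \<omega>)\<^sup>2)"
      and Qp: "quad_var h p \<in> borel_measurable (F p)" using gap by auto
    have mF[measurable]: "J p \<in> borel_measurable (F q)" "\<eta> \<in> borel_measurable (F q)"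
      "quad_var h p \<in> borel_measurable (F q)" "?D \<in> borel_measurable (F q)"
      using measurable_F_mono[OF pq(1)] Jp \<eta> Qp W_incr_measurable gap pq by auto
    have [measurable]: "J p \<in> borel_measurable M" "\<eta> \<in> borel_measurable M"
      "quad_var h p \<in> borel_measurable M" "?D \<in> borel_measurable M"
      using mF[THEN measurable_F_M[OF pq(2)]] by auto
    note qg = quad_var_gap[OF \<open>0 \<le> p\<close> \<open>p < q\<close>, of h _ "\<eta> _"]
    have Q: "quad_var h q \<omega> = quad_var h p \<omega> + (\<eta> \<omega>)\<^sup>2 * (q - p)" if "\<omega> \<in> space M" for \<omega>
      using qg(2) h gap that by blast
    have 1: "J q \<in> borel_measurable (F q)"
      by (subst measurable_cong[of _ _ "\<lambda>\<omega>. J p \<omega> + \<eta> \<omega> * ?D \<omega>"]) (auto simp: J)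
    have 2: "quad_var h q \<in> borel_measurable (F q)"
      by (subst measurable_cong[of _ _ "\<lambda>\<omega>. quad_var h p \<omega> + (\<eta> \<omega>)\<^sup>2 * (q - p)"]) (auto simp: Q)
    obtain C where C: "\<And>\<omega>. \<omega> \<in> space M \<Longrightarrow> quad_var h p \<omega> \<le> C" using gap by auto
    have sqB: "(\<eta> \<omega>)\<^sup>2 \<le> B\<^sup>2" if "\<omega> \<in> space M" for \<omega>
      using B[OF that] by (meson abs_ge_zero abs_le_square_iff abs_of_nonneg order_trans dual_order.trans power_mono power2_abs order_refl power2_le_iff_abs_le)
    have 3: "quad_var h q \<omega> \<le> C + B\<^sup>2 * (q - p)" if "\<omega> \<in> space M" for \<omega>
      using C[OF that] sqB[OF that] gap by (simp add: Q[OF that] add_mono mult_right_mono)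
    have iQp: "integrable M (quad_var h p)"
      by (rule integrable_const_bound[of _ C]) (use C quad_var_nonneg in \<open>auto simp: abs_of_nonneg\<close>)
    have i\<eta>2: "integrable M (\<lambda>\<omega>. (\<eta> \<omega>)\<^sup>2)"
      by (rule integrable_const_bound[of _ "B\<^sup>2"]) (use sqB in auto)
    have iJ\<eta>: "integrable M (\<lambda>\<omega>. J p \<omega> * \<eta> \<omega>)"
      by (rule integrable_mult_L2) (use Jpi i\<eta>2 in auto)
    note m1 = mult_incr[OF \<open>0 \<le> p\<close> \<open>p < q\<close> _ iJ\<eta>] and m2 = mult_incr[OF \<open>0 \<le> p\<close> \<open>p < q\<close> _ i\<eta>2]
    have meas: "(\<lambda>\<omega>. J p \<omega> * \<eta> \<omega>) \<in> borel_measurable (F p)" "(\<lambda>\<omega>. (\<eta> \<omega>)\<^sup>2) \<in> borel_measurable (F p)"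
      using Jp \<eta> by auto
    have J2: "(J q \<omega>)\<^sup>2 = (J p \<omega>)\<^sup>2 + 2 * (J p \<omega> * \<eta> \<omega> * ?D \<omega>) + (\<eta> \<omega>)\<^sup>2 * (?D \<omega>)\<^sup>2"
      if "\<omega> \<in> space M" for \<omega>
      by (simp add: J[OF that] power2_eq_square algebra_simps)
    have 4: "integrable M (\<lambda>\<omega>. (J q \<omega>)\<^sup>2)"
      by (subst Bochner_Integration.integrable_cong[OF refl J2]) (use Jpi m1(1) m2(3) meas in auto)
    have "expectation (\<lambda>\<omega>. (J q \<omega>)\<^sup>2)
       = expectation (\<lambda>\<omega>. (J p \<omega>)\<^sup>2 + 2 * (J p \<omega> * \<eta> \<omega> * ?D \<omega>) + (\<eta> \<omega>)\<^sup>2 * (?D \<omega>)\<^sup>2)"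
      by (rule Bochner_Integration.integral_cong[OF refl J2])
    also have "\<dots> = expectation (\<lambda>\<omega>. (J p \<omega>)\<^sup>2) + (q - p) * expectation (\<lambda>\<omega>. (\<eta> \<omega>)\<^sup>2)"
      using Jpi m1[OF meas(1)] m2[OF meas(2)] by simp
    also have "\<dots> = expectation (\<lambda>\<omega>. quad_var h p \<omega> + (\<eta> \<omega>)\<^sup>2 * (q - p))"
      using gap iQp i\<eta>2 by (simp add: eta_contract_eq)
    also have "\<dots> = expectation (quad_var h q)"
      by (rule Bochner_Integration.integral_cong) (auto simp: Q)
    finally have 5: "expectation (\<lambda>\<omega>. (J q \<omega>)\<^sup>2) = expectation (quad_var h q)" .
    have 6: "set_integrable lborel {0..q} (\<lambda>s. (h s \<omega>)\<^sup>2)" if "\<omega> \<in> space M" for \<omega>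
      using qg(1) h gap that by blast
    show ?case using 1 2 3 4 5 6 by blast
  qed
qed

text \<open>The martingale property, tested against a square integrable \<open>Y\<close> known at
  time \<open>s\<close>. Across a gap the change is \<open>\<eta> Y\<close> times an increment of
  \<open>W\<close>, and \<open>\<eta> Y\<close> is known at the left end, so the change has mean
  zero.\<close>

lemma step_orth:
  assumes st: "step_on T P h J" and "0 \<le> s" "s \<le> r" "r \<le> T"
    and Y: "Y \<in> borel_measurable (F s)" "integrable M (\<lambda>\<omega>. (Y \<omega>)\<^sup>2)"
  shows "expectation (\<lambda>\<omega>. Y \<omega> * J r \<omega>) = expectation (\<lambda>\<omega>. Y \<omega> * J s \<omega>)"
proof -
  have fin: "finite P" using st by (auto simp: step_on_def)
  have [measurable]: "Y \<in> borel_measurable M" using measurable_F_M Y \<open>0 \<le> s\<close> by auto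
  show ?thesis
    using fin \<open>s \<le> r\<close>
  proof (induction rule: gap_induct)
    case start show ?case ..
  next
    case (gap p q)
    then have "0 \<le> p" "q \<le> T" using assms by auto
    obtain \<eta> B where \<eta>: "\<eta> \<in> borel_measurable (F p)"
      and B: "\<And>\<omega>. \<omega> \<in> space M \<Longrightarrow> \<bar>\<eta> \<omega>\<bar> \<le> B"
      and "\<And>\<omega> s. \<omega> \<in> space M \<Longrightarrow> s \<in> {p<..q} \<Longrightarrow> h s \<omega> = \<eta> \<omega>"
      and J: "\<And>\<omega>. \<omega> \<in> space M \<Longrightarrow> J q \<omega> = J p \<omega> + \<eta> \<omega> * (W q \<omega> - W p \<omega>)"
      by (rule step_onE[OF st \<open>0 \<le> p\<close> \<open>p < q\<close> \<open>q \<le> T\<close> gap(4)]) (rule that)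
    have [measurable]: "\<eta> \<in> borel_measurable M" "J p \<in> borel_measurable M"
      using measurable_F_M[OF \<open>0 \<le> p\<close>] \<eta> step_basic[OF st \<open>0 \<le> p\<close>] gap \<open>q \<le> T\<close> by auto
    have i: "integrable M (\<lambda>\<omega>. \<eta> \<omega> * Y \<omega>)"
      by (rule integrable_bounded_mult[OF _ L2_imp_L1[OF _ Y(2)] B]) measurable
    have m: "(\<lambda>\<omega>. \<eta> \<omega> * Y \<omega>) \<in> borel_measurable (F p)"
      using \<eta> measurable_F_mono[OF \<open>s \<le> p\<close> Y(1)] by auto
    note mi = mult_incr[OF \<open>0 \<le> p\<close> \<open>p < q\<close> m i]
    have iY: "integrable M (\<lambda>\<omega>. Y \<omega> * J p \<omega>)"
      by (rule integrable_mult_L2) (use Y step_basic[OF st \<open>0 \<le> p\<close>] gap \<open>q \<le> T\<close> in auto)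
    have "expectation (\<lambda>\<omega>. Y \<omega> * J q \<omega>)
      = expectation (\<lambda>\<omega>. Y \<omega> * J p \<omega> + \<eta> \<omega> * Y \<omega> * (W q \<omega> - W p \<omega>))"
      by (rule Bochner_Integration.integral_cong) (auto simp: J algebra_simps)
    also have "\<dots> = expectation (\<lambda>\<omega>. Y \<omega> * J s \<omega>)"
      using mi iY gap by simp
    finally show ?case .
  qed
qed

lemma step_measurable:
  assumes "step_on T P h J" "0 \<le> r" "r \<le> T"
  shows "J r \<in> borel_measurable M" "quad_var h r \<in> borel_measurable M"
  using step_basic[OF assms] measurable_F_M[OF assms(2)] by auto

lemma step_mono:
  assumes st: "step_on T P h J" and "r \<le> T"
  shows "step_on r P h J"
proof -
  have [measurable]: "(\<lambda>z. indicator {0..T} (fst z) * h (fst z) (snd z)) \<in> borel_measurable (lborel \<Otimes>\<^sub>M M)"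
    using st by (simp add: step_on_def)
  have "(\<lambda>z. indicator {0..r} (fst z) * h (fst z) (snd z))
      = (\<lambda>z. indicator {0..r} (fst z) * (indicator {0..T} (fst z) * h (fst z) (snd z)))"
    using \<open>r \<le> T\<close> by (auto simp: indicator_def)
  also have "\<dots> \<in> borel_measurable (lborel \<Otimes>\<^sub>M M)" by measurable
  finally show ?thesis using st \<open>r \<le> T\<close> unfolding step_on_def by (meson order_trans)
qed

lemma step_diff:
  assumes st: "step_on T P h J" and st': "step_on T P' h' J'"
  shows "step_on T (P \<union> P') (\<lambda>s \<omega>. h s \<omega> - h' s \<omega>) (\<lambda>s \<omega>. J s \<omega> - J' s \<omega>)"
  unfolding step_on_def
proof (intro conjI allI impI)
  show "finite (P \<union> P')" "\<forall>\<omega>\<in>space M. J 0 \<omega> - J' 0 \<omega> = 0"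
    using st st' by (auto simp: step_on_def)
  have [measurable]: "(\<lambda>z. indicator {0..T} (fst z) * h (fst z) (snd z)) \<in> borel_measurable (lborel \<Otimes>\<^sub>M M)"
    "(\<lambda>z. indicator {0..T} (fst z) * h' (fst z) (snd z)) \<in> borel_measurable (lborel \<Otimes>\<^sub>M M)"
    using st st' by (simp_all add: step_on_def)
  show "(\<lambda>z. indicator {0..T} (fst z) * (h (fst z) (snd z) - h' (fst z) (snd z))) \<in> borel_measurable (lborel \<Otimes>\<^sub>M M)"
    unfolding right_diff_distrib by measurable
next
  fix p q :: real assume pq: "0 \<le> p" "p < q" "q \<le> T" "{p<..<q} \<inter> (P \<union> P') = {}"
  have "{p<..<q} \<inter> P = {}" "{p<..<q} \<inter> P' = {}" using pq by auto
  note gaps = this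
  obtain \<eta> B where e: "\<eta> \<in> borel_measurable (F p)" "\<And>\<omega>. \<omega> \<in> space M \<Longrightarrow> \<bar>\<eta> \<omega>\<bar> \<le> B"
      "\<And>\<omega> s. \<omega> \<in> space M \<Longrightarrow> s \<in> {p<..q} \<Longrightarrow> h s \<omega> = \<eta> \<omega>"
      "\<And>\<omega>. \<omega> \<in> space M \<Longrightarrow> J q \<omega> = J p \<omega> + \<eta> \<omega> * (W q \<omega> - W p \<omega>)"
    by (rule step_onE[OF st pq(1-3) gaps(1)]) (rule that)
  obtain \<eta>' B' where e': "\<eta>' \<in> borel_measurable (F p)" "\<And>\<omega>. \<omega> \<in> space M \<Longrightarrow> \<bar>\<eta>' \<omega>\<bar> \<le> B'"
      "\<And>\<omega> s. \<omega> \<in> space M \<Longrightarrow> s \<in> {p<..q} \<Longrightarrow> h' s \<omega> = \<eta>' \<omega>"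
      "\<And>\<omega>. \<omega> \<in> space M \<Longrightarrow> J' q \<omega> = J' p \<omega> + \<eta>' \<omega> * (W q \<omega> - W p \<omega>)"
    by (rule step_onE[OF st' pq(1-3) gaps(2)]) (rule that)
  have "\<bar>\<eta> \<omega> - \<eta>' \<omega>\<bar> \<le> B + B'" if "\<omega> \<in> space M" for \<omega>
    using e(2)[OF that] e'(2)[OF that] by linarith
  then show "\<exists>\<eta> B. \<eta> \<in> borel_measurable (F p) \<and> (\<forall>\<omega>\<in>space M. \<bar>\<eta> \<omega>\<bar> \<le> B \<and>
          (\<forall>s\<in>{p<..q}. h s \<omega> - h' s \<omega> = \<eta> \<omega>) \<and> J q \<omega> - J' q \<omega> = J p \<omega> - J' p \<omega> + \<eta> \<omega> * (W q \<omega> - W p \<omega>))"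
    using e(1) e'(1)
    by (intro exI[of _ "\<lambda>\<omega>. \<eta> \<omega> - \<eta>' \<omega>"] exI[of _ "B + B'"]) (simp add: e(3,4) e'(3,4) algebra_simps)
qed

text \<open>Allows several integrands to share one set of jump times.\<close>

lemma step_refine:
  assumes st: "step_on T P h J" and "finite P'" "P \<subseteq> P'"
  shows "step_on T P' h J"
proof -
  have "{p<..<q} \<inter> P = {}" if "{p<..<q} \<inter> P' = {}" for p q using that assms(3) by auto
  then show ?thesis using st \<open>finite P'\<close> unfolding step_on_def by presburger
qed

text \<open>The value on a gap is named canonically as \<open>h q\<close>, so that the estimate for
  several components needs no choice of a witness for each of them.\<close>

lemma step_gap:
  assumes st: "step_on T P h J" and pq: "0 \<le> p" "p < q" "q \<le> T" "{p<..<q} \<inter> P = {}"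
  shows "h q \<in> borel_measurable (F p)" "\<exists>B. \<forall>\<omega>\<in>space M. \<bar>h q \<omega>\<bar> \<le> B"
    "\<And>\<omega> s. \<omega> \<in> space M \<Longrightarrow> s \<in> {p<..q} \<Longrightarrow> h s \<omega> = h q \<omega>"
    "\<And>\<omega>. \<omega> \<in> space M \<Longrightarrow> J q \<omega> = J p \<omega> + h q \<omega> * (W q \<omega> - W p \<omega>)"
proof -
  obtain \<eta> B where e: "\<eta> \<in> borel_measurable (F p)" "\<And>\<omega>. \<omega> \<in> space M \<Longrightarrow> \<bar>\<eta> \<omega>\<bar> \<le> B"
      "\<And>\<omega> s. \<omega> \<in> space M \<Longrightarrow> s \<in> {p<..q} \<Longrightarrow> h s \<omega> = \<eta> \<omega>"
      "\<And>\<omega>. \<omega> \<in> space M \<Longrightarrow> J q \<omega> = J p \<omega> + \<eta> \<omega> * (W q \<omega> - W p \<omega>)"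
    by (rule step_onE[OF st pq]) (rule that)
  have q: "h q \<omega> = \<eta> \<omega>" if "\<omega> \<in> space M" for \<omega> using e(3)[OF that, of q] pq by simp
  show "h q \<in> borel_measurable (F p)"
    using e(1) q by (subst measurable_cong[of _ _ \<eta>]) auto
  show "\<exists>B. \<forall>\<omega>\<in>space M. \<bar>h q \<omega>\<bar> \<le> B" using e(2) q by (intro exI[of _ B]) simp
  show "h s \<omega> = h q \<omega>" if "\<omega> \<in> space M" "s \<in> {p<..q}" for s \<omega> using e(3)[OF that] q that by simp
  show "J q \<omega> = J p \<omega> + h q \<omega> * (W q \<omega> - W p \<omega>)" if "\<omega> \<in> space M" for \<omega>
    using e(4)[OF that] q that by simp
qed

text \<open>Across a gap the total quadratic variation grows by
  \<open>\<bar>h\<bar>\<^sup>2 (q - p)\<close>. The mean of the weighted square gains at most the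
  weighted mean of that growth, and \<open>1 + x \<le> exp x\<close> bounds this by the drop of the
  weight divided by \<open>l\<close>. The drops telescope to the right-hand side, which is at most
  \<open>1 / l\<close> however large the integrand is.\<close>

lemma step_exp_weight:
  fixes h :: "'i \<Rightarrow> real \<Rightarrow> 'w \<Rightarrow> real"
  assumes "finite I" and st: "\<And>i. i \<in> I \<Longrightarrow> step_on T P (h i) (J i)" and "0 \<le> T" "0 < l" "finite P"
  shows "expectation (\<lambda>\<omega>. exp (- l * (\<Sum>i\<in>I. quad_var (h i) T \<omega>)) * (\<Sum>i\<in>I. (J i T \<omega>)\<^sup>2))
    \<le> expectation (\<lambda>\<omega>. (1 - exp (- l * (\<Sum>i\<in>I. quad_var (h i) T \<omega>))) / l)"
proof -
  define Q where "Q r \<omega> = (\<Sum>i\<in>I. quad_var (h i) r \<omega>)" for r \<omega>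
  have Q0: "0 \<le> Q r \<omega>" for r \<omega> unfolding Q_def by (intro sum_nonneg quad_var_nonneg)
  have "r \<le> T \<longrightarrow> expectation (\<lambda>\<omega>. exp (- l * Q r \<omega>) * (\<Sum>i\<in>I. (J i r \<omega>)\<^sup>2))
      \<le> expectation (\<lambda>\<omega>. (1 - exp (- l * Q r \<omega>)) / l)" if "0 \<le> r" for r
    using \<open>finite P\<close> that
  proof (induction rule: gap_induct)
    case start
    have "(\<Sum>i\<in>I. (J i 0 \<omega>)\<^sup>2) = 0" if "\<omega> \<in> space M" for \<omega>
      using st that by (auto simp: step_on_def)
    then have "expectation (\<lambda>\<omega>. exp (- l * Q 0 \<omega>) * (\<Sum>i\<in>I. (J i 0 \<omega>)\<^sup>2)) = expectation (\<lambda>\<omega>. 0)"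
      by (intro Bochner_Integration.integral_cong) auto
    then show ?case by (simp add: Q_def)
  next
    case (gap p q)
    show ?case
    proof
      assume "q \<le> T"
      then have "p \<le> T" using gap by simp
      note g = step_gap[OF st \<open>0 \<le> p\<close> \<open>p < q\<close> \<open>q \<le> T\<close> gap(4)]
      note b = step_basic[OF st \<open>0 \<le> p\<close> \<open>p \<le> T\<close>]
      let ?D = "\<lambda>\<omega>. W q \<omega> - W p \<omega>"
      \<comment> \<open>The weight at time \<open>q\<close>, rewritten in quantities known at time
        \<open>p\<close>; only in this form may it multiply an increment of \<open>W\<close> in
        \<open>mult_incr\<close>.\<close>
      define A where "A \<omega> = exp (- l * (Q p \<omega> + (\<Sum>i\<in>I. (h i q \<omega>)\<^sup>2) * (q - p)))" for \<omega>
      have JF: "J i p \<in> borel_measurable (F p)" "h i q \<in> borel_measurable (F p)"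
        "quad_var (h i) p \<in> borel_measurable (F p)" if "i \<in> I" for i
        using b g that by auto
      have QF: "Q p \<in> borel_measurable (F p)"
        unfolding Q_def by (intro borel_measurable_sum JF)
      have AF: "A \<in> borel_measurable (F p)"
        unfolding A_def
        by (intro borel_measurable_exp[THEN measurable_compose[rotated]] borel_measurable_times borel_measurable_add QF
            borel_measurable_sum borel_measurable_power JF borel_measurable_const)
      have JM[measurable]: "J i p \<in> borel_measurable M" "h i q \<in> borel_measurable M"
        if "i \<in> I" for i using JF[OF that] measurable_F_M[OF \<open>0 \<le> p\<close>] by auto
      have [measurable]: "A \<in> borel_measurable M" "Q p \<in> borel_measurable M"
        using AF QF measurable_F_M[OF \<open>0 \<le> p\<close>] by auto
      have A01: "0 < A \<omega>" "A \<omega> \<le> exp (- l * Q p \<omega>)" "exp (- l * Q p \<omega>) \<le> 1" for \<omega>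
        using \<open>0 < l\<close> gap Q0[of p \<omega>]
        by (auto simp: A_def intro!: mult_left_mono mult_nonneg_nonneg sum_nonneg add_nonneg_nonneg)
      have A1: "\<bar>A \<omega>\<bar> \<le> 1" for \<omega>
        using order_trans[OF A01(2,3), of \<omega>] A01(1)[of \<omega>] by simp
      have exp1: "\<bar>exp (- l * Q p \<omega>)\<bar> \<le> 1" for \<omega> using A01(3)[of \<omega>] by simp
      have Qq: "Q q \<omega> = Q p \<omega> + (\<Sum>i\<in>I. (h i q \<omega>)\<^sup>2) * (q - p)" if "\<omega> \<in> space M" for \<omega>
      proof -
        have "quad_var (h i) q \<omega> = quad_var (h i) p \<omega> + (h i q \<omega>)\<^sup>2 * (q - p)" if "i \<in> I" for i
          using b[OF that] g(3)[OF that] \<open>\<omega> \<in> space M\<close>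
          by (intro quad_var_gap(2)[OF \<open>0 \<le> p\<close> \<open>p < q\<close>]) blast+
        then show ?thesis by (simp add: Q_def sum.distrib sum_distrib_right)
      qed
      have i1: "integrable M (\<lambda>\<omega>. (J i p \<omega>)\<^sup>2)" if "i \<in> I" for i using b that by blast
      have i2: "integrable M (\<lambda>\<omega>. (h i q \<omega>)\<^sup>2)" if "i \<in> I" for i
      proof -
        obtain B where B: "\<And>\<omega>. \<omega> \<in> space M \<Longrightarrow> \<bar>h i q \<omega>\<bar> \<le> B" using g(2) \<open>i \<in> I\<close> by blast
        have "(h i q \<omega>)\<^sup>2 \<le> B\<^sup>2" if "\<omega> \<in> space M" for \<omega>
          using power_mono[OF B[OF that], of 2] by simp
        then show ?thesis using JM(2)[OF \<open>i \<in> I\<close>]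
          by (intro integrable_const_bound[of _ "B\<^sup>2"]) auto
      qed
      have iA: "integrable M (\<lambda>\<omega>. A \<omega> * f \<omega>)" if "integrable M f" for f
        by (rule integrable_bounded_mult[OF _ that A1]) simp
      have i3: "integrable M (\<lambda>\<omega>. A \<omega> * (J i p \<omega> * h i q \<omega>))" if "i \<in> I" for i
        using i1 i2 JM that by (intro iA integrable_mult_L2) auto
      have F3: "(\<lambda>\<omega>. A \<omega> * (J i p \<omega> * h i q \<omega>)) \<in> borel_measurable (F p)"
        "(\<lambda>\<omega>. A \<omega> * (h i q \<omega>)\<^sup>2) \<in> borel_measurable (F p)" if "i \<in> I" for i
        using AF JF[OF that] by auto
      note m1 = mult_incr[OF \<open>0 \<le> p\<close> \<open>p < q\<close> F3(1) i3]
        and m2 = mult_incr[OF \<open>0 \<le> p\<close> \<open>p < q\<close> F3(2) iA[OF i2]]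
      have exi: "exp (- l * Q q \<omega>) * (\<Sum>i\<in>I. (J i q \<omega>)\<^sup>2) = (\<Sum>i\<in>I. A \<omega> * (J i p \<omega>)\<^sup>2
          + 2 * (A \<omega> * (J i p \<omega> * h i q \<omega>) * ?D \<omega>) + A \<omega> * (h i q \<omega>)\<^sup>2 * (?D \<omega>)\<^sup>2)"
        if "\<omega> \<in> space M" for \<omega>
      proof -
        have "A \<omega> * (J i q \<omega>)\<^sup>2 = A \<omega> * (J i p \<omega>)\<^sup>2
          + 2 * (A \<omega> * (J i p \<omega> * h i q \<omega>) * ?D \<omega>) + A \<omega> * (h i q \<omega>)\<^sup>2 * (?D \<omega>)\<^sup>2" if "i \<in> I" for i
          unfolding g(4)[OF \<open>i \<in> I\<close> \<open>\<omega> \<in> space M\<close>] by (simp add: power2_eq_square algebra_simps)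
        moreover have "exp (- l * Q q \<omega>) = A \<omega>" using Qq[OF that] by (simp add: A_def)
        ultimately show ?thesis by (simp add: sum_distrib_left)
      qed
      have "expectation (\<lambda>\<omega>. exp (- l * Q q \<omega>) * (\<Sum>i\<in>I. (J i q \<omega>)\<^sup>2))
        = expectation (\<lambda>\<omega>. \<Sum>i\<in>I. A \<omega> * (J i p \<omega>)\<^sup>2
          + 2 * (A \<omega> * (J i p \<omega> * h i q \<omega>) * ?D \<omega>) + A \<omega> * (h i q \<omega>)\<^sup>2 * (?D \<omega>)\<^sup>2)"
        by (rule Bochner_Integration.integral_cong[OF refl exi])
      also have "\<dots> = (\<Sum>i\<in>I. expectation (\<lambda>\<omega>. A \<omega> * (J i p \<omega>)\<^sup>2)
           + (q - p) * expectation (\<lambda>\<omega>. A \<omega> * (h i q \<omega>)\<^sup>2))"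
        using iA[OF i1] m1 m2 by (subst Bochner_Integration.integral_sum) auto
      also have "\<dots> = expectation (\<lambda>\<omega>. \<Sum>i\<in>I. A \<omega> * (J i p \<omega>)\<^sup>2 + (q - p) * (A \<omega> * (h i q \<omega>)\<^sup>2))"
        using iA[OF i1] iA[OF i2] by (subst Bochner_Integration.integral_sum) auto
      also have "\<dots> \<le> expectation (\<lambda>\<omega>. exp (- l * Q p \<omega>) * (\<Sum>i\<in>I. (J i p \<omega>)\<^sup>2)
          + (exp (- l * Q p \<omega>) - A \<omega>) / l)"
      proof (rule integral_mono)
        show "integrable M (\<lambda>\<omega>. \<Sum>i\<in>I. A \<omega> * (J i p \<omega>)\<^sup>2 + (q - p) * (A \<omega> * (h i q \<omega>)\<^sup>2))"
          using iA[OF i1] iA[OF i2] by auto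
        have "integrable M (\<lambda>\<omega>. exp (- l * Q p \<omega>) * (\<Sum>i\<in>I. (J i p \<omega>)\<^sup>2))"
          by (rule integrable_bounded_mult[of _ _ 1]) (use i1 A01(3) in auto)
        moreover have "integrable M (\<lambda>\<omega>. exp (- l * Q p \<omega>))" "integrable M A"
          by (rule integrable_const_bound[of _ 1], use A01(3) A1 in auto)+
        ultimately show "integrable M (\<lambda>\<omega>. exp (- l * Q p \<omega>) * (\<Sum>i\<in>I. (J i p \<omega>)\<^sup>2)
          + (exp (- l * Q p \<omega>) - A \<omega>) / l)" by auto
        fix \<omega>
        \<comment> \<open>\<open>x\<close> is \<open>l\<close> times the growth of the quadratic
          variation over the gap, so \<open>A \<omega> * exp x\<close> is the weight at
          \<open>p\<close>.\<close>
        define x where "x = l * ((\<Sum>i\<in>I. (h i q \<omega>)\<^sup>2) * (q - p))"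
        have "A \<omega> * (1 + x) \<le> A \<omega> * exp x"
          using exp_ge_add_one_self A01(1)[of \<omega>] by (intro mult_left_mono) auto
        also have "A \<omega> * exp x = exp (- l * Q p \<omega>)"
          by (simp add: A_def x_def exp_add[symmetric] algebra_simps)
        finally have "A \<omega> * x / l \<le> (exp (- l * Q p \<omega>) - A \<omega>) / l"
          using \<open>0 < l\<close> by (intro divide_right_mono) (auto simp: algebra_simps)
        moreover have "A \<omega> * x / l = (q - p) * (A \<omega> * (\<Sum>i\<in>I. (h i q \<omega>)\<^sup>2))"
          using \<open>0 < l\<close> by (simp add: x_def)
        ultimately have "(q - p) * (A \<omega> * (\<Sum>i\<in>I. (h i q \<omega>)\<^sup>2)) \<le> (exp (- l * Q p \<omega>) - A \<omega>) / l"
          by simp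
        moreover have "A \<omega> * (\<Sum>i\<in>I. (J i p \<omega>)\<^sup>2) \<le> exp (- l * Q p \<omega>) * (\<Sum>i\<in>I. (J i p \<omega>)\<^sup>2)"
          using A01(2) by (intro mult_right_mono sum_nonneg) auto
        ultimately show "(\<Sum>i\<in>I. A \<omega> * (J i p \<omega>)\<^sup>2 + (q - p) * (A \<omega> * (h i q \<omega>)\<^sup>2))
          \<le> exp (- l * Q p \<omega>) * (\<Sum>i\<in>I. (J i p \<omega>)\<^sup>2) + (exp (- l * Q p \<omega>) - A \<omega>) / l"
          by (simp add: sum.distrib sum_distrib_left)
      qed
      also have "\<dots> = expectation (\<lambda>\<omega>. exp (- l * Q p \<omega>) * (\<Sum>i\<in>I. (J i p \<omega>)\<^sup>2))
          + expectation (\<lambda>\<omega>. (exp (- l * Q p \<omega>) - A \<omega>) / l)"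
      proof (rule Bochner_Integration.integral_add)
        show "integrable M (\<lambda>\<omega>. exp (- l * Q p \<omega>) * (\<Sum>i\<in>I. (J i p \<omega>)\<^sup>2))"
          by (rule integrable_bounded_mult[of _ _ 1]) (use i1 A01(3) in auto)
        have "integrable M (\<lambda>\<omega>. exp (- l * Q p \<omega>))" "integrable M A"
          by (rule integrable_const_bound[of _ 1], use A01(3) A1 in auto)+
        then show "integrable M (\<lambda>\<omega>. (exp (- l * Q p \<omega>) - A \<omega>) / l)" by auto
      qed
      also have "\<dots> \<le> expectation (\<lambda>\<omega>. (1 - exp (- l * Q p \<omega>)) / l)
          + expectation (\<lambda>\<omega>. (exp (- l * Q p \<omega>) - A \<omega>) / l)"
        using gap \<open>p \<le> T\<close> by simp
      also have "\<dots> = expectation (\<lambda>\<omega>. (1 - exp (- l * Q p \<omega>)) / l + (exp (- l * Q p \<omega>) - A \<omega>) / l)"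
      proof (rule Bochner_Integration.integral_add[symmetric])
        have "integrable M (\<lambda>\<omega>. exp (- l * Q p \<omega>))" "integrable M A"
          by (rule integrable_const_bound[of _ 1], use A01(3) A1 in auto)+
        then show "integrable M (\<lambda>\<omega>. (1 - exp (- l * Q p \<omega>)) / l)"
          "integrable M (\<lambda>\<omega>. (exp (- l * Q p \<omega>) - A \<omega>) / l)" by auto
      qed
      also have "\<dots> = expectation (\<lambda>\<omega>. (1 - exp (- l * Q q \<omega>)) / l)"
        by (rule Bochner_Integration.integral_cong) (auto simp: Qq A_def diff_divide_distrib)
      finally show "expectation (\<lambda>\<omega>. exp (- l * Q q \<omega>) * (\<Sum>i\<in>I. (J i q \<omega>)\<^sup>2))
        \<le> expectation (\<lambda>\<omega>. (1 - exp (- l * Q q \<omega>)) / l)" .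
    qed
  qed
  from this[of T] show ?thesis using \<open>0 \<le> T\<close> by (simp add: Q_def)
qed

end

section \<open>Simple processes as step integrands, and their truncation\<close>

lemma simple_process_mono:
  assumes "simple_process F T m \<tau> \<xi>" "i \<le> j" "j \<le> m"
  shows "\<tau> i \<le> \<tau> j"
  using assms(2,3)
proof (induction j rule: dec_induct)
  case (step n)
  then have "\<tau> n < \<tau> (Suc n)" using assms(1) by (auto simp: simple_process_def)
  then show ?case using step by simp
qed simp

text \<open>The first node beyond \<open>p\<close> cannot lie before \<open>q\<close>, because the
  gap contains no node.\<close>

lemma simple_process_locate:
  assumes sp: "simple_process F T m \<tau> \<xi>" and "0 \<le> p" "p < q" "q \<le> T"
    and gap: "{p<..<q} \<inter> \<tau> ` {..m} = {}"
  obtains i where "i < m" "\<tau> i \<le> p" "q \<le> \<tau> (Suc i)"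
proof -
  define k where "k = (LEAST k. p < \<tau> k)"
  have "\<tau> 0 = 0" "\<tau> m = T" using sp by (auto simp: simple_process_def)
  have pm: "p < \<tau> m" using \<open>p < q\<close> \<open>q \<le> T\<close> \<open>\<tau> m = T\<close> by linarith
  have k: "p < \<tau> k" unfolding k_def using pm by (rule LeastI)
  have "k \<le> m" unfolding k_def using pm by (rule Least_le)
  have "k \<noteq> 0" using k \<open>\<tau> 0 = 0\<close> \<open>0 \<le> p\<close> by (auto intro: ccontr)
  then obtain i where i: "k = Suc i" using not0_implies_Suc by blast
  have "\<tau> i \<le> p" using not_less_Least[of i "\<lambda>k. p < \<tau> k"] i k_def by auto
  moreover have "q \<le> \<tau> k"
  proof (rule ccontr)
    assume "\<not> q \<le> \<tau> k"
    then have "\<tau> k \<in> {p<..<q} \<inter> \<tau> ` {..m}" using k \<open>k \<le> m\<close> by auto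
    then show False using gap by blast
  qed
  ultimately show thesis using i \<open>k \<le> m\<close> by (intro that[of i]) auto
qed

text \<open>The minimum freezes both ends of an interval at \<open>r\<close>: intervals after
  \<open>r\<close> contribute nothing, and the one containing \<open>r\<close> is cut there. This is
  the integral over \<open>[0, r]\<close>.\<close>

definition stopped_simple_integral ::
  "(real \<Rightarrow> 'w \<Rightarrow> real) \<Rightarrow> nat \<Rightarrow> (nat \<Rightarrow> real) \<Rightarrow> (nat \<Rightarrow> 'w \<Rightarrow> real) \<Rightarrow> real \<Rightarrow> 'w \<Rightarrow> real" where
  "stopped_simple_integral W m \<tau> \<xi> r \<omega> =
     (\<Sum>i<m. \<xi> i \<omega> * (W (min (\<tau> (Suc i)) r) \<omega> - W (min (\<tau> i) r) \<omega>))"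

lemma stopped_simple_integral_end:
  assumes "simple_process F T m \<tau> \<xi>"
  shows "stopped_simple_integral W m \<tau> \<xi> T = simple_integral W m \<tau> \<xi>"
proof -
  have "\<tau> m = T" using assms by (simp add: simple_process_def)
  then have "min (\<tau> i) T = \<tau> i" if "i \<le> m" for i
    using simple_process_mono[OF assms, of i m] that by simp
  then show ?thesis
    unfolding stopped_simple_integral_def simple_integral_def by (intro ext sum.cong) auto
qed

lemma sum_if_single:
  fixes f :: "nat \<Rightarrow> real"
  assumes "i < m" and "\<And>j. j < m \<Longrightarrow> j \<noteq> i \<Longrightarrow> f j = 0"
  shows "(\<Sum>j<m. f j) = f i"
  using assms by (subst sum.remove[of _ i]) (auto intro!: sum.neutral)

context brownian begin

lemma simple_measurable:
  assumes "simple_process F T m \<tau> \<xi>" "i < m"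
  shows "\<xi> i \<in> borel_measurable M"
proof -
  have "0 \<le> \<tau> i" using simple_process_mono[OF assms(1), of 0 i] assms by (auto simp: simple_process_def)
  moreover have "\<xi> i \<in> borel_measurable (F (\<tau> i))" using assms unfolding simple_process_def by blast
  ultimately show ?thesis by (rule measurable_F_M)
qed

lemma simple_step_on:
  assumes sp: "simple_process F T m \<tau> \<xi>" and "0 \<le> T"
  shows "step_on T (\<tau> ` {..m}) (simple_value m \<tau> \<xi>) (stopped_simple_integral W m \<tau> \<xi>)"
  unfolding step_on_def
proof (intro conjI allI impI)
  have \<tau>0: "\<tau> 0 = 0" and \<tau>m: "\<tau> m = T" using sp by (auto simp: simple_process_def)
  note mono = simple_process_mono[OF sp]
  show "finite (\<tau> ` {..m})" by simp
  have "min (\<tau> i) 0 = 0" if "i \<le> m" for i using mono[of 0 i] that \<tau>0 by simp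
  then show "\<forall>\<omega>\<in>space M. stopped_simple_integral W m \<tau> \<xi> 0 \<omega> = 0"
    unfolding stopped_simple_integral_def by (auto intro!: sum.neutral)
  have [measurable]: "\<xi> i \<in> borel_measurable M" if "i < m" for i using simple_measurable[OF sp that] .
  have "(\<lambda>z. \<xi> i (snd z) * indicator {\<tau> i<..\<tau> (Suc i)} (fst z)) \<in> borel_measurable (lborel \<Otimes>\<^sub>M M)"
    if "i < m" for i using that by measurable
  then have [measurable]: "(\<lambda>z. simple_value m \<tau> \<xi> (fst z) (snd z)) \<in> borel_measurable (lborel \<Otimes>\<^sub>M M)"
    unfolding simple_value_def by (intro borel_measurable_sum) auto
  show "(\<lambda>z. indicator {0..T} (fst z) * simple_value m \<tau> \<xi> (fst z) (snd z)) \<in> borel_measurable (lborel \<Otimes>\<^sub>M M)"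
    by measurable
  fix p q :: real assume pq: "0 \<le> p" "p < q" "q \<le> T" "{p<..<q} \<inter> \<tau> ` {..m} = {}"
  obtain i where i: "i < m" "\<tau> i \<le> p" "q \<le> \<tau> (Suc i)"
    by (rule simple_process_locate[OF sp pq])
  have other: "\<tau> (Suc j) \<le> p \<or> q \<le> \<tau> j" if "j < m" "j \<noteq> i" for j
  proof (cases "j < i")
    case True then show ?thesis using mono[of "Suc j" i] i by simp
  next
    case False then show ?thesis using mono[of "Suc i" j] i that by simp
  qed
  obtain B where B: "\<And>\<omega>. \<omega> \<in> space M \<Longrightarrow> \<bar>\<xi> i \<omega>\<bar> \<le> B"
    using sp i unfolding simple_process_def space_F by blast
  have "\<xi> i \<in> borel_measurable (F p)"
    using measurable_F_mono[OF i(2)] sp i by (auto simp: simple_process_def)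
  moreover have "simple_value m \<tau> \<xi> s \<omega> = \<xi> i \<omega>" if "s \<in> {p<..q}" for s \<omega>
    unfolding simple_value_def
    by (subst sum_if_single[OF i(1)]) (use i that other in \<open>force simp: indicator_def\<close>)+
  moreover have "stopped_simple_integral W m \<tau> \<xi> q \<omega> =
      stopped_simple_integral W m \<tau> \<xi> p \<omega> + \<xi> i \<omega> * (W q \<omega> - W p \<omega>)" for \<omega>
  proof -
    have "stopped_simple_integral W m \<tau> \<xi> q \<omega> - stopped_simple_integral W m \<tau> \<xi> p \<omega>
      = (\<Sum>j<m. \<xi> j \<omega> * ((W (min (\<tau> (Suc j)) q) \<omega> - W (min (\<tau> j) q) \<omega>)
           - (W (min (\<tau> (Suc j)) p) \<omega> - W (min (\<tau> j) p) \<omega>)))"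
      unfolding stopped_simple_integral_def sum_subtractf[symmetric] by (simp add: algebra_simps)
    also have "\<dots> = \<xi> i \<omega> * ((W (min (\<tau> (Suc i)) q) \<omega> - W (min (\<tau> i) q) \<omega>)
           - (W (min (\<tau> (Suc i)) p) \<omega> - W (min (\<tau> i) p) \<omega>))"
    proof (rule sum_if_single[OF i(1)])
      fix j assume "j < m" "j \<noteq> i"
      moreover have "\<tau> j < \<tau> (Suc j)" using sp \<open>j < m\<close> by (simp add: simple_process_def)
      ultimately show "\<xi> j \<omega> * ((W (min (\<tau> (Suc j)) q) \<omega> - W (min (\<tau> j) q) \<omega>)
           - (W (min (\<tau> (Suc j)) p) \<omega> - W (min (\<tau> j) p) \<omega>)) = 0"
        using other[of j] pq by (auto simp: min_def)
    qed
    also have "\<dots> = \<xi> i \<omega> * (W q \<omega> - W p \<omega>)" using i pq by (simp add: min_def)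
    finally show ?thesis by simp
  qed
  ultimately show "\<exists>\<eta> B. \<eta> \<in> borel_measurable (F p) \<and> (\<forall>\<omega>\<in>space M. \<bar>\<eta> \<omega>\<bar> \<le> B \<and>
      (\<forall>s\<in>{p<..q}. simple_value m \<tau> \<xi> s \<omega> = \<eta> \<omega>) \<and>
      stopped_simple_integral W m \<tau> \<xi> q \<omega> = stopped_simple_integral W m \<tau> \<xi> p \<omega> + \<eta> \<omega> * (W q \<omega> - W p \<omega>))"
    using B by blast
qed

text \<open>The half-open intervals are disjoint, so at every time at most one summand is nonzero
  and squaring commutes with the sum.\<close>

lemma quad_var_simple:
  assumes sp: "simple_process F T m \<tau> \<xi>"
  shows "quad_var (simple_value m \<tau> \<xi>) T \<omega> = (\<Sum>i<m. (\<xi> i \<omega>)\<^sup>2 * (\<tau> (Suc i) - \<tau> i))"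
proof -
  note mono = simple_process_mono[OF sp]
  have \<tau>0: "\<tau> 0 = 0" and \<tau>m: "\<tau> m = T" using sp by (auto simp: simple_process_def)
  have "indicator {0..T} s *\<^sub>R (simple_value m \<tau> \<xi> s \<omega>)\<^sup>2
      = (\<Sum>i<m. (\<xi> i \<omega>)\<^sup>2 * indicator {\<tau> i<..\<tau> (Suc i)} s)" for s
  proof (cases "\<exists>i<m. s \<in> {\<tau> i<..\<tau> (Suc i)}")
    case True
    then obtain i where i: "i < m" "\<tau> i < s" "s \<le> \<tau> (Suc i)" by auto
    have other: "indicator {\<tau> j<..\<tau> (Suc j)} s = (0::real)" if "j < m" "j \<noteq> i" for j
      using that i mono[of "Suc j" i] mono[of "Suc i" j] by (cases "j < i") (auto simp: indicator_def)
    have "s \<in> {0..T}" using i mono[of 0 i] mono[of "Suc i" m] \<tau>0 \<tau>m by auto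
    moreover have "(\<Sum>j<m. \<xi> j \<omega> * indicator {\<tau> j<..\<tau> (Suc j)} s) = \<xi> i \<omega> * indicator {\<tau> i<..\<tau> (Suc i)} s"
      "(\<Sum>j<m. (\<xi> j \<omega>)\<^sup>2 * indicator {\<tau> j<..\<tau> (Suc j)} s) = (\<xi> i \<omega>)\<^sup>2 * indicator {\<tau> i<..\<tau> (Suc i)} s"
      by (rule sum_if_single[OF i(1)], simp add: other)+
    ultimately show ?thesis
      unfolding simple_value_def using i by simp
  next
    case False
    then have "indicator {\<tau> j<..\<tau> (Suc j)} s = (0::real)" if "j < m" for j using that by (auto simp: indicator_def)
    then show ?thesis by (simp add: simple_value_def)
  qed
  then have "quad_var (simple_value m \<tau> \<xi>) T \<omega>
      = (LINT s|lborel. (\<Sum>i<m. (\<xi> i \<omega>)\<^sup>2 * indicator {\<tau> i<..\<tau> (Suc i)} s))"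
    by (simp add: quad_var_def set_lebesgue_integral_def)
  also have "\<dots> = (\<Sum>i<m. (\<xi> i \<omega>)\<^sup>2 * (\<tau> (Suc i) - \<tau> i))"
    by (subst Bochner_Integration.integral_sum) (use mono in \<open>auto simp: integrable_real_indicator\<close>)
  finally show ?thesis .
qed

text \<open>Switches the process off from the first interval whose contribution would lift the
  quadratic variation above \<open>R\<close>. The sum includes the index \<open>i\<close> itself, so
  the level is never exceeded; this look-ahead is still adapted because \<open>\<xi> i\<close> is
  known at \<open>\<tau> i\<close>.\<close>

definition truncate_at ::
  "real \<Rightarrow> (nat \<Rightarrow> real) \<Rightarrow> (nat \<Rightarrow> 'w \<Rightarrow> real) \<Rightarrow> nat \<Rightarrow> 'w \<Rightarrow> real" where
  "truncate_at R \<tau> \<xi> i \<omega> =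
     (if (\<Sum>j\<le>i. (\<xi> j \<omega>)\<^sup>2 * (\<tau> (Suc j) - \<tau> j)) \<le> R then \<xi> i \<omega> else 0)"

lemma simple_process_truncate:
  assumes sp: "simple_process F T m \<tau> \<xi>"
  shows "simple_process F T m \<tau> (truncate_at R \<tau> \<xi>)"
  unfolding simple_process_def
proof (intro conjI allI impI)
  note mono = simple_process_mono[OF sp]
  show "\<tau> 0 = 0" "\<tau> m = T" "\<And>i. i < m \<Longrightarrow> \<tau> i < \<tau> (Suc i)" using sp by (auto simp: simple_process_def)
  fix i assume "i < m"
  have \<xi>: "\<xi> j \<in> borel_measurable (F (\<tau> i))" if "j \<le> i" for j
    using sp that \<open>i < m\<close> by (intro measurable_F_mono[OF mono[of j i]]) (auto simp: simple_process_def)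
  then have [measurable]: "(\<lambda>\<omega>. \<Sum>j\<le>i. (\<xi> j \<omega>)\<^sup>2 * (\<tau> (Suc j) - \<tau> j)) \<in> borel_measurable (F (\<tau> i))"
    by (intro borel_measurable_sum) auto
  have [measurable]: "\<xi> i \<in> borel_measurable (F (\<tau> i))" using \<xi> by simp
  show "truncate_at R \<tau> \<xi> i \<in> borel_measurable (F (\<tau> i))"
    unfolding truncate_at_def[abs_def] by measurable
  obtain B where "\<And>\<omega>. \<omega> \<in> space (F (\<tau> i)) \<Longrightarrow> \<bar>\<xi> i \<omega>\<bar> \<le> B"
    using sp \<open>i < m\<close> unfolding simple_process_def by blast
  then show "\<exists>B. \<forall>\<omega>\<in>space (F (\<tau> i)). \<bar>truncate_at R \<tau> \<xi> i \<omega>\<bar> \<le> B"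
    by (intro exI[of _ "max B 0"]) (auto simp: truncate_at_def le_max_iff_disj)
qed

lemma truncate_at_bound:
  assumes sp: "simple_process F T m \<tau> \<xi>" and "0 \<le> R" "k \<le> m"
  shows "(\<Sum>i<k. (truncate_at R \<tau> \<xi> i \<omega>)\<^sup>2 * (\<tau> (Suc i) - \<tau> i)) \<le> R"
proof -
  have pos: "0 \<le> (\<xi> i \<omega>)\<^sup>2 * (\<tau> (Suc i) - \<tau> i)" if "i < m" for i
    using sp that by (auto simp: simple_process_def less_imp_le)
  \<comment> \<open>The comparison with the full sum carries the induction: if the value at
    \<open>k\<close> is kept, the full sum up to and including \<open>k\<close> is at most
    \<open>R\<close>.\<close>
  have "(\<Sum>i<k. (truncate_at R \<tau> \<xi> i \<omega>)\<^sup>2 * (\<tau> (Suc i) - \<tau> i)) \<le> R \<and>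
      (\<Sum>i<k. (truncate_at R \<tau> \<xi> i \<omega>)\<^sup>2 * (\<tau> (Suc i) - \<tau> i)) \<le> (\<Sum>i<k. (\<xi> i \<omega>)\<^sup>2 * (\<tau> (Suc i) - \<tau> i))"
    using \<open>k \<le> m\<close>
  proof (induction k)
    case (Suc k)
    then show ?case using pos[of k] by (auto simp: truncate_at_def lessThan_Suc_atMost[symmetric])
  qed (use \<open>0 \<le> R\<close> in simp)
  then show ?thesis by simp
qed

lemma truncate_at_eq:
  assumes sp: "simple_process F T m \<tau> \<xi>" and "i < m"
    and "(\<Sum>j<m. (\<xi> j \<omega>)\<^sup>2 * (\<tau> (Suc j) - \<tau> j)) \<le> R"
  shows "truncate_at R \<tau> \<xi> i \<omega> = \<xi> i \<omega>"
proof -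
  have "(\<Sum>j\<le>i. (\<xi> j \<omega>)\<^sup>2 * (\<tau> (Suc j) - \<tau> j)) \<le> (\<Sum>j<m. (\<xi> j \<omega>)\<^sup>2 * (\<tau> (Suc j) - \<tau> j))"
    by (rule sum_mono2) (use sp \<open>i < m\<close> in \<open>auto simp: simple_process_def less_imp_le\<close>)
  then show ?thesis using assms by (simp add: truncate_at_def)
qed

end

section \<open>The Ito integral\<close>

lemma L2_diff:
  fixes f g :: "'a \<Rightarrow> real"
  assumes [measurable]: "f \<in> borel_measurable N" "g \<in> borel_measurable N"
    and i: "integrable N (\<lambda>x. (f x)\<^sup>2)" "integrable N (\<lambda>x. (g x)\<^sup>2)"
  shows "integrable N (\<lambda>x. (f x - g x)\<^sup>2)"
    "(\<integral>x. (f x - g x)\<^sup>2 \<partial>N) \<le> 2 * (\<integral>x. (f x)\<^sup>2 \<partial>N) + 2 * (\<integral>x. (g x)\<^sup>2 \<partial>N)"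
proof -
  have b: "(a - b)\<^sup>2 \<le> 2 * a\<^sup>2 + 2 * b\<^sup>2" for a b :: real
    using zero_le_power2[of "a + b"] unfolding power2_diff power2_sum by linarith
  have i2: "integrable N (\<lambda>x. 2 * (f x)\<^sup>2 + 2 * (g x)\<^sup>2)" using i by simp
  show j: "integrable N (\<lambda>x. (f x - g x)\<^sup>2)"
    by (rule Bochner_Integration.integrable_bound[OF i2]) (use b in auto)
  have "(\<integral>x. (f x - g x)\<^sup>2 \<partial>N) \<le> (\<integral>x. 2 * (f x)\<^sup>2 + 2 * (g x)\<^sup>2 \<partial>N)"
    by (rule integral_mono[OF j i2]) (rule b)
  then show "(\<integral>x. (f x - g x)\<^sup>2 \<partial>N) \<le> 2 * (\<integral>x. (f x)\<^sup>2 \<partial>N) + 2 * (\<integral>x. (g x)\<^sup>2 \<partial>N)"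
    using i by simp
qed

text \<open>Rests on \<open>\<bar>a\<^sup>2 - b\<^sup>2\<bar> \<le> e b\<^sup>2 + (1 + 1 / e) (a -
  b)\<^sup>2\<close>, a form of Young's inequality in which the square of the limit carries an
  arbitrarily small factor.\<close>

lemma L2_norm_tendsto:
  fixes f :: "nat \<Rightarrow> 'a \<Rightarrow> real"
  assumes [measurable]: "\<And>n. f n \<in> borel_measurable N" "g \<in> borel_measurable N"
    and i: "\<And>n. integrable N (\<lambda>x. (f n x)\<^sup>2)" "integrable N (\<lambda>x. (g x)\<^sup>2)"
    and lim: "(\<lambda>n. \<integral>x. (f n x - g x)\<^sup>2 \<partial>N) \<longlonglongrightarrow> 0"
  shows "(\<lambda>n. \<integral>x. (f n x)\<^sup>2 \<partial>N) \<longlonglongrightarrow> (\<integral>x. (g x)\<^sup>2 \<partial>N)"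
proof -
  let ?G = "\<integral>x. (g x)\<^sup>2 \<partial>N" and ?D = "\<lambda>n. \<integral>x. (f n x - g x)\<^sup>2 \<partial>N"
  note d = L2_diff[OF assms(1,2) i]
  have G0: "0 \<le> ?G" by simp
  have key: "\<bar>(\<integral>x. (f n x)\<^sup>2 \<partial>N) - ?G\<bar> \<le> e * ?G + (1 + 1 / e) * ?D n" if e: "0 < e" for n e
  proof -
    have pt: "\<bar>a\<^sup>2 - b\<^sup>2\<bar> \<le> e * b\<^sup>2 + (1 + 1 / e) * (a - b)\<^sup>2" for a b :: real
    proof -
      have "0 \<le> (e * b - (a - b))\<^sup>2 / e" "0 \<le> (e * b + (a - b))\<^sup>2 / e" using e by auto
      moreover have "(e * b - (a - b))\<^sup>2 / e = e * b\<^sup>2 - 2 * (b * (a - b)) + (a - b)\<^sup>2 / e"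
        "(e * b + (a - b))\<^sup>2 / e = e * b\<^sup>2 + 2 * (b * (a - b)) + (a - b)\<^sup>2 / e"
        using e by (simp_all add: power2_eq_square field_simps)
      moreover have "a\<^sup>2 - b\<^sup>2 = (a - b)\<^sup>2 + 2 * (b * (a - b))" by (simp add: power2_eq_square algebra_simps)
      moreover have "(1 + 1 / e) * (a - b)\<^sup>2 = (a - b)\<^sup>2 + (a - b)\<^sup>2 / e" by (simp add: algebra_simps)
      ultimately show ?thesis using zero_le_power2[of "a - b"] by linarith
    qed
    have "\<bar>(\<integral>x. (f n x)\<^sup>2 \<partial>N) - ?G\<bar> = \<bar>\<integral>x. (f n x)\<^sup>2 - (g x)\<^sup>2 \<partial>N\<bar>" using i by simp
    also have "\<dots> \<le> (\<integral>x. \<bar>(f n x)\<^sup>2 - (g x)\<^sup>2\<bar> \<partial>N)" by (rule integral_abs_bound)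
    also have "\<dots> \<le> (\<integral>x. e * (g x)\<^sup>2 + (1 + 1 / e) * (f n x - g x)\<^sup>2 \<partial>N)"
      using i d(1) pt by (intro integral_mono) auto
    also have "\<dots> = e * ?G + (1 + 1 / e) * ?D n" using i d(1) by simp
    finally show ?thesis .
  qed
  show ?thesis
  proof (rule LIMSEQ_I)
    fix r :: real assume r: "0 < r"
    \<comment> \<open>Chosen so that \<open>e * ?G\<close> is at most \<open>r / 2\<close>; the
      summand \<open>1\<close> covers the case \<open>?G = 0\<close>.\<close>
    define e where "e = r / (2 * (?G + 1))"
    have pos: "0 < 2 * (?G + 1)" by (intro mult_pos_pos add_nonneg_pos G0) auto
    have e: "0 < e" unfolding e_def by (rule divide_pos_pos[OF r pos])
    have "e * (2 * (?G + 1)) = r" using pos by (simp add: e_def)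
    then have "e * ?G \<le> r / 2" using e by (simp add: algebra_simps)
    obtain n0 where n0: "\<And>n. n \<ge> n0 \<Longrightarrow> \<bar>?D n\<bar> < r / 2 / (1 + 1 / e)"
      using LIMSEQ_D[OF lim, of "r / 2 / (1 + 1 / e)"] r e by (auto simp: add_pos_pos)
    have "norm ((\<integral>x. (f n x)\<^sup>2 \<partial>N) - ?G) < r" if "n \<ge> n0" for n
    proof -
      have c: "0 < 1 + 1 / e" using e by (simp add: add_pos_pos)
      have "?D n < r / 2 / (1 + 1 / e)" using n0[OF that] by simp
      then have "(1 + 1 / e) * ?D n < r / 2"
        unfolding pos_less_divide_eq[OF c] by (simp only: mult.commute)
      then have "e * ?G + (1 + 1 / e) * ?D n < r" using \<open>e * ?G \<le> r / 2\<close> by linarith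
      then show ?thesis unfolding real_norm_def by (rule le_less_trans[OF key[OF e, of n]])
    qed
    then show "\<exists>n0. \<forall>n\<ge>n0. norm ((\<integral>x. (f n x)\<^sup>2 \<partial>N) - ?G) < r" by blast
  qed
qed

lemma tendsto_in_probability_subseq:
  assumes "tendsto_in_probability M X Z" "strict_mono r"
  shows "tendsto_in_probability M (\<lambda>n. X (r n)) Z"
  using assms unfolding tendsto_in_probability_def
  by (auto intro: LIMSEQ_subseq_LIMSEQ[unfolded comp_def])

text \<open>Convergence in probability is handled through the expectation of
  \<open>min 1 \<bar>Y\<bar>\<close>, to which theorems on convergence in mean apply.\<close>

lemma (in prob_space) expectation_min_le:
  fixes Y :: "'a \<Rightarrow> real"
  assumes [measurable]: "Y \<in> borel_measurable M" and "0 < e"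
  shows "expectation (\<lambda>\<omega>. min 1 \<bar>Y \<omega>\<bar>) \<le> e + prob {\<omega>\<in>space M. \<bar>Y \<omega>\<bar> > e}"
proof -
  have "expectation (\<lambda>\<omega>. min 1 \<bar>Y \<omega>\<bar>) \<le> expectation (\<lambda>\<omega>. e + indicator {\<omega>\<in>space M. \<bar>Y \<omega>\<bar> > e} \<omega>)"
  proof (rule integral_mono)
    show "integrable M (\<lambda>\<omega>. min 1 \<bar>Y \<omega>\<bar>)" by (rule integrable_const_bound[of _ 1]) auto
    show "integrable M (\<lambda>\<omega>. e + indicator {\<omega>\<in>space M. \<bar>Y \<omega>\<bar> > e} \<omega>)"
      by (intro Bochner_Integration.integrable_add integrable_real_indicator) (auto simp: emeasure_eq_measure)
    show "min 1 \<bar>Y \<omega>\<bar> \<le> e + indicator {\<omega>\<in>space M. \<bar>Y \<omega>\<bar> > e} \<omega>" if "\<omega> \<in> space M" for \<omega>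
      using that \<open>0 < e\<close> by (auto simp: indicator_def)
  qed
  also have "\<dots> = e + prob {\<omega>\<in>space M. \<bar>Y \<omega>\<bar> > e}"
    by (subst Bochner_Integration.integral_add) (auto simp: emeasure_eq_measure prob_space integrable_real_indicator)
  finally show ?thesis .
qed

lemma (in prob_space) expectation_min_AE_subseq:
  fixes Y :: "nat \<Rightarrow> 'a \<Rightarrow> real"
  assumes [measurable]: "\<And>n. Y n \<in> borel_measurable M"
    and "(\<lambda>n. expectation (\<lambda>\<omega>. min 1 \<bar>Y n \<omega>\<bar>)) \<longlonglongrightarrow> 0"
  obtains r where "strict_mono r" "AE \<omega> in M. (\<lambda>n. Y (r n) \<omega>) \<longlonglongrightarrow> 0"
proof -
  have "\<exists>r::nat\<Rightarrow>nat. strict_mono r \<and> (AE \<omega> in M. (\<lambda>n. min 1 \<bar>Y (r n) \<omega>\<bar>) \<longlonglongrightarrow> 0)"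
    by (rule tendsto_L1_AE_subseq) (use assms in \<open>auto intro!: integrable_const_bound[of _ 1]\<close>)
  then obtain r where r: "strict_mono r" "AE \<omega> in M. (\<lambda>n. min 1 \<bar>Y (r n) \<omega>\<bar>) \<longlonglongrightarrow> 0" by blast
  \<comment> \<open>Once the capped value is below \<open>1\<close>, the cap is inactive.\<close>
  have "x \<longlonglongrightarrow> 0" if lim: "(\<lambda>n. min 1 \<bar>x n\<bar>) \<longlonglongrightarrow> 0" for x :: "nat \<Rightarrow> real"
  proof -
    have "eventually (\<lambda>n. min 1 \<bar>x n\<bar> < 1) sequentially" using order_tendstoD(2)[OF lim, of 1] by simp
    then have "eventually (\<lambda>n. min 1 \<bar>x n\<bar> = \<bar>x n\<bar>) sequentially" by eventually_elim auto
    then have "(\<lambda>n. \<bar>x n\<bar>) \<longlonglongrightarrow> 0" using lim tendsto_cong by fastforce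
    then show ?thesis by (simp add: tendsto_rabs_zero_iff)
  qed
  then have "AE \<omega> in M. (\<lambda>n. Y (r n) \<omega>) \<longlonglongrightarrow> 0" using r(2) by (auto elim: eventually_mono)
  then show thesis using r(1) that by blast
qed

lemma (in prob_space) tendsto_in_probability_AE_subseq:
  assumes [measurable]: "\<And>n. X n \<in> borel_measurable M" "Z \<in> borel_measurable M"
    and lim: "tendsto_in_probability M X Z"
  obtains r where "strict_mono r" "AE \<omega> in M. (\<lambda>n. X (r n) \<omega>) \<longlonglongrightarrow> Z \<omega>"
proof -
  let ?E = "\<lambda>n. expectation (\<lambda>\<omega>. min 1 \<bar>X n \<omega> - Z \<omega>\<bar>)"
  have "?E \<longlonglongrightarrow> 0"
  proof (rule LIMSEQ_I)
    fix r :: real assume r: "0 < r"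
    have "(\<lambda>n. prob {\<omega> \<in> space M. \<bar>X n \<omega> - Z \<omega>\<bar> > r / 2}) \<longlonglongrightarrow> 0"
      using lim half_gt_zero[OF r] unfolding tendsto_in_probability_def by blast
    from LIMSEQ_D[OF this, of "r / 2"] r obtain n0 where
      n0: "\<And>n. n \<ge> n0 \<Longrightarrow> prob {\<omega> \<in> space M. \<bar>X n \<omega> - Z \<omega>\<bar> > r / 2} < r / 2" by auto
    have "norm (?E n - 0) < r" if "n \<ge> n0" for n
    proof -
      have "0 \<le> ?E n" by (intro integral_nonneg_AE) auto
      moreover have "?E n \<le> r / 2 + prob {\<omega> \<in> space M. \<bar>X n \<omega> - Z \<omega>\<bar> > r / 2}"
        using r by (intro expectation_min_le) auto
      ultimately show ?thesis using n0[OF that] by simp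
    qed
    then show "\<exists>n0. \<forall>n\<ge>n0. norm (?E n - 0) < r" by blast
  qed
  from expectation_min_AE_subseq[OF _ this] obtain r
    where r: "strict_mono r" "AE \<omega> in M. (\<lambda>n. X (r n) \<omega> - Z \<omega>) \<longlonglongrightarrow> 0" by auto
  then have "AE \<omega> in M. (\<lambda>n. X (r n) \<omega>) \<longlonglongrightarrow> Z \<omega>"
    by (auto elim!: eventually_mono simp: LIM_zero_iff)
  then show thesis using r(1) that by blast
qed

text \<open>Extension by zero to the whole time axis, with the sample point first: paths become
  functions on \<open>lborel\<close>, and joint measurability refers to the plain product with
  \<open>lborel\<close> instead of a restricted space.\<close>

definition restrict_time :: "real \<Rightarrow> (real \<Rightarrow> 'w \<Rightarrow> real) \<Rightarrow> 'w \<Rightarrow> real \<Rightarrow> real" where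
  "restrict_time T h \<omega> s = indicator {0..T} s * h s \<omega>"

lemma restrict_time_diff:
  "restrict_time T (\<lambda>s \<omega>. h s \<omega> - h' s \<omega>) \<omega> s = restrict_time T h \<omega> s - restrict_time T h' \<omega> s"
  by (simp add: restrict_time_def algebra_simps)

lemma restrict_time_square:
  "(restrict_time T h \<omega> s)\<^sup>2 = indicator {0..T} s *\<^sub>R (h s \<omega>)\<^sup>2"
  by (simp add: restrict_time_def indicator_def)

lemma set_integrable_square_iff:
  "set_integrable lborel {0..T} (\<lambda>s. (h s \<omega>)\<^sup>2) \<longleftrightarrow> integrable lborel (\<lambda>s. (restrict_time T h \<omega> s)\<^sup>2)"
  by (simp add: set_integrable_def restrict_time_square)

text \<open>Times outside the interval are sent to \<open>0\<close>, which lies in it as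
  \<open>0 \<le> T\<close>; the indicator then hides the values at the moved times.\<close>

lemma restrict_space_pair_measurable:
  fixes f :: "real \<times> 'w \<Rightarrow> real"
  assumes "0 \<le> T" and f[measurable]: "f \<in> borel_measurable (restrict_space borel {0..T} \<Otimes>\<^sub>M N)"
  shows "(\<lambda>z. indicator {0..T} (fst z) * f z) \<in> borel_measurable (lborel \<Otimes>\<^sub>M N)"
proof -
  have "(\<lambda>s. if s \<in> {0..T} then s else (0::real)) \<in> lborel \<rightarrow>\<^sub>M restrict_space borel {0..T}"
    using \<open>0 \<le> T\<close> by (intro measurable_restrict_space2) auto
  then have [measurable]: "(\<lambda>s. if 0 \<le> s \<and> s \<le> T then s else (0::real)) \<in> lborel \<rightarrow>\<^sub>M restrict_space borel {0..T}"
    by simp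
  have "(\<lambda>z. indicator {0..T} (fst z) * f z)
     = (\<lambda>z. indicator {0..T} (fst z) * f ((if 0 \<le> fst z \<and> fst z \<le> T then fst z else 0), snd z))"
    by (auto simp: indicator_def)
  also have "\<dots> \<in> borel_measurable (lborel \<Otimes>\<^sub>M N)" by measurable
  finally show ?thesis .
qed

context brownian begin

text \<open>Measurability in time and sample point without regard to the filtration. It is what the
  theorems of Fubini and Tonelli ask for, and unlike \<open>progressive\<close> it involves a single
  product space for the whole interval.\<close>

definition jointly :: "real \<Rightarrow> (real \<Rightarrow> 'w \<Rightarrow> real) \<Rightarrow> bool" where
  "jointly T h \<longleftrightarrow> (\<lambda>z. restrict_time T h (snd z) (fst z)) \<in> borel_measurable (lborel \<Otimes>\<^sub>M M)"

lemma jointly_alt: "jointly T h \<longleftrightarrow>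
    (\<lambda>z. indicator {0..T} (fst z) * h (fst z) (snd z)) \<in> borel_measurable (lborel \<Otimes>\<^sub>M M)"
  by (simp add: jointly_def restrict_time_def)

lemma step_jointly: "step_on T P h J \<Longrightarrow> jointly T h"
  by (simp add: step_on_def jointly_alt)

lemma progressive_jointly:
  assumes "progressive F h" "0 \<le> T"
  shows "jointly T h"
proof -
  have f: "(\<lambda>(s, \<omega>). h s \<omega>) \<in> borel_measurable (restrict_space borel {0..T} \<Otimes>\<^sub>M F T)"
    using assms by (simp add: progressive_def)
  have "(\<lambda>z. z) \<in> restrict_space borel {0..T} \<Otimes>\<^sub>M M \<rightarrow>\<^sub>M restrict_space borel {0..T} \<Otimes>\<^sub>M F T"
  proof -
    have id: "(\<lambda>x. x) \<in> M \<rightarrow>\<^sub>M F T"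
      by (rule measurable_F_M[OF \<open>0 \<le> T\<close>]) (rule measurable_ident_sets[OF refl])
    have "(\<lambda>z. (fst z, snd z)) \<in> restrict_space borel {0..T} \<Otimes>\<^sub>M M \<rightarrow>\<^sub>M restrict_space borel {0..T} \<Otimes>\<^sub>M F T"
      by (rule measurable_Pair[OF measurable_fst measurable_compose[OF measurable_snd id]])
    then show ?thesis by simp
  qed
  from measurable_comp[OF this f]
  have "(\<lambda>(s, \<omega>). h s \<omega>) \<in> borel_measurable (restrict_space borel {0..T} \<Otimes>\<^sub>M M)" by (simp add: comp_def)
  from restrict_space_pair_measurable[OF \<open>0 \<le> T\<close> this] show ?thesis
    by (simp add: jointly_alt case_prod_beta)
qed

lemma jointly_diff: "jointly T h \<Longrightarrow> jointly T h' \<Longrightarrow> jointly T (\<lambda>s \<omega>. h s \<omega> - h' s \<omega>)"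
  unfolding jointly_def restrict_time_diff by (rule borel_measurable_diff)

lemma jointly_path:
  assumes "jointly T h" "\<omega> \<in> space M"
  shows "restrict_time T h \<omega> \<in> borel_measurable lborel"
proof -
  have [measurable]: "(\<lambda>z. restrict_time T h (snd z) (fst z)) \<in> borel_measurable (lborel \<Otimes>\<^sub>M M)"
    using assms by (simp add: jointly_def)
  have "(\<lambda>s. (\<lambda>z. restrict_time T h (snd z) (fst z)) (s, \<omega>)) \<in> borel_measurable lborel"
    using assms(2) by measurable
  then show ?thesis by simp
qed

lemma quad_var_alt: "quad_var h T \<omega> = (\<integral>s. (restrict_time T h \<omega> s)\<^sup>2 \<partial>lborel)"
  by (simp add: quad_var_def set_lebesgue_integral_def restrict_time_square)

lemma quad_var_measurable:
  assumes "jointly T h"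
  shows "quad_var h T \<in> borel_measurable M"
proof -
  have *: "(\<lambda>z. restrict_time T h (snd z) (fst z)) \<in> borel_measurable (lborel \<Otimes>\<^sub>M M)"
    using assms by (simp add: jointly_def)
  have "(\<lambda>(\<omega>, s). restrict_time T h \<omega> s) \<in> borel_measurable (M \<Otimes>\<^sub>M lborel)"
    using measurable_comp[OF measurable_pair_swap' *] by (simp add: comp_def case_prod_beta)
  then have "(\<lambda>(\<omega>, s). (restrict_time T h \<omega> s)\<^sup>2) \<in> borel_measurable (M \<Otimes>\<^sub>M lborel)"
    unfolding case_prod_beta by (rule borel_measurable_power)
  then show ?thesis unfolding quad_var_alt[abs_def]
    by (rule lborel.borel_measurable_lebesgue_integral)
qed

lemma quad_var_diff_le:
  assumes "jointly T h" "jointly T h'" "\<omega> \<in> space M"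
    and "set_integrable lborel {0..T} (\<lambda>s. (h s \<omega>)\<^sup>2)" "set_integrable lborel {0..T} (\<lambda>s. (h' s \<omega>)\<^sup>2)"
  shows "quad_var (\<lambda>s \<omega>. h s \<omega> - h' s \<omega>) T \<omega> \<le> 2 * quad_var h T \<omega> + 2 * quad_var h' T \<omega>"
  unfolding quad_var_alt restrict_time_diff
  using assms by (intro L2_diff(2) jointly_path) (auto simp: set_integrable_square_iff)

lemma quad_var_tendsto:
  assumes "\<And>n. jointly T (h n)" "jointly T h'" "\<omega> \<in> space M"
    and "\<And>n. set_integrable lborel {0..T} (\<lambda>s. (h n s \<omega>)\<^sup>2)" "set_integrable lborel {0..T} (\<lambda>s. (h' s \<omega>)\<^sup>2)"
    and "(\<lambda>n. quad_var (\<lambda>s \<omega>. h n s \<omega> - h' s \<omega>) T \<omega>) \<longlonglongrightarrow> 0"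
  shows "(\<lambda>n. quad_var (h n) T \<omega>) \<longlonglongrightarrow> quad_var h' T \<omega>"
  using assms unfolding quad_var_alt restrict_time_diff
  by (intro L2_norm_tendsto jointly_path) (auto simp: set_integrable_square_iff)

text \<open>Convergence in probability gives almost sure convergence along a subsequence; this is
  done for the integrands and then, along a further subsequence, for the integrals.\<close>

lemma ito_AE_approx:
  assumes ito: "has_ito_integral M F W H T Z" and "0 \<le> T"
  obtains m \<tau> \<xi> where "\<And>n. simple_process F T (m n) (\<tau> n) (\<xi> n)"
    "AE \<omega> in M. (\<lambda>n. quad_var (\<lambda>s \<omega>. simple_value (m n) (\<tau> n) (\<xi> n) s \<omega> - H s \<omega>) T \<omega>) \<longlonglongrightarrow> 0"
    "AE \<omega> in M. (\<lambda>n. stopped_simple_integral W (m n) (\<tau> n) (\<xi> n) T \<omega>) \<longlonglongrightarrow> Z \<omega>"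
proof -
  obtain m \<tau> \<xi> where sp: "\<And>n. simple_process F T (m n) (\<tau> n) (\<xi> n)"
    and D: "tendsto_in_probability M
          (\<lambda>n \<omega>. LINT s:{0..T}|lborel. (simple_value (m n) (\<tau> n) (\<xi> n) s \<omega> - H s \<omega>)\<^sup>2) (\<lambda>_. 0)"
    and Z: "tendsto_in_probability M (\<lambda>n. simple_integral W (m n) (\<tau> n) (\<xi> n)) Z"
    using ito unfolding has_ito_integral_def by blast
  have [measurable]: "Z \<in> borel_measurable M" and "progressive F H"
    using ito by (auto simp: has_ito_integral_def)
  have H: "jointly T H" by (rule progressive_jointly) fact+
  note st = simple_step_on[OF sp \<open>0 \<le> T\<close>]
  let ?D = "\<lambda>n. quad_var (\<lambda>s \<omega>. simple_value (m n) (\<tau> n) (\<xi> n) s \<omega> - H s \<omega>) T"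
  have D': "tendsto_in_probability M ?D (\<lambda>_. 0)" using D by (simp add: quad_var_def[abs_def])
  have "?D n \<in> borel_measurable M" for n
    by (intro quad_var_measurable jointly_diff H step_jointly[OF st])
  from tendsto_in_probability_AE_subseq[OF this _ D'] obtain r
    where r: "strict_mono r" "AE \<omega> in M. (\<lambda>n. ?D (r n) \<omega>) \<longlonglongrightarrow> 0" by auto
  have Z': "tendsto_in_probability M (\<lambda>n. stopped_simple_integral W (m (r n)) (\<tau> (r n)) (\<xi> (r n)) T) Z"
    using tendsto_in_probability_subseq[OF Z r(1)] by (simp add: stopped_simple_integral_end[OF sp])
  have "stopped_simple_integral W (m (r n)) (\<tau> (r n)) (\<xi> (r n)) T \<in> borel_measurable M" for n
    using step_measurable(1)[OF st] \<open>0 \<le> T\<close> by auto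
  from tendsto_in_probability_AE_subseq[OF this _ Z'] obtain q
    where q: "strict_mono q" "AE \<omega> in M. (\<lambda>n. stopped_simple_integral W (m (r (q n))) (\<tau> (r (q n))) (\<xi> (r (q n))) T \<omega>) \<longlonglongrightarrow> Z \<omega>"
    by auto
  have "AE \<omega> in M. (\<lambda>n. ?D (r (q n)) \<omega>) \<longlonglongrightarrow> 0"
    using r(2) by eventually_elim (rule LIMSEQ_subseq_LIMSEQ[OF _ q(1), unfolded comp_def])
  then show thesis using q(2) sp by (intro that[of "\<lambda>n. m (r (q n))" "\<lambda>n. \<tau> (r (q n))" "\<lambda>n. \<xi> (r (q n))"]) auto
qed

text \<open>Step processes approximate all components at once. The left-hand side passes to the
  limit by Fatou's lemma, which asks for no integrability of \<open>Z\<close>, and the right-hand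
  side by dominated convergence, since its integrand lies between \<open>0\<close> and
  \<open>1 / l\<close>.\<close>

lemma ito_exp_weight:
  fixes H :: "'i \<Rightarrow> real \<Rightarrow> 'w \<Rightarrow> real"
  assumes I: "finite I" and ito: "\<And>i. i \<in> I \<Longrightarrow> has_ito_integral M F W (H i) T (Z i)" and "0 \<le> T" "0 < l"
  shows "(\<integral>\<^sup>+\<omega>. ennreal (exp (- l * (\<Sum>i\<in>I. quad_var (H i) T \<omega>)) * (\<Sum>i\<in>I. (Z i \<omega>)\<^sup>2)) \<partial>M)
    \<le> ennreal (expectation (\<lambda>\<omega>. (1 - exp (- l * (\<Sum>i\<in>I. quad_var (H i) T \<omega>))) / l))"
proof -
  define approx where "approx i m \<tau> \<xi> \<longleftrightarrow> (\<forall>n. simple_process F T (m n) (\<tau> n) (\<xi> n)) \<and>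
    (AE \<omega> in M. (\<lambda>n. quad_var (\<lambda>s \<omega>. simple_value (m n) (\<tau> n) (\<xi> n) s \<omega> - H i s \<omega>) T \<omega>) \<longlonglongrightarrow> 0) \<and>
    (AE \<omega> in M. (\<lambda>n. stopped_simple_integral W (m n) (\<tau> n) (\<xi> n) T \<omega>) \<longlonglongrightarrow> Z i \<omega>)" for i m \<tau> \<xi>
  have "\<exists>m \<tau> \<xi>. approx i m \<tau> \<xi>" if "i \<in> I" for i
    unfolding approx_def by (rule ito_AE_approx[OF ito[OF that] \<open>0 \<le> T\<close>]) blast
  then obtain m \<tau> \<xi> where approx: "\<And>i. i \<in> I \<Longrightarrow> approx i (m i) (\<tau> i) (\<xi> i)"
    by metis
  have sp: "\<And>i n. i \<in> I \<Longrightarrow> simple_process F T (m i n) (\<tau> i n) (\<xi> i n)"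
    and D: "\<And>i. i \<in> I \<Longrightarrow> AE \<omega> in M. (\<lambda>n. quad_var (\<lambda>s \<omega>. simple_value (m i n) (\<tau> i n) (\<xi> i n) s \<omega> - H i s \<omega>) T \<omega>) \<longlonglongrightarrow> 0"
    and Z: "\<And>i. i \<in> I \<Longrightarrow> AE \<omega> in M. (\<lambda>n. stopped_simple_integral W (m i n) (\<tau> i n) (\<xi> i n) T \<omega>) \<longlonglongrightarrow> Z i \<omega>"
    using approx unfolding approx_def by blast+
  \<comment> \<open>\<open>step_exp_weight\<close> runs one induction for all components, hence the
    common set of jump times.\<close>
  define P where "P n = (\<Union>i\<in>I. \<tau> i n ` {..m i n})" for n
  define h where "h n i = simple_value (m i n) (\<tau> i n) (\<xi> i n)" for n i
  define J where "J n i = stopped_simple_integral W (m i n) (\<tau> i n) (\<xi> i n)" for n i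
  have finP: "finite (P n)" for n using I by (simp add: P_def)
  have st: "step_on T (P n) (h n i) (J n i)" if "i \<in> I" for n i
    unfolding h_def J_def
    by (rule step_refine[OF simple_step_on[OF sp \<open>0 \<le> T\<close>] finP]) (use that in \<open>auto simp: P_def\<close>)
  have [measurable]: "J n i T \<in> borel_measurable M" "quad_var (h n i) T \<in> borel_measurable M" if "i \<in> I" for n i
    using step_measurable[OF st[OF that] \<open>0 \<le> T\<close>] by auto
  have [measurable]: "Z i \<in> borel_measurable M" and Hp: "progressive F (H i)"
    and Hi: "AE \<omega> in M. set_integrable lborel {0..T} (\<lambda>s. (H i s \<omega>)\<^sup>2)" if "i \<in> I" for i
    using ito[OF that] by (simp_all only: has_ito_integral_def)
  have H: "jointly T (H i)" if "i \<in> I" for i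
    by (rule progressive_jointly[OF Hp[OF that] \<open>0 \<le> T\<close>])
  have [measurable]: "quad_var (H i) T \<in> borel_measurable M" if "i \<in> I" for i
    using quad_var_measurable[OF H[OF that]] .
  define Q where "Q n \<omega> = (\<Sum>i\<in>I. quad_var (h n i) T \<omega>)" for n \<omega>
  define S where "S \<omega> = (\<Sum>i\<in>I. quad_var (H i) T \<omega>)" for \<omega>
  have [measurable]: "Q n \<in> borel_measurable M" "S \<in> borel_measurable M" for n
    unfolding Q_def[abs_def] S_def[abs_def] by measurable
  have Q0: "0 \<le> Q n \<omega>" for n \<omega> unfolding Q_def by (intro sum_nonneg quad_var_nonneg)
  have lims: "AE \<omega> in M. (\<lambda>n. J n i T \<omega>) \<longlonglongrightarrow> Z i \<omega> \<and> (\<lambda>n. quad_var (h n i) T \<omega>) \<longlonglongrightarrow> quad_var (H i) T \<omega>"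
    if "i \<in> I" for i
    using D[OF that] Z[OF that] Hi[OF that] AE_space
  proof eventually_elim
    case (elim \<omega>)
    have "(\<lambda>n. quad_var (h n i) T \<omega>) \<longlonglongrightarrow> quad_var (H i) T \<omega>"
      using elim that st step_basic[OF st[OF that] \<open>0 \<le> T\<close>] unfolding h_def[symmetric]
      by (intro quad_var_tendsto step_jointly[OF st] H) auto
    then show ?case using elim by (simp add: J_def)
  qed
  have "AE \<omega> in M. \<forall>i\<in>I. (\<lambda>n. J n i T \<omega>) \<longlonglongrightarrow> Z i \<omega> \<and> (\<lambda>n. quad_var (h n i) T \<omega>) \<longlonglongrightarrow> quad_var (H i) T \<omega>"
    using I lims by (simp add: AE_finite_all)
  then have lim: "AE \<omega> in M. (\<lambda>n. Q n \<omega>) \<longlonglongrightarrow> S \<omega> \<and>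
      (\<lambda>n. exp (- l * Q n \<omega>) * (\<Sum>i\<in>I. (J n i T \<omega>)\<^sup>2)) \<longlonglongrightarrow> exp (- l * S \<omega>) * (\<Sum>i\<in>I. (Z i \<omega>)\<^sup>2)"
  proof eventually_elim
    case (elim \<omega>)
    then have "(\<lambda>n. Q n \<omega>) \<longlonglongrightarrow> S \<omega>" unfolding Q_def S_def by (intro tendsto_sum) auto
    then show ?case using elim by (auto intro!: tendsto_intros)
  qed
  let ?R = "\<lambda>\<omega>. (1 - exp (- l * S \<omega>)) / l"
  have R: "(\<lambda>n. expectation (\<lambda>\<omega>. (1 - exp (- l * Q n \<omega>)) / l)) \<longlonglongrightarrow> expectation ?R"
  proof (rule integral_dominated_convergence[where w = "\<lambda>_. 1 / l"])
    show "AE \<omega> in M. (\<lambda>n. (1 - exp (- l * Q n \<omega>)) / l) \<longlonglongrightarrow> ?R \<omega>"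
      using lim by eventually_elim (use \<open>0 < l\<close> in \<open>auto intro!: tendsto_intros\<close>)
    have "norm ((1 - exp (- l * Q n \<omega>)) / l) \<le> 1 / l" for n \<omega>
      using \<open>0 < l\<close> Q0[of n \<omega>] by (simp add: field_simps)
    then show "AE \<omega> in M. norm ((1 - exp (- l * Q n \<omega>)) / l) \<le> 1 / l" for n by simp
  qed auto
  have L: "(\<integral>\<^sup>+\<omega>. ennreal (exp (- l * Q n \<omega>) * (\<Sum>i\<in>I. (J n i T \<omega>)\<^sup>2)) \<partial>M)
      \<le> ennreal (expectation (\<lambda>\<omega>. (1 - exp (- l * Q n \<omega>)) / l))" for n
  proof -
    have "integrable M (\<lambda>\<omega>. exp (- l * Q n \<omega>) * (\<Sum>i\<in>I. (J n i T \<omega>)\<^sup>2))"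
      by (rule integrable_bounded_mult[of _ _ 1])
        (use step_basic[OF st \<open>0 \<le> T\<close>] Q0 \<open>0 < l\<close> in auto)
    then have "(\<integral>\<^sup>+\<omega>. ennreal (exp (- l * Q n \<omega>) * (\<Sum>i\<in>I. (J n i T \<omega>)\<^sup>2)) \<partial>M)
      = ennreal (expectation (\<lambda>\<omega>. exp (- l * Q n \<omega>) * (\<Sum>i\<in>I. (J n i T \<omega>)\<^sup>2)))"
      by (intro nn_integral_eq_integral AE_I2 mult_nonneg_nonneg sum_nonneg) auto
    also have "\<dots> \<le> ennreal (expectation (\<lambda>\<omega>. (1 - exp (- l * Q n \<omega>)) / l))"
      unfolding Q_def by (intro ennreal_leI step_exp_weight[OF I st \<open>0 \<le> T\<close> \<open>0 < l\<close> finP])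
    finally show ?thesis .
  qed
  have "(\<integral>\<^sup>+\<omega>. ennreal (exp (- l * S \<omega>) * (\<Sum>i\<in>I. (Z i \<omega>)\<^sup>2)) \<partial>M)
     = (\<integral>\<^sup>+\<omega>. liminf (\<lambda>n. ennreal (exp (- l * Q n \<omega>) * (\<Sum>i\<in>I. (J n i T \<omega>)\<^sup>2))) \<partial>M)"
  proof (rule nn_integral_cong_AE)
    show "AE \<omega> in M. ennreal (exp (- l * S \<omega>) * (\<Sum>i\<in>I. (Z i \<omega>)\<^sup>2))
        = liminf (\<lambda>n. ennreal (exp (- l * Q n \<omega>) * (\<Sum>i\<in>I. (J n i T \<omega>)\<^sup>2)))"
      using lim
    proof eventually_elim
      case (elim \<omega>)
      then have "(\<lambda>n. ennreal (exp (- l * Q n \<omega>) * (\<Sum>i\<in>I. (J n i T \<omega>)\<^sup>2)))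
        \<longlonglongrightarrow> ennreal (exp (- l * S \<omega>) * (\<Sum>i\<in>I. (Z i \<omega>)\<^sup>2))" by (intro tendsto_ennrealI) auto
      then show ?case by (simp add: lim_imp_Liminf)
    qed
  qed
  also have "\<dots> \<le> liminf (\<lambda>n. \<integral>\<^sup>+\<omega>. ennreal (exp (- l * Q n \<omega>) * (\<Sum>i\<in>I. (J n i T \<omega>)\<^sup>2)) \<partial>M)"
    by (rule nn_integral_liminf) measurable
  also have "\<dots> \<le> liminf (\<lambda>n. ennreal (expectation (\<lambda>\<omega>. (1 - exp (- l * Q n \<omega>)) / l)))"
    by (intro Liminf_mono always_eventually allI L)
  also have "\<dots> = ennreal (expectation ?R)"
    using R by (intro lim_imp_Liminf tendsto_ennrealI) auto
  finally show ?thesis by (simp add: S_def)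
qed

section \<open>Mean-square approximation, isometry and martingale property\<close>

lemma quad_var_mono:
  assumes "0 \<le> r" "r \<le> T" "set_integrable lborel {0..T} (\<lambda>s. (h s \<omega>)\<^sup>2)"
  shows "set_integrable lborel {0..r} (\<lambda>s. (h s \<omega>)\<^sup>2)" "quad_var h r \<omega> \<le> quad_var h T \<omega>"
proof -
  show i: "set_integrable lborel {0..r} (\<lambda>s. (h s \<omega>)\<^sup>2)"
    by (rule set_integrable_subset[OF assms(3)]) (use assms in auto)
  show "quad_var h r \<omega> \<le> quad_var h T \<omega>"
    unfolding quad_var_def set_lebesgue_integral_def
    using i assms by (intro integral_mono) (auto simp: set_integrable_def indicator_def)
qed

lemma square_integrable_diff:
  assumes "jointly T h" "jointly T h'" "\<omega> \<in> space M"
    and "set_integrable lborel {0..T} (\<lambda>s. (h s \<omega>)\<^sup>2)" "set_integrable lborel {0..T} (\<lambda>s. (h' s \<omega>)\<^sup>2)"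
  shows "set_integrable lborel {0..T} (\<lambda>s. (h s \<omega> - h' s \<omega>)\<^sup>2)"
  using L2_diff(1)[OF jointly_path[OF assms(1,3)] jointly_path[OF assms(2,3)]] assms(4,5)
  by (simp add: set_integrable_square_iff set_integrable_square_iff[of T "\<lambda>s \<omega>. h s \<omega> - h' s \<omega>"] restrict_time_diff)

lemma quad_var_triangle:
  assumes "jointly T h" "jointly T h'" "jointly T g" "\<omega> \<in> space M"
    and "set_integrable lborel {0..T} (\<lambda>s. (h s \<omega>)\<^sup>2)" "set_integrable lborel {0..T} (\<lambda>s. (h' s \<omega>)\<^sup>2)"
    "set_integrable lborel {0..T} (\<lambda>s. (g s \<omega>)\<^sup>2)"
  shows "quad_var (\<lambda>s \<omega>. h s \<omega> - h' s \<omega>) T \<omega>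
    \<le> 2 * quad_var (\<lambda>s \<omega>. h s \<omega> - g s \<omega>) T \<omega> + 2 * quad_var (\<lambda>s \<omega>. h' s \<omega> - g s \<omega>) T \<omega>"
  using quad_var_diff_le[OF jointly_diff[OF assms(1,3)] jointly_diff[OF assms(2,3)] assms(4)
      square_integrable_diff[OF assms(1,3,4,5,7)] square_integrable_diff[OF assms(2,3,4,6,7)]]
  by simp

lemma step_quad_var_integrable:
  assumes "step_on T P h J" "0 \<le> T"
  shows "integrable M (quad_var h T)"
proof -
  obtain B where "\<And>\<omega>. \<omega> \<in> space M \<Longrightarrow> quad_var h T \<omega> \<le> B" using step_basic[OF assms] by blast
  then show ?thesis using step_measurable(2)[OF assms] quad_var_nonneg
    by (intro integrable_const_bound[of _ B]) auto
qed

lemma step_quad_var_diff_integrable: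
  assumes st: "step_on T P h J" and "0 \<le> T" and H: "jointly T H"
    and Hi: "AE \<omega> in M. set_integrable lborel {0..T} (\<lambda>s. (H s \<omega>)\<^sup>2)" and i: "integrable M (quad_var H T)"
  shows "integrable M (quad_var (\<lambda>s \<omega>. h s \<omega> - H s \<omega>) T)"
proof (rule Bochner_Integration.integrable_bound)
  show "integrable M (\<lambda>\<omega>. 2 * quad_var h T \<omega> + 2 * quad_var H T \<omega>)"
    using step_quad_var_integrable[OF st \<open>0 \<le> T\<close>] i by simp
  show "quad_var (\<lambda>s \<omega>. h s \<omega> - H s \<omega>) T \<in> borel_measurable M"
    by (intro quad_var_measurable jointly_diff step_jointly[OF st] H)
  show "AE \<omega> in M. norm (quad_var (\<lambda>s \<omega>. h s \<omega> - H s \<omega>) T \<omega>) \<le> norm (2 * quad_var h T \<omega> + 2 * quad_var H T \<omega>)"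
    using Hi AE_space
  proof eventually_elim
    case (elim \<omega>)
    have "set_integrable lborel {0..T} (\<lambda>s. (h s \<omega>)\<^sup>2)" using step_basic[OF st \<open>0 \<le> T\<close>] elim by blast
    from quad_var_diff_le[OF step_jointly[OF st] H elim(2) this elim(1)]
    show ?case using quad_var_nonneg[of h T \<omega>] quad_var_nonneg[of H T \<omega>]
        quad_var_nonneg[of "\<lambda>s \<omega>. h s \<omega> - H s \<omega>" T \<omega>] by simp
  qed
qed

text \<open>The approximants in the definition of the integral only converge in probability; cutting them
  off when their own quadratic variation exceeds a level makes them converge in mean square.\<close>

lemma ito_weak_approx:
  assumes ito: "has_ito_integral M F W H T Z" and "0 \<le> T" and A: "integrable M (quad_var H T)" and "0 < e"
  shows "\<exists>P h J. step_on T P h J \<and> expectation (quad_var (\<lambda>s \<omega>. h s \<omega> - H s \<omega>) T) < e \<and>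
    expectation (\<lambda>\<omega>. min 1 \<bar>J T \<omega> - Z \<omega>\<bar>) < e"
proof -
  obtain m \<tau> \<xi> where sp: "\<And>n. simple_process F T (m n) (\<tau> n) (\<xi> n)"
    and D0: "AE \<omega> in M. (\<lambda>n. quad_var (\<lambda>s \<omega>. simple_value (m n) (\<tau> n) (\<xi> n) s \<omega> - H s \<omega>) T \<omega>) \<longlonglongrightarrow> 0"
    and Z0: "AE \<omega> in M. (\<lambda>n. stopped_simple_integral W (m n) (\<tau> n) (\<xi> n) T \<omega>) \<longlonglongrightarrow> Z \<omega>"
    by (rule ito_AE_approx[OF ito \<open>0 \<le> T\<close>]) (rule that)
  have [measurable]: "Z \<in> borel_measurable M" and Hp: "progressive F H"
    and Hi: "AE \<omega> in M. set_integrable lborel {0..T} (\<lambda>s. (H s \<omega>)\<^sup>2)"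
    using ito by (simp_all only: has_ito_integral_def)
  have H: "jointly T H" by (rule progressive_jointly[OF Hp \<open>0 \<le> T\<close>])
  define S where "S = quad_var H T"
  have S0: "0 \<le> S \<omega>" for \<omega> unfolding S_def by (rule quad_var_nonneg)
  have Si: "integrable M S" using A by (simp add: S_def)
  have [measurable]: "S \<in> borel_measurable M" using Si by simp
  \<comment> \<open>On the event that \<open>S\<close> is at least \<open>R\<close>, the truncated
    integrand satisfies \<open>D n \<le> 2 R + 2 S \<le> 4 S\<close>, and
    \<open>V n \<le> 1\<close>. There \<open>f R\<close> dominates both errors, and its mean is
    small for large \<open>R\<close>.\<close>
  define f where "f R \<omega> = (4 * S \<omega> + 1) * indicator {x. real R \<le> x} (S \<omega>)" for R :: nat and \<omega>
  have [measurable]: "f R \<in> borel_measurable M" for R unfolding f_def[abs_def] by measurable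
  have flim: "(\<lambda>R. expectation (f R)) \<longlonglongrightarrow> expectation (\<lambda>_. 0)"
  proof (rule integral_dominated_convergence[where w = "\<lambda>\<omega>. 4 * S \<omega> + 1"])
    show "integrable M (\<lambda>\<omega>. 4 * S \<omega> + 1)" using Si by simp
    have "(\<lambda>R. f R \<omega>) \<longlonglongrightarrow> 0" for \<omega>
    proof (rule tendsto_eventually)
      obtain R0 where "S \<omega> < real R0" using reals_Archimedean2 by blast
      then show "eventually (\<lambda>R. f R \<omega> = 0) sequentially"
        unfolding eventually_sequentially by (intro exI[of _ R0]) (auto simp: f_def indicator_def)
    qed
    then show "AE \<omega> in M. (\<lambda>R. f R \<omega>) \<longlonglongrightarrow> 0" by simp
    show "AE \<omega> in M. norm (f R \<omega>) \<le> 4 * S \<omega> + 1" for R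
      using S0 by (auto simp: f_def indicator_def)
  qed auto
  then have "eventually (\<lambda>R. expectation (f R) < e / 2) sequentially"
    using \<open>0 < e\<close> by (intro order_tendstoD(2)[OF flim]) simp
  then obtain R where R: "expectation (f R) < e / 2" by (auto simp: eventually_sequentially)
  have fi: "integrable M (f R)"
    by (rule Bochner_Integration.integrable_bound[of _ "\<lambda>\<omega>. 4 * S \<omega> + 1"])
      (use Si S0 in \<open>auto simp: f_def indicator_def\<close>)
  define g where "g n = simple_value (m n) (\<tau> n) (truncate_at (real R) (\<tau> n) (\<xi> n))" for n
  define J where "J n = stopped_simple_integral W (m n) (\<tau> n) (truncate_at (real R) (\<tau> n) (\<xi> n))" for n
  note spt = simple_process_truncate[OF sp, of _ "real R"]
  have st: "step_on T (\<tau> n ` {..m n}) (g n) (J n)" for n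
    unfolding g_def J_def by (rule simple_step_on[OF spt \<open>0 \<le> T\<close>])
  have gR: "quad_var (g n) T \<omega> \<le> real R" for n \<omega>
    unfolding g_def quad_var_simple[OF spt] by (rule truncate_at_bound[OF sp]) auto
  define D where "D n = quad_var (\<lambda>s \<omega>. g n s \<omega> - H s \<omega>) T" for n
  have Di: "integrable M (D n)" for n
    unfolding D_def by (rule step_quad_var_diff_integrable[OF st \<open>0 \<le> T\<close> H Hi A])
  have D_nonneg: "0 \<le> D n \<omega>" for n \<omega> unfolding D_def by (rule quad_var_nonneg)
  have [measurable]: "D n \<in> borel_measurable M" "J n T \<in> borel_measurable M" for n
    using Di step_measurable(1)[OF st \<open>0 \<le> T\<close>] by auto
  have Dle: "AE \<omega> in M. D n \<omega> \<le> 2 * real R + 2 * S \<omega>" for n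
    using Hi AE_space
  proof eventually_elim
    case (elim \<omega>)
    have "set_integrable lborel {0..T} (\<lambda>s. (g n s \<omega>)\<^sup>2)" using step_basic[OF st \<open>0 \<le> T\<close>] elim by blast
    from quad_var_diff_le[OF step_jointly[OF st] H elim(2) this elim(1)] gR[of n \<omega>]
    show ?case by (simp add: D_def S_def)
  qed
  define V where "V n \<omega> = min 1 \<bar>J n T \<omega> - Z \<omega>\<bar>" for n \<omega>
  have [measurable]: "V n \<in> borel_measurable M" for n unfolding V_def[abs_def] by measurable
  have V01: "0 \<le> V n \<omega>" "V n \<omega> \<le> 1" for n \<omega> by (auto simp: V_def)
  \<comment> \<open>On the event that \<open>S\<close> is below \<open>R\<close> the truncation is
    eventually inactive, so \<open>X n\<close> tends to \<open>0\<close> almost surely; it is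
    bounded by \<open>4 R + 1\<close>.\<close>
  define X where "X n \<omega> = indicator {x. x < real R} (S \<omega>) * (D n \<omega> + V n \<omega>)" for n \<omega>
  have [measurable]: "X n \<in> borel_measurable M" for n unfolding X_def[abs_def] by measurable
  have Xlim: "AE \<omega> in M. (\<lambda>n. X n \<omega>) \<longlonglongrightarrow> 0"
    using Hi AE_space D0 Z0
  proof eventually_elim
    case (elim \<omega>)
    show ?case
    proof (cases "S \<omega> < real R")
      case True
      note st0 = simple_step_on[OF sp \<open>0 \<le> T\<close>]
      have "(\<lambda>n. quad_var (simple_value (m n) (\<tau> n) (\<xi> n)) T \<omega>) \<longlonglongrightarrow> S \<omega>"
        unfolding S_def using elim step_basic[OF st0 \<open>0 \<le> T\<close>]
        by (intro quad_var_tendsto step_jointly[OF st0] H) auto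
      from order_tendstoD(2)[OF this True]
      have "eventually (\<lambda>n. D n \<omega> = quad_var (\<lambda>s \<omega>. simple_value (m n) (\<tau> n) (\<xi> n) s \<omega> - H s \<omega>) T \<omega> \<and>
        J n T \<omega> = stopped_simple_integral W (m n) (\<tau> n) (\<xi> n) T \<omega>) sequentially"
      proof eventually_elim
        case (elim n)
        then have "truncate_at (real R) (\<tau> n) (\<xi> n) i \<omega> = \<xi> n i \<omega>" if "i < m n" for i
          using truncate_at_eq[OF sp that] by (simp add: quad_var_simple[OF sp])
        then have "g n s \<omega> = simple_value (m n) (\<tau> n) (\<xi> n) s \<omega>"
          "J n T \<omega> = stopped_simple_integral W (m n) (\<tau> n) (\<xi> n) T \<omega>" for s
          unfolding g_def J_def simple_value_def stopped_simple_integral_def by (auto intro!: sum.cong)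
        then show ?case by (simp add: D_def quad_var_def)
      qed
      then have "eventually (\<lambda>n. X n \<omega> = quad_var (\<lambda>s \<omega>. simple_value (m n) (\<tau> n) (\<xi> n) s \<omega> - H s \<omega>) T \<omega>
          + min 1 \<bar>stopped_simple_integral W (m n) (\<tau> n) (\<xi> n) T \<omega> - Z \<omega>\<bar>) sequentially"
        by eventually_elim (use True in \<open>simp add: X_def V_def\<close>)
      moreover have "(\<lambda>n. quad_var (\<lambda>s \<omega>. simple_value (m n) (\<tau> n) (\<xi> n) s \<omega> - H s \<omega>) T \<omega>
          + min 1 \<bar>stopped_simple_integral W (m n) (\<tau> n) (\<xi> n) T \<omega> - Z \<omega>\<bar>) \<longlonglongrightarrow> 0 + min 1 \<bar>Z \<omega> - Z \<omega>\<bar>"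
        using elim by (intro tendsto_intros) auto
      ultimately show ?thesis by (simp add: tendsto_cong)
    qed (simp add: X_def)
  qed
  have Xb: "AE \<omega> in M. norm (X n \<omega>) \<le> 4 * real R + 1" for n
    using Dle[of n]
  proof eventually_elim
    case (elim \<omega>)
    then show ?case using V01[of n \<omega>] D_nonneg[of n \<omega>] by (auto simp: X_def indicator_def)
  qed
  have "(\<lambda>n. expectation (X n)) \<longlonglongrightarrow> expectation (\<lambda>_. 0)"
    by (rule integral_dominated_convergence[where w = "\<lambda>_. 4 * real R + 1"]) (use Xlim Xb in auto)
  then have "eventually (\<lambda>n. expectation (X n) < e / 2) sequentially"
    using \<open>0 < e\<close> by (intro order_tendstoD(2)[of _ "expectation (\<lambda>_. 0)"]) auto
  then obtain n where n: "expectation (X n) < e / 2" by (auto simp: eventually_sequentially)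
  have Xi: "integrable M (X n)" by (rule integrable_const_bound[OF Xb]) measurable
  have "expectation (D n) \<le> expectation (\<lambda>\<omega>. X n \<omega> + f R \<omega>)"
  proof (rule integral_mono_AE[OF Di])
    show "AE \<omega> in M. D n \<omega> \<le> X n \<omega> + f R \<omega>"
      using Dle[of n]
      by eventually_elim (use V01[of n] S0 in \<open>auto simp: X_def f_def indicator_def\<close>)
  qed (use Xi fi in auto)
  also have "\<dots> < e" using n R Xi fi by simp
  finally have 1: "expectation (D n) < e" .
  have Vi: "integrable M (V n)" by (rule integrable_const_bound[of _ 1]) (use V01 in auto)
  have "expectation (V n) \<le> expectation (\<lambda>\<omega>. X n \<omega> + f R \<omega>)"
  proof (rule integral_mono[OF Vi])
    show "V n \<omega> \<le> X n \<omega> + f R \<omega>" for \<omega>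
      using V01[of n \<omega>] S0[of \<omega>] D_nonneg[of n \<omega>] by (auto simp: X_def f_def indicator_def)
  qed (use Xi fi in auto)
  also have "\<dots> < e" using n R Xi fi by simp
  finally have 2: "expectation (V n) < e" .
  show ?thesis using st[of n] 1 2 unfolding D_def V_def[abs_def] by blast
qed

text \<open>The isometry for the difference of two step integrals, with \<open>H\<close> as an
  intermediate point: this is the Cauchy estimate behind convergence in mean square.\<close>

lemma step_diff_square:
  assumes st: "step_on T P h J" and st': "step_on T P' h' J'" and "0 \<le> T" and H: "jointly T H"
    and Hi: "AE \<omega> in M. set_integrable lborel {0..T} (\<lambda>s. (H s \<omega>)\<^sup>2)" and i: "integrable M (quad_var H T)"
  shows "integrable M (\<lambda>\<omega>. (J T \<omega> - J' T \<omega>)\<^sup>2)"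
    "expectation (\<lambda>\<omega>. (J T \<omega> - J' T \<omega>)\<^sup>2) \<le> 2 * expectation (quad_var (\<lambda>s \<omega>. h s \<omega> - H s \<omega>) T)
      + 2 * expectation (quad_var (\<lambda>s \<omega>. h' s \<omega> - H s \<omega>) T)"
proof -
  note sd = step_diff[OF st st']
  note b = step_basic[OF sd \<open>0 \<le> T\<close> order_refl]
  note d = step_quad_var_diff_integrable[OF st \<open>0 \<le> T\<close> H Hi i] step_quad_var_diff_integrable[OF st' \<open>0 \<le> T\<close> H Hi i]
  show "integrable M (\<lambda>\<omega>. (J T \<omega> - J' T \<omega>)\<^sup>2)" using b by blast
  have "expectation (\<lambda>\<omega>. (J T \<omega> - J' T \<omega>)\<^sup>2) = expectation (quad_var (\<lambda>s \<omega>. h s \<omega> - h' s \<omega>) T)"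
    using b by blast
  also have "\<dots> \<le> expectation (\<lambda>\<omega>. 2 * quad_var (\<lambda>s \<omega>. h s \<omega> - H s \<omega>) T \<omega> + 2 * quad_var (\<lambda>s \<omega>. h' s \<omega> - H s \<omega>) T \<omega>)"
  proof (rule integral_mono_AE[OF step_quad_var_integrable[OF sd \<open>0 \<le> T\<close>]])
    show "AE \<omega> in M. quad_var (\<lambda>s \<omega>. h s \<omega> - h' s \<omega>) T \<omega>
        \<le> 2 * quad_var (\<lambda>s \<omega>. h s \<omega> - H s \<omega>) T \<omega> + 2 * quad_var (\<lambda>s \<omega>. h' s \<omega> - H s \<omega>) T \<omega>"
      using Hi AE_space
    proof eventually_elim
      case (elim \<omega>)
      then show ?case
        using step_basic[OF st \<open>0 \<le> T\<close>] step_basic[OF st' \<open>0 \<le> T\<close>]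
        by (intro quad_var_triangle step_jointly[OF st] step_jointly[OF st'] H) auto
    qed
  qed (use d in auto)
  also have "\<dots> = 2 * expectation (quad_var (\<lambda>s \<omega>. h s \<omega> - H s \<omega>) T)
      + 2 * expectation (quad_var (\<lambda>s \<omega>. h' s \<omega> - H s \<omega>) T)" using d by simp
  finally show "expectation (\<lambda>\<omega>. (J T \<omega> - J' T \<omega>)\<^sup>2) \<le> 2 * expectation (quad_var (\<lambda>s \<omega>. h s \<omega> - H s \<omega>) T)
      + 2 * expectation (quad_var (\<lambda>s \<omega>. h' s \<omega> - H s \<omega>) T)" .
qed

text \<open>The weak approximants form a Cauchy sequence in mean square by
  \<open>step_diff_square\<close>, and a subsequence converges to \<open>Z\<close> almost surely.
  Fatou's lemma along this subsequence, with \<open>n\<close> fixed, bounds the distance from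
  \<open>J n T\<close> to \<open>Z\<close>.\<close>

lemma ito_L2_approx:
  assumes ito: "has_ito_integral M F W H T Z" and "0 \<le> T" and A: "integrable M (quad_var H T)" and "0 < e"
  obtains P h J where "step_on T P h J" "expectation (quad_var (\<lambda>s \<omega>. h s \<omega> - H s \<omega>) T) < e"
    "integrable M (\<lambda>\<omega>. (J T \<omega> - Z \<omega>)\<^sup>2)" "expectation (\<lambda>\<omega>. (J T \<omega> - Z \<omega>)\<^sup>2) < e"
proof -
  have [measurable]: "Z \<in> borel_measurable M" and Hp: "progressive F H"
    and Hi: "AE \<omega> in M. set_integrable lborel {0..T} (\<lambda>s. (H s \<omega>)\<^sup>2)"
    using ito by (simp_all only: has_ito_integral_def)
  have H: "jointly T H" by (rule progressive_jointly[OF Hp \<open>0 \<le> T\<close>])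
  define a where "a n = 1 / real (Suc n)" for n
  have a0: "0 < a n" for n by (simp add: a_def)
  have alim: "a \<longlonglongrightarrow> 0" unfolding a_def using LIMSEQ_inverse_real_of_nat by (simp add: inverse_eq_divide)
  define good where "good n P h J \<longleftrightarrow> step_on T P h J \<and> expectation (quad_var (\<lambda>s \<omega>. h s \<omega> - H s \<omega>) T) < a n \<and>
    expectation (\<lambda>\<omega>. min 1 \<bar>J T \<omega> - Z \<omega>\<bar>) < a n" for n P h J
  have "\<exists>P h J. good n P h J" for n
    unfolding good_def by (rule ito_weak_approx[OF ito \<open>0 \<le> T\<close> A a0])
  then obtain P h J where good: "\<And>n. good n (P n) (h n) (J n)" by metis
  have st: "step_on T (P n) (h n) (J n)" and hD: "expectation (quad_var (\<lambda>s \<omega>. h n s \<omega> - H s \<omega>) T) < a n"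
    and hV: "expectation (\<lambda>\<omega>. min 1 \<bar>J n T \<omega> - Z \<omega>\<bar>) < a n" for n
    using good[of n] by (auto simp: good_def)
  have [measurable]: "J n T \<in> borel_measurable M" for n using step_measurable(1)[OF st \<open>0 \<le> T\<close>] by simp
  have "(\<lambda>n. expectation (\<lambda>\<omega>. min 1 \<bar>J n T \<omega> - Z \<omega>\<bar>)) \<longlonglongrightarrow> 0"
    by (rule tendsto_sandwich[OF _ _ tendsto_const alim])
      (auto intro!: always_eventually integral_nonneg_AE less_imp_le hV)
  from expectation_min_AE_subseq[OF _ this] obtain r
    where r: "strict_mono r" "AE \<omega> in M. (\<lambda>n. J (r n) T \<omega> - Z \<omega>) \<longlonglongrightarrow> 0" by auto
  \<comment> \<open>The Cauchy estimate will leave \<open>2 * a n + 2 * a (r k)\<close>, whose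
    second summand vanishes as \<open>k\<close> grows.\<close>
  have "eventually (\<lambda>n. 2 * a n < e) sequentially"
    using \<open>0 < e\<close> tendsto_mult[OF tendsto_const[of "2::real"] alim] by (intro order_tendstoD(2)[of _ 0]) auto
  then obtain n where n: "2 * a n < e" by (auto simp: eventually_sequentially)
  have "(\<integral>\<^sup>+\<omega>. ennreal ((J n T \<omega> - Z \<omega>)\<^sup>2) \<partial>M)
      = (\<integral>\<^sup>+\<omega>. liminf (\<lambda>k. ennreal ((J n T \<omega> - J (r k) T \<omega>)\<^sup>2)) \<partial>M)"
  proof (rule nn_integral_cong_AE)
    show "AE \<omega> in M. ennreal ((J n T \<omega> - Z \<omega>)\<^sup>2) = liminf (\<lambda>k. ennreal ((J n T \<omega> - J (r k) T \<omega>)\<^sup>2))"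
      using r(2)
    proof eventually_elim
      case (elim \<omega>)
      then have "(\<lambda>k. J (r k) T \<omega>) \<longlonglongrightarrow> Z \<omega>" by (simp add: LIM_zero_iff)
      then have "(\<lambda>k. ennreal ((J n T \<omega> - J (r k) T \<omega>)\<^sup>2)) \<longlonglongrightarrow> ennreal ((J n T \<omega> - Z \<omega>)\<^sup>2)"
        by (intro tendsto_ennrealI tendsto_intros)
      then show ?case by (rule lim_imp_Liminf[OF sequentially_bot, symmetric])
    qed
  qed
  also have "\<dots> \<le> liminf (\<lambda>k. \<integral>\<^sup>+\<omega>. ennreal ((J n T \<omega> - J (r k) T \<omega>)\<^sup>2) \<partial>M)"
    by (rule nn_integral_liminf) measurable
  also have "\<dots> \<le> liminf (\<lambda>k. ennreal (2 * a n + 2 * a (r k)))"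
  proof (intro Liminf_mono always_eventually allI)
    fix k
    note d = step_diff_square[OF st st \<open>0 \<le> T\<close> H Hi A, of n "r k"]
    have "(\<integral>\<^sup>+\<omega>. ennreal ((J n T \<omega> - J (r k) T \<omega>)\<^sup>2) \<partial>M) = ennreal (expectation (\<lambda>\<omega>. (J n T \<omega> - J (r k) T \<omega>)\<^sup>2))"
      using d(1) by (intro nn_integral_eq_integral) auto
    also have "\<dots> \<le> ennreal (2 * a n + 2 * a (r k))"
      using d(2) hD[of n] hD[of "r k"] by (intro ennreal_leI) linarith
    finally show "(\<integral>\<^sup>+\<omega>. ennreal ((J n T \<omega> - J (r k) T \<omega>)\<^sup>2) \<partial>M) \<le> ennreal (2 * a n + 2 * a (r k))" .
  qed
  also have "\<dots> = ennreal (2 * a n)"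
  proof (rule lim_imp_Liminf)
    have "(\<lambda>k. a (r k)) \<longlonglongrightarrow> 0" using LIMSEQ_subseq_LIMSEQ[OF alim r(1)] by (simp add: comp_def)
    then have "(\<lambda>k. 2 * a n + 2 * a (r k)) \<longlonglongrightarrow> 2 * a n + 2 * 0" by (intro tendsto_intros)
    then show "(\<lambda>k. ennreal (2 * a n + 2 * a (r k))) \<longlonglongrightarrow> ennreal (2 * a n)" by (intro tendsto_ennrealI) simp
  qed simp
  finally have le: "(\<integral>\<^sup>+\<omega>. ennreal ((J n T \<omega> - Z \<omega>)\<^sup>2) \<partial>M) \<le> ennreal (2 * a n)" .
  have i: "integrable M (\<lambda>\<omega>. (J n T \<omega> - Z \<omega>)\<^sup>2)"
    by (rule integrableI_bounded) (use le in \<open>auto simp: top.not_eq_extremum intro: le_less_trans\<close>)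
  have "expectation (\<lambda>\<omega>. (J n T \<omega> - Z \<omega>)\<^sup>2) \<le> 2 * a n"
    using le a0[of n] nn_integral_eq_integral[OF i] by (simp add: less_imp_le)
  then show thesis
    using n a0[of n] hD[of n] by (intro that[OF st _ i]) linarith+
qed

text \<open>Makes the mean quadratic variation a squared norm on the product space, so that
  \<open>L2_norm_tendsto\<close> applies to integrands exactly as to random variables.\<close>

lemma quad_var_prod_integral:
  assumes H: "jointly T H" and Hi: "AE \<omega> in M. set_integrable lborel {0..T} (\<lambda>s. (H s \<omega>)\<^sup>2)"
    and A: "integrable M (quad_var H T)"
  shows "integrable (M \<Otimes>\<^sub>M lborel) (\<lambda>(\<omega>, s). (restrict_time T H \<omega> s)\<^sup>2)"
    "(\<integral>z. (case z of (\<omega>, s) \<Rightarrow> (restrict_time T H \<omega> s)\<^sup>2) \<partial>(M \<Otimes>\<^sub>M lborel)) = expectation (quad_var H T)"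
proof -
  interpret pair_sigma_finite M lborel ..
  have *: "(\<lambda>z. restrict_time T H (snd z) (fst z)) \<in> borel_measurable (lborel \<Otimes>\<^sub>M M)"
    using H by (simp add: jointly_def)
  have "(\<lambda>(\<omega>, s). restrict_time T H \<omega> s) \<in> borel_measurable (M \<Otimes>\<^sub>M lborel)"
    using measurable_comp[OF measurable_pair_swap' *] by (simp add: comp_def case_prod_beta)
  then have m: "(\<lambda>(\<omega>, s). (restrict_time T H \<omega> s)\<^sup>2) \<in> borel_measurable (M \<Otimes>\<^sub>M lborel)"
    unfolding case_prod_beta by (rule borel_measurable_power)
  show i: "integrable (M \<Otimes>\<^sub>M lborel) (\<lambda>(\<omega>, s). (restrict_time T H \<omega> s)\<^sup>2)"
  proof (rule Fubini_integrable[OF m])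
    show "integrable M (\<lambda>\<omega>. \<integral>s. norm (case (\<omega>, s) of (\<omega>, s) \<Rightarrow> (restrict_time T H \<omega> s)\<^sup>2) \<partial>lborel)"
      using A by (simp add: quad_var_alt[abs_def])
    show "AE \<omega> in M. integrable lborel (\<lambda>s. case (\<omega>, s) of (\<omega>, s) \<Rightarrow> (restrict_time T H \<omega> s)\<^sup>2)"
      using Hi by (simp add: set_integrable_square_iff)
  qed
  show "(\<integral>z. (case z of (\<omega>, s) \<Rightarrow> (restrict_time T H \<omega> s)\<^sup>2) \<partial>(M \<Otimes>\<^sub>M lborel)) = expectation (quad_var H T)"
    using integral_fst'[OF i] by (simp add: quad_var_alt[abs_def])
qed

text \<open>Both sides are limits of their counterparts for step integrands: the mean square of
  \<open>Z\<close> on the probability space, the quadratic variation on its product with the time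
  axis.\<close>

lemma ito_isometry:
  assumes ito: "has_ito_integral M F W H T Z" and "0 \<le> T" and A: "integrable M (quad_var H T)"
  shows "integrable M (\<lambda>\<omega>. (Z \<omega>)\<^sup>2)" "expectation (\<lambda>\<omega>. (Z \<omega>)\<^sup>2) = expectation (quad_var H T)"
proof -
  have [measurable]: "Z \<in> borel_measurable M" and Hp: "progressive F H"
    and Hi: "AE \<omega> in M. set_integrable lborel {0..T} (\<lambda>s. (H s \<omega>)\<^sup>2)"
    using ito by (simp_all only: has_ito_integral_def)
  have H: "jointly T H" by (rule progressive_jointly[OF Hp \<open>0 \<le> T\<close>])
  define a where "a n = 1 / real (Suc n)" for n
  have a0: "0 < a n" for n by (simp add: a_def)
  have alim: "a \<longlonglongrightarrow> 0" unfolding a_def using LIMSEQ_inverse_real_of_nat by (simp add: inverse_eq_divide)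
  define good where "good n P h J \<longleftrightarrow> step_on T P h J \<and> expectation (quad_var (\<lambda>s \<omega>. h s \<omega> - H s \<omega>) T) < a n \<and>
    integrable M (\<lambda>\<omega>. (J T \<omega> - Z \<omega>)\<^sup>2) \<and> expectation (\<lambda>\<omega>. (J T \<omega> - Z \<omega>)\<^sup>2) < a n" for n P h J
  have "\<exists>P h J. good n P h J" for n
    unfolding good_def by (rule ito_L2_approx[OF ito \<open>0 \<le> T\<close> A a0]) blast
  then obtain P h J where good: "\<And>n. good n (P n) (h n) (J n)" by metis
  have st: "step_on T (P n) (h n) (J n)" and hD: "expectation (quad_var (\<lambda>s \<omega>. h n s \<omega> - H s \<omega>) T) < a n"
    and Ji: "integrable M (\<lambda>\<omega>. (J n T \<omega> - Z \<omega>)\<^sup>2)" and hV: "expectation (\<lambda>\<omega>. (J n T \<omega> - Z \<omega>)\<^sup>2) < a n" for n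
    using good[of n] by (auto simp: good_def)
  have [measurable]: "J n T \<in> borel_measurable M" for n using step_measurable(1)[OF st \<open>0 \<le> T\<close>] by simp
  have J2: "integrable M (\<lambda>\<omega>. (J n T \<omega>)\<^sup>2)" "expectation (\<lambda>\<omega>. (J n T \<omega>)\<^sup>2) = expectation (quad_var (h n) T)"
    and hi: "AE \<omega> in M. set_integrable lborel {0..T} (\<lambda>s. (h n s \<omega>)\<^sup>2)" for n
    using step_basic[OF st \<open>0 \<le> T\<close> order_refl] by auto
  show Z2: "integrable M (\<lambda>\<omega>. (Z \<omega>)\<^sup>2)"
    using L2_diff(1)[of "J 0 T" M "\<lambda>\<omega>. J 0 T \<omega> - Z \<omega>"] J2(1)[of 0] Ji[of 0] by simp
  have "(\<lambda>n. expectation (\<lambda>\<omega>. (J n T \<omega> - Z \<omega>)\<^sup>2)) \<longlonglongrightarrow> 0"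
    by (rule tendsto_sandwich[OF _ _ tendsto_const alim]) (auto intro!: always_eventually less_imp_le hV)
  then have l1: "(\<lambda>n. expectation (\<lambda>\<omega>. (J n T \<omega>)\<^sup>2)) \<longlonglongrightarrow> expectation (\<lambda>\<omega>. (Z \<omega>)\<^sup>2)"
    using J2(1) Z2 by (intro L2_norm_tendsto) auto
  let ?N = "M \<Otimes>\<^sub>M lborel"
  note pH = quad_var_prod_integral[OF H Hi A]
  note ph = quad_var_prod_integral[OF step_jointly[OF st] hi step_quad_var_integrable[OF st \<open>0 \<le> T\<close>]]
  have dHi: "AE \<omega> in M. set_integrable lborel {0..T} (\<lambda>s. (h n s \<omega> - H s \<omega>)\<^sup>2)" for n
    using hi[of n] Hi AE_space
    by eventually_elim (intro square_integrable_diff step_jointly[OF st] H)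
  note pd = quad_var_prod_integral[OF jointly_diff[OF step_jointly[OF st] H] dHi
      step_quad_var_diff_integrable[OF st \<open>0 \<le> T\<close> H Hi A]]
  have jm: "(\<lambda>(\<omega>, s). restrict_time T k \<omega> s) \<in> borel_measurable ?N" if "jointly T k" for k
  proof -
    have "(\<lambda>z. restrict_time T k (snd z) (fst z)) \<in> borel_measurable (lborel \<Otimes>\<^sub>M M)"
      using that by (simp add: jointly_def)
    from measurable_comp[OF measurable_pair_swap' this] show ?thesis by (simp add: comp_def case_prod_beta)
  qed
  have "(\<lambda>n. \<integral>z. (case z of (\<omega>, s) \<Rightarrow> restrict_time T (h n) \<omega> s)\<^sup>2 \<partial>?N)
      \<longlonglongrightarrow> (\<integral>z. (case z of (\<omega>, s) \<Rightarrow> restrict_time T H \<omega> s)\<^sup>2 \<partial>?N)"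
  proof (rule L2_norm_tendsto[OF jm[OF step_jointly[OF st]] jm[OF H]])
    show "integrable ?N (\<lambda>z. (case z of (\<omega>, s) \<Rightarrow> restrict_time T (h n) \<omega> s)\<^sup>2)" for n
      using ph(1)[of n] by (simp add: split_beta')
    show "integrable ?N (\<lambda>z. (case z of (\<omega>, s) \<Rightarrow> restrict_time T H \<omega> s)\<^sup>2)"
      using pH(1) by (simp add: split_beta')
    have "(\<lambda>n. expectation (quad_var (\<lambda>s \<omega>. h n s \<omega> - H s \<omega>) T)) \<longlonglongrightarrow> 0"
      by (rule tendsto_sandwich[OF _ _ tendsto_const alim])
        (auto intro!: always_eventually less_imp_le hD integral_nonneg_AE quad_var_nonneg)
    then show "(\<lambda>n. \<integral>z. ((case z of (\<omega>, s) \<Rightarrow> restrict_time T (h n) \<omega> s)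
        - (case z of (\<omega>, s) \<Rightarrow> restrict_time T H \<omega> s))\<^sup>2 \<partial>?N) \<longlonglongrightarrow> 0"
      unfolding pd(2)[symmetric] by (simp add: split_beta' restrict_time_diff)
  qed
  then have "(\<lambda>n. expectation (quad_var (h n) T)) \<longlonglongrightarrow> expectation (quad_var H T)"
    unfolding ph(2)[symmetric] pH(2)[symmetric] by (simp add: split_beta')
  then show "expectation (\<lambda>\<omega>. (Z \<omega>)\<^sup>2) = expectation (quad_var H T)"
    using l1 LIMSEQ_unique unfolding J2(2) by blast
qed

text \<open>\<open>Zs\<close> and \<open>Zt\<close> come with unrelated approximants. The integrand
  approximating on \<open>[0, t]\<close> also approximates on \<open>[0, s]\<close>, and its
  integral up to \<open>s\<close> is close to the approximant of \<open>Zs\<close> because both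
  integrands are close to \<open>H\<close>; \<open>step_orth\<close> links its values at the two
  times.\<close>

lemma ito_orth:
  assumes itos: "has_ito_integral M F W H s Zs" and itot: "has_ito_integral M F W H t Zt"
    and "0 \<le> s" "s \<le> t" and A: "integrable M (quad_var H t)"
    and Y: "Y \<in> borel_measurable (F s)" "integrable M (\<lambda>\<omega>. (Y \<omega>)\<^sup>2)"
  shows "expectation (\<lambda>\<omega>. Y \<omega> * Zt \<omega>) = expectation (\<lambda>\<omega>. Y \<omega> * Zs \<omega>)"
proof -
  have "0 \<le> t" using assms by simp
  have [measurable]: "Zt \<in> borel_measurable M" "Zs \<in> borel_measurable M" and Hp: "progressive F H"
    and Hi: "AE \<omega> in M. set_integrable lborel {0..t} (\<lambda>s. (H s \<omega>)\<^sup>2)"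
    and His: "AE \<omega> in M. set_integrable lborel {0..s} (\<lambda>s. (H s \<omega>)\<^sup>2)"
    using itos itot by (simp_all only: has_ito_integral_def)
  have [measurable]: "Y \<in> borel_measurable M" using measurable_F_M Y \<open>0 \<le> s\<close> by auto
  have H: "jointly t H" "jointly s H"
    using progressive_jointly[OF Hp] \<open>0 \<le> t\<close> \<open>0 \<le> s\<close> by auto
  have As: "integrable M (quad_var H s)"
  proof (rule Bochner_Integration.integrable_bound[OF A])
    show "AE \<omega> in M. norm (quad_var H s \<omega>) \<le> norm (quad_var H t \<omega>)"
      using Hi by eventually_elim (use quad_var_mono(2)[OF \<open>0 \<le> s\<close> \<open>s \<le> t\<close>] quad_var_nonneg in auto)
  qed (rule quad_var_measurable[OF H(2)])
  note Zt2 = ito_isometry(1)[OF itot \<open>0 \<le> t\<close> A] and Zs2 = ito_isometry(1)[OF itos \<open>0 \<le> s\<close> As]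
  \<comment> \<open>The mean square of the total error \<open>V\<close> is at most
    \<open>3 (4 e + e + e) = 18 e\<close>; with \<open>e = d\<^sup>2\<close>, dividing by
    \<open>d\<close> leaves \<open>18 d\<close>.\<close>
  define c where "c = expectation (\<lambda>\<omega>. (Y \<omega>)\<^sup>2) + 18"
  have small: "\<bar>expectation (\<lambda>\<omega>. Y \<omega> * Zt \<omega>) - expectation (\<lambda>\<omega>. Y \<omega> * Zs \<omega>)\<bar> \<le> d * c" if "0 < d" for d
  proof -
    define e where "e = d\<^sup>2"
    have e: "0 < e" using that by (simp add: e_def)
    obtain P h J where st: "step_on t P h J" "expectation (quad_var (\<lambda>s \<omega>. h s \<omega> - H s \<omega>) t) < e"
      and J: "integrable M (\<lambda>\<omega>. (J t \<omega> - Zt \<omega>)\<^sup>2)" "expectation (\<lambda>\<omega>. (J t \<omega> - Zt \<omega>)\<^sup>2) < e"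
      by (rule ito_L2_approx[OF itot \<open>0 \<le> t\<close> A e]) (rule that)
    obtain P' h' J' where st': "step_on s P' h' J'" "expectation (quad_var (\<lambda>s \<omega>. h' s \<omega> - H s \<omega>) s) < e"
      and J': "integrable M (\<lambda>\<omega>. (J' s \<omega> - Zs \<omega>)\<^sup>2)" "expectation (\<lambda>\<omega>. (J' s \<omega> - Zs \<omega>)\<^sup>2) < e"
      by (rule ito_L2_approx[OF itos \<open>0 \<le> s\<close> As e]) (rule that)
    note sts = step_mono[OF st(1) \<open>s \<le> t\<close>]
    have [measurable]: "J t \<in> borel_measurable M" "J s \<in> borel_measurable M" "J' s \<in> borel_measurable M"
      using step_measurable(1)[OF st(1)] step_measurable(1)[OF st'(1)] \<open>0 \<le> s\<close> \<open>s \<le> t\<close> \<open>0 \<le> t\<close> by auto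
    have "expectation (quad_var (\<lambda>s \<omega>. h s \<omega> - H s \<omega>) s) \<le> expectation (quad_var (\<lambda>s \<omega>. h s \<omega> - H s \<omega>) t)"
    proof (rule integral_mono_AE)
      show "integrable M (quad_var (\<lambda>s \<omega>. h s \<omega> - H s \<omega>) s)"
        by (rule step_quad_var_diff_integrable[OF sts \<open>0 \<le> s\<close> H(2) His As])
      show "integrable M (quad_var (\<lambda>s \<omega>. h s \<omega> - H s \<omega>) t)"
        by (rule step_quad_var_diff_integrable[OF st(1) \<open>0 \<le> t\<close> H(1) Hi A])
      show "AE \<omega> in M. quad_var (\<lambda>s \<omega>. h s \<omega> - H s \<omega>) s \<omega> \<le> quad_var (\<lambda>s \<omega>. h s \<omega> - H s \<omega>) t \<omega>"
        using Hi AE_space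
      proof eventually_elim
        case (elim \<omega>)
        have "set_integrable lborel {0..t} (\<lambda>s. (h s \<omega> - H s \<omega>)\<^sup>2)"
          using elim step_basic[OF st(1) \<open>0 \<le> t\<close> order_refl]
          by (intro square_integrable_diff step_jointly[OF st(1)] H) auto
        then show ?case by (rule quad_var_mono(2)[OF \<open>0 \<le> s\<close> \<open>s \<le> t\<close>])
      qed
    qed
    then have JJ: "integrable M (\<lambda>\<omega>. (J s \<omega> - J' s \<omega>)\<^sup>2)" "expectation (\<lambda>\<omega>. (J s \<omega> - J' s \<omega>)\<^sup>2) \<le> 4 * e"
      using step_diff_square[OF sts st'(1) \<open>0 \<le> s\<close> H(2) His As] st(2) st'(2) by auto
    define V where "V \<omega> = (J s \<omega> - J' s \<omega>) + (J' s \<omega> - Zs \<omega>) - (J t \<omega> - Zt \<omega>)" for \<omega>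
    have [measurable]: "V \<in> borel_measurable M" unfolding V_def[abs_def] by measurable
    have Vle: "(V \<omega>)\<^sup>2 \<le> 3 * (J s \<omega> - J' s \<omega>)\<^sup>2 + 3 * (J' s \<omega> - Zs \<omega>)\<^sup>2 + 3 * (J t \<omega> - Zt \<omega>)\<^sup>2" for \<omega>
    proof -
      have "(a + b - c)\<^sup>2 \<le> 3 * a\<^sup>2 + 3 * b\<^sup>2 + 3 * c\<^sup>2" for a b c :: real
        using zero_le_power2[of "a - b"] zero_le_power2[of "a + c"] zero_le_power2[of "b + c"]
        by (simp add: power2_eq_square algebra_simps)
      then show ?thesis unfolding V_def .
    qed
    have Ri: "integrable M (\<lambda>\<omega>. 3 * (J s \<omega> - J' s \<omega>)\<^sup>2 + 3 * (J' s \<omega> - Zs \<omega>)\<^sup>2 + 3 * (J t \<omega> - Zt \<omega>)\<^sup>2)"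
      using J J' JJ by auto
    have V2: "integrable M (\<lambda>\<omega>. (V \<omega>)\<^sup>2)"
      by (rule Bochner_Integration.integrable_bound[OF Ri]) (use Vle in auto)
    have "expectation (\<lambda>\<omega>. (V \<omega>)\<^sup>2) \<le> 18 * e"
      using integral_mono[OF V2 Ri Vle] J J' JJ by simp
    have iY: "integrable M (\<lambda>\<omega>. Y \<omega> * X \<omega>)" if "X \<in> borel_measurable M" "integrable M (\<lambda>\<omega>. (X \<omega>)\<^sup>2)" for X
      using that Y by (intro integrable_mult_L2) auto
    have iYJ: "integrable M (\<lambda>\<omega>. Y \<omega> * J t \<omega>)" "integrable M (\<lambda>\<omega>. Y \<omega> * J s \<omega>)"
      using step_basic[OF st(1) \<open>0 \<le> t\<close> order_refl] step_basic[OF st(1) \<open>0 \<le> s\<close> \<open>s \<le> t\<close>] by (auto intro!: iY)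
    have iYZ: "integrable M (\<lambda>\<omega>. Y \<omega> * Zt \<omega>)" "integrable M (\<lambda>\<omega>. Y \<omega> * Zs \<omega>)" using Zt2 Zs2 by (auto intro!: iY)
    have "expectation (\<lambda>\<omega>. Y \<omega> * V \<omega>)
      = expectation (\<lambda>\<omega>. Y \<omega> * J s \<omega> - Y \<omega> * Zs \<omega> - Y \<omega> * J t \<omega> + Y \<omega> * Zt \<omega>)"
      by (rule Bochner_Integration.integral_cong) (auto simp: V_def algebra_simps)
    also have "\<dots> = expectation (\<lambda>\<omega>. Y \<omega> * Zt \<omega>) - expectation (\<lambda>\<omega>. Y \<omega> * Zs \<omega>)"
      using iYJ iYZ step_orth[OF st(1) \<open>0 \<le> s\<close> \<open>s \<le> t\<close> order_refl Y] by simp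
    finally have eq: "expectation (\<lambda>\<omega>. Y \<omega> * V \<omega>) = expectation (\<lambda>\<omega>. Y \<omega> * Zt \<omega>) - expectation (\<lambda>\<omega>. Y \<omega> * Zs \<omega>)" .
    have yv: "\<bar>y * v\<bar> \<le> d * y\<^sup>2 + v\<^sup>2 / d" for y v :: real
    proof -
      have "0 \<le> (d * y - v)\<^sup>2 / d" "0 \<le> (d * y + v)\<^sup>2 / d" using \<open>0 < d\<close> by auto
      moreover have "(d * y - v)\<^sup>2 / d = d * y\<^sup>2 - 2 * (y * v) + v\<^sup>2 / d" "(d * y + v)\<^sup>2 / d = d * y\<^sup>2 + 2 * (y * v) + v\<^sup>2 / d"
        using \<open>0 < d\<close> by (simp_all add: power2_eq_square field_simps)
      moreover have "0 \<le> d * y\<^sup>2 + v\<^sup>2 / d" using \<open>0 < d\<close> by simp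
      ultimately show ?thesis by linarith
    qed
    have "\<bar>expectation (\<lambda>\<omega>. Y \<omega> * V \<omega>)\<bar> \<le> expectation (\<lambda>\<omega>. \<bar>Y \<omega> * V \<omega>\<bar>)" by (rule integral_abs_bound)
    also have "\<dots> \<le> expectation (\<lambda>\<omega>. d * (Y \<omega>)\<^sup>2 + (V \<omega>)\<^sup>2 / d)"
      by (rule integral_mono) (use iY[OF _ V2] Y V2 yv in auto)
    also have "\<dots> = d * expectation (\<lambda>\<omega>. (Y \<omega>)\<^sup>2) + expectation (\<lambda>\<omega>. (V \<omega>)\<^sup>2) / d"
      using Y V2 by simp
    also have "\<dots> \<le> d * expectation (\<lambda>\<omega>. (Y \<omega>)\<^sup>2) + 18 * e / d"
      using \<open>expectation (\<lambda>\<omega>. (V \<omega>)\<^sup>2) \<le> 18 * e\<close> \<open>0 < d\<close> by (simp add: divide_right_mono)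
    also have "\<dots> = d * c" using \<open>0 < d\<close> by (simp add: c_def e_def power2_eq_square algebra_simps)
    finally show ?thesis unfolding eq .
  qed
  have "((\<lambda>d. d * c) \<longlongrightarrow> 0 * c) (at_right 0)" by (intro tendsto_intros)
  then have "\<bar>expectation (\<lambda>\<omega>. Y \<omega> * Zt \<omega>) - expectation (\<lambda>\<omega>. Y \<omega> * Zs \<omega>)\<bar> \<le> 0 * c"
    by (rule tendsto_lowerbound) (auto simp: eventually_at_filter small)
  then show ?thesis by simp
qed

end

section \<open>Moments of linear equations with random forcing\<close>

text \<open>Iteration: inserting \<open>m exp (2 c s)\<close> into the inequality halves the
  coefficient \<open>m\<close> up to the contribution of \<open>a\<close>, because the exponent is
  twice the rate \<open>c\<close>. The a priori bound therefore enters only as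
  \<open>B / 2 ^ n\<close>. It must be finite, since a \<open>z\<close> that is infinite at all
  positive times satisfies the inequality, but it leaves no trace in the result.\<close>

lemma gronwall_ennreal:
  fixes z :: "real \<Rightarrow> ennreal"
  assumes "0 \<le> a" "0 < c" "0 \<le> B"
    and bound: "\<And>s. 0 \<le> s \<Longrightarrow> s \<le> T \<Longrightarrow> z s \<le> ennreal B"
    and ineq: "\<And>s. 0 \<le> s \<Longrightarrow> s \<le> T \<Longrightarrow>
      z s \<le> ennreal a + ennreal c * (\<integral>\<^sup>+r. z r * indicator {0..s} r \<partial>lborel)"
    and "0 \<le> s" "s \<le> T"
  shows "z s \<le> ennreal (2 * a * exp (2 * c * s))"
proof -
  have it: "z s \<le> ennreal ((2 * a + B / 2 ^ n) * exp (2 * c * s))" if "0 \<le> s" "s \<le> T" for n s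
    using that
  proof (induction n arbitrary: s)
    case 0
    have "B * 1 \<le> (2 * a + B) * exp (2 * c * s)"
      using assms 0 by (intro mult_mono) auto
    then show ?case using bound[of s] 0 by (auto intro!: order_trans[OF bound[of s]] ennreal_leI)
  next
    case (Suc n)
    define m where "m = 2 * a + B / 2 ^ n"
    have m0: "0 \<le> m" using assms by (simp add: m_def)
    have "(\<integral>\<^sup>+r. z r * indicator {0..s} r \<partial>lborel) \<le> (\<integral>\<^sup>+r. ennreal (m * exp (2 * c * r)) * indicator {0..s} r \<partial>lborel)"
      using Suc by (intro nn_integral_mono) (auto simp: m_def indicator_def)
    also have "\<dots> = ennreal (m * exp (2 * c * s) / (2 * c) - m * exp (2 * c * 0) / (2 * c))"
      using m0 \<open>0 < c\<close> Suc.prems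
      by (intro nn_integral_FTC_Icc) (auto intro!: derivative_eq_intros)
    finally have "z s \<le> ennreal a + ennreal c * ennreal (m * exp (2 * c * s) / (2 * c) - m / (2 * c))"
      by (intro order_trans[OF ineq[OF Suc.prems]] add_left_mono mult_left_mono) auto
    also have "\<dots> = ennreal (a + c * (m * exp (2 * c * s) / (2 * c) - m / (2 * c)))"
    proof -
      have "0 \<le> m * exp (2 * c * s) / (2 * c) - m / (2 * c)"
        using mult_left_mono[of 1 "exp (2 * c * s)" m] m0 \<open>0 < c\<close> Suc.prems
        by (simp add: diff_divide_distrib[symmetric])
      then show ?thesis using assms by (simp add: ennreal_mult' ennreal_plus)
    qed
    also have "\<dots> \<le> ennreal ((2 * a + B / 2 ^ Suc n) * exp (2 * c * s))"
    proof (rule ennreal_leI)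
      have "c * (m * exp (2 * c * s) / (2 * c) - m / (2 * c)) = m / 2 * exp (2 * c * s) - m / 2"
        using \<open>0 < c\<close> by (simp add: field_simps)
      moreover have "a * 1 \<le> a * exp (2 * c * s)" using assms Suc.prems by (intro mult_left_mono) auto
      moreover have "(2 * a + B / 2 ^ Suc n) * exp (2 * c * s) = a * exp (2 * c * s) + m / 2 * exp (2 * c * s)"
        by (simp add: m_def field_simps)
      ultimately show "a + c * (m * exp (2 * c * s) / (2 * c) - m / (2 * c)) \<le> (2 * a + B / 2 ^ Suc n) * exp (2 * c * s)"
        using m0 by linarith
    qed
    finally show ?case .
  qed
  have "(\<lambda>n. ennreal ((2 * a + B / 2 ^ n) * exp (2 * c * s))) \<longlonglongrightarrow> ennreal ((2 * a + 0) * exp (2 * c * s))"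
    by (intro tendsto_ennrealI tendsto_intros LIMSEQ_divide_realpow_zero) auto
  then have "z s \<le> ennreal ((2 * a + 0) * exp (2 * c * s))"
    by (rule LIMSEQ_le_const) (use it assms in auto)
  then show ?thesis by simp
qed

section \<open>Calculus with primitives of integrable functions\<close>

lemma set_integral_combine:
  fixes f :: "real \<Rightarrow> real"
  assumes "a \<le> b" "b \<le> c" and i: "set_integrable lborel {a..c} f"
  shows "(LINT s:{a..c}|lborel. f s) = (LINT s:{a..b}|lborel. f s) + (LINT s:{b..c}|lborel. f s)"
proof -
  have "set_integrable lborel {a..b} f" "set_integrable lborel {b..c} f"
    using assms by (auto intro: set_integrable_subset[OF i])
  then show ?thesis
    using Henstock_Kurzweil_Integration.integral_combine[OF assms(1,2) set_borel_integral_eq_integral(1)[OF i]]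
    by (simp add: set_borel_integral_eq_integral(2) i)
qed

lemma set_integral_primitive_continuous:
  fixes q :: "real \<Rightarrow> real"
  assumes i: "set_integrable lborel {0..t} q"
  shows "continuous_on {0..t} (\<lambda>s. LINT r:{0..s}|lborel. q r)"
proof -
  have "continuous_on {0..t} (\<lambda>s. integral {0..s} q)"
    by (rule indefinite_integral_continuous_1[OF set_borel_integral_eq_integral(1)[OF i]])
  moreover have "integral {0..s} q = (LINT r:{0..s}|lborel. q r)" if "s \<in> {0..t}" for s
    using set_integrable_subset[OF i, of "{0..s}"] that by (simp add: set_borel_integral_eq_integral(2))
  ultimately show ?thesis by (rule continuous_on_eq)
qed

text \<open>The chain rule would give equality with \<open>1\<close> in place of
  \<open>exp 1\<close>, but \<open>S\<close> is merely a primitive of an integrable function. On an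
  interval where \<open>l * S\<close> grows by at most \<open>1\<close>, the weight changes by at
  most the factor \<open>exp 1\<close>, and \<open>1 + x \<le> exp x\<close> suffices; continuity of
  \<open>S\<close> provides such intervals around every point, and bisection glues them.\<close>

lemma exp_primitive_bound:
  fixes q :: "real \<Rightarrow> real"
  assumes i: "set_integrable lborel {0..t} q" and q: "\<And>s. 0 \<le> q s" and "0 \<le> t" "0 < l"
  defines "S \<equiv> \<lambda>s. LINT r:{0..s}|lborel. q r"
  shows "set_integrable lborel {0..t} (\<lambda>s. exp (- l * S s) * q s)"
    "(1 - exp (- l * S t)) / l \<le> exp 1 * (LINT s:{0..t}|lborel. exp (- l * S s) * q s)"
proof -
  have cont: "continuous_on {0..t} S" unfolding S_def by (rule set_integral_primitive_continuous[OF i])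
  have S0: "0 \<le> S s" for s
    unfolding S_def set_lebesgue_integral_def using q by (intro integral_nonneg_AE) auto
  have ii: "set_integrable lborel {a..b} q" if "0 \<le> a" "b \<le> t" for a b
    using that by (intro set_integrable_subset[OF i]) auto
  have Sdiff: "S b - S a = (LINT s:{a..b}|lborel. q s)" if "0 \<le> a" "a \<le> b" "b \<le> t" for a b
    using set_integral_combine[OF that(1,2) ii[OF _ that(3)]] by (simp add: S_def)
  have mono: "S a \<le> S b" if "0 \<le> a" "a \<le> b" "b \<le> t" for a b
  proof -
    have "0 \<le> (LINT s:{a..b}|lborel. q s)"
      unfolding set_lebesgue_integral_def using q by (intro integral_nonneg_AE) auto
    then show ?thesis using Sdiff[OF that] by simp
  qed
  show j: "set_integrable lborel {0..t} (\<lambda>s. exp (- l * S s) * q s)"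
    unfolding set_integrable_def
  proof (rule Bochner_Integration.integrable_bound)
    show "integrable lborel (\<lambda>s. indicator {0..t} s *\<^sub>R q s)" using i by (simp add: set_integrable_def)
    have "continuous_on {0..t} (\<lambda>s. exp (- l * S s))" using cont by (intro continuous_intros)
    then have "(\<lambda>s. indicator {0..t} s * exp (- l * S s)) \<in> borel_measurable lborel"
      using borel_measurable_continuous_on_indicator[of "{0..t}" "\<lambda>s. exp (- l * S s)"] by simp
    moreover have "(\<lambda>s. indicator {0..t} s *\<^sub>R q s) \<in> borel_measurable lborel"
      using i unfolding set_integrable_def by (rule borel_measurable_integrable)
    ultimately have "(\<lambda>s. (indicator {0..t} s * exp (- l * S s)) * (indicator {0..t} s *\<^sub>R q s)) \<in> borel_measurable lborel"
      by (rule borel_measurable_times)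
    then show "(\<lambda>s. indicator {0..t} s *\<^sub>R (exp (- l * S s) * q s)) \<in> borel_measurable lborel"
      by (rule measurable_cong[THEN iffD1, rotated]) (auto simp: indicator_def)
    show "AE s in lborel. norm (indicator {0..t} s *\<^sub>R (exp (- l * S s) * q s)) \<le> norm (indicator {0..t} s *\<^sub>R q s)"
      using S0 q \<open>0 < l\<close> by (auto simp: indicator_def abs_mult mult_left_le_one_le)
  qed
  have jj: "set_integrable lborel {a..b} (\<lambda>s. exp (- l * S s) * q s)" if "0 \<le> a" "b \<le> t" for a b
    using that by (intro set_integrable_subset[OF j]) auto
  define P where "P a b \<longleftrightarrow> (0 \<le> a \<longrightarrow> a \<le> b \<longrightarrow> b \<le> t \<longrightarrow>
    exp (- l * S a) - exp (- l * S b) \<le> exp 1 * l * (LINT s:{a..b}|lborel. exp (- l * S s) * q s))" for a b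
  have "P 0 t"
    using \<open>0 \<le> t\<close>
  proof (induction rule: Bolzano)
    case (trans a b c)
    show ?case unfolding P_def
    proof (intro impI)
      assume ac: "0 \<le> a" "a \<le> c" "c \<le> t"
      have "(LINT s:{a..c}|lborel. exp (- l * S s) * q s) =
        (LINT s:{a..b}|lborel. exp (- l * S s) * q s) + (LINT s:{b..c}|lborel. exp (- l * S s) * q s)"
        by (rule set_integral_combine[OF trans(3,4) jj]) (use ac in auto)
      then show "exp (- l * S a) - exp (- l * S c) \<le> exp 1 * l * (LINT s:{a..c}|lborel. exp (- l * S s) * q s)"
        using trans ac unfolding P_def by (simp add: distrib_left)
    qed
  next
    case (local x)
    have "continuous (at x within {0..t}) S" using cont local by (auto simp: continuous_on_eq_continuous_within)
    then have "\<forall>e>0. \<exists>d>0. \<forall>y\<in>{0..t}. dist y x < d \<longrightarrow> dist (S y) (S x) < e"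
      by (simp add: continuous_within_eps_delta)
    \<comment> \<open>Two distances below \<open>1 / (2 * l)\<close> add up to a growth of
      \<open>S\<close> by at most \<open>1 / l\<close>.\<close>
    then obtain d where d: "d > 0" "\<And>y. y \<in> {0..t} \<Longrightarrow> dist y x < d \<Longrightarrow> dist (S y) (S x) < 1 / (2 * l)"
      using \<open>0 < l\<close> by (metis zero_less_divide_1_iff zero_less_mult_iff zero_less_numeral)
    have "P a b" if ab: "a \<le> x" "x \<le> b" "b - a < d" for a b
      unfolding P_def
    proof (intro impI)
      assume h: "0 \<le> a" "a \<le> b" "b \<le> t"
      have "dist (S a) (S x) < 1 / (2 * l)" "dist (S b) (S x) < 1 / (2 * l)"
        using d(2)[of a] d(2)[of b] ab h by (auto simp: dist_real_def)
      then have "S b - S a < 1 / (2 * l) + 1 / (2 * l)" by (simp add: dist_real_def)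
      then have lS: "l * (S b - S a) \<le> 1" using \<open>0 < l\<close> by (simp add: field_simps)
      have "exp (- l * S a) * (1 - l * (S b - S a)) \<le> exp (- l * S a) * exp (- (l * (S b - S a)))"
        using exp_ge_add_one_self[of "- (l * (S b - S a))"] by (intro mult_left_mono) auto
      also have "\<dots> = exp (- l * S b)" by (simp add: exp_add[symmetric] algebra_simps)
      finally have "exp (- l * S a) - exp (- l * S b) \<le> l * (exp (- l * S a) * (S b - S a))"
        by (simp add: algebra_simps)
      also have "exp (- l * S a) * (S b - S a) = (LINT s:{a..b}|lborel. exp (- l * S a) * q s)"
        using Sdiff[OF h] by simp
      also have "\<dots> \<le> (LINT s:{a..b}|lborel. exp 1 * (exp (- l * S s) * q s))"
      proof (rule set_integral_mono)
        fix s assume s: "s \<in> {a..b}"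
        \<comment> \<open>Here the factor \<open>exp 1\<close> arises: the weight at the left end is
          compared with the weight at \<open>s\<close>.\<close>
        have "l * (S s - S a) \<le> l * (S b - S a)" using mono[of s b] s h \<open>0 < l\<close> by (intro mult_left_mono) auto
        then have "- l * S a \<le> 1 + - l * S s" using lS by (simp add: algebra_simps)
        then have "exp (- l * S a) \<le> exp 1 * exp (- l * S s)" unfolding exp_add[symmetric] by simp
        then show "exp (- l * S a) * q s \<le> exp 1 * (exp (- l * S s) * q s)"
          using q[of s] mult_right_mono by (fastforce simp: mult.assoc[symmetric])
      qed (use ii jj h in auto)
      also have "\<dots> = exp 1 * (LINT s:{a..b}|lborel. exp (- l * S s) * q s)" by simp
      finally show "exp (- l * S a) - exp (- l * S b) \<le> exp 1 * l * (LINT s:{a..b}|lborel. exp (- l * S s) * q s)"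
        using \<open>0 < l\<close> by (simp add: mult.left_commute mult.assoc)
    qed
    then show ?case using \<open>d > 0\<close> by blast
  qed
  moreover have "S 0 = 0"
  proof -
    have "(\<lambda>s. indicator {0..0} s *\<^sub>R q s) = (\<lambda>s. indicator {0::real} s *\<^sub>R q 0)" by (auto simp: indicator_def)
    then show ?thesis by (simp add: S_def set_lebesgue_integral_def)
  qed
  ultimately have "1 - exp (- l * S t) \<le> exp 1 * l * (LINT s:{0..t}|lborel. exp (- l * S s) * q s)"
    using \<open>0 \<le> t\<close> by (simp add: P_def)
  then show "(1 - exp (- l * S t)) / l \<le> exp 1 * (LINT s:{0..t}|lborel. exp (- l * S s) * q s)"
    using \<open>0 < l\<close> by (simp add: pos_divide_le_eq mult.commute mult.left_commute)
qed

text \<open>The square of the integral is an integral over a square. The two triangles cut off by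
  the diagonal contribute equally, by exchanging the order of integration, and the diagonal is a
  null set.\<close>

lemma square_of_integral:
  fixes b :: "real \<Rightarrow> real"
  assumes i: "integrable lborel b"
  shows "(\<integral>s. b s \<partial>lborel)\<^sup>2 = 2 * (\<integral>s. b s * (\<integral>r. indicator {..s} r * b r \<partial>lborel) \<partial>lborel)"
proof -
  have [measurable]: "b \<in> borel_measurable borel" using i by auto
  let ?B = "\<integral>s. b s \<partial>lborel"
  let ?g = "\<lambda>(s, r). indicator {..s} r * (b s * b r)"
  have ib: "integrable lborel (\<lambda>r. indicator A r * b r)" if "A \<in> sets borel" for A
    using integrable_real_mult_indicator[OF _ i, of A] that by (simp add: mult.commute)
  have f: "integrable (lborel \<Otimes>\<^sub>M lborel) (\<lambda>(s, r). b s * b r)"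
    by (rule lborel_pair.Fubini_integrable) (use i in \<open>auto simp: abs_mult\<close>)
  have mg[measurable]: "?g \<in> borel_measurable (lborel \<Otimes>\<^sub>M lborel)"
    unfolding atMost_def indicator_def by measurable
  have g: "integrable (lborel \<Otimes>\<^sub>M lborel) ?g"
    by (rule Bochner_Integration.integrable_bound[OF f mg]) (auto simp: indicator_def)
  have 1: "(\<integral>s. b s * (\<integral>r. indicator {..s} r * b r \<partial>lborel) \<partial>lborel) = (\<integral>s. \<integral>r. indicator {..s} r * (b s * b r) \<partial>lborel \<partial>lborel)"
    by (simp add: mult.left_commute)
  also have "\<dots> = (\<integral>r. \<integral>s. indicator {..s} r * (b s * b r) \<partial>lborel \<partial>lborel)"
    using lborel_pair.Fubini_integral[OF g] by simp
  also have "\<dots> = (\<integral>r. b r * (\<integral>s. indicator {r..} s * b s \<partial>lborel) \<partial>lborel)"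
  proof (rule Bochner_Integration.integral_cong[OF refl])
    fix r
    have "(\<integral>s. indicator {..s} r * (b s * b r) \<partial>lborel) = (\<integral>s. b r * (indicator {r..} s * b s) \<partial>lborel)"
      by (rule Bochner_Integration.integral_cong) (auto simp: indicator_def)
    then show "(\<integral>s. indicator {..s} r * (b s * b r) \<partial>lborel) = b r * (\<integral>s. indicator {r..} s * b s \<partial>lborel)" by simp
  qed
  finally have 2: "(\<integral>s. b s * (\<integral>r. indicator {..s} r * b r \<partial>lborel) \<partial>lborel)
     = (\<integral>s. b s * (\<integral>r. indicator {s..} r * b r \<partial>lborel) \<partial>lborel)" .
  have split: "(\<integral>r. indicator {..s} r * b r \<partial>lborel) + (\<integral>r. indicator {s..} r * b r \<partial>lborel) = ?B" for s
  proof -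
    have "(\<integral>r. indicator {..s} r * b r \<partial>lborel) + (\<integral>r. indicator {s..} r * b r \<partial>lborel)
       = (\<integral>r. indicator {..s} r * b r + indicator {s..} r * b r \<partial>lborel)" using ib by simp
    also have "\<dots> = ?B"
    proof (rule integral_cong_AE)
      show "AE r in lborel. indicator {..s} r * b r + indicator {s..} r * b r = b r"
        using AE_lborel_singleton[of s] by eventually_elim (auto simp: indicator_def)
    qed auto
    finally show ?thesis .
  qed
  have bd: "integrable lborel (\<lambda>s. b s * (\<integral>r. indicator {..s} r * b r \<partial>lborel))"
    using lborel_pair.integrable_fst'[OF g] by (simp add: mult.left_commute)
  have "(\<integral>r. indicator {s..} r * b r \<partial>lborel) = ?B - (\<integral>r. indicator {..s} r * b r \<partial>lborel)" for s
    using split[of s] by simp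
  then have "(\<integral>s. b s * (\<integral>r. indicator {s..} r * b r \<partial>lborel) \<partial>lborel)
    = (\<integral>s. ?B * b s - b s * (\<integral>r. indicator {..s} r * b r \<partial>lborel) \<partial>lborel)"
    by (simp add: right_diff_distrib mult.commute)
  also have "\<dots> = ?B * ?B - (\<integral>s. b s * (\<integral>r. indicator {..s} r * b r \<partial>lborel) \<partial>lborel)"
    using bd i by simp
  finally show ?thesis using 2 by (simp add: power2_eq_square)
qed

lemma set_square_of_integral:
  fixes b :: "real \<Rightarrow> real"
  assumes i: "set_integrable lborel {0..T} b"
  shows "(LINT s:{0..T}|lborel. b s)\<^sup>2 = 2 * (LINT s:{0..T}|lborel. b s * (LINT r:{0..s}|lborel. b r))"
proof -
  have "(LINT s:{0..T}|lborel. b s)\<^sup>2 = 2 * (\<integral>s. indicator {0..T} s *\<^sub>R b s * (\<integral>r. indicator {..s} r * (indicator {0..T} r *\<^sub>R b r) \<partial>lborel) \<partial>lborel)"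
    unfolding set_lebesgue_integral_def
    by (rule square_of_integral) (use i in \<open>simp add: set_integrable_def\<close>)
  also have "(\<integral>s. indicator {0..T} s *\<^sub>R b s * (\<integral>r. indicator {..s} r * (indicator {0..T} r *\<^sub>R b r) \<partial>lborel) \<partial>lborel)
    = (\<integral>s. indicator {0..T} s *\<^sub>R (b s * (LINT r:{0..s}|lborel. b r)) \<partial>lborel)"
  proof (rule Bochner_Integration.integral_cong[OF refl])
    fix s
    have "(\<integral>r. indicator {..s} r * (indicator {0..T} r *\<^sub>R b r) \<partial>lborel) = (LINT r:{0..s}|lborel. b r)" if "s \<in> {0..T}"
      unfolding set_lebesgue_integral_def
      by (rule Bochner_Integration.integral_cong) (use that in \<open>auto simp: indicator_def\<close>)
    then show "indicator {0..T} s *\<^sub>R b s * (\<integral>r. indicator {..s} r * (indicator {0..T} r *\<^sub>R b r) \<partial>lborel)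
      = indicator {0..T} s *\<^sub>R (b s * (LINT r:{0..s}|lborel. b r))"
      by (auto simp: indicator_def)
  qed
  finally show ?thesis by (simp add: set_lebesgue_integral_def)
qed

text \<open>The Cauchy-Schwarz inequality against the constant \<open>1\<close>. The right-hand side
  is an \<open>ennreal\<close> integral since paths of the drift are so far only known to be
  integrable, not square integrable.\<close>

lemma set_integral_square_le:
  fixes b :: "real \<Rightarrow> real"
  assumes i: "set_integrable lborel {0..s} b" and "0 \<le> s"
  shows "ennreal ((LINT r:{0..s}|lborel. b r)\<^sup>2) \<le> ennreal s * (\<integral>\<^sup>+r. ennreal ((b r)\<^sup>2) * indicator {0..s} r \<partial>lborel)"
proof -
  let ?f = "\<lambda>r. indicator {0..s} r *\<^sub>R b r"
  have [measurable]: "?f \<in> borel_measurable lborel" using i unfolding set_integrable_def by (rule borel_measurable_integrable)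
  have "ennreal \<bar>LINT r:{0..s}|lborel. b r\<bar> \<le> (\<integral>\<^sup>+r. ennreal (norm (?f r)) \<partial>lborel)"
    using integral_norm_bound_ennreal[of lborel ?f] i by (simp add: set_integrable_def set_lebesgue_integral_def)
  also have "\<dots> = (\<integral>\<^sup>+r. ennreal (norm (?f r)) * indicator {0..s} r \<partial>lborel)"
    by (rule nn_integral_cong) (auto simp: indicator_def)
  finally have "(ennreal \<bar>LINT r:{0..s}|lborel. b r\<bar>)\<^sup>2 \<le> (\<integral>\<^sup>+r. ennreal (norm (?f r)) * indicator {0..s} r \<partial>lborel)\<^sup>2"
    by (rule power_mono) simp
  also have "\<dots> \<le> (\<integral>\<^sup>+r. (ennreal (norm (?f r)))\<^sup>2 \<partial>lborel) * (\<integral>\<^sup>+r. (indicator {0..s} r)\<^sup>2 \<partial>lborel)"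
    by (rule Cauchy_Schwarz_nn_integral) measurable
  also have "(\<integral>\<^sup>+r. (indicator {0..s} r)\<^sup>2 \<partial>lborel) = (\<integral>\<^sup>+r. indicator {0..s} r \<partial>lborel)"
    by (rule nn_integral_cong) (auto simp: indicator_def)
  also have "\<dots> = ennreal s" using \<open>0 \<le> s\<close> by simp
  also have "(\<integral>\<^sup>+r. (ennreal (norm (?f r)))\<^sup>2 \<partial>lborel) = (\<integral>\<^sup>+r. ennreal ((b r)\<^sup>2) * indicator {0..s} r \<partial>lborel)"
    by (rule nn_integral_cong) (auto simp: indicator_def ennreal_power)
  finally show ?thesis by (simp add: ennreal_power mult.commute)
qed

section \<open>Joint measurability in time and sample point\<close>

context brownian begin

lemma jointly_add: "jointly T h \<Longrightarrow> jointly T h' \<Longrightarrow> jointly T (\<lambda>s \<omega>. h s \<omega> + h' s \<omega>)"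
  using borel_measurable_add unfolding jointly_def restrict_time_def distrib_left by blast

lemma jointly_mult:
  assumes "jointly T h" "jointly T h'"
  shows "jointly T (\<lambda>s \<omega>. h s \<omega> * h' s \<omega>)"
proof -
  have "restrict_time T (\<lambda>s \<omega>. h s \<omega> * h' s \<omega>) \<omega> s = restrict_time T h \<omega> s * restrict_time T h' \<omega> s" for \<omega> s
    by (simp add: restrict_time_def indicator_def)
  then show ?thesis using assms borel_measurable_times unfolding jointly_def by simp
qed

lemma jointly_random:
  assumes [measurable]: "Y \<in> borel_measurable M"
  shows "jointly T (\<lambda>s. Y)"
  unfolding jointly_alt by measurable

lemma jointly_const: "jointly T (\<lambda>s \<omega>. c)"
  by (rule jointly_random) simp

lemma jointly_sum: "(\<And>i. i \<in> A \<Longrightarrow> jointly T (h i)) \<Longrightarrow> jointly T (\<lambda>s \<omega>. \<Sum>i\<in>A. h i s \<omega>)"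
  by (induction A rule: infinite_finite_induct) (auto intro: jointly_add jointly_const)

lemma jointly_square: "jointly T h \<Longrightarrow> jointly T (\<lambda>s \<omega>. (h s \<omega>)\<^sup>2)"
  unfolding power2_eq_square by (rule jointly_mult)

lemma jointly_exp:
  assumes "jointly T h"
  shows "jointly T (\<lambda>s \<omega>. exp (h s \<omega>))"
proof -
  have [measurable]: "(\<lambda>z. restrict_time T h (snd z) (fst z)) \<in> borel_measurable (lborel \<Otimes>\<^sub>M M)"
    using assms by (simp add: jointly_def)
  have "restrict_time T (\<lambda>s \<omega>. exp (h s \<omega>)) \<omega> s = indicator {0..T} s * exp (restrict_time T h \<omega> s)" for \<omega> s
    by (simp add: restrict_time_def indicator_def)
  then show ?thesis unfolding jointly_def by simp
qed

lemma jointly_section: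
  assumes "jointly T h" "0 \<le> s" "s \<le> T"
  shows "h s \<in> borel_measurable M"
proof -
  have [measurable]: "(\<lambda>z. restrict_time T h (snd z) (fst z)) \<in> borel_measurable (lborel \<Otimes>\<^sub>M M)"
    using assms by (simp add: jointly_def)
  have "(\<lambda>\<omega>. (\<lambda>z. restrict_time T h (snd z) (fst z)) (s, \<omega>)) \<in> borel_measurable M" by measurable
  then show ?thesis using assms by (simp add: restrict_time_def)
qed

text \<open>A primitive is a parameter integral over the region \<open>r \<le> s\<close>; with
  \<open>r\<close> as a third coordinate this region and the integrand are measurable on the triple
  product.\<close>

lemma jointly_primitive:
  assumes "jointly T h"
  shows "jointly T (\<lambda>s \<omega>. LINT r:{0..s}|lborel. h r \<omega>)"
proof -
  have [measurable]: "(\<lambda>z. restrict_time T h (snd z) (fst z)) \<in> borel_measurable (lborel \<Otimes>\<^sub>M M)"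
    using assms by (simp add: jointly_def)
  have "(\<lambda>y. restrict_time T h (snd (fst y)) (snd y))
      = (\<lambda>z. restrict_time T h (snd z) (fst z)) \<circ> (\<lambda>y. (snd y, snd (fst y)))" by auto
  also have "\<dots> \<in> borel_measurable ((lborel \<Otimes>\<^sub>M M) \<Otimes>\<^sub>M lborel)"
    by (rule measurable_comp[of _ _ "lborel \<Otimes>\<^sub>M M"]) measurable
  finally have [measurable]: "(\<lambda>y. restrict_time T h (snd (fst y)) (snd y)) \<in> borel_measurable ((lborel \<Otimes>\<^sub>M M) \<Otimes>\<^sub>M lborel)" .
  have "Measurable.pred ((lborel \<Otimes>\<^sub>M M) \<Otimes>\<^sub>M lborel) (\<lambda>y. snd y \<le> (fst (fst y) :: real))"
    by measurable
  then have "(\<lambda>y. of_bool (snd y \<le> fst (fst y)) * restrict_time T h (snd (fst y)) (snd y))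
      \<in> borel_measurable ((lborel \<Otimes>\<^sub>M M) \<Otimes>\<^sub>M lborel)"
    unfolding of_bool_def by measurable
  then have "(\<lambda>z. \<integral>r. of_bool (r \<le> fst z) * restrict_time T h (snd z) r \<partial>lborel) \<in> borel_measurable (lborel \<Otimes>\<^sub>M M)"
    by (intro lborel.borel_measurable_lebesgue_integral) (simp add: split_beta')
  then have "(\<lambda>z. indicator {0..T} (fst z) * (\<integral>r. of_bool (r \<le> fst z) * restrict_time T h (snd z) r \<partial>lborel))
      \<in> borel_measurable (lborel \<Otimes>\<^sub>M M)" by measurable
  also have "(\<lambda>z. indicator {0..T} (fst z) * (\<integral>r. of_bool (r \<le> fst z) * restrict_time T h (snd z) r \<partial>lborel))
     = (\<lambda>z. restrict_time T (\<lambda>s \<omega>. LINT r:{0..s}|lborel. h r \<omega>) (snd z) (fst z))"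
  proof
    fix z :: "real \<times> 'w"
    have "(\<integral>r. of_bool (r \<le> fst z) * restrict_time T h (snd z) r \<partial>lborel) = (LINT r:{0..fst z}|lborel. h r (snd z))"
      if "fst z \<in> {0..T}"
      unfolding set_lebesgue_integral_def restrict_time_def
      by (rule Bochner_Integration.integral_cong) (use that in \<open>auto simp: indicator_def\<close>)
    then show "indicator {0..T} (fst z) * (\<integral>r. of_bool (r \<le> fst z) * restrict_time T h (snd z) r \<partial>lborel)
      = restrict_time T (\<lambda>s \<omega>. LINT r:{0..s}|lborel. h r \<omega>) (snd z) (fst z)"
      by (auto simp: restrict_time_def indicator_def)
  qed
  finally show ?thesis by (simp add: jointly_def)
qed

lemma jointly_quad_var: "jointly T h \<Longrightarrow> jointly T (\<lambda>s. quad_var h s)"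
  unfolding quad_var_def[abs_def] by (intro jointly_primitive jointly_square)

lemma jointly_ennreal:
  assumes "jointly T h" "s \<le> T"
  shows "(\<lambda>z. ennreal (h (fst z) (snd z)) * indicator {0..s} (fst z)) \<in> borel_measurable (lborel \<Otimes>\<^sub>M M)"
proof -
  have [measurable]: "(\<lambda>z. restrict_time T h (snd z) (fst z)) \<in> borel_measurable (lborel \<Otimes>\<^sub>M M)"
    using assms by (simp add: jointly_def)
  have "(\<lambda>z. ennreal (h (fst z) (snd z)) * indicator {0..s} (fst z))
     = (\<lambda>z. ennreal (restrict_time T h (snd z) (fst z)) * indicator {0..s} (fst z))"
    using assms by (auto simp: restrict_time_def indicator_def)
  then show ?thesis by simp
qed

lemma jointly_ennreal_path:
  assumes "jointly T h" "s \<le> T" "\<omega> \<in> space M"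
  shows "(\<lambda>r. ennreal (h r \<omega>) * indicator {0..s} r) \<in> borel_measurable lborel"
proof -
  have [measurable]: "(\<lambda>z. ennreal (h (fst z) (snd z)) * indicator {0..s} (fst z)) \<in> borel_measurable (lborel \<Otimes>\<^sub>M M)"
    by (rule jointly_ennreal) fact+
  have "(\<lambda>r. (\<lambda>z. ennreal (h (fst z) (snd z)) * indicator {0..s} (fst z)) (r, \<omega>)) \<in> borel_measurable lborel"
    using assms(3) by measurable
  then show ?thesis by simp
qed

lemma jointly_nn_fubini:
  assumes "jointly T h" "s \<le> T"
  shows "(\<integral>\<^sup>+\<omega>. \<integral>\<^sup>+r. ennreal (h r \<omega>) * indicator {0..s} r \<partial>lborel \<partial>M)
    = (\<integral>\<^sup>+r. (\<integral>\<^sup>+\<omega>. ennreal (h r \<omega>) \<partial>M) * indicator {0..s} r \<partial>lborel)"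
    "(\<lambda>\<omega>. \<integral>\<^sup>+r. ennreal (h r \<omega>) * indicator {0..s} r \<partial>lborel) \<in> borel_measurable M"
proof -
  interpret pair_sigma_finite lborel M ..
  have m: "(\<lambda>(r, \<omega>). ennreal (h r \<omega>) * indicator {0..s} r) \<in> borel_measurable (lborel \<Otimes>\<^sub>M M)"
    using jointly_ennreal[OF assms] by (simp add: split_beta')
  have "(\<lambda>(\<omega>, r). ennreal (h r \<omega>) * indicator {0..s} r) \<in> borel_measurable (M \<Otimes>\<^sub>M lborel)"
    using measurable_comp[OF measurable_pair_swap' m] by (simp add: comp_def split_beta')
  then show "(\<lambda>\<omega>. \<integral>\<^sup>+r. ennreal (h r \<omega>) * indicator {0..s} r \<partial>lborel) \<in> borel_measurable M"
    by (rule lborel.borel_measurable_nn_integral)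
  have "(\<integral>\<^sup>+\<omega>. ennreal (h r \<omega>) * indicator {0..s} r \<partial>M) = (\<integral>\<^sup>+\<omega>. ennreal (h r \<omega>) \<partial>M) * indicator {0..s} r" for r
    by (auto simp: indicator_def)
  then show "(\<integral>\<^sup>+\<omega>. \<integral>\<^sup>+r. ennreal (h r \<omega>) * indicator {0..s} r \<partial>lborel \<partial>M)
    = (\<integral>\<^sup>+r. (\<integral>\<^sup>+\<omega>. ennreal (h r \<omega>) \<partial>M) * indicator {0..s} r \<partial>lborel)"
    using Fubini'[OF m] by simp
qed

lemma progressive_section:
  assumes "progressive F h" "0 \<le> t"
  shows "h t \<in> borel_measurable (F t)"
proof -
  have [measurable]: "(\<lambda>(s, \<omega>). h s \<omega>) \<in> borel_measurable (restrict_space borel {0..t} \<Otimes>\<^sub>M F t)"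
    using assms by (simp add: progressive_def)
  have "t \<in> space (restrict_space borel {0..t})" using \<open>0 \<le> t\<close> by (simp add: space_restrict_space)
  then have "(\<lambda>\<omega>. (t, \<omega>)) \<in> F t \<rightarrow>\<^sub>M restrict_space borel {0..t} \<Otimes>\<^sub>M F t" by measurable
  from measurable_comp[OF this, of "\<lambda>(s, \<omega>). h s \<omega>"] show ?thesis by (simp add: comp_def)
qed

end

text \<open>\<open>H\<close> may be any process with the growth bound, not necessarily a function of
  \<open>X\<close>; this is what remains of the nonlinear coefficients once they are
  projected.\<close>

locale linear_sde = brownian M F W
  for M :: "'w measure" and F :: "real \<Rightarrow> 'w measure" and W :: "real \<Rightarrow> 'w \<Rightarrow> real" +
  fixes I :: "'i set" and X H :: "'i \<Rightarrow> real \<Rightarrow> 'w \<Rightarrow> real" and A :: "'i \<Rightarrow> 'i \<Rightarrow> real"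
    and x0 :: "'i \<Rightarrow> real" and K :: real
  assumes fin: "finite I" and K0: "0 \<le> K"
    and X_prog: "\<And>i. i \<in> I \<Longrightarrow> progressive F (X i)"
    and growth: "\<And>s \<omega>. 0 \<le> s \<Longrightarrow> \<omega> \<in> space M \<Longrightarrow>
      (\<Sum>i\<in>I. (H i s \<omega>)\<^sup>2) \<le> K * (1 + (\<Sum>i\<in>I. (X i s \<omega>)\<^sup>2))"
    and init: "AE \<omega> in M. \<forall>i\<in>I. X i 0 \<omega> = x0 i"
    and eqn: "\<And>i. i \<in> I \<Longrightarrow> ito_equation M F W (X i) (\<lambda>s \<omega>. \<Sum>j\<in>I. A i j * X j s \<omega>) (H i)"
begin

definition drift where "drift i s \<omega> = (\<Sum>j\<in>I. A i j * X j s \<omega>)"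
definition drift_int where "drift_int i s \<omega> = (LINT r:{0..s}|lborel. drift i r \<omega>)"
text \<open>Reading the stochastic integral off the equation fixes one jointly measurable process
  for all times at once, whereas the equation provides a separate random variable \<open>Z\<close>
  for each time.\<close>

definition noise where "noise i s \<omega> = X i s \<omega> - x0 i - drift_int i s \<omega>"
definition sqX where "sqX s \<omega> = (\<Sum>i\<in>I. (X i s \<omega>)\<^sup>2)"
definition sqH where "sqH s \<omega> = (\<Sum>i\<in>I. (H i s \<omega>)\<^sup>2)"
definition sqN where "sqN s \<omega> = (\<Sum>i\<in>I. (noise i s \<omega>)\<^sup>2)"

lemma noise_is_ito:
  assumes "i \<in> I" "0 \<le> t"
  shows "\<exists>Z. has_ito_integral M F W (H i) t Z \<and> (AE \<omega> in M. Z \<omega> = noise i t \<omega>)"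
proof -
  obtain Z where Z: "has_ito_integral M F W (H i) t Z"
    and eq: "AE \<omega> in M. X i t \<omega> - X i 0 \<omega> = (LINT s:{0..t}|lborel. \<Sum>j\<in>I. A i j * X j s \<omega>) + Z \<omega>"
    using eqn[OF assms(1)] assms(2) unfolding ito_equation_def by blast
  have "AE \<omega> in M. Z \<omega> = noise i t \<omega>"
    using eq init by eventually_elim (use assms in \<open>auto simp: noise_def drift_int_def drift_def\<close>)
  then show ?thesis using Z by blast
qed

lemma drift_path_integrable:
  assumes "0 \<le> t"
  shows "AE \<omega> in M. \<forall>i\<in>I. set_integrable lborel {0..t} (\<lambda>s. drift i s \<omega>)"
  using eqn assms fin unfolding ito_equation_def drift_def by (simp add: AE_finite_all)

lemma H_prog: "i \<in> I \<Longrightarrow> progressive F (H i)"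
  using noise_is_ito[of i 0] by (auto simp: has_ito_integral_def)

lemma H_path_integrable:
  assumes "0 \<le> t"
  shows "AE \<omega> in M. \<forall>i\<in>I. set_integrable lborel {0..t} (\<lambda>s. (H i s \<omega>)\<^sup>2)"
  using noise_is_ito[OF _ assms] fin by (auto simp: has_ito_integral_def AE_finite_all)

lemma jointly_X: "i \<in> I \<Longrightarrow> 0 \<le> T \<Longrightarrow> jointly T (X i)"
  and jointly_H: "i \<in> I \<Longrightarrow> 0 \<le> T \<Longrightarrow> jointly T (H i)"
  using progressive_jointly X_prog H_prog by auto

lemma jointly_drift: "0 \<le> T \<Longrightarrow> jointly T (drift i)"
  unfolding drift_def[abs_def] by (intro jointly_sum jointly_mult jointly_const jointly_X)

lemma jointly_drift_int: "0 \<le> T \<Longrightarrow> jointly T (drift_int i)"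
  unfolding drift_int_def[abs_def] by (intro jointly_primitive jointly_drift)

lemma jointly_noise: "i \<in> I \<Longrightarrow> 0 \<le> T \<Longrightarrow> jointly T (noise i)"
  unfolding noise_def[abs_def] by (intro jointly_diff jointly_const jointly_X jointly_drift_int)

lemma jointly_sqX: "0 \<le> T \<Longrightarrow> jointly T sqX"
  and jointly_sqN: "0 \<le> T \<Longrightarrow> jointly T sqN"
  unfolding sqX_def[abs_def] sqN_def[abs_def]
  by (auto intro!: jointly_sum jointly_square jointly_X jointly_noise)

lemma sq_nonneg: "0 \<le> sqX s \<omega>" "0 \<le> sqH s \<omega>" "0 \<le> sqN s \<omega>"
  unfolding sqX_def sqH_def sqN_def by (auto intro: sum_nonneg)

text \<open>The squared Frobenius norm of the matrix, as produced by the Cauchy-Schwarz inequality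
  in \<open>drift_square_le\<close>.\<close>

definition normA where "normA = (\<Sum>i\<in>I. \<Sum>j\<in>I. (A i j)\<^sup>2)"

lemma normA_nonneg: "0 \<le> normA" unfolding normA_def by (auto intro!: sum_nonneg)

lemma drift_square_le: "(\<Sum>i\<in>I. (drift i s \<omega>)\<^sup>2) \<le> normA * sqX s \<omega>"
proof -
  have "(drift i s \<omega>)\<^sup>2 \<le> (\<Sum>j\<in>I. (A i j)\<^sup>2) * sqX s \<omega>" for i
    unfolding drift_def sqX_def by (rule Cauchy_Schwarz_ineq_sum)
  then show ?thesis unfolding normA_def sum_distrib_right by (intro sum_mono)
qed

text \<open>In the bound of \<open>sqX\<close> by \<open>3 (n + sqN + y)\<close> the initial value
  contributes \<open>3 * n\<close> and the noise \<open>3\<close>; the rest is three times the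
  Gronwall bound for the squared drift integral \<open>y\<close>. The rate \<open>c\<close> collects
  \<open>T\<close> from the Cauchy-Schwarz inequality in time, \<open>normA\<close> from the matrix,
  and another \<open>3\<close> from the bound of \<open>sqX\<close>.\<close>

definition path_const where "path_const T =
   (let n = (\<Sum>i\<in>I. (x0 i)\<^sup>2); c = 3 * T * normA
    in 3 * n + 3 + 6 * (c * (n * T + 1)) * exp (2 * (c + 1) * T))"

lemma path_const_nonneg: "0 \<le> T \<Longrightarrow> 0 \<le> path_const T"
  unfolding path_const_def Let_def using normA_nonneg
  by (intro add_nonneg_nonneg mult_nonneg_nonneg sum_nonneg) auto

lemma sqX_le: "sqX s \<omega> \<le> 3 * ((\<Sum>i\<in>I. (x0 i)\<^sup>2) + sqN s \<omega> + (\<Sum>i\<in>I. (drift_int i s \<omega>)\<^sup>2))"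
proof -
  have "(a + b + c)\<^sup>2 \<le> 3 * (a\<^sup>2 + b\<^sup>2 + c\<^sup>2)" for a b c :: real
    using zero_le_power2[of "a - b"] zero_le_power2[of "a - c"] zero_le_power2[of "b - c"]
    by (simp add: power2_eq_square algebra_simps)
  then have "(x0 i + noise i s \<omega> + drift_int i s \<omega>)\<^sup>2
      \<le> 3 * ((x0 i)\<^sup>2 + (noise i s \<omega>)\<^sup>2 + (drift_int i s \<omega>)\<^sup>2)" for i .
  then have "(X i s \<omega>)\<^sup>2 \<le> 3 * ((x0 i)\<^sup>2 + (noise i s \<omega>)\<^sup>2 + (drift_int i s \<omega>)\<^sup>2)" for i
    by (simp add: noise_def)
  then have "sqX s \<omega> \<le> (\<Sum>i\<in>I. 3 * ((x0 i)\<^sup>2 + (noise i s \<omega>)\<^sup>2 + (drift_int i s \<omega>)\<^sup>2))"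
    unfolding sqX_def by (intro sum_mono)
  then show ?thesis by (simp add: sqN_def sum.distrib sum_distrib_left distrib_left)
qed

text \<open>Gronwall's inequality on a single path, with the noise as a given forcing. No moments
  are involved, and the bound is linear in the squared noise and its time integral, so that a random
  weight and expectations can be applied afterwards.\<close>

lemma path_bound:
  assumes \<omega>: "\<omega> \<in> space M" and bi: "\<forall>i\<in>I. set_integrable lborel {0..T} (\<lambda>s. drift i s \<omega>)"
    and r: "0 \<le> r" "r \<le> T"
  shows "ennreal (sqX r \<omega>) \<le> ennreal (path_const T) *
    (1 + ennreal (sqN r \<omega>) + (\<integral>\<^sup>+s. ennreal (sqN s \<omega>) * indicator {0..r} s \<partial>lborel))"
proof -
  have "0 \<le> T" using r by simp
  define n where "n = (\<Sum>i\<in>I. (x0 i)\<^sup>2)"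
  define c where "c = 3 * T * normA"
  define y where "y s = (\<Sum>i\<in>I. (drift_int i s \<omega>)\<^sup>2)" for s
  have nonneg: "0 \<le> n" "0 \<le> c" "0 \<le> y s" for s
    using normA_nonneg \<open>0 \<le> T\<close> by (auto simp: n_def c_def y_def intro!: sum_nonneg)
  have C: "path_const T = 3 * n + 3 + 6 * (c * (n * T + 1)) * exp (2 * (c + 1) * T)"
    by (simp add: path_const_def n_def c_def Let_def)
  define G where "G = (\<integral>\<^sup>+s. ennreal (sqN s \<omega>) * indicator {0..r} s \<partial>lborel)"
  show ?thesis
  proof (cases "G = \<infinity>")
    case True
    \<comment> \<open>Positivity makes the right-hand side infinite when the time integral of the
      noise is.\<close>
    have "0 < path_const T" unfolding C using nonneg \<open>0 \<le> T\<close>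
      by (intro add_nonneg_pos add_pos_nonneg mult_nonneg_nonneg add_nonneg_nonneg) auto
    then show ?thesis using True by (simp add: G_def ennreal_mult_eq_top_iff ennreal_mult_top)
  next
    case False
    then obtain g where g: "G = ennreal g" "0 \<le> g" by (cases G) auto
    have bi': "set_integrable lborel {0..s} (\<lambda>s. drift i s \<omega>)" if "i \<in> I" "0 \<le> s" "s \<le> r" for i s
      using bi that r by (auto intro: set_integrable_subset)
    have mN: "(\<lambda>q. ennreal (sqN q \<omega>) * indicator {0..s} q) \<in> borel_measurable lborel" if "s \<le> r" for s
      by (rule jointly_ennreal_path[OF jointly_sqN[OF \<open>0 \<le> T\<close>] _ \<omega>]) (use that r in auto)
    have my: "(\<lambda>q. ennreal (y q) * indicator {0..s} q) \<in> borel_measurable lborel" if "s \<le> r" for s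
      unfolding y_def
      by (rule jointly_ennreal_path[OF _ _ \<omega>, of T])
        (use that r in \<open>auto intro!: jointly_sum jointly_square jointly_drift_int\<close>)
    have mb: "(\<lambda>q. ennreal ((drift i q \<omega>)\<^sup>2) * indicator {0..s} q) \<in> borel_measurable lborel" if "s \<le> r" for s i
      by (rule jointly_ennreal_path[OF _ _ \<omega>, of T]) (use that r in \<open>auto intro!: jointly_square jointly_drift\<close>)
    \<comment> \<open>The rate is \<open>c + 1\<close> because \<open>gronwall_ennreal\<close> asks
      for a positive one, and \<open>c\<close> vanishes for \<open>T = 0\<close> or a zero
      matrix.\<close>
    have ineq: "ennreal (y s) \<le> ennreal (c * (n * T + g)) + ennreal (c + 1) * (\<integral>\<^sup>+q. ennreal (y q) * indicator {0..s} q \<partial>lborel)"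
      if s: "0 \<le> s" "s \<le> r" for s
    proof -
      have "ennreal (y s) = (\<Sum>i\<in>I. ennreal ((drift_int i s \<omega>)\<^sup>2))" by (simp add: y_def)
      also have "\<dots> \<le> (\<Sum>i\<in>I. ennreal s * (\<integral>\<^sup>+q. ennreal ((drift i q \<omega>)\<^sup>2) * indicator {0..s} q \<partial>lborel))"
        unfolding drift_int_def using s by (intro sum_mono set_integral_square_le bi') auto
      also have "\<dots> = ennreal s * (\<integral>\<^sup>+q. (\<Sum>i\<in>I. ennreal ((drift i q \<omega>)\<^sup>2) * indicator {0..s} q) \<partial>lborel)"
        unfolding sum_distrib_left[symmetric] by (subst nn_integral_sum[OF mb[OF s(2)]]) (rule refl)
      also have "\<dots> \<le> ennreal T * (\<integral>\<^sup>+q. ennreal (3 * normA) * (ennreal n * indicator {0..s} q +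
          ennreal (sqN q \<omega>) * indicator {0..s} q + ennreal (y q) * indicator {0..s} q) \<partial>lborel)"
      proof (intro mult_mono nn_integral_mono)
        fix q
        have "(\<Sum>i\<in>I. (drift i q \<omega>)\<^sup>2) \<le> normA * (3 * (n + sqN q \<omega> + y q))"
          using order_trans[OF drift_square_le mult_left_mono[OF sqX_le normA_nonneg]] by (simp add: n_def y_def)
        then have "ennreal (\<Sum>i\<in>I. (drift i q \<omega>)\<^sup>2) \<le> ennreal (3 * normA * (n + sqN q \<omega> + y q))"
          by (intro ennreal_leI) (simp add: algebra_simps)
        also have "\<dots> = ennreal (3 * normA) * (ennreal n + ennreal (sqN q \<omega>) + ennreal (y q))"
          using nonneg sq_nonneg normA_nonneg by (simp add: ennreal_mult ennreal_plus add_nonneg_nonneg)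
        finally show "(\<Sum>i\<in>I. ennreal ((drift i q \<omega>)\<^sup>2) * indicator {0..s} q) \<le> ennreal (3 * normA) * (ennreal n * indicator {0..s} q +
          ennreal (sqN q \<omega>) * indicator {0..s} q + ennreal (y q) * indicator {0..s} q)"
          by (auto simp: indicator_def)
      qed (use s r in auto)
      also have "(\<integral>\<^sup>+q. ennreal (3 * normA) * (ennreal n * indicator {0..s} q +
          ennreal (sqN q \<omega>) * indicator {0..s} q + ennreal (y q) * indicator {0..s} q) \<partial>lborel)
        = ennreal (3 * normA) * (ennreal n * ennreal s + (\<integral>\<^sup>+q. ennreal (sqN q \<omega>) * indicator {0..s} q \<partial>lborel)
           + (\<integral>\<^sup>+q. ennreal (y q) * indicator {0..s} q \<partial>lborel))"
        using mN[OF s(2)] my[OF s(2)] s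
        by (simp add: nn_integral_cmult nn_integral_add nn_integral_cmult_indicator)
      also have "ennreal T * (ennreal (3 * normA) * (ennreal n * ennreal s + (\<integral>\<^sup>+q. ennreal (sqN q \<omega>) * indicator {0..s} q \<partial>lborel)
           + (\<integral>\<^sup>+q. ennreal (y q) * indicator {0..s} q \<partial>lborel)))
        \<le> ennreal T * (ennreal (3 * normA) * (ennreal n * ennreal T + ennreal g
           + (\<integral>\<^sup>+q. ennreal (y q) * indicator {0..s} q \<partial>lborel)))"
      proof -
        have "(\<integral>\<^sup>+q. ennreal (sqN q \<omega>) * indicator {0..s} q \<partial>lborel) \<le> G"
          unfolding G_def using s by (intro nn_integral_mono) (auto simp: indicator_def)
        then show ?thesis using s r by (intro mult_left_mono add_mono) (auto simp: g intro: ennreal_leI)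
      qed
      also have "\<dots> = ennreal c * (ennreal (n * T + g) + (\<integral>\<^sup>+q. ennreal (y q) * indicator {0..s} q \<partial>lborel))"
        using nonneg \<open>0 \<le> T\<close> g normA_nonneg
        by (simp add: c_def ennreal_mult ennreal_plus mult.assoc[symmetric] mult.commute[of "ennreal T"])
      also have "\<dots> \<le> ennreal (c * (n * T + g)) + ennreal (c + 1) * (\<integral>\<^sup>+q. ennreal (y q) * indicator {0..s} q \<partial>lborel)"
        using nonneg \<open>0 \<le> T\<close> g by (simp add: distrib_left ennreal_mult add_left_mono mult_right_mono ennreal_leI)
      finally show ?thesis .
    qed
    \<comment> \<open>The a priori bound for Gronwall's inequality; it comes from integrability of
      the drift along this path.\<close>
    define B where "B = (\<Sum>i\<in>I. (LINT s:{0..T}|lborel. \<bar>drift i s \<omega>\<bar>)\<^sup>2)"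
    have bound: "ennreal (y s) \<le> ennreal B" if s: "0 \<le> s" "s \<le> r" for s
    proof (intro ennreal_leI)
      have "(drift_int i s \<omega>)\<^sup>2 \<le> (LINT s:{0..T}|lborel. \<bar>drift i s \<omega>\<bar>)\<^sup>2" if "i \<in> I" for i
      proof -
        have j: "set_integrable lborel {0..T} (\<lambda>s. \<bar>drift i s \<omega>\<bar>)" using bi that by (simp add: set_integrable_abs)
        have "\<bar>drift_int i s \<omega>\<bar> \<le> (LINT q:{0..s}|lborel. \<bar>drift i q \<omega>\<bar>)"
          unfolding drift_int_def set_lebesgue_integral_def
          using integral_abs_bound[of lborel "\<lambda>q. indicator {0..s} q *\<^sub>R drift i q \<omega>"] by (simp add: abs_mult)
        also have "\<dots> \<le> (LINT q:{0..T}|lborel. \<bar>drift i q \<omega>\<bar>)"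
          unfolding set_lebesgue_integral_def
          using j set_integrable_subset[OF j, of "{0..s}"] s r
          by (intro integral_mono) (auto simp: set_integrable_def indicator_def)
        finally show ?thesis using abs_le_square_iff by fastforce
      qed
      then show "y s \<le> B" unfolding y_def B_def by (intro sum_mono)
    qed
    have "0 \<le> B" unfolding B_def by (intro sum_nonneg) auto
    have yr: "ennreal (y r) \<le> ennreal (2 * (c * (n * T + g)) * exp (2 * (c + 1) * r))"
      by (rule gronwall_ennreal[where T = r, OF _ _ \<open>0 \<le> B\<close> bound ineq])
        (use nonneg g \<open>0 \<le> T\<close> r in auto)
    have "y r \<le> 2 * (c * (n * T + g)) * exp (2 * (c + 1) * r)"
      using yr nonneg g \<open>0 \<le> T\<close> by (simp add: ennreal_le_iff)
    \<comment> \<open>Separates \<open>g\<close>, which depends on the path, from the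
      constants.\<close>
    also have "\<dots> \<le> 2 * (c * ((n * T + 1) * (1 + g))) * exp (2 * (c + 1) * T)"
    proof (rule mult_mono)
      have "n * T + g \<le> (n * T + 1) * (1 + g)"
        using mult_nonneg_nonneg[OF mult_nonneg_nonneg[OF nonneg(1) \<open>0 \<le> T\<close>] g(2)] by (simp add: algebra_simps)
      then show "2 * (c * (n * T + g)) \<le> 2 * (c * ((n * T + 1) * (1 + g)))"
        using nonneg by (intro mult_left_mono) auto
      show "exp (2 * (c + 1) * r) \<le> exp (2 * (c + 1) * T)"
        unfolding exp_le_cancel_iff using nonneg r by (intro mult_left_mono) auto
    qed (use nonneg g \<open>0 \<le> T\<close> in auto)
    finally have y': "y r \<le> 2 * (c * ((n * T + 1) * (1 + g))) * exp (2 * (c + 1) * T)" .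
    have "sqX r \<omega> \<le> 3 * (n + sqN r \<omega> + y r)" using sqX_le by (simp add: n_def y_def)
    also have "\<dots> \<le> path_const T * (1 + sqN r \<omega> + g)"
    proof -
      let ?E = "6 * (c * (n * T + 1)) * exp (2 * (c + 1) * T)"
      have E: "0 \<le> ?E" using nonneg \<open>0 \<le> T\<close> by simp
      have "3 * (2 * (c * ((n * T + 1) * (1 + g))) * e) = 6 * (c * (n * T + 1)) * e * (1 + g)" for e
        by (simp add: algebra_simps)
      then have "3 * y r \<le> ?E * (1 + g)" using mult_left_mono[OF y', of 3] by simp
      also have "\<dots> \<le> ?E * (1 + sqN r \<omega> + g)" using sq_nonneg(3)[of r \<omega>] E by (intro mult_left_mono) auto
      finally have "3 * y r \<le> ?E * (1 + sqN r \<omega> + g)" .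
      moreover have "3 * n * 1 \<le> 3 * n * (1 + sqN r \<omega> + g)" "3 * sqN r \<omega> \<le> 3 * (1 + sqN r \<omega> + g)"
        using nonneg(1) g sq_nonneg(3)[of r \<omega>] by (intro mult_left_mono; simp)+
      ultimately show ?thesis unfolding C by (simp add: distrib_right distrib_left)
    qed
    finally have "ennreal (sqX r \<omega>) \<le> ennreal (path_const T * (1 + sqN r \<omega> + g))" by (rule ennreal_leI)
    also have "\<dots> = ennreal (path_const T) * (1 + ennreal (sqN r \<omega>) + G)"
      using path_const_nonneg[OF \<open>0 \<le> T\<close>] g sq_nonneg by (simp add: ennreal_mult ennreal_plus)
    finally show ?thesis by (simp add: G_def)
  qed
qed

definition wt where "wt l s \<omega> = exp (- l * (\<Sum>i\<in>I. quad_var (H i) s \<omega>))"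

lemma jointly_wt: "0 \<le> T \<Longrightarrow> jointly T (wt l)"
  unfolding wt_def[abs_def]
  by (intro jointly_exp jointly_mult jointly_const jointly_sum jointly_quad_var jointly_H)

lemma wt_bounds: "0 < l \<Longrightarrow> 0 < wt l s \<omega>" "0 < l \<Longrightarrow> wt l s \<omega> \<le> 1"
  by (auto simp: wt_def intro!: mult_nonneg_nonneg sum_nonneg quad_var_nonneg)

lemma sum_quad_var_eq:
  assumes "\<forall>i\<in>I. set_integrable lborel {0..T} (\<lambda>s. (H i s \<omega>)\<^sup>2)" "0 \<le> s" "s \<le> T"
  shows "(\<Sum>i\<in>I. quad_var (H i) s \<omega>) = (LINT r:{0..s}|lborel. sqH r \<omega>)"
    "set_integrable lborel {0..s} (\<lambda>r. sqH r \<omega>)"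
proof -
  have i: "set_integrable lborel {0..s} (\<lambda>s. (H i s \<omega>)\<^sup>2)" if "i \<in> I" for i
    using quad_var_mono(1)[of s T "H i" \<omega>] assms that by auto
  show "(\<Sum>i\<in>I. quad_var (H i) s \<omega>) = (LINT r:{0..s}|lborel. sqH r \<omega>)"
    unfolding quad_var_def sqH_def using i
    by (simp add: set_lebesgue_integral_def set_integrable_def sum_distrib_left)
  show "set_integrable lborel {0..s} (\<lambda>r. sqH r \<omega>)"
    unfolding sqH_def using i by (simp add: set_integrable_def sum_distrib_left)
qed

text \<open>\<open>exp 1\<close> comes from \<open>exp_primitive_bound\<close>,
  \<open>K * (1 + path_const T)\<close> from the growth bound and \<open>path_bound\<close>, and
  \<open>1 + T\<close> from integrating the result over time.\<close>

definition weight_const where "weight_const T = exp 1 * K * (1 + path_const T) * (1 + T)"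

lemma weight_const_nonneg: "0 \<le> T \<Longrightarrow> 0 \<le> weight_const T"
  unfolding weight_const_def using K0 path_const_nonneg by simp

text \<open>Closes the circle path by path: the loss of weight is controlled by the weighted
  \<open>\<bar>H\<bar>\<^sup>2\<close>, hence by the weighted state, hence by the weighted noise.
  The time integral of the noise inside \<open>path_bound\<close> can be weighted as well because
  the weight decreases in time.\<close>

lemma weighted_path_bound:
  assumes \<omega>: "\<omega> \<in> space M" and bi: "\<forall>i\<in>I. set_integrable lborel {0..T} (\<lambda>s. drift i s \<omega>)"
    and Hi: "\<forall>i\<in>I. set_integrable lborel {0..T} (\<lambda>s. (H i s \<omega>)\<^sup>2)"
    and "0 < l" and s: "0 \<le> s" "s \<le> T"
  shows "ennreal ((1 - wt l s \<omega>) / l) \<le> ennreal (weight_const T)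
    + ennreal (weight_const T) * (\<integral>\<^sup>+r. ennreal (wt l r \<omega> * sqN r \<omega>) * indicator {0..s} r \<partial>lborel)"
proof -
  have "0 \<le> T" using s by simp
  define C where "C = path_const T"
  have C0: "0 \<le> C" unfolding C_def by (rule path_const_nonneg) fact
  define G where "G = (\<integral>\<^sup>+r. ennreal (wt l r \<omega> * sqN r \<omega>) * indicator {0..s} r \<partial>lborel)"
  have wt_eq: "wt l r \<omega> = exp (- l * (LINT q:{0..r}|lborel. sqH q \<omega>))" if "0 \<le> r" "r \<le> T" for r
    unfolding wt_def using sum_quad_var_eq(1)[OF Hi that] by simp
  have mN: "(\<lambda>q. ennreal (sqN q \<omega>) * indicator {0..r} q) \<in> borel_measurable lborel" if "r \<le> T" for r
    by (rule jointly_ennreal_path[OF jointly_sqN[OF \<open>0 \<le> T\<close>] that \<omega>])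
  have mwN: "(\<lambda>q. ennreal (wt l q \<omega> * sqN q \<omega>) * indicator {0..r} q) \<in> borel_measurable lborel" if "r \<le> T" for r
    by (rule jointly_ennreal_path[OF jointly_mult[OF jointly_wt[OF \<open>0 \<le> T\<close>] jointly_sqN[OF \<open>0 \<le> T\<close>]] that \<omega>])
  have pt: "ennreal (wt l r \<omega> * sqH r \<omega>) \<le> ennreal (K * (1 + C)) * (1 + ennreal (wt l r \<omega> * sqN r \<omega>) + G)"
    if r: "0 \<le> r" "r \<le> s" for r
  proof -
    have "wt l r \<omega> * sqH r \<omega> \<le> wt l r \<omega> * (K * (1 + sqX r \<omega>))"
      using growth[OF r(1) \<omega>] wt_bounds[OF \<open>0 < l\<close>, of r \<omega>] by (intro mult_left_mono) (auto simp: sqH_def sqX_def)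
    also have "\<dots> = K * (wt l r \<omega> + wt l r \<omega> * sqX r \<omega>)" by (simp add: algebra_simps)
    also have "\<dots> \<le> K * (1 + wt l r \<omega> * sqX r \<omega>)"
      using wt_bounds(2)[OF \<open>0 < l\<close>, of r \<omega>] K0 by (intro mult_left_mono) auto
    finally have "ennreal (wt l r \<omega> * sqH r \<omega>) \<le> ennreal (K * (1 + wt l r \<omega> * sqX r \<omega>))" by (rule ennreal_leI)
    also have "\<dots> = ennreal K * (1 + ennreal (wt l r \<omega>) * ennreal (sqX r \<omega>))"
      using K0 wt_bounds(1)[OF \<open>0 < l\<close>, of r \<omega>] sq_nonneg
      by (simp add: ennreal_mult ennreal_plus less_imp_le)
    also have "\<dots> \<le> ennreal K * (1 + ennreal (wt l r \<omega>) * (ennreal C * (1 + ennreal (sqN r \<omega>)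
          + (\<integral>\<^sup>+q. ennreal (sqN q \<omega>) * indicator {0..r} q \<partial>lborel))))"
      unfolding C_def using r s by (intro mult_left_mono add_left_mono path_bound[OF \<omega> bi]) auto
    also have "ennreal (wt l r \<omega>) * (ennreal C * (1 + ennreal (sqN r \<omega>)
          + (\<integral>\<^sup>+q. ennreal (sqN q \<omega>) * indicator {0..r} q \<partial>lborel)))
      = ennreal C * (ennreal (wt l r \<omega>) + ennreal (wt l r \<omega> * sqN r \<omega>)
          + (\<integral>\<^sup>+q. ennreal (wt l r \<omega>) * (ennreal (sqN q \<omega>) * indicator {0..r} q) \<partial>lborel))"
    proof -
      have "w * (k * (1 + n + g)) = k * (w + w * n + w * g)" for w k n g :: ennreal
        by (simp add: distrib_left mult_ac)
      moreover have "ennreal (wt l r \<omega> * sqN r \<omega>) = ennreal (wt l r \<omega>) * ennreal (sqN r \<omega>)"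
        using wt_bounds(1)[OF \<open>0 < l\<close>, of r \<omega>] sq_nonneg by (simp add: ennreal_mult less_imp_le)
      moreover have "r \<le> T" using r s by simp
      ultimately show ?thesis by (simp only: nn_integral_cmult[OF mN])
    qed
    also have "\<dots> \<le> ennreal C * (1 + ennreal (wt l r \<omega> * sqN r \<omega>) + G)"
    proof (intro mult_left_mono add_mono)
      show "(\<integral>\<^sup>+q. ennreal (wt l r \<omega>) * (ennreal (sqN q \<omega>) * indicator {0..r} q) \<partial>lborel) \<le> G"
        unfolding G_def
      proof (rule nn_integral_mono)
        fix q
        show "ennreal (wt l r \<omega>) * (ennreal (sqN q \<omega>) * indicator {0..r} q) \<le> ennreal (wt l q \<omega> * sqN q \<omega>) * indicator {0..s} q"
        proof (cases "q \<in> {0..r}")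
          case True
          \<comment> \<open>Monotonicity of the quadratic variation: the weight at the later time
            \<open>r\<close> is at most the weight at \<open>q\<close>, so it may be moved under the
            integral.\<close>
          have "quad_var (H i) q \<omega> \<le> quad_var (H i) r \<omega>" if "i \<in> I" for i
            using True r s Hi that quad_var_mono(1)[of r T "H i" \<omega>] by (intro quad_var_mono(2)) auto
          then have "wt l r \<omega> \<le> wt l q \<omega>" using \<open>0 < l\<close> by (simp add: wt_def sum_mono)
          then have "ennreal (wt l r \<omega>) * ennreal (sqN q \<omega>) \<le> ennreal (wt l q \<omega>) * ennreal (sqN q \<omega>)"
            by (intro mult_right_mono ennreal_leI) auto
          then show ?thesis using True r wt_bounds(1)[OF \<open>0 < l\<close>, of q \<omega>] sq_nonneg
            by (simp add: ennreal_mult less_imp_le)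
        qed simp
      qed
      show "ennreal (wt l r \<omega>) \<le> 1" using wt_bounds(2)[OF \<open>0 < l\<close>, of r \<omega>] by (simp add: ennreal_le_1)
    qed auto
    also have "ennreal K * (1 + ennreal C * (1 + ennreal (wt l r \<omega> * sqN r \<omega>) + G))
      \<le> ennreal K * ((1 + ennreal (wt l r \<omega> * sqN r \<omega>) + G) + ennreal C * (1 + ennreal (wt l r \<omega> * sqN r \<omega>) + G))"
      by (intro mult_left_mono add_right_mono) (auto simp: add.assoc)
    also have "\<dots> = ennreal (K * (1 + C)) * (1 + ennreal (wt l r \<omega> * sqN r \<omega>) + G)"
      using K0 C0 by (simp add: ennreal_mult ennreal_plus distrib_left distrib_right mult.assoc)
    finally show ?thesis by (simp add: mult_left_mono)
  qed
  note ep = exp_primitive_bound[OF sum_quad_var_eq(2)[OF Hi s] sq_nonneg(2) s(1) \<open>0 < l\<close>]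
  define E where "E r = exp (- l * (LINT q:{0..r}|lborel. sqH q \<omega>)) * sqH r \<omega>" for r
  note ep' = ep[folded E_def]
  have E0: "0 \<le> E r" for r using sq_nonneg by (simp add: E_def)
  have E_eq: "E r = wt l r \<omega> * sqH r \<omega>" if "r \<in> {0..s}" for r using wt_eq[of r] that s by (simp add: E_def)
  have "(1 - wt l s \<omega>) / l \<le> exp 1 * (LINT r:{0..s}|lborel. E r)"
    using ep'(2) wt_eq[OF s] by simp
  then have "ennreal ((1 - wt l s \<omega>) / l) \<le> ennreal (exp 1) * ennreal (LINT r:{0..s}|lborel. E r)"
    by (simp add: ennreal_mult'[symmetric] ennreal_leI)
  also have "ennreal (LINT r:{0..s}|lborel. E r)
     = (\<integral>\<^sup>+r. ennreal (indicator {0..s} r *\<^sub>R E r) \<partial>lborel)"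
    unfolding set_lebesgue_integral_def
    by (rule nn_integral_eq_integral[symmetric]) (use ep'(1) E0 in \<open>auto simp: set_integrable_def\<close>)
  also have "\<dots> \<le> (\<integral>\<^sup>+r. ennreal (K * (1 + C)) * ((1 + G) * indicator {0..s} r
        + ennreal (wt l r \<omega> * sqN r \<omega>) * indicator {0..s} r) \<partial>lborel)"
  proof (rule nn_integral_mono)
    fix r
    show "ennreal (indicator {0..s} r *\<^sub>R E r)
      \<le> ennreal (K * (1 + C)) * ((1 + G) * indicator {0..s} r + ennreal (wt l r \<omega> * sqN r \<omega>) * indicator {0..s} r)"
    proof (cases "r \<in> {0..s}")
      case True
      then show ?thesis using pt[of r] E_eq[of r] s by (simp add: add_ac)
    qed simp
  qed
  also have "\<dots> = ennreal (K * (1 + C)) * ((1 + G) * ennreal s + G)"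
    using s mwN[OF s(2)] by (simp add: nn_integral_cmult nn_integral_add nn_integral_cmult_indicator G_def)
  also have "\<dots> \<le> ennreal (K * (1 + C)) * ((1 + G) * ennreal T + (1 + G))"
    using s by (intro mult_left_mono add_mono) (auto intro: ennreal_leI)
  also have "\<dots> = ennreal (K * (1 + C)) * (ennreal (1 + T) * (1 + G))"
    using \<open>0 \<le> T\<close> by (simp add: ennreal_plus distrib_left distrib_right mult.commute add_ac)
  also have "ennreal (exp 1) * (ennreal (K * (1 + C)) * (ennreal (1 + T) * (1 + G))) = ennreal (weight_const T) * (1 + G)"
    using K0 C0 \<open>0 \<le> T\<close> by (simp add: weight_const_def C_def[symmetric] ennreal_mult mult.assoc)
  finally show ?thesis by (simp add: G_def distrib_left mult_left_mono)
qed

text \<open>\<open>ito_exp_weight\<close> bounds the weighted noise by the mean loss of weight. That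
  is at most \<open>1 / l\<close>, hence finite, and by \<open>weighted_path_bound\<close> it is
  controlled by the time integral of the weighted noise itself, so Gronwall's inequality applies.
  The constant does not involve \<open>l\<close>.\<close>

lemma weighted_noise_bound:
  assumes "0 \<le> T" "0 < l" and s: "0 \<le> s" "s \<le> T"
  shows "(\<integral>\<^sup>+\<omega>. ennreal (wt l s \<omega> * sqN s \<omega>) \<partial>M) \<le> ennreal (2 * weight_const T * exp (2 * (weight_const T + 1) * T))"
proof -
  define z where "z s = (\<integral>\<^sup>+\<omega>. ennreal (wt l s \<omega> * sqN s \<omega>) \<partial>M)" for s
  have z1: "z s \<le> ennreal (expectation (\<lambda>\<omega>. (1 - wt l s \<omega>) / l))" if s: "0 \<le> s" for s
  proof -
    obtain Z where Z: "\<And>i. i \<in> I \<Longrightarrow> has_ito_integral M F W (H i) s (Z i)" "\<And>i. i \<in> I \<Longrightarrow> AE \<omega> in M. Z i \<omega> = noise i s \<omega>"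
      using noise_is_ito[OF _ s] by metis
    have "AE \<omega> in M. \<forall>i\<in>I. Z i \<omega> = noise i s \<omega>" using Z(2) fin by (simp add: AE_finite_all)
    then have "AE \<omega> in M. ennreal (wt l s \<omega> * sqN s \<omega>)
        = ennreal (exp (- l * (\<Sum>i\<in>I. quad_var (H i) s \<omega>)) * (\<Sum>i\<in>I. (Z i \<omega>)\<^sup>2))"
      by eventually_elim (simp add: wt_def sqN_def)
    then have "z s = (\<integral>\<^sup>+\<omega>. ennreal (exp (- l * (\<Sum>i\<in>I. quad_var (H i) s \<omega>)) * (\<Sum>i\<in>I. (Z i \<omega>)\<^sup>2)) \<partial>M)"
      unfolding z_def by (rule nn_integral_cong_AE)
    also have "\<dots> \<le> ennreal (expectation (\<lambda>\<omega>. (1 - exp (- l * (\<Sum>i\<in>I. quad_var (H i) s \<omega>))) / l))"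
      by (rule ito_exp_weight[OF fin Z(1) s \<open>0 < l\<close>])
    finally show ?thesis by (simp add: wt_def)
  qed
  have wm: "wt l s \<in> borel_measurable M" if "0 \<le> s" for s
    by (rule jointly_section[OF jointly_wt[OF that] that order_refl])
  have wi: "integrable M (\<lambda>\<omega>. (1 - wt l s \<omega>) / l)" if "0 \<le> s" for s
  proof (rule integrable_const_bound[of _ "1 / l"])
    show "AE \<omega> in M. norm ((1 - wt l s \<omega>) / l) \<le> 1 / l"
      using wt_bounds[OF \<open>0 < l\<close>, of s] \<open>0 < l\<close> by (auto simp: divide_right_mono less_imp_le)
  qed (use wm[OF that] in measurable)
  have bound: "z s \<le> ennreal (1 / l)" if "0 \<le> s" for s
  proof -
    have "(1 - wt l s \<omega>) / l \<le> 1 / l" for \<omega>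
      using wt_bounds(1)[OF \<open>0 < l\<close>, of s \<omega>] \<open>0 < l\<close> by (intro divide_right_mono) auto
    then have "expectation (\<lambda>\<omega>. (1 - wt l s \<omega>) / l) \<le> expectation (\<lambda>\<omega>. 1 / l)"
      using wi[OF that] by (intro integral_mono) auto
    then show ?thesis using z1[OF that] by (simp add: prob_space order_trans[OF _ ennreal_leI])
  qed
  let ?w = "weight_const T"
  have w0: "0 \<le> ?w" by (rule weight_const_nonneg) fact
  have ineq: "z s \<le> ennreal ?w + ennreal (?w + 1) * (\<integral>\<^sup>+r. z r * indicator {0..s} r \<partial>lborel)"
    if s: "0 \<le> s" "s \<le> T" for s
  proof -
    have wt1: "0 \<le> (1 - wt l s \<omega>) / l" for \<omega>
      using wt_bounds(2)[OF \<open>0 < l\<close>, of s \<omega>] \<open>0 < l\<close> by simp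
    have "z s \<le> (\<integral>\<^sup>+\<omega>. ennreal ((1 - wt l s \<omega>) / l) \<partial>M)"
      using z1[OF s(1)] nn_integral_eq_integral[OF wi[OF s(1)]] wt1 by simp
    also have "\<dots> \<le> (\<integral>\<^sup>+\<omega>. ennreal ?w + ennreal ?w * (\<integral>\<^sup>+r. ennreal (wt l r \<omega> * sqN r \<omega>) * indicator {0..s} r \<partial>lborel) \<partial>M)"
    proof (rule nn_integral_mono_AE)
      show "AE \<omega> in M. ennreal ((1 - wt l s \<omega>) / l) \<le> ennreal ?w
          + ennreal ?w * (\<integral>\<^sup>+r. ennreal (wt l r \<omega> * sqN r \<omega>) * indicator {0..s} r \<partial>lborel)"
        using drift_path_integrable[OF \<open>0 \<le> T\<close>] H_path_integrable[OF \<open>0 \<le> T\<close>] AE_space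
        by eventually_elim (rule weighted_path_bound[OF _ _ _ \<open>0 < l\<close> s])
    qed
    also have "\<dots> = ennreal ?w + ennreal ?w * (\<integral>\<^sup>+r. z r * indicator {0..s} r \<partial>lborel)"
      using jointly_nn_fubini[OF jointly_mult[OF jointly_wt[OF \<open>0 \<le> T\<close>] jointly_sqN[OF \<open>0 \<le> T\<close>]] s(2)]
      by (simp add: nn_integral_add nn_integral_cmult emeasure_space_1 z_def)
    also have "\<dots> \<le> ennreal ?w + ennreal (?w + 1) * (\<integral>\<^sup>+r. z r * indicator {0..s} r \<partial>lborel)"
      by (intro add_left_mono mult_right_mono ennreal_leI) auto
    finally show ?thesis .
  qed
  have "z s \<le> ennreal (2 * ?w * exp (2 * (?w + 1) * s))"
    by (rule gronwall_ennreal[where T = T and B = "1 / l", OF w0 _ _ bound ineq]) (use s w0 \<open>0 < l\<close> in auto)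
  also have "\<dots> \<le> ennreal (2 * ?w * exp (2 * (?w + 1) * T))"
    using w0 s by (intro ennreal_leI mult_left_mono) (auto intro!: mult_left_mono)
  finally show ?thesis by (simp add: z_def)
qed

text \<open>The weights with \<open>l = 1 / (n + 1)\<close> tend to \<open>1\<close> pointwise, and
  Fatou's lemma keeps the uniform bound.\<close>

lemma noise_moment:
  assumes s: "0 \<le> s" "s \<le> T"
  shows "(\<integral>\<^sup>+\<omega>. ennreal (sqN s \<omega>) \<partial>M) \<le> ennreal (2 * weight_const T * exp (2 * (weight_const T + 1) * T))"
proof -
  have "0 \<le> T" using s by simp
  let ?c = "ennreal (2 * weight_const T * exp (2 * (weight_const T + 1) * T))"
  let ?l = "\<lambda>n. 1 / real (Suc n)"
  have lim: "(\<lambda>n. ennreal (wt (?l n) s \<omega> * sqN s \<omega>)) \<longlonglongrightarrow> ennreal (sqN s \<omega>)" for \<omega>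
  proof -
    have "?l \<longlonglongrightarrow> 0" using LIMSEQ_inverse_real_of_nat by (simp add: inverse_eq_divide)
    then have "(\<lambda>n. exp (- ?l n * (\<Sum>i\<in>I. quad_var (H i) s \<omega>)) * sqN s \<omega>)
        \<longlonglongrightarrow> exp (- 0 * (\<Sum>i\<in>I. quad_var (H i) s \<omega>)) * sqN s \<omega>"
      by (intro tendsto_intros)
    then show ?thesis unfolding wt_def by (intro tendsto_ennrealI) simp
  qed
  have m: "(\<lambda>\<omega>. ennreal (wt l s \<omega> * sqN s \<omega>)) \<in> borel_measurable M" for l
    using jointly_section[OF jointly_mult[OF jointly_wt[OF \<open>0 \<le> T\<close>] jointly_sqN[OF \<open>0 \<le> T\<close>]] s] by simp
  have "(\<integral>\<^sup>+\<omega>. ennreal (sqN s \<omega>) \<partial>M) = (\<integral>\<^sup>+\<omega>. liminf (\<lambda>n. ennreal (wt (?l n) s \<omega> * sqN s \<omega>)) \<partial>M)"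
    by (simp only: lim_imp_Liminf[OF sequentially_bot lim])
  also have "\<dots> \<le> liminf (\<lambda>n. \<integral>\<^sup>+\<omega>. ennreal (wt (?l n) s \<omega> * sqN s \<omega>) \<partial>M)"
    by (rule nn_integral_liminf) (rule m)
  also have "\<dots> \<le> liminf (\<lambda>n. ?c)"
    by (intro Liminf_mono always_eventually allI weighted_noise_bound[OF \<open>0 \<le> T\<close> _ s]) simp
  also have "\<dots> = ?c" by (simp add: Liminf_const)
  finally show ?thesis .
qed

text \<open>Integrates \<open>path_bound\<close> over the sample space, where both noise terms have
  bounded means by \<open>noise_moment\<close>.\<close>

lemma state_moment:
  assumes "0 \<le> T"
  shows "\<exists>C\<ge>0. \<forall>s\<in>{0..T}. (\<integral>\<^sup>+\<omega>. ennreal (sqX s \<omega>) \<partial>M) \<le> ennreal C"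
proof -
  define c where "c = 2 * weight_const T * exp (2 * (weight_const T + 1) * T)"
  have c0: "0 \<le> c" using weight_const_nonneg[OF assms] by (simp add: c_def)
  have "(\<integral>\<^sup>+\<omega>. ennreal (sqX s \<omega>) \<partial>M) \<le> ennreal (path_const T * (1 + c + c * T))" if s: "s \<in> {0..T}" for s
  proof -
    have mN: "sqN s \<in> borel_measurable M" using jointly_section[OF jointly_sqN[OF assms]] s by simp
    note fub = jointly_nn_fubini[OF jointly_sqN[OF assms], of s]
    have "(\<integral>\<^sup>+\<omega>. ennreal (sqX s \<omega>) \<partial>M) \<le> (\<integral>\<^sup>+\<omega>. ennreal (path_const T) *
      (1 + ennreal (sqN s \<omega>) + (\<integral>\<^sup>+r. ennreal (sqN r \<omega>) * indicator {0..s} r \<partial>lborel)) \<partial>M)"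
    proof (rule nn_integral_mono_AE)
      show "AE \<omega> in M. ennreal (sqX s \<omega>) \<le> ennreal (path_const T) *
          (1 + ennreal (sqN s \<omega>) + (\<integral>\<^sup>+r. ennreal (sqN r \<omega>) * indicator {0..s} r \<partial>lborel))"
        using drift_path_integrable[OF assms] AE_space
        by eventually_elim (rule path_bound, use s in auto)
    qed
    also have "\<dots> = ennreal (path_const T) * (1 + (\<integral>\<^sup>+\<omega>. ennreal (sqN s \<omega>) \<partial>M)
        + (\<integral>\<^sup>+r. (\<integral>\<^sup>+\<omega>. ennreal (sqN r \<omega>) \<partial>M) * indicator {0..s} r \<partial>lborel))"
      using mN fub s by (simp add: nn_integral_cmult nn_integral_add emeasure_space_1)
    also have "\<dots> \<le> ennreal (path_const T) * (1 + ennreal c + ennreal c * ennreal T)"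
    proof (intro mult_left_mono add_mono)
      show "(\<integral>\<^sup>+\<omega>. ennreal (sqN s \<omega>) \<partial>M) \<le> ennreal c" unfolding c_def using s by (intro noise_moment) auto
      have "(\<integral>\<^sup>+r. (\<integral>\<^sup>+\<omega>. ennreal (sqN r \<omega>) \<partial>M) * indicator {0..s} r \<partial>lborel)
          \<le> (\<integral>\<^sup>+r. ennreal c * indicator {0..T} r \<partial>lborel)"
      proof (rule nn_integral_mono)
        fix r
        show "(\<integral>\<^sup>+\<omega>. ennreal (sqN r \<omega>) \<partial>M) * indicator {0..s} r \<le> ennreal c * indicator {0..T} r"
          using noise_moment[of r T] s by (auto simp: indicator_def c_def)
      qed
      also have "\<dots> = ennreal c * ennreal T" using assms by (simp add: nn_integral_cmult_indicator)
      finally show "(\<integral>\<^sup>+r. (\<integral>\<^sup>+\<omega>. ennreal (sqN r \<omega>) \<partial>M) * indicator {0..s} r \<partial>lborel) \<le> ennreal c * ennreal T" .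
    qed auto
    also have "\<dots> = ennreal (path_const T * (1 + c + c * T))"
      using c0 assms path_const_nonneg[OF assms] by (simp add: ennreal_mult ennreal_plus)
    finally show ?thesis .
  qed
  moreover have "0 \<le> path_const T * (1 + c + c * T)" using c0 assms path_const_nonneg[OF assms] by simp
  ultimately show ?thesis by blast
qed

end

section \<open>Processes with bounded second moments\<close>

context brownian begin

text \<open>The moments are written as \<open>ennreal\<close> integrals, so that the bound itself
  asserts finiteness; its uniformity in \<open>s\<close> makes products integrable over the time
  interval as well.\<close>

definition L2_bounded :: "real \<Rightarrow> (real \<Rightarrow> 'w \<Rightarrow> real) \<Rightarrow> bool" where
  "L2_bounded T f \<longleftrightarrow> jointly T f \<and>
     (\<exists>C\<ge>0. \<forall>s\<in>{0..T}. (\<integral>\<^sup>+\<omega>. ennreal ((f s \<omega>)\<^sup>2) \<partial>M) \<le> ennreal C)"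

lemma L2_bounded_measurable: "L2_bounded T f \<Longrightarrow> 0 \<le> s \<Longrightarrow> s \<le> T \<Longrightarrow> f s \<in> borel_measurable M"
  using jointly_section by (auto simp: L2_bounded_def)

lemma L2_bounded_integrable:
  assumes f: "L2_bounded T f" and s: "0 \<le> s" "s \<le> T"
  shows "integrable M (\<lambda>\<omega>. (f s \<omega>)\<^sup>2)"
proof (rule integrableI_bounded)
  show "(\<lambda>\<omega>. (f s \<omega>)\<^sup>2) \<in> borel_measurable M"
    using L2_bounded_measurable[OF assms] by measurable
  obtain C where "(\<integral>\<^sup>+\<omega>. ennreal ((f s \<omega>)\<^sup>2) \<partial>M) \<le> ennreal C"
    using f s unfolding L2_bounded_def by (meson atLeastAtMost_iff)
  then show "(\<integral>\<^sup>+\<omega>. ennreal (norm ((f s \<omega>)\<^sup>2)) \<partial>M) < \<infinity>" by (auto intro: le_less_trans)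
qed

lemma L2_bounded_dominated:
  assumes f: "L2_bounded T f" and g: "L2_bounded T g" and h: "jointly T h"
    and le: "\<And>s \<omega>. 0 \<le> s \<Longrightarrow> s \<le> T \<Longrightarrow> \<omega> \<in> space M \<Longrightarrow> (h s \<omega>)\<^sup>2 \<le> c * ((f s \<omega>)\<^sup>2 + (g s \<omega>)\<^sup>2)" and "0 \<le> c"
  shows "L2_bounded T h"
proof -
  obtain C where C: "0 \<le> C" "\<And>s. s \<in> {0..T} \<Longrightarrow> (\<integral>\<^sup>+\<omega>. ennreal ((f s \<omega>)\<^sup>2) \<partial>M) \<le> ennreal C"
    using f by (auto simp: L2_bounded_def)
  obtain D where D: "0 \<le> D" "\<And>s. s \<in> {0..T} \<Longrightarrow> (\<integral>\<^sup>+\<omega>. ennreal ((g s \<omega>)\<^sup>2) \<partial>M) \<le> ennreal D"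
    using g by (auto simp: L2_bounded_def)
  have "(\<integral>\<^sup>+\<omega>. ennreal ((h s \<omega>)\<^sup>2) \<partial>M) \<le> ennreal (c * (C + D))" if s: "s \<in> {0..T}" for s
  proof -
    have [measurable]: "f s \<in> borel_measurable M" "g s \<in> borel_measurable M"
      using L2_bounded_measurable f g s by auto
    have "(\<integral>\<^sup>+\<omega>. ennreal ((h s \<omega>)\<^sup>2) \<partial>M) \<le> (\<integral>\<^sup>+\<omega>. ennreal c * (ennreal ((f s \<omega>)\<^sup>2) + ennreal ((g s \<omega>)\<^sup>2)) \<partial>M)"
    proof (rule nn_integral_mono)
      fix \<omega> assume "\<omega> \<in> space M"
      then have "ennreal ((h s \<omega>)\<^sup>2) \<le> ennreal (c * ((f s \<omega>)\<^sup>2 + (g s \<omega>)\<^sup>2))"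
        using le[of s \<omega>] s by (intro ennreal_leI) auto
      then show "ennreal ((h s \<omega>)\<^sup>2) \<le> ennreal c * (ennreal ((f s \<omega>)\<^sup>2) + ennreal ((g s \<omega>)\<^sup>2))"
        using \<open>0 \<le> c\<close> by (simp add: ennreal_mult ennreal_plus)
    qed
    also have "\<dots> = ennreal c * ((\<integral>\<^sup>+\<omega>. ennreal ((f s \<omega>)\<^sup>2) \<partial>M) + (\<integral>\<^sup>+\<omega>. ennreal ((g s \<omega>)\<^sup>2) \<partial>M))"
      by (simp add: nn_integral_cmult nn_integral_add)
    also have "\<dots> \<le> ennreal c * (ennreal C + ennreal D)"
      using C D s by (intro mult_left_mono add_mono) auto
    also have "\<dots> = ennreal (c * (C + D))" using C D \<open>0 \<le> c\<close> by (simp add: ennreal_mult ennreal_plus)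
    finally show ?thesis .
  qed
  moreover have "0 \<le> c * (C + D)" using C D \<open>0 \<le> c\<close> by simp
  ultimately show ?thesis using h unfolding L2_bounded_def by blast
qed

lemma L2_bounded_random:
  assumes "Y \<in> borel_measurable M" "integrable M (\<lambda>\<omega>. (Y \<omega>)\<^sup>2)"
  shows "L2_bounded T (\<lambda>s. Y)"
  unfolding L2_bounded_def
  using jointly_random[OF assms(1)] nn_integral_eq_integral[OF assms(2)]
  by (intro conjI exI[of _ "expectation (\<lambda>\<omega>. (Y \<omega>)\<^sup>2)"]) auto

lemma L2_bounded_const: "L2_bounded T (\<lambda>s \<omega>. c)"
  by (rule L2_bounded_random) auto

lemma L2_bounded_add:
  assumes "L2_bounded T f" "L2_bounded T g"
  shows "L2_bounded T (\<lambda>s \<omega>. f s \<omega> + g s \<omega>)"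
proof (rule L2_bounded_dominated[OF assms, of _ 2])
  have "(a + b)\<^sup>2 \<le> 2 * (a\<^sup>2 + b\<^sup>2)" for a b :: real
    using zero_le_power2[of "a - b"] by (simp add: power2_eq_square algebra_simps)
  then show "(f s \<omega> + g s \<omega>)\<^sup>2 \<le> 2 * ((f s \<omega>)\<^sup>2 + (g s \<omega>)\<^sup>2)" for s \<omega> .
qed (use assms in \<open>auto simp: L2_bounded_def intro: jointly_add\<close>)

lemma L2_bounded_cmult:
  assumes "L2_bounded T f"
  shows "L2_bounded T (\<lambda>s \<omega>. c * f s \<omega>)"
proof (rule L2_bounded_dominated[OF assms assms, of _ "c\<^sup>2"])
  show "jointly T (\<lambda>s \<omega>. c * f s \<omega>)"
    using assms by (auto simp: L2_bounded_def intro!: jointly_mult jointly_const)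
  show "(c * f s \<omega>)\<^sup>2 \<le> c\<^sup>2 * ((f s \<omega>)\<^sup>2 + (f s \<omega>)\<^sup>2)" for s \<omega>
    unfolding power_mult_distrib by (intro mult_left_mono) auto
qed simp

lemma L2_bounded_sum: "(\<And>i. i \<in> A \<Longrightarrow> L2_bounded T (f i)) \<Longrightarrow> L2_bounded T (\<lambda>s \<omega>. \<Sum>i\<in>A. f i s \<omega>)"
  by (induction A rule: infinite_finite_induct) (auto intro: L2_bounded_add L2_bounded_const)

lemma L2_bounded_mult_integrable:
  assumes f: "L2_bounded T f" and g: "L2_bounded T g" and "0 \<le> s" "s \<le> T"
  shows "integrable M (\<lambda>\<omega>. f s \<omega> * g s \<omega>)"
  by (rule integrable_mult_L2) (use assms L2_bounded_measurable L2_bounded_integrable in auto)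

text \<open>Fubini's theorem for a product of two such processes:
  \<open>\<bar>a b\<bar> \<le> a\<^sup>2 + b\<^sup>2\<close> and the uniform bounds give
  integrability on the product of time and sample space.\<close>

lemma L2_bounded_product:
  assumes f: "L2_bounded T f" and g: "L2_bounded T g"
  shows "set_integrable lborel {0..T} (\<lambda>s. expectation (\<lambda>\<omega>. f s \<omega> * g s \<omega>))"
    "integrable M (\<lambda>\<omega>. LINT s:{0..T}|lborel. f s \<omega> * g s \<omega>)"
    "(LINT s:{0..T}|lborel. expectation (\<lambda>\<omega>. f s \<omega> * g s \<omega>))
      = expectation (\<lambda>\<omega>. LINT s:{0..T}|lborel. f s \<omega> * g s \<omega>)"
proof -
  note nn_fst = nn_integral_fst
  interpret pair_sigma_finite lborel M ..
  have jf: "jointly T f" and jg: "jointly T g" using f g by (auto simp: L2_bounded_def)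
  let ?h = "\<lambda>(s, \<omega>). restrict_time T (\<lambda>s \<omega>. f s \<omega> * g s \<omega>) \<omega> s"
  have h: "?h \<in> borel_measurable (lborel \<Otimes>\<^sub>M M)"
    using jointly_mult[OF jf jg] by (simp add: jointly_def split_beta')
  obtain C where C: "0 \<le> C" "\<And>s. s \<in> {0..T} \<Longrightarrow> (\<integral>\<^sup>+\<omega>. ennreal ((f s \<omega>)\<^sup>2) \<partial>M) \<le> ennreal C"
    using f by (auto simp: L2_bounded_def)
  obtain D where D: "0 \<le> D" "\<And>s. s \<in> {0..T} \<Longrightarrow> (\<integral>\<^sup>+\<omega>. ennreal ((g s \<omega>)\<^sup>2) \<partial>M) \<le> ennreal D"
    using g by (auto simp: L2_bounded_def)
  have i: "integrable (lborel \<Otimes>\<^sub>M M) ?h"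
  proof (rule integrableI_bounded[OF h])
    have "(\<integral>\<^sup>+z. ennreal (norm (?h z)) \<partial>(lborel \<Otimes>\<^sub>M M)) = (\<integral>\<^sup>+s. \<integral>\<^sup>+\<omega>. ennreal (norm (?h (s, \<omega>))) \<partial>M \<partial>lborel)"
      by (rule nn_fst[symmetric]) (use h in measurable)
    also have "\<dots> \<le> (\<integral>\<^sup>+s. ennreal (C + D) * indicator {0..T} s \<partial>lborel)"
    proof (rule nn_integral_mono)
      fix s
      show "(\<integral>\<^sup>+\<omega>. ennreal (norm (?h (s, \<omega>))) \<partial>M) \<le> ennreal (C + D) * indicator {0..T} s"
      proof (cases "s \<in> {0..T}")
        case True
        then have [measurable]: "f s \<in> borel_measurable M" "g s \<in> borel_measurable M"
          using L2_bounded_measurable f g by auto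
        have "(\<integral>\<^sup>+\<omega>. ennreal (norm (?h (s, \<omega>))) \<partial>M) \<le> (\<integral>\<^sup>+\<omega>. ennreal ((f s \<omega>)\<^sup>2) + ennreal ((g s \<omega>)\<^sup>2) \<partial>M)"
        proof (rule nn_integral_mono)
          fix \<omega>
          have "\<bar>a * b\<bar> \<le> a\<^sup>2 + b\<^sup>2" for a b :: real
            using sum_squares_bound[of "\<bar>a\<bar>" "\<bar>b\<bar>"] zero_le_power2[of a] zero_le_power2[of b]
            unfolding abs_mult power2_abs by linarith
          then have "ennreal \<bar>f s \<omega> * g s \<omega>\<bar> \<le> ennreal ((f s \<omega>)\<^sup>2 + (g s \<omega>)\<^sup>2)" by (rule ennreal_leI)
          then show "ennreal (norm (?h (s, \<omega>))) \<le> ennreal ((f s \<omega>)\<^sup>2) + ennreal ((g s \<omega>)\<^sup>2)"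
            using True by (simp add: restrict_time_def ennreal_plus)
        qed
        also have "\<dots> \<le> ennreal C + ennreal D" using C D True by (simp add: nn_integral_add add_mono)
        finally show ?thesis using True C D by (simp add: ennreal_plus)
      qed (simp add: restrict_time_def)
    qed
    also have "\<dots> < \<infinity>" by (cases "0 \<le> T") (simp_all add: nn_integral_cmult_indicator ennreal_mult_less_top)
    finally show "(\<integral>\<^sup>+z. ennreal (norm (?h z)) \<partial>(lborel \<Otimes>\<^sub>M M)) < \<infinity>" .
  qed
  have E: "(\<integral>\<omega>. ?h (s, \<omega>) \<partial>M) = indicator {0..T} s * expectation (\<lambda>\<omega>. f s \<omega> * g s \<omega>)" for s
    by (simp add: restrict_time_def)
  have L: "(\<integral>s. ?h (s, \<omega>) \<partial>lborel) = (LINT s:{0..T}|lborel. f s \<omega> * g s \<omega>)" for \<omega>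
    by (simp add: restrict_time_def set_lebesgue_integral_def)
  show "set_integrable lborel {0..T} (\<lambda>s. expectation (\<lambda>\<omega>. f s \<omega> * g s \<omega>))"
    using integrable_fst'[OF i] unfolding E by (simp add: set_integrable_def)
  have "integrable M (\<lambda>\<omega>. \<integral>s. ?h (s, \<omega>) \<partial>lborel)"
    using integrable_snd[of "\<lambda>s \<omega>. ?h (s, \<omega>)"] i by (simp add: split_beta')
  then show "integrable M (\<lambda>\<omega>. LINT s:{0..T}|lborel. f s \<omega> * g s \<omega>)" unfolding L .
  have "(\<integral>\<omega>. (\<integral>s. ?h (s, \<omega>) \<partial>lborel) \<partial>M) = (\<integral>s. (\<integral>\<omega>. ?h (s, \<omega>) \<partial>M) \<partial>lborel)"
    using Fubini_integral[of "\<lambda>s \<omega>. ?h (s, \<omega>)"] i by (simp add: split_beta')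
  then show "(LINT s:{0..T}|lborel. expectation (\<lambda>\<omega>. f s \<omega> * g s \<omega>))
      = expectation (\<lambda>\<omega>. LINT s:{0..T}|lborel. f s \<omega> * g s \<omega>)"
    unfolding E L by (simp add: set_lebesgue_integral_def)
qed

end

section \<open>The energy identity\<close>

context linear_sde begin

lemma L2_bounded_X:
  assumes "i \<in> I" "0 \<le> T"
  shows "L2_bounded T (X i)"
proof -
  obtain C where C: "0 \<le> C" "\<And>s. s \<in> {0..T} \<Longrightarrow> (\<integral>\<^sup>+\<omega>. ennreal (sqX s \<omega>) \<partial>M) \<le> ennreal C"
    using state_moment[OF assms(2)] by blast
  have "(\<integral>\<^sup>+\<omega>. ennreal ((X i s \<omega>)\<^sup>2) \<partial>M) \<le> ennreal C" if "s \<in> {0..T}" for s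
  proof -
    have "(X i s \<omega>)\<^sup>2 \<le> sqX s \<omega>" for \<omega> unfolding sqX_def using fin assms by (intro member_le_sum) auto
    then show ?thesis by (intro order_trans[OF nn_integral_mono C(2)[OF that]] ennreal_leI)
  qed
  then show ?thesis using jointly_X[OF assms] C(1) unfolding L2_bounded_def by blast
qed

lemma L2_bounded_noise:
  assumes "i \<in> I" "0 \<le> T"
  shows "L2_bounded T (noise i)"
proof -
  let ?c = "2 * weight_const T * exp (2 * (weight_const T + 1) * T)"
  have "(\<integral>\<^sup>+\<omega>. ennreal ((noise i s \<omega>)\<^sup>2) \<partial>M) \<le> ennreal ?c" if "s \<in> {0..T}" for s
  proof -
    have "(noise i s \<omega>)\<^sup>2 \<le> sqN s \<omega>" for \<omega> unfolding sqN_def using fin assms by (intro member_le_sum) auto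
    then show ?thesis using that by (intro order_trans[OF nn_integral_mono noise_moment] ennreal_leI) auto
  qed
  moreover have "0 \<le> ?c" using weight_const_nonneg[OF assms(2)] by simp
  ultimately show ?thesis using jointly_noise[OF assms] unfolding L2_bounded_def by blast
qed

lemma L2_bounded_drift: "0 \<le> T \<Longrightarrow> L2_bounded T (drift i)"
  unfolding drift_def[abs_def] by (intro L2_bounded_sum L2_bounded_cmult L2_bounded_X)

text \<open>Obtained not by integrating the drift but by subtracting the initial value and the noise
  from the state, whose moments are already bounded.\<close>

lemma L2_bounded_drift_int:
  assumes "i \<in> I" "0 \<le> T"
  shows "L2_bounded T (drift_int i)"
proof -
  have "drift_int i = (\<lambda>s \<omega>. X i s \<omega> + ((- x0 i) + (-1) * noise i s \<omega>))" by (simp add: noise_def)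
  moreover have "L2_bounded T (\<lambda>s \<omega>. X i s \<omega> + ((- x0 i) + (-1) * noise i s \<omega>))"
    by (intro L2_bounded_add L2_bounded_cmult L2_bounded_const L2_bounded_X L2_bounded_noise assms)
  ultimately show ?thesis by simp
qed

lemma L2_bounded_H:
  assumes "i \<in> I" "0 \<le> T"
  shows "L2_bounded T (H i)"
proof -
  obtain C where C: "0 \<le> C" "\<And>s. s \<in> {0..T} \<Longrightarrow> (\<integral>\<^sup>+\<omega>. ennreal (sqX s \<omega>) \<partial>M) \<le> ennreal C"
    using state_moment[OF assms(2)] by blast
  have "(\<integral>\<^sup>+\<omega>. ennreal ((H i s \<omega>)\<^sup>2) \<partial>M) \<le> ennreal (K * (1 + C))" if s: "s \<in> {0..T}" for s
  proof -
    have [measurable]: "sqX s \<in> borel_measurable M" using jointly_section[OF jointly_sqX[OF assms(2)]] s by auto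
    have "(\<integral>\<^sup>+\<omega>. ennreal ((H i s \<omega>)\<^sup>2) \<partial>M) \<le> (\<integral>\<^sup>+\<omega>. ennreal K * (1 + ennreal (sqX s \<omega>)) \<partial>M)"
    proof (rule nn_integral_mono)
      fix \<omega> assume "\<omega> \<in> space M"
      have "(H i s \<omega>)\<^sup>2 \<le> (\<Sum>i\<in>I. (H i s \<omega>)\<^sup>2)" using fin assms by (intro member_le_sum) auto
      also have "\<dots> \<le> K * (1 + sqX s \<omega>)" using growth[of s \<omega>] s \<open>\<omega> \<in> space M\<close> by (simp add: sqX_def)
      finally have "ennreal ((H i s \<omega>)\<^sup>2) \<le> ennreal (K * (1 + sqX s \<omega>))" by (rule ennreal_leI)
      then show "ennreal ((H i s \<omega>)\<^sup>2) \<le> ennreal K * (1 + ennreal (sqX s \<omega>))"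
        using K0 sq_nonneg by (simp add: ennreal_mult ennreal_plus)
    qed
    also have "\<dots> = ennreal K * (1 + (\<integral>\<^sup>+\<omega>. ennreal (sqX s \<omega>) \<partial>M))"
      by (simp add: nn_integral_cmult nn_integral_add emeasure_space_1)
    also have "\<dots> \<le> ennreal K * (1 + ennreal C)" using C s by (intro mult_left_mono add_left_mono) auto
    also have "\<dots> = ennreal (K * (1 + C))" using C K0 by (simp add: ennreal_mult ennreal_plus)
    finally show ?thesis .
  qed
  moreover have "0 \<le> K * (1 + C)" using K0 C by simp
  ultimately show ?thesis using jointly_H[OF assms] unfolding L2_bounded_def by blast
qed

lemma quad_var_H_integrable:
  assumes "i \<in> I" "0 \<le> T"
  shows "integrable M (quad_var (H i) T)"
    "expectation (quad_var (H i) T) = (LINT s:{0..T}|lborel. expectation (\<lambda>\<omega>. (H i s \<omega>)\<^sup>2))"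
  using L2_bounded_product(2,3)[OF L2_bounded_H[OF assms] L2_bounded_H[OF assms]]
  by (simp_all add: quad_var_def[abs_def] power2_eq_square)

lemma drift_adapted: "0 \<le> s \<Longrightarrow> drift i s \<in> borel_measurable (F s)"
  unfolding drift_def[abs_def]
  using progressive_section[OF X_prog] by (intro borel_measurable_sum borel_measurable_times) auto

lemma noise_isometry:
  assumes "i \<in> I" "0 \<le> T"
  shows "expectation (\<lambda>\<omega>. (noise i T \<omega>)\<^sup>2) = (LINT s:{0..T}|lborel. expectation (\<lambda>\<omega>. (H i s \<omega>)\<^sup>2))"
proof -
  obtain Z where Z: "has_ito_integral M F W (H i) T Z" "AE \<omega> in M. Z \<omega> = noise i T \<omega>"
    using noise_is_ito[OF assms] by blast
  have [measurable]: "Z \<in> borel_measurable M" "noise i T \<in> borel_measurable M"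
    using Z(1) L2_bounded_measurable[OF L2_bounded_noise[OF assms]] assms by (auto simp: has_ito_integral_def)
  have "expectation (\<lambda>\<omega>. (noise i T \<omega>)\<^sup>2) = expectation (\<lambda>\<omega>. (Z \<omega>)\<^sup>2)"
    by (rule integral_cong_AE) (use Z(2) in auto)
  then show ?thesis
    using ito_isometry(2)[OF Z(1) assms(2) quad_var_H_integrable(1)[OF assms]] quad_var_H_integrable(2)[OF assms] by simp
qed

lemma noise_orth:
  assumes "i \<in> I" "0 \<le> s" "s \<le> T" and Y: "Y \<in> borel_measurable (F s)" "integrable M (\<lambda>\<omega>. (Y \<omega>)\<^sup>2)"
  shows "expectation (\<lambda>\<omega>. Y \<omega> * noise i T \<omega>) = expectation (\<lambda>\<omega>. Y \<omega> * noise i s \<omega>)"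
proof -
  have "0 \<le> T" using assms by simp
  obtain Z where Z: "has_ito_integral M F W (H i) T Z" "AE \<omega> in M. Z \<omega> = noise i T \<omega>"
    using noise_is_ito[OF assms(1) \<open>0 \<le> T\<close>] by blast
  obtain Z' where Z': "has_ito_integral M F W (H i) s Z'" "AE \<omega> in M. Z' \<omega> = noise i s \<omega>"
    using noise_is_ito[OF assms(1,2)] by blast
  have [measurable]: "Z \<in> borel_measurable M" "Z' \<in> borel_measurable M"
    "noise i T \<in> borel_measurable M" "noise i s \<in> borel_measurable M" "Y \<in> borel_measurable M"
    using Z(1) Z'(1) L2_bounded_measurable[OF L2_bounded_noise[OF assms(1) \<open>0 \<le> T\<close>]] assms \<open>0 \<le> T\<close>
      measurable_F_M[OF assms(2) Y(1)] by (auto simp: has_ito_integral_def)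
  have "expectation (\<lambda>\<omega>. Y \<omega> * noise i T \<omega>) = expectation (\<lambda>\<omega>. Y \<omega> * Z \<omega>)"
    by (rule integral_cong_AE) (use Z(2) in auto)
  also have "\<dots> = expectation (\<lambda>\<omega>. Y \<omega> * Z' \<omega>)"
    by (rule ito_orth[OF Z'(1) Z(1) assms(2,3) quad_var_H_integrable(1)[OF assms(1) \<open>0 \<le> T\<close>] Y])
  also have "\<dots> = expectation (\<lambda>\<omega>. Y \<omega> * noise i s \<omega>)"
    by (rule integral_cong_AE) (use Z'(2) in auto)
  finally show ?thesis .
qed

text \<open>The martingale property with a constant test variable reduces the claim to time
  \<open>0\<close>, where the noise vanishes almost surely by the initial condition.\<close>

lemma noise_mean:
  assumes "i \<in> I" "0 \<le> T"
  shows "expectation (noise i T) = 0"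
proof -
  have "AE \<omega> in M. noise i 0 \<omega> = 0"
    using init
  proof eventually_elim
    case (elim \<omega>)
    have "(\<lambda>r. indicator {0..0} r *\<^sub>R drift i r \<omega>) = (\<lambda>r. indicator {0::real} r *\<^sub>R drift i 0 \<omega>)" by (auto simp: indicator_def)
    then show ?case using elim assms by (simp add: noise_def drift_int_def set_lebesgue_integral_def)
  qed
  moreover have "noise i 0 \<in> borel_measurable M"
    using L2_bounded_measurable[OF L2_bounded_noise[OF assms(1) order_refl]] by simp
  ultimately have "expectation (noise i 0) = expectation (\<lambda>_. 0)" by (intro integral_cong_AE) auto
  then show ?thesis using noise_orth[OF assms(1) order_refl assms(2), of "\<lambda>_. 1"] by simp
qed

text \<open>This replaces Ito's formula. With \<open>B\<close> the drift integral and \<open>N\<close> the noise, \<open>(x0 + B + N)\<^sup>2\<close> is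
  expanded: \<open>B\<^sup>2\<close> is a double integral over a square, and the martingale property of \<open>N\<close> turns
  \<open>E (B T * N T)\<close> into \<open>\<integral> E (b s * N s) ds\<close>, where \<open>b\<close> is the drift.\<close>

lemma component_energy:
  assumes i: "i \<in> I" and T: "0 \<le> T"
  shows "expectation (\<lambda>\<omega>. (X i T \<omega>)\<^sup>2) = (x0 i)\<^sup>2
    + 2 * (LINT s:{0..T}|lborel. expectation (\<lambda>\<omega>. drift i s \<omega> * X i s \<omega>))
    + (LINT s:{0..T}|lborel. expectation (\<lambda>\<omega>. (H i s \<omega>)\<^sup>2))"
proof -
  note LN = L2_bounded_noise[OF i T] and LB = L2_bounded_drift_int[OF i T] and Lb = L2_bounded_drift[OF T, of i]
  note mult = L2_bounded_mult_integrable
  have m[measurable]: "noise i T \<in> borel_measurable M" "drift_int i T \<in> borel_measurable M"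
    using L2_bounded_measurable LN LB T by auto
  have N2: "integrable M (\<lambda>\<omega>. (noise i T \<omega>)\<^sup>2)" and B2: "integrable M (\<lambda>\<omega>. (drift_int i T \<omega>)\<^sup>2)"
    using L2_bounded_integrable[OF LN] L2_bounded_integrable[OF LB] T by auto
  have N1: "integrable M (noise i T)" and B1: "integrable M (drift_int i T)"
    by (rule L2_imp_L1[OF m(1) N2], rule L2_imp_L1[OF m(2) B2])
  have NB: "integrable M (\<lambda>\<omega>. noise i T \<omega> * drift_int i T \<omega>)" using mult[OF LN LB] T by simp
  define a where "a = (\<lambda>s. expectation (\<lambda>\<omega>. drift i s \<omega>))"
  define bB where "bB = (\<lambda>s. expectation (\<lambda>\<omega>. drift i s \<omega> * drift_int i s \<omega>))"
  define bN where "bN = (\<lambda>s. expectation (\<lambda>\<omega>. drift i s \<omega> * noise i s \<omega>))"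
  have int: "set_integrable lborel {0..T} a" "set_integrable lborel {0..T} bB" "set_integrable lborel {0..T} bN"
    using L2_bounded_product(1)[OF Lb L2_bounded_const[of T 1]] L2_bounded_product(1)[OF Lb LB] L2_bounded_product(1)[OF Lb LN]
    by (simp_all add: a_def bB_def bN_def)
  have EB: "expectation (drift_int i T) = (LINT s:{0..T}|lborel. a s)"
    using L2_bounded_product(3)[OF Lb L2_bounded_const[of T 1]] by (simp add: a_def drift_int_def[abs_def])
  have EB2: "expectation (\<lambda>\<omega>. (drift_int i T \<omega>)\<^sup>2) = 2 * (LINT s:{0..T}|lborel. bB s)"
  proof -
    have "expectation (\<lambda>\<omega>. (drift_int i T \<omega>)\<^sup>2) = expectation (\<lambda>\<omega>. 2 * (LINT s:{0..T}|lborel. drift i s \<omega> * drift_int i s \<omega>))"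
    proof (rule integral_cong_AE)
      show "(\<lambda>\<omega>. 2 * (LINT s:{0..T}|lborel. drift i s \<omega> * drift_int i s \<omega>)) \<in> borel_measurable M"
        using L2_bounded_product(2)[OF Lb LB] by simp
      show "AE \<omega> in M. (drift_int i T \<omega>)\<^sup>2 = 2 * (LINT s:{0..T}|lborel. drift i s \<omega> * drift_int i s \<omega>)"
        using drift_path_integrable[OF T]
      proof eventually_elim
        case (elim \<omega>)
        then have "set_integrable lborel {0..T} (\<lambda>s. drift i s \<omega>)" using i by blast
        from set_square_of_integral[OF this] show ?case by (simp only: drift_int_def)
      qed
    qed simp
    then show ?thesis using L2_bounded_product(3)[OF Lb LB] by (simp add: bB_def)
  qed
  have ENB: "expectation (\<lambda>\<omega>. noise i T \<omega> * drift_int i T \<omega>) = (LINT s:{0..T}|lborel. bN s)"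
  proof -
    \<comment> \<open>\<open>noise i T\<close> is regarded as a process constant in time, which lets
      Fubini's theorem exchange expectation and time integral.\<close>
    note LT = L2_bounded_random[OF \<open>noise i T \<in> borel_measurable M\<close> N2, of T]
    have "expectation (\<lambda>\<omega>. noise i T \<omega> * drift_int i T \<omega>)
        = expectation (\<lambda>\<omega>. LINT s:{0..T}|lborel. drift i s \<omega> * noise i T \<omega>)"
      by (simp add: drift_int_def mult.commute)
    also have "\<dots> = (LINT s:{0..T}|lborel. expectation (\<lambda>\<omega>. drift i s \<omega> * noise i T \<omega>))"
      by (rule L2_bounded_product(3)[OF Lb LT, symmetric])
    \<comment> \<open>The drift at \<open>s\<close> is known at \<open>s\<close>, so it is an
      admissible test variable for the martingale property.\<close>
    also have "\<dots> = (LINT s:{0..T}|lborel. bN s)"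
      unfolding bN_def
      by (rule set_lebesgue_integral_cong)
        (auto intro!: noise_orth[OF i _ _ drift_adapted L2_bounded_integrable[OF Lb]])
    finally show ?thesis .
  qed
  have "(X i T \<omega>)\<^sup>2 = (x0 i)\<^sup>2 + 2 * x0 i * drift_int i T \<omega> + 2 * x0 i * noise i T \<omega>
      + (drift_int i T \<omega>)\<^sup>2 + 2 * (noise i T \<omega> * drift_int i T \<omega>) + (noise i T \<omega>)\<^sup>2" for \<omega>
  proof -
    have "X i T \<omega> = x0 i + drift_int i T \<omega> + noise i T \<omega>" by (simp add: noise_def)
    then show ?thesis by (simp add: power2_eq_square algebra_simps)
  qed
  then have "expectation (\<lambda>\<omega>. (X i T \<omega>)\<^sup>2) = (x0 i)\<^sup>2 + 2 * x0 i * expectation (drift_int i T)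
      + 2 * x0 i * expectation (noise i T) + expectation (\<lambda>\<omega>. (drift_int i T \<omega>)\<^sup>2)
      + 2 * expectation (\<lambda>\<omega>. noise i T \<omega> * drift_int i T \<omega>) + expectation (\<lambda>\<omega>. (noise i T \<omega>)\<^sup>2)"
    using N1 B1 N2 B2 NB by (simp add: prob_space)
  also have "\<dots> = (x0 i)\<^sup>2 + 2 * (x0 i * (LINT s:{0..T}|lborel. a s) + (LINT s:{0..T}|lborel. bB s) + (LINT s:{0..T}|lborel. bN s))
      + (LINT s:{0..T}|lborel. expectation (\<lambda>\<omega>. (H i s \<omega>)\<^sup>2))"
    unfolding EB EB2 ENB noise_mean[OF i T] noise_isometry[OF i T] by simp
  also have "x0 i * (LINT s:{0..T}|lborel. a s) + (LINT s:{0..T}|lborel. bB s) + (LINT s:{0..T}|lborel. bN s)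
      = (LINT s:{0..T}|lborel. x0 i * a s + bB s + bN s)"
    using int by (simp add: set_integral_add)
  \<comment> \<open>The three drift terms recombine, since initial value, drift integral and noise
    add up to the state at each time \<open>s\<close>.\<close>
  also have "\<dots> = (LINT s:{0..T}|lborel. expectation (\<lambda>\<omega>. drift i s \<omega> * X i s \<omega>))"
  proof (rule set_lebesgue_integral_cong)
    show "\<forall>s. s \<in> {0..T} \<longrightarrow> x0 i * a s + bB s + bN s = expectation (\<lambda>\<omega>. drift i s \<omega> * X i s \<omega>)"
    proof (intro allI impI)
      fix s assume s: "s \<in> {0..T}"
      have "drift i s \<omega> * X i s \<omega> = x0 i * drift i s \<omega> + drift i s \<omega> * drift_int i s \<omega> + drift i s \<omega> * noise i s \<omega>" for \<omega>
        by (simp add: noise_def algebra_simps)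
      moreover have "integrable M (drift i s)"
        by (rule L2_imp_L1; rule L2_bounded_measurable[OF Lb] L2_bounded_integrable[OF Lb]; use s in simp)
      ultimately show "x0 i * a s + bB s + bN s = expectation (\<lambda>\<omega>. drift i s \<omega> * X i s \<omega>)"
        using mult[OF Lb LB] mult[OF Lb LN] s by (simp add: a_def bB_def bN_def)
    qed
  qed simp
  finally show ?thesis .
qed

theorem energy_identity:
  assumes T: "0 \<le> T"
  shows "integrable M (sqX T)" "\<And>s. 0 \<le> s \<Longrightarrow> integrable M (sqH s)"
    "set_integrable lborel {0..T} (\<lambda>s. expectation (sqH s))"
    "expectation (sqX T) = (\<Sum>i\<in>I. (x0 i)\<^sup>2)
      + 2 * (LINT s:{0..T}|lborel. expectation (\<lambda>\<omega>. \<Sum>i\<in>I. drift i s \<omega> * X i s \<omega>))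
      + (LINT s:{0..T}|lborel. expectation (sqH s))"
proof -
  have X2: "integrable M (\<lambda>\<omega>. (X i T \<omega>)\<^sup>2)" if "i \<in> I" for i
    using L2_bounded_integrable[OF L2_bounded_X[OF that T]] T by simp
  show "integrable M (sqX T)" unfolding sqX_def[abs_def] using X2 by simp
  have H2: "integrable M (\<lambda>\<omega>. (H i s \<omega>)\<^sup>2)" if "i \<in> I" "0 \<le> s" for i s
    using L2_bounded_integrable[OF L2_bounded_H[OF that]] that by simp
  show "integrable M (sqH s)" if "0 \<le> s" for s unfolding sqH_def[abs_def] using H2 that by simp
  have EH: "expectation (sqH s) = (\<Sum>i\<in>I. expectation (\<lambda>\<omega>. (H i s \<omega>)\<^sup>2))" if "s \<in> {0..T}" for s
    unfolding sqH_def[abs_def] using H2 that by simp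
  have iH: "set_integrable lborel {0..T} (\<lambda>s. expectation (\<lambda>\<omega>. (H i s \<omega>)\<^sup>2))" if "i \<in> I" for i
    using L2_bounded_product(1)[OF L2_bounded_H[OF that T] L2_bounded_H[OF that T]] by (simp add: power2_eq_square)
  have setsum: "set_integrable lborel {0..T} (\<lambda>s. \<Sum>i\<in>I. f i s)"
    "(LINT s:{0..T}|lborel. \<Sum>i\<in>I. f i s) = (\<Sum>i\<in>I. LINT s:{0..T}|lborel. f i s)"
    if "\<And>i. i \<in> I \<Longrightarrow> set_integrable lborel {0..T} (f i)" for f :: "'i \<Rightarrow> real \<Rightarrow> real"
    using that by (simp_all add: set_integrable_def set_lebesgue_integral_def sum_distrib_left)
  show "set_integrable lborel {0..T} (\<lambda>s. expectation (sqH s))"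
    using setsum(1)[OF iH] by (subst set_integrable_cong[OF refl refl EH]) auto
  have ib: "set_integrable lborel {0..T} (\<lambda>s. expectation (\<lambda>\<omega>. drift i s \<omega> * X i s \<omega>))" if "i \<in> I" for i
    by (rule L2_bounded_product(1)[OF L2_bounded_drift[OF T] L2_bounded_X[OF that T]])
  have Eb: "expectation (\<lambda>\<omega>. \<Sum>i\<in>I. drift i s \<omega> * X i s \<omega>) = (\<Sum>i\<in>I. expectation (\<lambda>\<omega>. drift i s \<omega> * X i s \<omega>))"
    if "s \<in> {0..T}" for s
    using L2_bounded_mult_integrable[OF L2_bounded_drift[OF T] L2_bounded_X[OF _ T]] that by simp
  have "(LINT s:{0..T}|lborel. expectation (sqH s)) = (\<Sum>i\<in>I. LINT s:{0..T}|lborel. expectation (\<lambda>\<omega>. (H i s \<omega>)\<^sup>2))"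
    using setsum(2)[OF iH] by (subst set_lebesgue_integral_cong[where g = "\<lambda>s. \<Sum>i\<in>I. expectation (\<lambda>\<omega>. (H i s \<omega>)\<^sup>2)"]) (auto simp: EH)
  moreover have "(LINT s:{0..T}|lborel. expectation (\<lambda>\<omega>. \<Sum>i\<in>I. drift i s \<omega> * X i s \<omega>))
      = (\<Sum>i\<in>I. LINT s:{0..T}|lborel. expectation (\<lambda>\<omega>. drift i s \<omega> * X i s \<omega>))"
    using setsum(2)[OF ib]
    by (subst set_lebesgue_integral_cong[where g = "\<lambda>s. \<Sum>i\<in>I. expectation (\<lambda>\<omega>. drift i s \<omega> * X i s \<omega>)"]) (auto simp: Eb)
  moreover have "expectation (sqX T) = (\<Sum>i\<in>I. expectation (\<lambda>\<omega>. (X i T \<omega>)\<^sup>2))"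
    unfolding sqX_def[abs_def] using X2 by simp
  ultimately show "expectation (sqX T) = (\<Sum>i\<in>I. (x0 i)\<^sup>2)
      + 2 * (LINT s:{0..T}|lborel. expectation (\<lambda>\<omega>. \<Sum>i\<in>I. drift i s \<omega> * X i s \<omega>))
      + (LINT s:{0..T}|lborel. expectation (sqH s))"
    by (simp add: component_energy T sum.distrib sum_distrib_left)
qed

end

section \<open>Orthonormal polynomials\<close>

definition poly_inner :: "real \<Rightarrow> real \<Rightarrow> real poly \<Rightarrow> real poly \<Rightarrow> real" where
  "poly_inner a b p q = (LINT x:{a..b}|lborel. poly p x * poly q x)"

lemma set_integrable_poly: "set_integrable lborel {a..b} (poly (p :: real poly))"
  by (rule borel_integrable_atLeastAtMost') (intro continuous_intros)

lemma set_integrable_poly_mult: "set_integrable lborel {a..b} (\<lambda>x. poly (p :: real poly) x * poly q x)"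
  by (rule borel_integrable_atLeastAtMost') (intro continuous_intros)

lemma poly_inner_commute: "poly_inner a b p q = poly_inner a b q p"
  by (simp add: poly_inner_def mult.commute)

lemma poly_inner_add: "poly_inner a b (p + p') q = poly_inner a b p q + poly_inner a b p' q"
  by (simp add: poly_inner_def distrib_right set_integral_add set_integrable_poly_mult)

lemma poly_inner_smult: "poly_inner a b (smult c p) q = c * poly_inner a b p q"
  by (simp add: poly_inner_def mult.assoc)

lemma poly_inner_0 [simp]: "poly_inner a b 0 q = 0"
  by (simp add: poly_inner_def)

lemma poly_inner_diff: "poly_inner a b (p - p') q = poly_inner a b p q - poly_inner a b p' q"
  by (simp add: poly_inner_def left_diff_distrib set_integral_diff set_integrable_poly_mult)

lemma poly_inner_sum: "poly_inner a b (\<Sum>i\<in>A. p i) q = (\<Sum>i\<in>A. poly_inner a b (p i) q)"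
  by (induction A rule: infinite_finite_induct) (simp_all add: poly_inner_add)

lemma poly_inner_smult_right: "poly_inner a b q (smult c p) = c * poly_inner a b q p"
  and poly_inner_sum_right: "poly_inner a b q (\<Sum>i\<in>A. r i) = (\<Sum>i\<in>A. poly_inner a b q (r i))"
  by (simp_all add: poly_inner_commute[of a b q] poly_inner_smult poly_inner_sum)

lemma poly_inner_pos:
  assumes "a < b" "p \<noteq> 0"
  shows "0 < poly_inner a b p p"
proof -
  have c: "continuous_on {a..b} (\<lambda>x. poly p x * poly p x)" by (intro continuous_intros)
  have eq: "poly_inner a b p p = integral {a..b} (\<lambda>x. poly p x * poly p x)"
    unfolding poly_inner_def by (rule set_borel_integral_eq_integral(2)[OF set_integrable_poly_mult])
  have "0 \<le> poly_inner a b p p"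
    unfolding poly_inner_def set_lebesgue_integral_def by (rule integral_nonneg_AE) auto
  moreover have "poly_inner a b p p \<noteq> 0"
  proof
    assume "poly_inner a b p p = 0"
    then have "\<forall>x\<in>{a..b}. poly p x * poly p x = 0"
      using integral_eq_0_iff[OF c] assms(1) unfolding eq by simp
    then have "{a..b} \<subseteq> {x. poly p x = 0}" by auto
    then have "finite {a..b}" using poly_roots_finite[OF assms(2)] finite_subset by blast
    then show False using assms(1) by (simp add: infinite_Icc)
  qed
  ultimately show ?thesis by simp
qed

text \<open>Gram-Schmidt applied to the monomials, with the expansion of every polynomial carried
  through the induction. Counting by \<open>degree < n\<close> lets the induction start at the empty
  system; the alternative \<open>q = 0\<close> covers the zero polynomial, whose degree
  \<open>0\<close> is not below \<open>0\<close>.\<close>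

lemma orthonormal_polys_aux:
  assumes "a < b"
  shows "\<exists>p :: nat \<Rightarrow> real poly. (\<forall>i<n. degree (p i) < n) \<and>
    (\<forall>i<n. \<forall>j<n. poly_inner a b (p i) (p j) = (if i = j then 1 else 0)) \<and>
    (\<forall>q. q = 0 \<or> degree q < n \<longrightarrow> q = (\<Sum>i<n. smult (poly_inner a b q (p i)) (p i)))"
proof (induction n)
  case (Suc n)
  then obtain p where deg: "\<And>i. i < n \<Longrightarrow> degree (p i) < n"
    and orth: "\<And>i j. i < n \<Longrightarrow> j < n \<Longrightarrow> poly_inner a b (p i) (p j) = (if i = j then 1 else 0)"
    and rep: "\<And>q. q = 0 \<or> degree q < n \<Longrightarrow> q = (\<Sum>i<n. smult (poly_inner a b q (p i)) (p i))" by blast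
  \<comment> \<open>The next monomial minus its projection; its top coefficient stays
    \<open>1\<close>, so it cannot vanish and can be normalized.\<close>
  define r where "r = monom 1 n - (\<Sum>i<n. smult (poly_inner a b (monom 1 n) (p i)) (p i))"
  have "degree (\<Sum>i<n. smult (poly_inner a b (monom 1 n) (p i)) (p i)) < n" if "n \<noteq> 0"
    using that deg by (intro degree_sum_less) (auto intro: le_less_trans[OF degree_smult_le])
  then have co: "coeff (\<Sum>i<n. smult (poly_inner a b (monom 1 n) (p i)) (p i)) n = 0"
    by (cases "n = 0") (auto intro: coeff_eq_0)
  have degs: "degree (\<Sum>i<n. smult (poly_inner a b (monom 1 n) (p i)) (p i)) \<le> n"
    using deg by (intro degree_sum_le) (auto intro: order_trans[OF degree_smult_le] less_imp_le)
  have cr: "coeff r n = 1" unfolding r_def using co by simp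
  have dr: "degree r \<le> n" unfolding r_def using degs degree_monom_le by (intro degree_diff_le) auto
  have r0: "r \<noteq> 0" using cr by auto
  have rp: "poly_inner a b r (p j) = 0" if "j < n" for j
  proof -
    have "poly_inner a b r (p j) = poly_inner a b (monom 1 n) (p j)
      - (\<Sum>i<n. poly_inner a b (monom 1 n) (p i) * poly_inner a b (p i) (p j))"
      unfolding r_def by (simp add: poly_inner_diff poly_inner_sum poly_inner_smult)
    also have "(\<Sum>i<n. poly_inner a b (monom 1 n) (p i) * poly_inner a b (p i) (p j)) = poly_inner a b (monom 1 n) (p j)"
      by (subst sum_if_single[OF that]) (use that orth in auto)
    finally show ?thesis by simp
  qed
  define s where "s = sqrt (poly_inner a b r r)"
  have s: "0 < s" "s * s = poly_inner a b r r" using poly_inner_pos[OF assms r0] by (auto simp: s_def)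
  define p' where "p' = p(n := smult (1 / s) r)"
  have p'i: "p' i = p i" if "i < n" for i using that by (simp add: p'_def)
  have p'n: "p' n = smult (1 / s) r" by (simp add: p'_def)
  have rr: "poly_inner a b r (p' n) = s"
    unfolding p'n poly_inner_smult_right s(2)[symmetric] using s(1) by simp
  show ?case
  proof (intro exI[of _ p'] conjI allI impI)
    show "degree (p' i) < Suc n" if "i < Suc n" for i
      using that deg[of i] dr degree_smult_le[of "1 / s" r] by (cases "i = n") (auto simp: p'_def)
    show "poly_inner a b (p' i) (p' j) = (if i = j then 1 else 0)" if "i < Suc n" "j < Suc n" for i j
    proof -
      have nn: "poly_inner a b (p' n) (p' n) = 1"
        using rr s(1) unfolding p'n by (simp add: poly_inner_smult)
      have nj: "poly_inner a b (p' n) (p' j) = 0" if "j < n" for j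
        using rp[OF that] that by (simp add: p'n p'i poly_inner_smult)
      show ?thesis using that nn nj orth poly_inner_commute[of a b "p' i" "p' j"]
        by (cases "i = n"; cases "j = n") (auto simp: p'i)
    qed
    fix q :: "real poly" assume q: "q = 0 \<or> degree q < Suc n"
    define c where "c = coeff q n"
    \<comment> \<open>Subtracting the multiple of \<open>r\<close> with the same top coefficient
      lowers the degree, so the induction hypothesis applies.\<close>
    define q' where "q' = q - smult c r"
    have "coeff q' n = 0" using cr by (simp add: q'_def c_def)
    moreover have "degree q' \<le> n" unfolding q'_def using q dr
      by (intro degree_diff_le) (auto intro: order_trans[OF degree_smult_le])
    ultimately have q': "q' = 0 \<or> degree q' < n"
      by (metis le_neq_implies_less leading_coeff_0_iff)
    have qq: "q = q' + smult c r" by (simp add: q'_def)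
    have ip: "poly_inner a b q' (p i) = poly_inner a b q (p' i)" if "i < n" for i
      using rp[OF that] that by (simp add: qq p'i poly_inner_add poly_inner_smult)
    have "poly_inner a b q' (p' n) = 0"
    proof -
      have "poly_inner a b q' (p' n) = (\<Sum>i<n. poly_inner a b q' (p i) * poly_inner a b (p i) (p' n))"
        by (subst rep[OF q']) (simp add: poly_inner_sum poly_inner_smult)
      also have "\<dots> = 0" using rp by (intro sum.neutral) (simp add: p'n poly_inner_smult_right poly_inner_commute[of a b _ r])
      finally show ?thesis .
    qed
    then have "poly_inner a b q (p' n) = c * s" using rr by (simp add: qq poly_inner_add poly_inner_smult)
    then have "smult (poly_inner a b q (p' n)) (p' n) = smult c r" using s(1) by (simp add: p'n)
    moreover have "q' = (\<Sum>i<n. smult (poly_inner a b q (p' i)) (p' i))"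
      by (rule trans[OF rep[OF q']]) (simp add: ip p'i)
    ultimately have "q' + smult c r = (\<Sum>i<Suc n. smult (poly_inner a b q (p' i)) (p' i))"
      by (simp only: sum.lessThan_Suc)
    then show "q = (\<Sum>i<Suc n. smult (poly_inner a b q (p' i)) (p' i))"
      by (rule trans[OF qq])
  qed
qed simp

lemma orthonormal_polys:
  assumes "a < b"
  obtains p :: "nat \<Rightarrow> real poly" where "\<And>i. i \<le> k \<Longrightarrow> degree (p i) \<le> k"
    "\<And>i j. i \<le> k \<Longrightarrow> j \<le> k \<Longrightarrow> poly_inner a b (p i) (p j) = (if i = j then 1 else 0)"
    "\<And>q. degree q \<le> k \<Longrightarrow> q = (\<Sum>i\<le>k. smult (poly_inner a b q (p i)) (p i))"
proof -
  obtain p where "\<forall>i<Suc k. degree (p i) < Suc k"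
    "\<forall>i<Suc k. \<forall>j<Suc k. poly_inner a b (p i) (p j) = (if i = j then 1 else 0)"
    "\<forall>q. q = 0 \<or> degree q < Suc k \<longrightarrow> q = (\<Sum>i<Suc k. smult (poly_inner a b q (p i)) (p i))"
    using orthonormal_polys_aux[OF assms, of "Suc k"] by blast
  then show thesis
    by (intro that[of p]) (simp_all add: less_Suc_eq_le lessThan_Suc_atMost)
qed

text \<open>Serves to express coefficients by values at interior points, the form in which
  measurability of the solution is given. Both sides have degree at most \<open>k\<close> and agree
  at \<open>k + 1\<close> points.\<close>

lemma lagrange_interpolation:
  fixes y :: "nat \<Rightarrow> real"
  assumes inj: "inj_on y {..k}"
  obtains L :: "nat \<Rightarrow> real poly" where "\<And>q. degree q \<le> k \<Longrightarrow> q = (\<Sum>l\<le>k. smult (poly q (y l)) (L l))"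
proof -
  define L where "L l = (\<Prod>m\<in>{..k} - {l}. smult (1 / (y l - y m)) [:- y m, 1:])" for l
  have degL: "degree (L l) \<le> k" if "l \<le> k" for l
  proof -
    have "degree (L l) \<le> (\<Sum>m\<in>{..k} - {l}. degree (smult (1 / (y l - y m)) [:- y m, 1:]))"
      unfolding L_def by (rule degree_prod_sum_le[unfolded comp_def]) simp
    also have "\<dots> \<le> (\<Sum>m\<in>{..k} - {l}. 1)"
      by (intro sum_mono) (auto intro!: order_trans[OF degree_smult_le])
    also have "\<dots> = k" using that by (simp add: card_Diff_singleton)
    finally show ?thesis .
  qed
  have Ly: "poly (L l) (y m) = (if l = m then 1 else 0)" if "l \<le> k" "m \<le> k" for l m
  proof (cases "l = m")
    case True
    have "y l \<noteq> y n" if "n \<in> {..k} - {l}" for n using inj that \<open>l \<le> k\<close> by (auto simp: inj_on_def)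
    then show ?thesis using True by (simp add: L_def poly_prod diff_divide_distrib[symmetric])
  next
    case False
    then show ?thesis unfolding L_def poly_prod using that
      by (auto intro!: prod_zero bexI[of _ m])
  qed
  have "q = (\<Sum>l\<le>k. smult (poly q (y l)) (L l))" if q: "degree q \<le> k" for q
  proof (rule poly_eqI_degree[of "y ` {..k}"])
    show "card (y ` {..k}) > degree q" using q by (simp add: card_image[OF inj])
    have "degree (\<Sum>l\<le>k. smult (poly q (y l)) (L l)) \<le> k"
      using degL by (intro degree_sum_le) (auto intro: order_trans[OF degree_smult_le])
    then show "card (y ` {..k}) > degree (\<Sum>l\<le>k. smult (poly q (y l)) (L l))" by (simp add: card_image[OF inj])
    fix x assume "x \<in> y ` {..k}"
    then obtain m where m: "m \<le> k" "x = y m" by auto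
    have "(\<Sum>l\<le>k. poly q (y l) * poly (L l) (y m)) = (\<Sum>l\<le>k. if l = m then poly q (y m) else 0)"
      using Ly m by (intro sum.cong) auto
    then show "poly q x = poly (\<Sum>l\<le>k. smult (poly q (y l)) (L l)) x"
      using m by (simp add: poly_sum)
  qed
  then show thesis by (rule that)
qed

lemma poly_inner_by_parts:
  assumes "a \<le> b"
  shows "poly_inner a b p (pderiv q) + poly_inner a b q (pderiv p)
    = poly p b * poly q b - poly p a * poly q a"
proof -
  have "poly_inner a b p (pderiv q) + poly_inner a b q (pderiv p)
      = (LINT x:{a..b}|lborel. poly p x * poly (pderiv q) x + poly q x * poly (pderiv p) x)"
    unfolding poly_inner_def by (simp add: set_integral_add set_integrable_poly_mult)
  also have "\<dots> = (LINT x:{a..b}|lborel. poly (pderiv (p * q)) x)"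
    by (simp add: pderiv_mult mult.commute)
  also have "\<dots> = integral {a..b} (poly (pderiv (p * q)))"
    by (rule set_borel_integral_eq_integral(2)[OF set_integrable_poly])
  also have "\<dots> = poly (p * q) b - poly (p * q) a"
  proof (rule integral_unique[OF fundamental_theorem_of_calculus[OF assms]])
    show "(poly (p * q) has_vector_derivative poly (pderiv (p * q)) x) (at x within {a..b})" for x
      unfolding has_real_derivative_iff_has_vector_derivative[symmetric]
      by (rule has_field_derivative_at_within[OF poly_DERIV])
  qed
  finally show ?thesis by simp
qed

text \<open>Lets the drift be defined directly as a functional and turned into a matrix afterwards.
  Vectors are total functions here, and \<open>cong\<close> says that only their coordinates in
  \<open>I\<close> matter.\<close>

lemma linear_functional_matrix:
  fixes L :: "('i \<Rightarrow> real) \<Rightarrow> real"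
  assumes "finite I" and add: "\<And>x y. L (\<lambda>i. x i + y i) = L x + L y" and mult: "\<And>c x. L (\<lambda>i. c * x i) = c * L x"
    and cong: "\<And>x y. (\<And>i. i \<in> I \<Longrightarrow> x i = y i) \<Longrightarrow> L x = L y"
  shows "L x = (\<Sum>j\<in>I. L (\<lambda>i. if i = j then 1 else 0) * x j)"
proof -
  have L0: "L (\<lambda>i. 0) = 0" using mult[of 0 "\<lambda>i. 0"] by simp
  have "L (\<lambda>i. \<Sum>j\<in>A. x j * (if i = j then 1 else 0)) = (\<Sum>j\<in>A. L (\<lambda>i. if i = j then 1 else 0) * x j)"
    if "finite A" for A
    using that
  proof (induction A rule: finite_induct)
    case (insert a A)
    then show ?case
      using add[of "\<lambda>i. x a * (if i = a then 1 else 0)" "\<lambda>i. \<Sum>j\<in>A. x j * (if i = j then 1 else 0)"]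
        mult[of "x a" "\<lambda>i. if i = a then 1 else 0"]
      by (simp add: mult.commute)
  qed (simp add: L0)
  moreover have "L x = L (\<lambda>i. \<Sum>j\<in>I. x j * (if i = j then 1 else 0))"
    using \<open>finite I\<close> by (intro cong) (simp add: if_distrib cong: if_cong)
  ultimately show ?thesis using \<open>finite I\<close> by simp
qed

section \<open>The discontinuous Galerkin space\<close>

text \<open>Functions of the finite element space are arbitrary at the nodes; these form a null set,
  so integrals over a closed cell see only the polynomial inside.\<close>

lemma interval_agree:
  fixes f g :: "real \<Rightarrow> real"
  assumes "a < b" and eq: "\<And>x. x \<in> {a<..<b} \<Longrightarrow> f x = g x"
    and g: "(\<lambda>x. indicator {a..b} x * g x) \<in> borel_measurable lborel"
  shows "(\<lambda>x. indicator {a..b} x * f x) \<in> borel_measurable lborel"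
    "(LINT x:{a..b}|lborel. f x) = (LINT x:{a..b}|lborel. g x)"
    "set_integrable lborel {a..b} f \<longleftrightarrow> set_integrable lborel {a..b} g"
proof -
  \<comment> \<open>\<open>f\<close> is rebuilt from \<open>g\<close> on the open interval and from
    its two end values, which keeps it Borel measurable whatever these values are.\<close>
  have "(\<lambda>x. indicator {a<..<b} x * (indicator {a..b} x * g x) + indicator {a} x * f a + indicator {b} x * f b) \<in> borel_measurable lborel"
    using g by measurable
  moreover have "(\<lambda>x. indicator {a<..<b} x * (indicator {a..b} x * g x) + indicator {a} x * f a + indicator {b} x * f b)
      = (\<lambda>x. indicator {a..b} x * f x)"
  proof
    fix x
    show "indicator {a<..<b} x * (indicator {a..b} x * g x) + indicator {a} x * f a + indicator {b} x * f b = indicator {a..b} x * f x"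
    proof (cases "x \<in> {a<..<b}")
      case True then show ?thesis using eq[OF True] by simp
    next
      case False then show ?thesis using \<open>a < b\<close> by (auto simp: indicator_def)
    qed
  qed
  ultimately show f: "(\<lambda>x. indicator {a..b} x * f x) \<in> borel_measurable lborel" by simp
  have ae: "AE x in lborel. indicator {a..b} x *\<^sub>R f x = indicator {a..b} x *\<^sub>R g x"
    using AE_lborel_singleton[of a] AE_lborel_singleton[of b]
    by eventually_elim (use eq in \<open>auto simp: indicator_def\<close>)
  show "(LINT x:{a..b}|lborel. f x) = (LINT x:{a..b}|lborel. g x)"
    unfolding set_lebesgue_integral_def by (rule integral_cong_AE) (use f g ae in auto)
  show "set_integrable lborel {a..b} f \<longleftrightarrow> set_integrable lborel {a..b} g"
    unfolding set_integrable_def by (rule integrable_cong_AE) (use f g ae in auto)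
qed

lemma poly_mult_fun: "poly (p * q :: real poly) = (\<lambda>x. poly p x * poly q x)"
  by (rule ext) simp

lemma indicator_poly_measurable:
  "(\<lambda>x. indicator {a..b} x * poly (q :: real poly) x) \<in> borel_measurable lborel"
proof -
  have "poly q \<in> borel_measurable borel" by (intro borel_measurable_continuous_onI continuous_intros)
  then show ?thesis by measurable
qed

text \<open>The orthonormal basis of each cell is a parameter. \<open>p_rep\<close> says that it
  spans, so dimensions never have to be counted.\<close>

locale dg_space =
  fixes N k :: nat and xs :: "nat \<Rightarrow> real" and p :: "nat \<Rightarrow> nat \<Rightarrow> real poly"
  assumes N: "1 \<le> N" and incr: "\<And>j. j \<in> {1..N} \<Longrightarrow> xs (j - 1) < xs j"
    and p_degree: "\<And>j i. j \<in> {1..N} \<Longrightarrow> i \<le> k \<Longrightarrow> degree (p j i) \<le> k"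
    and p_orth: "\<And>j i l. j \<in> {1..N} \<Longrightarrow> i \<le> k \<Longrightarrow> l \<le> k \<Longrightarrow>
      poly_inner (xs (j - 1)) (xs j) (p j i) (p j l) = (if i = l then 1 else 0)"
    and p_rep: "\<And>j q. j \<in> {1..N} \<Longrightarrow> degree q \<le> k \<Longrightarrow>
      q = (\<Sum>i\<le>k. smult (poly_inner (xs (j - 1)) (xs j) q (p j i)) (p j i))"
begin

section \<open>Coefficients, the projection and traces\<close>

definition coef :: "(real \<Rightarrow> real) \<Rightarrow> nat \<Rightarrow> nat \<Rightarrow> real" where
  "coef w j i = (LINT x:cell xs j|lborel. w x * poly (p j i) x)"

definition expand :: "(nat \<Rightarrow> nat \<Rightarrow> real) \<Rightarrow> nat \<Rightarrow> real poly" where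
  "expand c j = (\<Sum>i\<le>k. smult (c j i) (p j i))"

lemma expand_degree: "j \<in> {1..N} \<Longrightarrow> degree (expand c j) \<le> k"
  unfolding expand_def using p_degree
  by (intro degree_sum_le) (auto intro: order_trans[OF degree_smult_le])

lemma interior_cell: "interior (cell xs j) = {xs (j - 1)<..<xs j}"
  by (simp add: cell_def interior_atLeastAtMost_real)

lemma expand_inner:
  assumes "j \<in> {1..N}"
  shows "poly_inner (xs (j - 1)) (xs j) (expand c j) (expand d j) = (\<Sum>i\<le>k. c j i * d j i)"
proof -
  have "poly_inner (xs (j - 1)) (xs j) (expand c j) (expand d j)
      = (\<Sum>i\<le>k. \<Sum>l\<le>k. c j l * (d j i * poly_inner (xs (j - 1)) (xs j) (p j l) (p j i)))"
    unfolding expand_def poly_inner_sum_right poly_inner_smult_right poly_inner_sum poly_inner_smult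
    by (simp add: sum_distrib_left mult.left_commute)
  also have "\<dots> = (\<Sum>i\<le>k. \<Sum>l\<le>k. if i = l then c j i * d j i else 0)"
    using p_orth[OF assms] by (intro sum.cong) auto
  finally show ?thesis by simp
qed

lemma expand_coef:
  assumes "j \<in> {1..N}" "i \<le> k"
  shows "poly_inner (xs (j - 1)) (xs j) (expand c j) (p j i) = c j i"
proof -
  have "poly_inner (xs (j - 1)) (xs j) (expand c j) (p j i) = (\<Sum>l\<le>k. if l = i then c j i else 0)"
    unfolding expand_def poly_inner_sum poly_inner_smult
    using p_orth[OF assms(1) _ assms(2)] by (intro sum.cong) auto
  then show ?thesis using assms by simp
qed

text \<open>The polynomial of the cell has the same inner products with the basis as
  \<open>w\<close>, and \<open>p_rep\<close> recovers it from them.\<close>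

lemma Vh_expand:
  assumes w: "w \<in> Vh N xs k" and j: "j \<in> {1..N}" and x: "x \<in> interior (cell xs j)"
  shows "w x = poly (expand (coef w) j) x"
proof -
  obtain q where q: "degree q \<le> k" "\<And>x. x \<in> interior (cell xs j) \<Longrightarrow> w x = poly q x"
    using w j unfolding Vh_def by blast
  have "coef w j i = poly_inner (xs (j - 1)) (xs j) q (p j i)" for i
    unfolding coef_def poly_inner_def cell_def
    by (rule interval_agree(2)[OF incr[OF j]])
      (use q(2) in \<open>auto simp: interior_cell poly_mult[symmetric] simp del: poly_mult intro: indicator_poly_measurable[simplified]\<close>)
  then have "expand (coef w) j = q" using p_rep[OF j q(1)] by (simp add: expand_def)
  then show ?thesis using q(2)[OF x] by simp
qed

lemma cell_agree:
  assumes j: "j \<in> {1..N}" and eq: "\<And>x. x \<in> interior (cell xs j) \<Longrightarrow> f x = poly q x"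
  shows "(LINT x:cell xs j|lborel. f x) = (LINT x:cell xs j|lborel. poly q x)" "set_integrable lborel (cell xs j) f"
proof -
  have "f x = poly q x" if "x \<in> {xs (j - 1)<..<xs j}" for x using eq that by (simp add: interior_cell)
  note ia = interval_agree(2,3)[OF incr[OF j] this indicator_poly_measurable]
  show "(LINT x:cell xs j|lborel. f x) = (LINT x:cell xs j|lborel. poly q x)" using ia(1) by (simp add: cell_def)
  show "set_integrable lborel (cell xs j) f" using ia(2) by (simp add: cell_def set_integrable_poly)
qed

lemma Vh_mult_integral:
  assumes v: "v \<in> Vh N xs k" and w: "w \<in> Vh N xs k" and j: "j \<in> {1..N}"
  shows "(LINT x:cell xs j|lborel. v x * w x) = (\<Sum>i\<le>k. coef v j i * coef w j i)"
    "set_integrable lborel (cell xs j) (\<lambda>x. v x * w x)"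
proof -
  have eq: "v x * w x = poly (expand (coef v) j * expand (coef w) j) x" if "x \<in> interior (cell xs j)" for x
    using Vh_expand[OF v j that] Vh_expand[OF w j that] by simp
  show "set_integrable lborel (cell xs j) (\<lambda>x. v x * w x)"
    by (rule cell_agree(2)[OF j]) (rule eq)
  have "(LINT x:cell xs j|lborel. v x * w x) = (LINT x:cell xs j|lborel. poly (expand (coef v) j * expand (coef w) j) x)"
    by (rule cell_agree(1)[OF j]) (rule eq)
  then show "(LINT x:cell xs j|lborel. v x * w x) = (\<Sum>i\<le>k. coef v j i * coef w j i)"
    using expand_inner[OF j, of "coef v" "coef w"] by (simp add: poly_inner_def cell_def poly_mult_fun)
qed

lemma xs_mono: "i \<le> j \<Longrightarrow> j \<le> N \<Longrightarrow> xs i \<le> xs j"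
proof (induction j rule: dec_induct)
  case (step n)
  then show ?case using incr[of "Suc n"] by simp
qed simp

lemma cells_integral:
  fixes g :: "real \<Rightarrow> real"
  assumes "\<And>j. j \<in> {1..N} \<Longrightarrow> set_integrable lborel (cell xs j) g"
  shows "(LINT x:{xs 0..xs N}|lborel. g x) = (\<Sum>j\<in>{1..N}. LINT x:cell xs j|lborel. g x)"
proof -
  have "set_integrable lborel {xs 0..xs n} g \<and>
      (LINT x:{xs 0..xs n}|lborel. g x) = (\<Sum>j\<in>{1..n}. LINT x:cell xs j|lborel. g x)" if "n \<le> N" for n
    using that
  proof (induction n)
    case 0
    have "(\<lambda>x. indicator {xs 0..xs 0} x *\<^sub>R g x) = (\<lambda>x. indicator {xs 0} x *\<^sub>R g (xs 0))" by (auto simp: indicator_def)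
    then show ?case by (simp add: set_integrable_def set_lebesgue_integral_def)
  next
    case (Suc n)
    have le: "xs 0 \<le> xs n" "xs n \<le> xs (Suc n)" using Suc.prems by (auto intro!: xs_mono)
    have c: "cell xs (Suc n) = {xs n..xs (Suc n)}" by (simp add: cell_def)
    have "{xs 0..xs (Suc n)} = {xs 0..xs n} \<union> cell xs (Suc n)"
      using ivl_disj_un_two_touch(4)[OF le] c by simp
    moreover have "set_integrable lborel ({xs 0..xs n} \<union> cell xs (Suc n)) g"
      by (rule set_integrable_Un) (use Suc assms[of "Suc n"] c in auto)
    ultimately have i: "set_integrable lborel {xs 0..xs (Suc n)} g" by simp
    have "(LINT x:{xs 0..xs (Suc n)}|lborel. g x)
        = (LINT x:{xs 0..xs n}|lborel. g x) + (LINT x:cell xs (Suc n)|lborel. g x)"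
      unfolding c by (rule set_integral_combine[OF le i])
    also have "(LINT x:{xs 0..xs n}|lborel. g x) = (\<Sum>j\<in>{1..n}. LINT x:cell xs j|lborel. g x)"
      using Suc.IH Suc.prems by simp
    also have "\<dots> + (LINT x:cell xs (Suc n)|lborel. g x) = (\<Sum>j\<in>{1..Suc n}. LINT x:cell xs j|lborel. g x)"
      by simp
    finally show ?case using i by blast
  qed
  then show ?thesis by blast
qed

lemma L2_norm_Vh:
  assumes w: "w \<in> Vh N xs k"
  shows "(L2_norm N xs w)\<^sup>2 = (\<Sum>j\<in>{1..N}. \<Sum>i\<le>k. (coef w j i)\<^sup>2)"
proof -
  have "(L2_norm N xs w)\<^sup>2 = (LINT x:{xs 0..xs N}|lborel. w x * w x)"
    unfolding L2_norm_def set_lebesgue_integral_def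
    by (subst real_sqrt_pow2) (auto intro!: integral_nonneg_AE simp: power2_eq_square)
  also have "\<dots> = (\<Sum>j\<in>{1..N}. LINT x:cell xs j|lborel. w x * w x)"
    by (rule cells_integral[OF Vh_mult_integral(2)[OF w w]])
  also have "\<dots> = (\<Sum>j\<in>{1..N}. \<Sum>i\<le>k. (coef w j i)\<^sup>2)"
    by (intro sum.cong refl) (simp add: Vh_mult_integral(1)[OF w w] power2_eq_square)
  finally show ?thesis .
qed

lemma poly_Vh: "degree q \<le> k \<Longrightarrow> poly q \<in> Vh N xs k"
  by (auto simp: Vh_def)

lemma cells_disjoint:
  assumes "j \<in> {1..N}" "l \<in> {1..N}" "x \<in> interior (cell xs j)" "x \<in> interior (cell xs l)"
  shows "j = l"
proof (rule ccontr)
  assume "j \<noteq> l"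
  then have "j \<le> l - 1 \<or> l \<le> j - 1" by auto
  moreover have "l - 1 \<le> N" "j - 1 \<le> N" using assms by auto
  ultimately show False
    using assms xs_mono[of j "l - 1"] xs_mono[of l "j - 1"] by (auto simp: interior_cell)
qed

text \<open>A concrete element of the space with prescribed coefficients. Open cells make the pieces
  disjoint; at the nodes the value is \<open>0\<close>, which is as good as any.\<close>

definition glue :: "(nat \<Rightarrow> nat \<Rightarrow> real) \<Rightarrow> real \<Rightarrow> real" where
  "glue c x = (\<Sum>j\<in>{1..N}. indicator (interior (cell xs j)) x * poly (expand c j) x)"

lemma glue_eq:
  assumes "j \<in> {1..N}" "x \<in> interior (cell xs j)"
  shows "glue c x = poly (expand c j) x"
proof -
  have "glue c x = (\<Sum>l\<in>{1..N}. if l = j then poly (expand c j) x else 0)"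
    unfolding glue_def using assms cells_disjoint by (intro sum.cong) (auto simp: indicator_def)
  then show ?thesis using assms by simp
qed

lemma glue_Vh: "glue c \<in> Vh N xs k"
  unfolding Vh_def using glue_eq expand_degree by blast

lemma coef_glue:
  assumes j: "j \<in> {1..N}" "i \<le> k"
  shows "coef (glue c) j i = c j i"
proof -
  have "coef (glue c) j i = (LINT x:cell xs j|lborel. poly (expand c j * p j i) x)"
    unfolding coef_def by (rule cell_agree(1)[OF j(1)]) (simp add: glue_eq[OF j(1)])
  then show ?thesis using expand_coef[OF j] by (simp add: poly_inner_def cell_def)
qed

text \<open>\<open>L2_proj\<close> is an arbitrary choice, so existence comes first, with
  \<open>glue (coef F)\<close> as a witness. Testing against single basis functions then shows that
  every choice has the coefficients of \<open>F\<close>, and the squared norm is the sum of their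
  squares.\<close>

lemma L2_norm_proj:
  assumes F: "\<And>j q. j \<in> {1..N} \<Longrightarrow> set_integrable lborel (cell xs j) (\<lambda>x. F x * poly q x)"
    and Fm: "\<And>j. j \<in> {1..N} \<Longrightarrow> (\<lambda>x. indicator (cell xs j) x * F x) \<in> borel_measurable lborel"
  shows "(L2_norm N xs (L2_proj N xs k F))\<^sup>2 = (\<Sum>j\<in>{1..N}. \<Sum>i\<le>k. (coef F j i)\<^sup>2)"
proof -
  have F\<phi>: "(LINT x:cell xs j|lborel. F x * \<phi> x) = (\<Sum>i\<le>k. coef F j i * coef \<phi> j i)"
    "set_integrable lborel (cell xs j) (\<lambda>x. F x * \<phi> x)"
    if \<phi>: "\<phi> \<in> Vh N xs k" and j: "j \<in> {1..N}" for \<phi> j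
  proof -
    have agree: "F x * \<phi> x = F x * poly (expand (coef \<phi>) j) x" if "x \<in> {xs (j - 1)<..<xs j}" for x
      using Vh_expand[OF \<phi> j, of x] that by (simp add: interior_cell)
    have "(\<lambda>x. indicator {xs (j - 1)..xs j} x * (F x * poly (expand (coef \<phi>) j) x)) \<in> borel_measurable lborel"
      using borel_measurable_integrable[OF F[OF j, of "expand (coef \<phi>) j", unfolded set_integrable_def]] by (simp add: cell_def)
    note ia = interval_agree(2,3)[OF incr[OF j] agree this]
    show "set_integrable lborel (cell xs j) (\<lambda>x. F x * \<phi> x)"
      using ia(2) F[OF j] by (simp add: cell_def)
    have "(LINT x:cell xs j|lborel. F x * \<phi> x) = (LINT x:cell xs j|lborel. F x * poly (expand (coef \<phi>) j) x)"
      using ia(1) by (simp add: cell_def)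
    also have "\<dots> = (LINT x:cell xs j|lborel. \<Sum>i\<le>k. coef \<phi> j i * (F x * poly (p j i) x))"
      by (simp add: expand_def poly_sum sum_distrib_left mult.left_commute)
    also have "\<dots> = (\<Sum>i\<le>k. LINT x:cell xs j|lborel. coef \<phi> j i * (F x * poly (p j i) x))"
    proof -
      have "set_integrable lborel (cell xs j) (\<lambda>x. coef \<phi> j i * (F x * poly (p j i) x))" for i
        by (intro set_integrable_mult_right F[OF j])
      then show ?thesis
        unfolding set_lebesgue_integral_def scaleR_sum_right set_integrable_def
        by (rule Bochner_Integration.integral_sum)
    qed
    also have "\<dots> = (\<Sum>i\<le>k. coef F j i * coef \<phi> j i)"
      by (simp add: coef_def mult.commute)
    finally show "(LINT x:cell xs j|lborel. F x * \<phi> x) = (\<Sum>i\<le>k. coef F j i * coef \<phi> j i)" .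
  qed
  let ?P = "\<lambda>q. q \<in> Vh N xs k \<and> (\<forall>\<phi>\<in>Vh N xs k. (LINT x:{xs 0..xs N}|lborel. q x * \<phi> x)
                       = (LINT x:{xs 0..xs N}|lborel. F x * \<phi> x))"
  have "?P (glue (coef F))"
  proof (intro conjI ballI)
    fix \<phi> assume \<phi>: "\<phi> \<in> Vh N xs k"
    show "(LINT x:{xs 0..xs N}|lborel. glue (coef F) x * \<phi> x) = (LINT x:{xs 0..xs N}|lborel. F x * \<phi> x)"
      using cells_integral[OF Vh_mult_integral(2)[OF glue_Vh \<phi>]] cells_integral[OF F\<phi>(2)[OF \<phi>]]
      by (simp add: Vh_mult_integral(1)[OF glue_Vh \<phi>] F\<phi>(1)[OF \<phi>] coef_glue)
  qed (rule glue_Vh)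
  then have "?P (L2_proj N xs k F)" unfolding L2_proj_def by (rule someI[of ?P])
  then have q: "L2_proj N xs k F \<in> Vh N xs k"
    and eq: "\<And>\<phi>. \<phi> \<in> Vh N xs k \<Longrightarrow> (LINT x:{xs 0..xs N}|lborel. L2_proj N xs k F x * \<phi> x)
                       = (LINT x:{xs 0..xs N}|lborel. F x * \<phi> x)" by blast+
  have "coef (L2_proj N xs k F) j i = coef F j i" if j: "j \<in> {1..N}" "i \<le> k" for j i
  proof -
    \<comment> \<open>The coefficients of a single basis function, extended by zero to the other
      cells.\<close>
    let ?e = "\<lambda>j' i'. if j' = j \<and> i' = i then 1 else (0::real)"
    have single: "(\<Sum>j\<in>{1..N}. \<Sum>i\<le>k. c j i * coef (glue ?e) j i) = c j i" for c
    proof -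
      have "(\<Sum>j\<in>{1..N}. \<Sum>i\<le>k. c j i * coef (glue ?e) j i) = (\<Sum>j'\<in>{1..N}. \<Sum>i'\<le>k. if i' = i then (if j' = j then c j i else 0) else 0)"
        by (intro sum.cong refl) (auto simp: coef_glue)
      also have "\<dots> = (\<Sum>j'\<in>{1..N}. if j' = j then c j i else 0)" using j by simp
      finally show ?thesis using j by simp
    qed
    have "(\<Sum>j\<in>{1..N}. \<Sum>i\<le>k. coef (L2_proj N xs k F) j i * coef (glue ?e) j i)
        = (\<Sum>j\<in>{1..N}. \<Sum>i\<le>k. coef F j i * coef (glue ?e) j i)"
      using eq[OF glue_Vh[of ?e]] cells_integral[OF Vh_mult_integral(2)[OF q glue_Vh[of ?e]]]
        cells_integral[OF F\<phi>(2)[OF glue_Vh[of ?e]]]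
      by (simp add: Vh_mult_integral(1)[OF q glue_Vh] F\<phi>(1)[OF glue_Vh])
    then show ?thesis unfolding single .
  qed
  then show ?thesis unfolding L2_norm_Vh[OF q] by simp
qed

lemma Lim_poly_left:
  assumes "a < b" "\<And>x. x \<in> {a<..<b} \<Longrightarrow> w x = poly q x"
  shows "Lim (at_left b) w = poly (q :: real poly) b"
proof (rule tendsto_Lim)
  have "(poly q \<longlongrightarrow> poly q b) (at_left b)"
    using poly_isCont[where p = q and x = b] by (simp only: isCont_def filterlim_at_split)
  moreover have "eventually (\<lambda>x. poly q x = w x) (at_left b)"
    using assms eventually_at_left_real[OF assms(1)] by (auto elim!: eventually_mono)
  ultimately show "(w \<longlongrightarrow> poly q b) (at_left b)" by (rule Lim_transform_eventually)
qed simp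

lemma Lim_poly_right:
  assumes "a < b" "\<And>x. x \<in> {a<..<b} \<Longrightarrow> w x = poly q x"
  shows "Lim (at_right a) w = poly (q :: real poly) a"
proof (rule tendsto_Lim)
  have "(poly q \<longlongrightarrow> poly q a) (at_right a)"
    using poly_isCont[where p = q and x = a] by (simp only: isCont_def filterlim_at_split)
  moreover have "eventually (\<lambda>x. poly q x = w x) (at_right a)"
    using assms eventually_at_right_real[OF assms(1)] by (auto elim!: eventually_mono)
  ultimately show "(w \<longlongrightarrow> poly q a) (at_right a)" by (rule Lim_transform_eventually)
qed simp

text \<open>Traces as linear functions of the coefficients. Nodes \<open>0\<close> and
  \<open>N\<close> are identified: the limit from the left at node \<open>0\<close> is taken on cell
  \<open>N\<close>, and in \<open>right_value\<close> the limit from the right at node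
  \<open>N\<close> is taken on cell \<open>1\<close>.\<close>

definition left_value :: "(nat \<Rightarrow> nat \<Rightarrow> real) \<Rightarrow> nat \<Rightarrow> real" where
  "left_value c j = (let n = if j = 0 then N else j in poly (expand c n) (xs n))"

definition right_value :: "(nat \<Rightarrow> nat \<Rightarrow> real) \<Rightarrow> nat \<Rightarrow> real" where
  "right_value c j = (let n = if j = N then 0 else j in poly (expand c (Suc n)) (xs n))"

lemma trace_minus_Vh:
  assumes "w \<in> Vh N xs k" "j \<le> N"
  shows "trace_minus N xs w j = left_value (coef w) j"
proof -
  define n where "n = (if j = 0 then N else j)"
  have n: "n \<in> {1..N}" using assms N by (auto simp: n_def)
  have "Lim (at_left (xs n)) w = poly (expand (coef w) n) (xs n)"
    using Vh_expand[OF assms(1) n] by (intro Lim_poly_left[OF incr[OF n]]) (auto simp: interior_cell)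
  then show ?thesis by (simp add: trace_minus_def left_value_def n_def)
qed

lemma trace_plus_Vh:
  assumes "w \<in> Vh N xs k" "j \<le> N"
  shows "trace_plus N xs w j = right_value (coef w) j"
proof -
  define n where "n = (if j = N then 0 else j)"
  have n: "Suc n \<in> {1..N}" using assms N by (auto simp: n_def)
  have "Lim (at_right (xs n)) w = poly (expand (coef w) (Suc n)) (xs n)"
    using Vh_expand[OF assms(1) n] incr[OF n]
    by (intro Lim_poly_right[of "xs n" "xs (Suc n)"]) (auto simp: interior_cell)
  then show ?thesis by (simp add: trace_plus_def right_value_def n_def)
qed

text \<open>Coefficients are point evaluations, so they inherit measurability in \<open>(t, \<omega>)\<close>.\<close>

lemma coef_point_values:
  assumes j: "j \<in> {1..N}"
  obtains y :: "nat \<Rightarrow> real" and c :: "nat \<Rightarrow> real"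
  where "\<And>l. y l \<in> interior (cell xs j)" "\<And>w. w \<in> Vh N xs k \<Longrightarrow> coef w j i = (\<Sum>l\<le>k. c l * w (y l))"
proof -
  \<comment> \<open>Distinct points of the open cell: the shift by \<open>2\<close> keeps every
    denominator above \<open>1\<close>, hence every point to the right of the left node.\<close>
  define y where "y l = xs j - (xs j - xs (j - 1)) / (real l + 2)" for l
  have pos: "0 < xs j - xs (j - 1)" using incr[OF j] by simp
  have y: "y l \<in> interior (cell xs j)" for l
  proof -
    have "(xs j - xs (j - 1)) / (real l + 2) < xs j - xs (j - 1)"
      using pos by (simp add: divide_less_eq)
    moreover have "0 < (xs j - xs (j - 1)) / (real l + 2)" using pos by simp
    ultimately show ?thesis by (simp add: y_def interior_cell)
  qed
  have "inj_on y {..k}"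
  proof (rule inj_onI)
    fix a b assume "y a = y b"
    then have "(xs j - xs (j - 1)) / (real a + 2) = (xs j - xs (j - 1)) / (real b + 2)" by (simp add: y_def)
    then have "(xs j - xs (j - 1)) * (real b + 2) = (xs j - xs (j - 1)) * (real a + 2)" by (subst (asm) frac_eq_eq) auto
    then show "a = b" using pos by simp
  qed
  then obtain L where L: "\<And>q. degree q \<le> k \<Longrightarrow> q = (\<Sum>l\<le>k. smult (poly q (y l)) (L l))"
    using lagrange_interpolation by blast
  show thesis
  proof (rule that[of y "\<lambda>l. poly_inner (xs (j - 1)) (xs j) (L l) (p j i)"])
    fix w assume w: "w \<in> Vh N xs k"
    have "coef w j i = (LINT x:cell xs j|lborel. poly (expand (coef w) j * p j i) x)"
      by (subst coef_def, rule cell_agree(1)[OF j]) (simp add: Vh_expand[OF w j])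
    also have "\<dots> = poly_inner (xs (j - 1)) (xs j) (expand (coef w) j) (p j i)" by (simp add: poly_inner_def cell_def)
    also have "\<dots> = poly_inner (xs (j - 1)) (xs j) (\<Sum>l\<le>k. smult (poly (expand (coef w) j) (y l)) (L l)) (p j i)"
      using L[OF expand_degree[OF j]] by simp
    also have "\<dots> = (\<Sum>l\<le>k. poly_inner (xs (j - 1)) (xs j) (L l) (p j i) * w (y l))"
      using Vh_expand[OF w j y] by (simp add: poly_inner_sum poly_inner_smult mult.commute)
    finally show "coef w j i = (\<Sum>l\<le>k. poly_inner (xs (j - 1)) (xs j) (L l) (p j i) * w (y l))" .
  qed (rule y)
qed

lemma expand_add: "expand (\<lambda>j i. c j i + d j i) j = expand c j + expand d j"
  by (simp add: expand_def smult_add_left sum.distrib)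

lemma expand_smult: "expand (\<lambda>j i. a * c j i) j = smult a (expand c j)"
  by (simp add: expand_def poly_eq_iff coeff_sum sum_distrib_left mult.assoc)

lemma expand_cong: "(\<And>i. i \<le> k \<Longrightarrow> c j i = d j i) \<Longrightarrow> expand c j = expand d j"
  by (simp add: expand_def)

lemma left_value_add: "left_value (\<lambda>j i. c j i + d j i) j = left_value c j + left_value d j"
  and right_value_add: "right_value (\<lambda>j i. c j i + d j i) j = right_value c j + right_value d j"
  and left_value_mult: "left_value (\<lambda>j i. a * c j i) j = a * left_value c j"
  and right_value_mult: "right_value (\<lambda>j i. a * c j i) j = a * right_value c j"
  by (simp_all add: left_value_def right_value_def Let_def expand_add expand_smult)

lemma boundary_value_cong:
  assumes "\<And>j i. j \<in> {1..N} \<Longrightarrow> i \<le> k \<Longrightarrow> c j i = d j i" "j \<le> N"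
  shows "left_value c j = left_value d j" "right_value c j = right_value d j"
proof -
  have e: "expand c j = expand d j" if "j \<in> {1..N}" for j using assms that by (intro expand_cong) auto
  show "left_value c j = left_value d j"
    using e[of "if j = 0 then N else j"] assms(2) N by (auto simp: left_value_def)
  show "right_value c j = right_value d j"
    using e[of "Suc (if j = N then 0 else j)"] assms(2) N by (auto simp: right_value_def)
qed

end

text \<open>A component \<open>(b, j, i)\<close> of the state is the \<open>i\<close>-th coefficient on cell \<open>j\<close> of \<open>v\<close> if \<open>b\<close>
  holds, and of \<open>u\<close> otherwise.\<close>

type_synonym dof = "bool \<times> nat \<times> nat"

section \<open>The drift of the scheme as a dissipative linear map\<close>

locale dg_fluxes = dg_space +
  fixes \<alpha> \<beta>1 \<beta>2 :: real
begin

definition dofs :: "dof set" where "dofs = UNIV \<times> {1..N} \<times> {..k}"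

definition dof_part :: "(dof \<Rightarrow> real) \<Rightarrow> bool \<Rightarrow> nat \<Rightarrow> nat \<Rightarrow> real" where
  "dof_part x b j i = x (b, j, i)"

text \<open>The flux that enters the equation of the field marked by \<open>b\<close>, so it
  approximates the other field: for \<open>True\<close>, the equation of \<open>v\<close>, it is the
  flux of \<open>u\<close>.\<close>

definition flux :: "bool \<Rightarrow> (dof \<Rightarrow> real) \<Rightarrow> nat \<Rightarrow> real" where
  "flux b x j = (let R = (\<lambda>b. right_value (dof_part x b) j); L = (\<lambda>b. left_value (dof_part x b) j) in
     if b then (R False + L False) / 2 + \<alpha> * (R False - L False) - \<beta>1 * (R True - L True)
     else (R True + L True) / 2 - \<alpha> * (R True - L True) - \<beta>2 * (R False - L False))"

text \<open>The drift of the scheme tested with a basis polynomial, whose traces on cell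
  \<open>j\<close> are its plain values at the two ends of the cell. The volume term involves the
  field opposite to \<open>b\<close>.\<close>

definition dof_drift :: "dof \<Rightarrow> (dof \<Rightarrow> real) \<Rightarrow> real" where
  "dof_drift m x = (case m of (b, j, i) \<Rightarrow>
     poly_inner (xs (j - 1)) (xs j) (expand (dof_part x (\<not> b)) j) (pderiv (p j i))
     - flux b x j * poly (p j i) (xs j) + flux b x (j - 1) * poly (p j i) (xs (j - 1)))"

lemma finite_dofs: "finite dofs" by (simp add: dofs_def)

lemma sum_dofs: "(\<Sum>m\<in>dofs. h m) = (\<Sum>j\<in>{1..N}. \<Sum>i\<le>k. h (True, j, i)) + (\<Sum>j\<in>{1..N}. \<Sum>i\<le>k. h (False, j, i))"
  for h :: "dof \<Rightarrow> real"
proof -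
  have "(\<Sum>m\<in>dofs. h m) = (\<Sum>b\<in>UNIV. \<Sum>j\<in>{1..N}. \<Sum>i\<le>k. h (b, j, i))"
    unfolding dofs_def sum.cartesian_product by (simp add: split_def)
  then show ?thesis by (simp add: UNIV_bool add.commute)
qed

lemma dof_part_add: "dof_part (\<lambda>m. x m + y m) b = (\<lambda>j i. dof_part x b j i + dof_part y b j i)"
  and dof_part_mult: "dof_part (\<lambda>m. a * x m) b = (\<lambda>j i. a * dof_part x b j i)"
  by (intro ext, simp add: dof_part_def)+

lemma flux_add: "flux b (\<lambda>m. x m + y m) j = flux b x j + flux b y j"
  unfolding flux_def Let_def dof_part_add left_value_add right_value_add by (simp add: algebra_simps add_divide_distrib)

lemma flux_mult: "flux b (\<lambda>m. a * x m) j = a * flux b x j"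
  unfolding flux_def Let_def dof_part_mult left_value_mult right_value_mult by (simp add: algebra_simps add_divide_distrib)

lemma flux_cong:
  assumes "\<And>m. m \<in> dofs \<Longrightarrow> x m = y m" "j \<le> N"
  shows "flux b x j = flux b y j"
proof -
  have "dof_part x b j i = dof_part y b j i" if "j \<in> {1..N}" "i \<le> k" for b j i
    using assms(1)[of "(b, j, i)"] that by (simp add: dof_part_def dofs_def)
  from boundary_value_cong[of "dof_part x _" "dof_part y _", OF this assms(2)] show ?thesis
    unfolding flux_def by simp
qed

lemma dof_drift_matrix:
  assumes "m \<in> dofs"
  shows "dof_drift m x = (\<Sum>m'\<in>dofs. dof_drift m (\<lambda>l. if l = m' then 1 else 0) * x m')"
proof (rule linear_functional_matrix[OF finite_dofs])
  obtain b j i where m: "m = (b, j, i)" by (cases m)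
  show "dof_drift m (\<lambda>i. x i + y i) = dof_drift m x + dof_drift m y" for x y
    by (simp add: m dof_drift_def dof_part_add expand_add poly_inner_add flux_add algebra_simps)
  show "dof_drift m (\<lambda>i. c * x i) = c * dof_drift m x" for c x
    by (simp add: m dof_drift_def dof_part_mult expand_smult poly_inner_smult flux_mult algebra_simps)
  show "dof_drift m x = dof_drift m y" if "\<And>i. i \<in> dofs \<Longrightarrow> x i = y i" for x y
  proof -
    have j: "j \<in> {1..N}" using assms by (simp add: m dofs_def)
    have "expand (dof_part x b) j = expand (dof_part y b) j" for b
      using that j by (intro expand_cong) (auto simp: dof_part_def dofs_def)
    moreover have "flux b x j = flux b y j" "flux b x (j - 1) = flux b y (j - 1)"
      using j by (auto intro!: flux_cong that)
    ultimately show ?thesis by (simp add: m dof_drift_def)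
  qed
qed

text \<open>Testing each equation with its own unknown and integrating by parts turns the volume
  terms of the two equations into products of \<open>u\<close> and \<open>v\<close> at the ends of
  the cell. Collected at the nodes, with periodicity closing the chain, the averages and the terms
  with \<open>\<alpha>\<close> cancel and only squared jumps remain.\<close>

lemma dof_drift_dissipative:
  "(\<Sum>m\<in>dofs. dof_drift m x * x m) =
    - (\<Sum>j\<in>{1..N}. \<beta>1 * (right_value (dof_part x True) j - left_value (dof_part x True) j)\<^sup>2
        + \<beta>2 * (right_value (dof_part x False) j - left_value (dof_part x False) j)\<^sup>2)"
proof -
  define L where "L b j = left_value (dof_part x b) j" for b j
  define R where "R b j = right_value (dof_part x b) j" for b j
  have cell: "(\<Sum>i\<le>k. dof_drift (b, j, i) x * x (b, j, i))
    = poly_inner (xs (j - 1)) (xs j) (expand (dof_part x (\<not> b)) j) (pderiv (expand (dof_part x b) j))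
     - flux b x j * L b j + flux b x (j - 1) * R b (j - 1)" if j: "j \<in> {1..N}" for b j
  proof -
    have "poly (expand (dof_part x b) j) (xs j) = L b j" "poly (expand (dof_part x b) j) (xs (j - 1)) = R b (j - 1)"
      using j by (auto simp: L_def R_def left_value_def right_value_def)
    then have LR: "L b j = (\<Sum>i\<le>k. x (b, j, i) * poly (p j i) (xs j))"
      "R b (j - 1) = (\<Sum>i\<le>k. x (b, j, i) * poly (p j i) (xs (j - 1)))"
      by (simp_all add: expand_def poly_sum dof_part_def)
    have "poly_inner (xs (j - 1)) (xs j) (expand (dof_part x (\<not> b)) j) (pderiv (expand (dof_part x b) j))
      = (\<Sum>i\<le>k. x (b, j, i) * poly_inner (xs (j - 1)) (xs j) (expand (dof_part x (\<not> b)) j) (pderiv (p j i)))"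
      unfolding expand_def[of "dof_part x b"] higher_pderiv_sum[of 1, simplified] pderiv_smult poly_inner_sum_right poly_inner_smult_right dof_part_def ..
    then show ?thesis
      unfolding LR by (simp add: dof_drift_def sum_distrib_left sum.distrib sum_subtractf algebra_simps)
  qed
  \<comment> \<open>The contribution to node \<open>j\<close> from the cell on its left;
    \<open>Ep\<close> is the one from the cell on its right and enters with the opposite
    sign.\<close>
  define Em where "Em j = L True j * L False j - flux True x j * L True j - flux False x j * L False j" for j
  define Ep where "Ep j = R True j * R False j - flux True x j * R True j - flux False x j * R False j" for j
  have "(\<Sum>m\<in>dofs. dof_drift m x * x m)
     = (\<Sum>j\<in>{1..N}. (\<Sum>i\<le>k. dof_drift (True, j, i) x * x (True, j, i)) + (\<Sum>i\<le>k. dof_drift (False, j, i) x * x (False, j, i)))"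
    by (simp add: sum_dofs sum.distrib)
  also have "\<dots> = (\<Sum>j\<in>{1..N}. Em j - Ep (j - 1))"
  proof (intro sum.cong refl)
    fix j assume j: "j \<in> {1..N}"
    have "poly_inner (xs (j - 1)) (xs j) (expand (dof_part x False) j) (pderiv (expand (dof_part x True) j))
      + poly_inner (xs (j - 1)) (xs j) (expand (dof_part x True) j) (pderiv (expand (dof_part x False) j))
      = L False j * L True j - R False (j - 1) * R True (j - 1)"
      using j poly_inner_by_parts[OF less_imp_le[OF incr[OF j]]]
      by (auto simp: L_def R_def left_value_def right_value_def)
    then show "(\<Sum>i\<le>k. dof_drift (True, j, i) x * x (True, j, i)) + (\<Sum>i\<le>k. dof_drift (False, j, i) x * x (False, j, i)) = Em j - Ep (j - 1)"
      using cell[OF j, of True] cell[OF j, of False] by (simp add: Em_def Ep_def algebra_simps)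
  qed
  also have "\<dots> = (\<Sum>j\<in>{1..N}. Em j) - (\<Sum>j\<in>{1..N}. Ep (j - 1))" by (rule sum_subtractf)
  \<comment> \<open>Cell \<open>j\<close> begins at node \<open>j - 1\<close>, so this sum runs over
    the nodes \<open>0\<close> to \<open>N - 1\<close>; periodicity then trades node
    \<open>0\<close> for node \<open>N\<close>.\<close>
  also have "(\<Sum>j\<in>{1..N}. Ep (j - 1)) = (\<Sum>j<N. Ep j)"
    by (rule sum.reindex_bij_witness[of _ Suc "\<lambda>j. j - 1"]) auto
  also have "\<dots> = (\<Sum>j\<in>{1..N}. Ep j)"
  proof -
    have "L b 0 = L b N" "R b 0 = R b N" for b using N by (simp_all add: L_def R_def left_value_def right_value_def)
    then have "Ep 0 = Ep N" using N by (simp add: Ep_def flux_def L_def R_def)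
    moreover have "{..<N} = insert 0 {1..<N}" "{1..N} = insert N {1..<N}" using N by auto
    ultimately show ?thesis by simp
  qed
  also have "(\<Sum>j\<in>{1..N}. Em j) - (\<Sum>j\<in>{1..N}. Ep j) = (\<Sum>j\<in>{1..N}. Em j - Ep j)" by (rule sum_subtractf[symmetric])
  \<comment> \<open>By \<open>[u v] = {u} [v] + {v} [u]\<close> the central parts cancel, and so do
    the two terms with \<open>\<alpha>\<close>, which have opposite signs.\<close>
  also have "\<dots> = (\<Sum>j\<in>{1..N}. - (\<beta>1 * (R True j - L True j)\<^sup>2 + \<beta>2 * (R False j - L False j)\<^sup>2))"
    by (intro sum.cong refl) (simp add: Em_def Ep_def flux_def L_def[symmetric] R_def[symmetric] power2_eq_square field_simps)
  finally show ?thesis by (simp only: sum_negf L_def R_def)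
qed

lemma trace_poly:
  assumes j: "j \<in> {1..N}"
  shows "trace_minus N xs (poly q) j = poly q (xs j)" "trace_plus N xs (poly q) (j - 1) = poly q (xs (j - 1))"
  using j Lim_poly_left[OF incr[OF j], of "poly q" q] Lim_poly_right[OF incr[OF j], of "poly q" q]
  by (auto simp: trace_minus_def trace_plus_def)

definition dof_values :: "(real \<Rightarrow> real) \<Rightarrow> (real \<Rightarrow> real) \<Rightarrow> dof \<Rightarrow> real" where
  "dof_values u v m = (case m of (b, j, i) \<Rightarrow> coef (if b then v else u) j i)"

lemma dof_part_dof_values: "dof_part (dof_values u v) b = coef (if b then v else u)"
  by (intro ext) (simp add: dof_part_def dof_values_def)

lemma flux_dof_values:
  assumes u: "u \<in> Vh N xs k" and v: "v \<in> Vh N xs k" and "j \<le> N"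
  shows "flux True (dof_values u v) j = flux_u N xs \<alpha> \<beta>1 u v j"
    "flux False (dof_values u v) j = flux_v N xs \<alpha> \<beta>2 u v j"
  using trace_minus_Vh[OF u assms(3)] trace_minus_Vh[OF v assms(3)] trace_plus_Vh[OF u assms(3)] trace_plus_Vh[OF v assms(3)]
  by (simp_all add: flux_def dof_part_dof_values flux_u_def flux_v_def avg_def jump_def)

lemma dg_drift_dof:
  assumes u: "u \<in> Vh N xs k" and v: "v \<in> Vh N xs k" and j: "j \<in> {1..N}"
  shows "dg_drift N xs u (flux_u N xs \<alpha> \<beta>1 u v) (poly (p j i)) j = dof_drift (True, j, i) (dof_values u v)"
    "dg_drift N xs v (flux_v N xs \<alpha> \<beta>2 u v) (poly (p j i)) j = dof_drift (False, j, i) (dof_values u v)"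
proof -
  have d: "deriv (poly q) = poly (pderiv q)" for q :: "real poly" by (intro ext DERIV_imp_deriv poly_DERIV)
  have I: "(LINT x:cell xs j|lborel. w x * deriv (poly (p j i)) x) = poly_inner (xs (j - 1)) (xs j) (expand (coef w) j) (pderiv (p j i))"
    if w: "w \<in> Vh N xs k" for w
  proof -
    have "(LINT x:cell xs j|lborel. w x * deriv (poly (p j i)) x) = (LINT x:cell xs j|lborel. poly (expand (coef w) j * pderiv (p j i)) x)"
      unfolding d by (rule cell_agree(1)[OF j]) (simp add: Vh_expand[OF w j])
    then show ?thesis by (simp add: poly_inner_def cell_def poly_mult_fun)
  qed
  have "j \<le> N" "j - 1 \<le> N" using j by auto
  then show "dg_drift N xs u (flux_u N xs \<alpha> \<beta>1 u v) (poly (p j i)) j = dof_drift (True, j, i) (dof_values u v)"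
    "dg_drift N xs v (flux_v N xs \<alpha> \<beta>2 u v) (poly (p j i)) j = dof_drift (False, j, i) (dof_values u v)"
    unfolding dg_drift_def dof_drift_def trace_poly[OF j]
    by (simp_all add: I u v dof_part_dof_values flux_dof_values)
qed

lemma L2_norm_dofs:
  assumes "u \<in> Vh N xs k" "v \<in> Vh N xs k"
  shows "(L2_norm N xs u)\<^sup>2 + (L2_norm N xs v)\<^sup>2 = (\<Sum>m\<in>dofs. (dof_values u v m)\<^sup>2)"
  using L2_norm_Vh assms by (simp add: sum_dofs dof_values_def)

text \<open>Equivalence of norms on a finite-dimensional space in explicit form: the basis
  polynomials are bounded on their compact cells, so point values are controlled by the
  coefficients.\<close>

lemma dofs_interior_bound:
  obtains B where "0 \<le> B" "\<And>j i x. j \<in> {1..N} \<Longrightarrow> i \<le> k \<Longrightarrow> x \<in> cell xs j \<Longrightarrow> \<bar>poly (p j i) x\<bar> \<le> B"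
    "\<And>u v b j x. u \<in> Vh N xs k \<Longrightarrow> v \<in> Vh N xs k \<Longrightarrow> j \<in> {1..N} \<Longrightarrow> x \<in> interior (cell xs j) \<Longrightarrow>
      \<bar>(if b then v else u) x\<bar> \<le> B * (\<Sum>m\<in>dofs. \<bar>dof_values u v m\<bar>)"
proof -
  have "\<exists>b. \<forall>x\<in>cell xs j. \<bar>poly (p j i) x\<bar> \<le> b" for j i
  proof -
    have "compact (poly (p j i) ` cell xs j)"
      unfolding cell_def by (intro compact_continuous_image continuous_intros compact_Icc)
    then show ?thesis by (auto dest!: compact_imp_bounded simp: bounded_iff)
  qed
  then obtain b where b: "\<And>j i x. x \<in> cell xs j \<Longrightarrow> \<bar>poly (p j i) x\<bar> \<le> b j i" by metis
  define B where "B = (\<Sum>j\<in>{1..N}. \<Sum>i\<le>k. \<bar>b j i\<bar>)"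
  have B0: "0 \<le> B" by (auto simp: B_def intro!: sum_nonneg)
  have pB: "\<bar>poly (p j i) x\<bar> \<le> B" if "j \<in> {1..N}" "i \<le> k" "x \<in> cell xs j" for j i x
  proof -
    have "\<bar>b j i\<bar> \<le> (\<Sum>i\<le>k. \<bar>b j i\<bar>)" using that by (intro member_le_sum) auto
    also have "\<dots> \<le> B" unfolding B_def using that by (intro member_le_sum[of j "{1..N}" "\<lambda>j. \<Sum>i\<le>k. \<bar>b j i\<bar>"]) (auto intro!: sum_nonneg)
    finally show ?thesis using b[OF that(3), of i] by linarith
  qed
  show thesis
  proof (rule that[OF B0 pB])
    fix u v c j x assume uv: "u \<in> Vh N xs k" "v \<in> Vh N xs k" and j: "j \<in> {1..N}" and x: "x \<in> interior (cell xs j)"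
    define w where "w = (if c then v else u)"
    have w: "w \<in> Vh N xs k" using uv by (simp add: w_def)
    have "\<bar>w x\<bar> = \<bar>\<Sum>i\<le>k. coef w j i * poly (p j i) x\<bar>"
      using Vh_expand[OF w j x] by (simp add: expand_def poly_sum)
    also have "\<dots> \<le> (\<Sum>i\<le>k. \<bar>coef w j i\<bar> * B)"
      using pB[OF j _ interior_subset[THEN subsetD, OF x]]
      by (intro order_trans[OF sum_abs] sum_mono) (auto simp: abs_mult intro!: mult_left_mono)
    also have "\<dots> = B * (\<Sum>i\<le>k. \<bar>dof_values u v (c, j, i)\<bar>)"
      by (simp add: dof_values_def w_def sum_distrib_left mult.commute)
    also have "\<dots> \<le> B * (\<Sum>m\<in>dofs. \<bar>dof_values u v m\<bar>)"
    proof (intro mult_left_mono B0)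
      have "(\<Sum>i\<le>k. \<bar>dof_values u v (c, j, i)\<bar>) = (\<Sum>m\<in>(\<lambda>i. (c, j, i)) ` {..k}. \<bar>dof_values u v m\<bar>)"
        by (subst sum.reindex) (auto simp: inj_on_def)
      also have "\<dots> \<le> (\<Sum>m\<in>dofs. \<bar>dof_values u v m\<bar>)"
        using j finite_dofs by (intro sum_mono2) (auto simp: dofs_def)
      finally show "(\<Sum>i\<le>k. \<bar>dof_values u v (c, j, i)\<bar>) \<le> (\<Sum>m\<in>dofs. \<bar>dof_values u v m\<bar>)" .
    qed
    finally show "\<bar>(if c then v else u) x\<bar> \<le> B * (\<Sum>m\<in>dofs. \<bar>dof_values u v m\<bar>)" by (simp add: w_def)
  qed
qed

text \<open>\<open>G\<close> will be the forcing, which depends on the arbitrary values of the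
  solution at the nodes; hence its bound is asked for inside the cell only, and the two end points
  form a null set.\<close>

lemma bounded_coef:
  assumes j: "j \<in> {1..N}" and m: "(\<lambda>x. indicator (cell xs j) x * G x) \<in> borel_measurable lborel"
    and D: "\<And>x. x \<in> interior (cell xs j) \<Longrightarrow> \<bar>G x\<bar> \<le> D" and B: "\<And>x. x \<in> cell xs j \<Longrightarrow> \<bar>poly q x\<bar> \<le> B"
  shows "set_integrable lborel (cell xs j) (\<lambda>x. G x * poly q x)"
    "\<bar>LINT x:cell xs j|lborel. G x * poly q x\<bar> \<le> D * B * (xs j - xs (j - 1))"
proof -
  note lt = incr[OF j]
  have mm: "(\<lambda>x. indicator (cell xs j) x *\<^sub>R (G x * poly q x)) \<in> borel_measurable lborel"
  proof -
    have "poly q \<in> borel_measurable borel" by (intro borel_measurable_continuous_onI continuous_intros)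
    then have "(\<lambda>x. indicator (cell xs j) x * G x * poly q x) \<in> borel_measurable lborel" using m by measurable
    then show ?thesis by (simp add: mult.assoc)
  qed
  have ae: "AE x in lborel. norm (indicator (cell xs j) x *\<^sub>R (G x * poly q x)) \<le> indicator (cell xs j) x *\<^sub>R (D * B)"
    using AE_lborel_singleton[of "xs j"] AE_lborel_singleton[of "xs (j - 1)"]
  proof eventually_elim
    case (elim x)
    show ?case
    proof (cases "x \<in> cell xs j")
      case True
      then have "x \<in> interior (cell xs j)" using elim by (auto simp: interior_cell cell_def)
      then have "\<bar>G x\<bar> * \<bar>poly q x\<bar> \<le> D * B"
        using D B[OF True] by (intro mult_mono) (auto intro: order_trans[OF abs_ge_zero])
      then show ?thesis using True by (simp add: abs_mult)
    qed simp
  qed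
  have ic: "integrable lborel (\<lambda>x. indicator (cell xs j) x *\<^sub>R (D * B))"
    unfolding cell_def by (intro integrable_scaleR_left integrable_real_indicator) (auto simp: emeasure_lborel_Icc_eq)
  show i: "set_integrable lborel (cell xs j) (\<lambda>x. G x * poly q x)"
    unfolding set_integrable_def
    by (rule Bochner_Integration.integrable_bound[OF ic mm]) (use ae in eventually_elim, auto)
  have "\<bar>LINT x:cell xs j|lborel. G x * poly q x\<bar> \<le> (LINT x|lborel. norm (indicator (cell xs j) x *\<^sub>R (G x * poly q x)))"
    unfolding set_lebesgue_integral_def using integral_norm_bound by fastforce
  also have "\<dots> \<le> (LINT x|lborel. indicator (cell xs j) x *\<^sub>R (D * B))"
    using i ic ae by (intro integral_mono_AE) (auto simp: set_integrable_def)
  also have "\<dots> = D * B * (xs j - xs (j - 1))" using lt by (simp add: cell_def)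
  finally show "\<bar>LINT x:cell xs j|lborel. G x * poly q x\<bar> \<le> D * B * (xs j - xs (j - 1))" .
qed

end

section \<open>The stochastic scheme\<close>

lemma (in brownian) progressive_cong:
  assumes "progressive F h" "\<And>s \<omega>. 0 \<le> s \<Longrightarrow> \<omega> \<in> space M \<Longrightarrow> h s \<omega> = h' s \<omega>"
  shows "progressive F h'"
proof -
  have "(\<lambda>(s, \<omega>). h' s \<omega>) \<in> borel_measurable (restrict_space borel {0..t} \<Otimes>\<^sub>M F t)" if "0 \<le> t" for t
  proof (rule measurable_cong[THEN iffD1])
    show "(\<lambda>(s, \<omega>). h s \<omega>) \<in> borel_measurable (restrict_space borel {0..t} \<Otimes>\<^sub>M F t)"
      using assms(1) that by (simp add: progressive_def)
    show "(case z of (s, \<omega>) \<Rightarrow> h s \<omega>) = (case z of (s, \<omega>) \<Rightarrow> h' s \<omega>)"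
      if "z \<in> space (restrict_space borel {0..t} \<Otimes>\<^sub>M F t)" for z
      using that assms(2) by (auto simp: space_pair_measure space_restrict_space)
  qed
  then show ?thesis by (simp add: progressive_def)
qed

lemma (in brownian) progressive_lincomb:
  assumes "\<And>i. i \<in> A \<Longrightarrow> progressive F (h i)"
  shows "progressive F (\<lambda>s \<omega>. \<Sum>i\<in>A. c i * h i s \<omega>)"
  unfolding progressive_def
proof (intro allI impI)
  fix t :: real assume "0 \<le> t"
  have "(\<lambda>z. c i * (case z of (s, \<omega>) \<Rightarrow> h i s \<omega>)) \<in> borel_measurable (restrict_space borel {0..t} \<Otimes>\<^sub>M F t)"
    if "i \<in> A" for i
    using assms[OF that] \<open>0 \<le> t\<close> by (intro borel_measurable_times borel_measurable_const) (simp add: progressive_def)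
  then have "(\<lambda>z. \<Sum>i\<in>A. c i * (case z of (s, \<omega>) \<Rightarrow> h i s \<omega>)) \<in> borel_measurable (restrict_space borel {0..t} \<Otimes>\<^sub>M F t)"
    by (rule borel_measurable_sum)
  then show "(\<lambda>(s, \<omega>). \<Sum>i\<in>A. c i * h i s \<omega>) \<in> borel_measurable (restrict_space borel {0..t} \<Otimes>\<^sub>M F t)"
    by (simp add: split_beta')
qed

lemma (in brownian) ito_equation_cong:
  assumes "ito_equation M F W y b h"
    and "\<And>s \<omega>. 0 \<le> s \<Longrightarrow> \<omega> \<in> space M \<Longrightarrow> b s \<omega> = b' s \<omega>"
  shows "ito_equation M F W y b' h"
  unfolding ito_equation_def
proof (intro allI impI conjI)
  fix t :: real assume t: "0 \<le> t"
  have eq: "set_integrable lborel {0..t} (\<lambda>s. b s \<omega>) = set_integrable lborel {0..t} (\<lambda>s. b' s \<omega>)"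
    "(LINT s:{0..t}|lborel. b s \<omega>) = (LINT s:{0..t}|lborel. b' s \<omega>)" if "\<omega> \<in> space M" for \<omega>
    by (rule set_integrable_cong, simp_all add: assms(2)[OF _ that], rule set_lebesgue_integral_cong, simp_all add: assms(2)[OF _ that])
  have "AE \<omega> in M. set_integrable lborel {0..t} (\<lambda>s. b s \<omega>)"
    using assms(1) t unfolding ito_equation_def by blast
  then show "AE \<omega> in M. set_integrable lborel {0..t} (\<lambda>s. b' s \<omega>)"
    using AE_space by eventually_elim (simp add: eq)
  obtain Z where Z: "has_ito_integral M F W h t Z"
    "AE \<omega> in M. y t \<omega> - y 0 \<omega> = (LINT s:{0..t}|lborel. b s \<omega>) + Z \<omega>"
    using assms(1) t unfolding ito_equation_def by blast
  from Z(2) have "AE \<omega> in M. y t \<omega> - y 0 \<omega> = (LINT s:{0..t}|lborel. b' s \<omega>) + Z \<omega>"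
    using AE_space by eventually_elim (simp add: eq)
  with Z(1) show "\<exists>Z. has_ito_integral M F W h t Z \<and> (AE \<omega> in M. y t \<omega> - y 0 \<omega> = (LINT s:{0..t}|lborel. b' s \<omega>) + Z \<omega>)"
    by blast
qed

lemma composed_coefficient_measurable:
  fixes h :: "real \<Rightarrow> real \<Rightarrow> real \<Rightarrow> real \<Rightarrow> real"
  assumes h: "(\<lambda>(x, t, u, v). h x t u v) \<in> borel_measurable (restrict_space borel (I \<times> {0..} \<times> UNIV \<times> UNIV))"
    and sub: "{a..b} \<subseteq> I" "a \<le> b" and "0 \<le> t"
  shows "(\<lambda>x. indicator {a..b} x * h x t (poly q x) (poly r x)) \<in> borel_measurable lborel"
proof -
  have [measurable]: "poly q \<in> borel_measurable borel" for q :: "real poly"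
    by (intro borel_measurable_continuous_onI continuous_intros)
  \<comment> \<open>Points outside the cell are sent to \<open>a\<close>, so that the map takes its
    values in the set where \<open>h\<close> is measurable.\<close>
  let ?\<Phi> = "\<lambda>x. (if x \<in> {a..b} then x else a, t, poly q x, poly r x)"
  have "?\<Phi> \<in> borel \<rightarrow>\<^sub>M borel" by measurable
  then have "?\<Phi> \<in> borel \<rightarrow>\<^sub>M restrict_space borel (I \<times> {0..} \<times> UNIV \<times> UNIV)"
    using sub \<open>0 \<le> t\<close> by (intro measurable_restrict_space2) auto
  from measurable_compose[OF this h]
  have [measurable]: "(\<lambda>x. h (if x \<in> {a..b} then x else a) t (poly q x) (poly r x)) \<in> borel_measurable borel" by simp
  have "(\<lambda>x. indicator {a..b} x * h (if x \<in> {a..b} then x else a) t (poly q x) (poly r x)) \<in> borel_measurable lborel"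
    by measurable
  also have "(\<lambda>x. indicator {a..b} x * h (if x \<in> {a..b} then x else a) t (poly q x) (poly r x))
      = (\<lambda>x. indicator {a..b} x * h x t (poly q x) (poly r x))"
    by (auto simp: indicator_def)
  finally show ?thesis .
qed

lemma (in dg_space) cell_bounds:
  assumes "j \<in> {1..N}"
  shows "xs 0 \<le> xs (j - 1)" "xs j \<le> xs N"
  using assms by (auto intro!: xs_mono)

locale dg_solution_setting = brownian M F W + dg_fluxes N k xs p \<alpha> \<beta>1 \<beta>2
  for M :: "'w measure" and F :: "real \<Rightarrow> 'w measure" and W :: "real \<Rightarrow> 'w \<Rightarrow> real"
    and N k :: nat and xs :: "nat \<Rightarrow> real" and p :: "nat \<Rightarrow> nat \<Rightarrow> real poly" and \<alpha> \<beta>1 \<beta>2 :: real +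
  fixes C :: real and f g :: "real \<Rightarrow> real \<Rightarrow> real \<Rightarrow> real \<Rightarrow> real"
    and u0 v0 :: "real \<Rightarrow> real" and u v :: "'w \<Rightarrow> real \<Rightarrow> real \<Rightarrow> real"
  assumes adm: "admissible_coefficients C {xs 0..xs N} f g"
    and sol: "dg_solution M F W N xs k \<alpha> \<beta>1 \<beta>2 f g u0 v0 u v"
begin

lemma u_Vh: "\<omega> \<in> space M \<Longrightarrow> 0 \<le> t \<Longrightarrow> (\<lambda>x. u \<omega> x t) \<in> Vh N xs k"
  and v_Vh: "\<omega> \<in> space M \<Longrightarrow> 0 \<le> t \<Longrightarrow> (\<lambda>x. v \<omega> x t) \<in> Vh N xs k"
  using sol by (simp_all add: dg_solution_def Vh_process_def)

lemma u0_Vh: "u0 \<in> Vh N xs k" and v0_Vh: "v0 \<in> Vh N xs k"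
  using sol by (simp_all add: dg_solution_def)

definition state :: "dof \<Rightarrow> real \<Rightarrow> 'w \<Rightarrow> real" where
  "state m t \<omega> = dof_values (\<lambda>x. u \<omega> x t) (\<lambda>x. v \<omega> x t) m"

definition forcing :: "bool \<Rightarrow> real \<Rightarrow> 'w \<Rightarrow> real \<Rightarrow> real" where
  "forcing b t \<omega> x = (if b then f else g) x t (u \<omega> x t) (v \<omega> x t)"

definition diffusion :: "dof \<Rightarrow> real \<Rightarrow> 'w \<Rightarrow> real" where
  "diffusion m t \<omega> = (case m of (b, j, i) \<Rightarrow> coef (forcing b t \<omega>) j i)"

lemma state_progressive:
  assumes "m \<in> dofs"
  shows "progressive F (state m)"
proof -
  obtain b j i where m: "m = (b, j, i)" by (cases m)
  have j: "j \<in> {1..N}" using assms by (simp add: m dofs_def)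
  obtain y c where y: "\<And>l. y l \<in> interior (cell xs j)"
    and c: "\<And>w. w \<in> Vh N xs k \<Longrightarrow> coef w j i = (\<Sum>l\<le>k. c l * w (y l))"
    by (rule coef_point_values[OF j]) (rule that)
  have "y l \<in> off_nodes N xs" for l using y[of l] j unfolding off_nodes_def by blast
  then have "progressive F (\<lambda>t \<omega>. (if b then v else u) \<omega> (y l) t)" for l
    using sol by (auto simp: dg_solution_def Vh_process_def)
  then have "progressive F (\<lambda>t \<omega>. \<Sum>l\<in>{..k}. c l * (if b then v else u) \<omega> (y l) t)"
    by (intro progressive_lincomb)
  then show ?thesis
    by (rule progressive_cong) (use c u_Vh v_Vh in \<open>auto simp: state_def m dof_values_def\<close>)
qed

lemma state_initial: "AE \<omega> in M. \<forall>m\<in>dofs. state m 0 \<omega> = dof_values u0 v0 m"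
proof -
  have "AE \<omega> in M. \<forall>x\<in>off_nodes N xs. u \<omega> x 0 = u0 x \<and> v \<omega> x 0 = v0 x"
    using sol by (simp add: dg_solution_def)
  then show ?thesis
    using AE_space
  proof eventually_elim
    case (elim \<omega>)
    have "coef w j i = coef w' j i" if w: "w \<in> Vh N xs k" "w' \<in> Vh N xs k" and "\<forall>x\<in>off_nodes N xs. w x = w' x" and j: "j \<in> {1..N}"
      for w w' j i
    proof -
      obtain y c where y: "\<And>l. y l \<in> interior (cell xs j)"
        and c: "\<And>w. w \<in> Vh N xs k \<Longrightarrow> coef w j i = (\<Sum>l\<le>k. c l * w (y l))"
        by (rule coef_point_values[OF j]) (rule that)
      have "y l \<in> off_nodes N xs" for l using y[of l] j unfolding off_nodes_def by blast
      then show ?thesis using c w that(3) by simp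
    qed
    then show ?case using elim u_Vh[of \<omega> 0] v_Vh[of \<omega> 0] u0_Vh v0_Vh
      by (auto simp: dofs_def state_def dof_values_def)
  qed
qed

text \<open>The basis polynomial itself, not cut off outside its cell, serves as test function: the
  equation on cell \<open>j\<close> sees only its restriction to that cell.\<close>

lemma state_equation:
  assumes "m \<in> dofs"
  shows "ito_equation M F W (state m) (\<lambda>t \<omega>. dof_drift m (\<lambda>l. state l t \<omega>)) (diffusion m)"
proof -
  obtain b j i where m: "m = (b, j, i)" by (cases m)
  have j: "j \<in> {1..N}" "i \<le> k" using assms by (auto simp: m dofs_def)
  have \<phi>: "poly (p j i) \<in> Vh N xs k" by (rule poly_Vh[OF p_degree[OF j]])
  have st: "(\<lambda>l. state l t \<omega>) = dof_values (\<lambda>x. u \<omega> x t) (\<lambda>x. v \<omega> x t)" for t \<omega>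
    by (simp add: state_def)
  show ?thesis
  proof (cases b)
    case True
    have "ito_equation M F W
          (\<lambda>t \<omega>. LINT x:cell xs j|lborel. v \<omega> x t * poly (p j i) x)
          (\<lambda>t \<omega>. dg_drift N xs (\<lambda>x. u \<omega> x t)
                    (flux_u N xs \<alpha> \<beta>1 (\<lambda>x. u \<omega> x t) (\<lambda>x. v \<omega> x t)) (poly (p j i)) j)
          (\<lambda>t \<omega>. LINT x:cell xs j|lborel. f x t (u \<omega> x t) (v \<omega> x t) * poly (p j i) x)"
      using sol \<phi> j(1) unfolding dg_solution_def by blast
    moreover have "(\<lambda>t \<omega>. LINT x:cell xs j|lborel. v \<omega> x t * poly (p j i) x) = state m"
      "(\<lambda>t \<omega>. LINT x:cell xs j|lborel. f x t (u \<omega> x t) (v \<omega> x t) * poly (p j i) x) = diffusion m"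
      using True by (auto simp: m state_def dof_values_def coef_def diffusion_def forcing_def intro!: ext)
    ultimately have "ito_equation M F W (state m) (\<lambda>t \<omega>. dg_drift N xs (\<lambda>x. u \<omega> x t)
        (flux_u N xs \<alpha> \<beta>1 (\<lambda>x. u \<omega> x t) (\<lambda>x. v \<omega> x t)) (poly (p j i)) j) (diffusion m)"
      by simp
    then show ?thesis
      by (rule ito_equation_cong) (simp_all add: True m st dg_drift_dof(1)[OF u_Vh v_Vh j(1)])
  next
    case False
    have "ito_equation M F W
          (\<lambda>t \<omega>. LINT x:cell xs j|lborel. u \<omega> x t * poly (p j i) x)
          (\<lambda>t \<omega>. dg_drift N xs (\<lambda>x. v \<omega> x t)
                    (flux_v N xs \<alpha> \<beta>2 (\<lambda>x. u \<omega> x t) (\<lambda>x. v \<omega> x t)) (poly (p j i)) j)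
          (\<lambda>t \<omega>. LINT x:cell xs j|lborel. g x t (u \<omega> x t) (v \<omega> x t) * poly (p j i) x)"
      using sol \<phi> j(1) unfolding dg_solution_def by blast
    moreover have "(\<lambda>t \<omega>. LINT x:cell xs j|lborel. u \<omega> x t * poly (p j i) x) = state m"
      "(\<lambda>t \<omega>. LINT x:cell xs j|lborel. g x t (u \<omega> x t) (v \<omega> x t) * poly (p j i) x) = diffusion m"
      using False by (auto simp: m state_def dof_values_def coef_def diffusion_def forcing_def intro!: ext)
    ultimately have "ito_equation M F W (state m) (\<lambda>t \<omega>. dg_drift N xs (\<lambda>x. v \<omega> x t)
        (flux_v N xs \<alpha> \<beta>2 (\<lambda>x. u \<omega> x t) (\<lambda>x. v \<omega> x t)) (poly (p j i)) j) (diffusion m)"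
      by simp
    then show ?thesis
      by (rule ito_equation_cong) (simp_all add: False m st dg_drift_dof(2)[OF u_Vh v_Vh j(1)])
  qed
qed

lemma forcing_measurable:
  assumes \<omega>: "\<omega> \<in> space M" and t: "0 \<le> t" and j: "j \<in> {1..N}"
  shows "(\<lambda>x. indicator (cell xs j) x * forcing b t \<omega> x) \<in> borel_measurable lborel"
proof -
  define h where "h = (if b then f else g)"
  have h: "(\<lambda>(x, t, u, v). h x t u v) \<in> borel_measurable (restrict_space borel ({xs 0..xs N} \<times> {0..} \<times> UNIV \<times> UNIV))"
    using adm by (simp add: admissible_coefficients_def h_def)
  have sub: "{xs (j - 1)..xs j} \<subseteq> {xs 0..xs N}"
    using cell_bounds[OF j] by auto
  note m = composed_coefficient_measurable[OF h sub less_imp_le[OF incr[OF j]] t]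
  have "forcing b t \<omega> x = h x t (poly (expand (coef (\<lambda>x. u \<omega> x t)) j) x) (poly (expand (coef (\<lambda>x. v \<omega> x t)) j) x)"
    if "x \<in> {xs (j - 1)<..<xs j}" for x
    using Vh_expand[OF u_Vh[OF \<omega> t] j, of x] Vh_expand[OF v_Vh[OF \<omega> t] j, of x] that
    by (simp add: forcing_def h_def interior_cell)
  from interval_agree(1)[OF incr[OF j] this m] show ?thesis by (simp add: cell_def)
qed

lemma forcing_bound:
  obtains B c where "0 \<le> B" "0 \<le> c" "\<And>j i x. j \<in> {1..N} \<Longrightarrow> i \<le> k \<Longrightarrow> x \<in> cell xs j \<Longrightarrow> \<bar>poly (p j i) x\<bar> \<le> B"
    "\<And>\<omega> t b j x. \<omega> \<in> space M \<Longrightarrow> 0 \<le> (t :: real) \<Longrightarrow> j \<in> {1..N} \<Longrightarrow> x \<in> interior (cell xs j) \<Longrightarrow>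
      \<bar>forcing b t \<omega> x\<bar> \<le> c * (1 + (\<Sum>m\<in>dofs. \<bar>state m t \<omega>\<bar>))"
proof -
  obtain B where B: "0 \<le> B" "\<And>j i x. j \<in> {1..N} \<Longrightarrow> i \<le> k \<Longrightarrow> x \<in> cell xs j \<Longrightarrow> \<bar>poly (p j i) x\<bar> \<le> B"
    and w: "\<And>u v b j x. u \<in> Vh N xs k \<Longrightarrow> v \<in> Vh N xs k \<Longrightarrow> j \<in> {1..N} \<Longrightarrow> x \<in> interior (cell xs j) \<Longrightarrow>
      \<bar>(if b then v else u) x\<bar> \<le> B * (\<Sum>m\<in>dofs. \<bar>dof_values u v m\<bar>)"
    by (rule dofs_interior_bound) (rule that)
  show thesis
  proof (rule that[of B "\<bar>C\<bar> * (1 + 2 * B)", OF B(1) _ B(2)])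
    fix \<omega> and t :: real and b j x assume \<omega>: "\<omega> \<in> space M" and t: "0 \<le> t" and j: "j \<in> {1..N}" and x: "x \<in> interior (cell xs j)"
    define S where "S = (\<Sum>m\<in>dofs. \<bar>state m t \<omega>\<bar>)"
    have S0: "0 \<le> S" by (auto simp: S_def intro!: sum_nonneg)
    have uv: "\<bar>u \<omega> x t\<bar> \<le> B * S" "\<bar>v \<omega> x t\<bar> \<le> B * S"
      using w[OF u_Vh[OF \<omega> t] v_Vh[OF \<omega> t] j x, of False] w[OF u_Vh[OF \<omega> t] v_Vh[OF \<omega> t] j x, of True]
      by (simp_all add: S_def state_def)
    have "x \<in> {xs 0..xs N}"
      using x cell_bounds[OF j] by (auto simp: interior_cell)
    then have "\<bar>f x t (u \<omega> x t) (v \<omega> x t)\<bar> + \<bar>g x t (u \<omega> x t) (v \<omega> x t)\<bar> \<le> C * (1 + \<bar>u \<omega> x t\<bar> + \<bar>v \<omega> x t\<bar>)"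
      using adm t unfolding admissible_coefficients_def by blast
    then have "\<bar>forcing b t \<omega> x\<bar> \<le> C * (1 + \<bar>u \<omega> x t\<bar> + \<bar>v \<omega> x t\<bar>)"
      by (simp add: forcing_def) linarith
    \<comment> \<open>Both fields are at most \<open>B * S\<close> in absolute value, which gives
      the factor \<open>1 + 2 * B\<close>; the absolute value of \<open>C\<close> is taken because
      its sign is not assumed.\<close>
    also have "\<dots> \<le> \<bar>C\<bar> * ((1 + 2 * B) * (1 + S))"
    proof (rule mult_mono)
      show "1 + \<bar>u \<omega> x t\<bar> + \<bar>v \<omega> x t\<bar> \<le> (1 + 2 * B) * (1 + S)"
        using uv S0 B(1) by (simp add: algebra_simps)
    qed auto
    finally show "\<bar>forcing b t \<omega> x\<bar> \<le> \<bar>C\<bar> * (1 + 2 * B) * (1 + (\<Sum>m\<in>dofs. \<bar>state m t \<omega>\<bar>))"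
      by (simp add: S_def mult.assoc)
  qed (use B(1) in auto)
qed

lemma diffusion_growth:
  obtains K where "0 \<le> K" "\<And>t \<omega>. 0 \<le> (t :: real) \<Longrightarrow> \<omega> \<in> space M \<Longrightarrow>
      (\<Sum>m\<in>dofs. (diffusion m t \<omega>)\<^sup>2) \<le> K * (1 + (\<Sum>m\<in>dofs. (state m t \<omega>)\<^sup>2))"
proof -
  obtain B c where B: "0 \<le> B" "0 \<le> c" "\<And>j i x. j \<in> {1..N} \<Longrightarrow> i \<le> k \<Longrightarrow> x \<in> cell xs j \<Longrightarrow> \<bar>poly (p j i) x\<bar> \<le> B"
    and fb: "\<And>\<omega> t b j x. \<omega> \<in> space M \<Longrightarrow> 0 \<le> (t :: real) \<Longrightarrow> j \<in> {1..N} \<Longrightarrow> x \<in> interior (cell xs j) \<Longrightarrow>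
      \<bar>forcing b t \<omega> x\<bar> \<le> c * (1 + (\<Sum>m\<in>dofs. \<bar>state m t \<omega>\<bar>))"
    by (rule forcing_bound) (rule that)
  \<comment> \<open>A coefficient of the forcing will be at most \<open>d * (1 + S)\<close>:
    \<open>c\<close> stems from the forcing, \<open>B\<close> from the basis polynomial, and the
    length of the whole interval bounds that of the cell.\<close>
  define d where "d = c * B * (xs N - xs 0)"
  define n where "n = real (card dofs)"
  show thesis
  proof (rule that[of "n * (d\<^sup>2 * (2 * (1 + n)))"])
    show "0 \<le> n * (d\<^sup>2 * (2 * (1 + n)))" by (simp add: n_def)
    fix t :: real and \<omega> assume t: "0 \<le> t" and \<omega>: "\<omega> \<in> space M"
    define S where "S = (\<Sum>m\<in>dofs. \<bar>state m t \<omega>\<bar>)"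
    define Q where "Q = (\<Sum>m\<in>dofs. (state m t \<omega>)\<^sup>2)"
    have S0: "0 \<le> S" "0 \<le> Q" by (auto simp: S_def Q_def intro!: sum_nonneg)
    have SQ: "S\<^sup>2 \<le> n * Q"
      using sum_squared_le_sum_of_squares[of "\<lambda>m. \<bar>state m t \<omega>\<bar>" dofs] by (simp add: S_def Q_def n_def mult.commute)
    \<comment> \<open>Passing from \<open>S\<close> to the sum of squares \<open>Q\<close> costs the
      factor \<open>2 * (1 + n)\<close>; summing over the \<open>n\<close> components later costs
      another \<open>n\<close>.\<close>
    have "(1 + S)\<^sup>2 \<le> 2 * (1 + S\<^sup>2)" using zero_le_power2[of "1 - S"] by (simp add: power2_eq_square algebra_simps)
    also have "\<dots> \<le> 2 * ((1 + n) * (1 + Q))"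
      using SQ S0 by (simp add: algebra_simps n_def)
    finally have S2: "(1 + S)\<^sup>2 \<le> 2 * ((1 + n) * (1 + Q))" .
    have "(diffusion m t \<omega>)\<^sup>2 \<le> d\<^sup>2 * (2 * (1 + n)) * (1 + Q)" if m: "m \<in> dofs" for m
    proof -
      obtain b j i where bji: "m = (b, j, i)" by (cases m)
      have j: "j \<in> {1..N}" "i \<le> k" using m by (auto simp: bji dofs_def)
      have "\<bar>diffusion m t \<omega>\<bar> \<le> c * (1 + S) * B * (xs j - xs (j - 1))"
        unfolding diffusion_def bji coef_def S_def prod.case
        by (rule bounded_coef(2)[OF j(1) forcing_measurable[OF \<omega> t j(1)] fb[OF \<omega> t j(1)] B(3)[OF j]])
      also have "\<dots> \<le> c * (1 + S) * B * (xs N - xs 0)"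
        using cell_bounds[OF j(1)] B S0 by (intro mult_left_mono) auto
      also have "\<dots> = d * (1 + S)" by (simp add: d_def)
      finally have "\<bar>diffusion m t \<omega>\<bar>\<^sup>2 \<le> (d * (1 + S))\<^sup>2" by (intro power_mono) auto
      also have "\<dots> \<le> d\<^sup>2 * (2 * ((1 + n) * (1 + Q)))"
        unfolding power_mult_distrib by (intro mult_left_mono S2) auto
      finally show ?thesis by (simp add: algebra_simps)
    qed
    then have "(\<Sum>m\<in>dofs. (diffusion m t \<omega>)\<^sup>2) \<le> (\<Sum>m\<in>dofs. d\<^sup>2 * (2 * (1 + n)) * (1 + Q))" by (rule sum_mono)
    then show "(\<Sum>m\<in>dofs. (diffusion m t \<omega>)\<^sup>2) \<le> n * (d\<^sup>2 * (2 * (1 + n))) * (1 + (\<Sum>m\<in>dofs. (state m t \<omega>)\<^sup>2))"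
      by (simp add: n_def Q_def)
  qed
qed

text \<open>By \<open>L2_norm_proj\<close> the squared norm of each projection is the sum of the
  squared coefficients of its forcing, and these coefficients are the diffusion of the finite
  system.\<close>

lemma noise_dofs:
  assumes \<omega>: "\<omega> \<in> space M" and t: "0 \<le> t"
  shows "(L2_norm N xs (L2_proj N xs k (\<lambda>x. f x t (u \<omega> x t) (v \<omega> x t))))\<^sup>2
     + (L2_norm N xs (L2_proj N xs k (\<lambda>x. g x t (u \<omega> x t) (v \<omega> x t))))\<^sup>2 = (\<Sum>m\<in>dofs. (diffusion m t \<omega>)\<^sup>2)"
proof -
  obtain B c where fb: "\<And>\<omega> t b j x. \<omega> \<in> space M \<Longrightarrow> 0 \<le> (t :: real) \<Longrightarrow> j \<in> {1..N} \<Longrightarrow> x \<in> interior (cell xs j) \<Longrightarrow>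
      \<bar>forcing b t \<omega> x\<bar> \<le> c * (1 + (\<Sum>m\<in>dofs. \<bar>state m t \<omega>\<bar>))"
    by (rule forcing_bound) (rule that)
  have i: "set_integrable lborel (cell xs j) (\<lambda>x. forcing b t \<omega> x * poly q x)" if j: "j \<in> {1..N}" for b j q
  proof -
    have "compact (poly q ` cell xs j)"
      unfolding cell_def by (intro compact_continuous_image continuous_intros compact_Icc)
    then have "\<exists>D. \<forall>x\<in>cell xs j. \<bar>poly q x\<bar> \<le> D"
      by (auto dest!: compact_imp_bounded simp: bounded_iff)
    then obtain D where D: "\<And>x. x \<in> cell xs j \<Longrightarrow> \<bar>poly q x\<bar> \<le> D" by blast
    show ?thesis
      by (rule bounded_coef(1)[OF j forcing_measurable[OF \<omega> t j] fb[OF \<omega> t j] D])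
  qed
  have "(L2_norm N xs (L2_proj N xs k (forcing b t \<omega>)))\<^sup>2 = (\<Sum>j\<in>{1..N}. \<Sum>i\<le>k. (coef (forcing b t \<omega>) j i)\<^sup>2)" for b
    by (rule L2_norm_proj[OF i forcing_measurable[OF \<omega> t]])
  from this[of True] this[of False] show ?thesis
    by (simp add: forcing_def[abs_def] sum_dofs diffusion_def)
qed

theorem energy_estimate:
  assumes "0 \<le> \<beta>1" "0 \<le> \<beta>2" "0 \<le> t"
  defines "energy \<equiv> \<lambda>\<omega>. (L2_norm N xs (\<lambda>x. u \<omega> x t))\<^sup>2 + (L2_norm N xs (\<lambda>x. v \<omega> x t))\<^sup>2"
    and "energy0 \<equiv> (L2_norm N xs u0)\<^sup>2 + (L2_norm N xs v0)\<^sup>2"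
    and "noise \<equiv> \<lambda>s \<omega>. (L2_norm N xs (L2_proj N xs k (\<lambda>x. f x s (u \<omega> x s) (v \<omega> x s))))\<^sup>2
                      + (L2_norm N xs (L2_proj N xs k (\<lambda>x. g x s (u \<omega> x s) (v \<omega> x s))))\<^sup>2"
  shows "integrable M energy" "\<And>s. 0 \<le> s \<Longrightarrow> integrable M (noise s)"
    "set_integrable lborel {0..t} (\<lambda>s. expectation (noise s))"
    "expectation energy \<le> energy0 + (LINT s:{0..t}|lborel. expectation (noise s))"
    "\<beta>1 = 0 \<Longrightarrow> \<beta>2 = 0 \<Longrightarrow> expectation energy = energy0 + (LINT s:{0..t}|lborel. expectation (noise s))"
proof -
  obtain K where K: "0 \<le> K" "\<And>t \<omega>. 0 \<le> (t :: real) \<Longrightarrow> \<omega> \<in> space M \<Longrightarrow>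
      (\<Sum>m\<in>dofs. (diffusion m t \<omega>)\<^sup>2) \<le> K * (1 + (\<Sum>m\<in>dofs. (state m t \<omega>)\<^sup>2))"
    by (rule diffusion_growth) (rule that)
  \<comment> \<open>The columns of the drift matrix are the drifts of the unit vectors.\<close>
  define A where "A m m' = dof_drift m (\<lambda>l. if l = m' then 1 else 0)" for m m'
  have A: "dof_drift m x = (\<Sum>m'\<in>dofs. A m m' * x m')" if "m \<in> dofs" for m x
    unfolding A_def by (rule dof_drift_matrix[OF that])
  interpret sde: linear_sde M F W dofs state diffusion A "dof_values u0 v0" K
  proof unfold_locales
    show "ito_equation M F W (state i) (\<lambda>s \<omega>. \<Sum>j\<in>dofs. A i j * state j s \<omega>) (diffusion i)" if "i \<in> dofs" for i
      using state_equation[OF that] unfolding A[OF that] .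
  qed (use finite_dofs K state_progressive state_initial in auto)
  have noise_eq: "noise s \<omega> = sde.sqH s \<omega>" if "\<omega> \<in> space M" "0 \<le> s" for s \<omega>
    using noise_dofs[OF that] by (simp add: noise_def sde.sqH_def)
  have energy_eq: "energy \<omega> = sde.sqX t \<omega>" if "\<omega> \<in> space M" for \<omega>
    using L2_norm_dofs[OF u_Vh v_Vh, OF that \<open>0 \<le> t\<close> that \<open>0 \<le> t\<close>] by (simp add: energy_def sde.sqX_def state_def)
  have energy0_eq: "energy0 = (\<Sum>m\<in>dofs. (dof_values u0 v0 m)\<^sup>2)"
    using L2_norm_dofs[OF u0_Vh v0_Vh] by (simp add: energy0_def)
  have Enoise: "expectation (noise s) = expectation (sde.sqH s)" if "0 \<le> s" for s
    using that by (intro Bochner_Integration.integral_cong) (auto simp: noise_eq)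
  note id = sde.energy_identity[OF \<open>0 \<le> t\<close>]
  show "integrable M energy"
    using id(1) by (subst Bochner_Integration.integrable_cong[OF refl energy_eq]) auto
  show "integrable M (noise s)" if "0 \<le> s" for s
    using id(2)[OF that] that by (subst Bochner_Integration.integrable_cong[OF refl noise_eq]) auto
  show "set_integrable lborel {0..t} (\<lambda>s. expectation (noise s))"
    using id(3) by (subst set_integrable_cong[OF refl refl, of _ _ "\<lambda>s. expectation (sde.sqH s)"]) (auto simp: Enoise)
  \<comment> \<open>\<open>2 * D s\<close> is the rate at which the drift changes the mean energy: a
    nonpositive combination of mean squared jumps, and zero when \<open>\<beta>1\<close> and
    \<open>\<beta>2\<close> vanish.\<close>
  define D where "D s = expectation (\<lambda>\<omega>. \<Sum>i\<in>dofs. sde.drift i s \<omega> * state i s \<omega>)" for s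
  have drift_eq: "(\<Sum>i\<in>dofs. sde.drift i s \<omega> * state i s \<omega>)
    = - (\<Sum>j\<in>{1..N}. \<beta>1 * (right_value (dof_part (\<lambda>l. state l s \<omega>) True) j - left_value (dof_part (\<lambda>l. state l s \<omega>) True) j)\<^sup>2
        + \<beta>2 * (right_value (dof_part (\<lambda>l. state l s \<omega>) False) j - left_value (dof_part (\<lambda>l. state l s \<omega>) False) j)\<^sup>2)" for s \<omega>
    unfolding dof_drift_dissipative[symmetric] by (intro sum.cong) (simp_all add: sde.drift_def A)
  have "expectation energy = expectation (sde.sqX t)"
    by (rule Bochner_Integration.integral_cong) (auto simp: energy_eq)
  also have "\<dots> = energy0 + 2 * (LINT s:{0..t}|lborel. D s) + (LINT s:{0..t}|lborel. expectation (sde.sqH s))"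
    using id(4) by (simp add: energy0_eq D_def)
  also have "(LINT s:{0..t}|lborel. expectation (sde.sqH s)) = (LINT s:{0..t}|lborel. expectation (noise s))"
    by (rule set_lebesgue_integral_cong) (auto simp: Enoise)
  finally have eq: "expectation energy = energy0 + 2 * (LINT s:{0..t}|lborel. D s) + (LINT s:{0..t}|lborel. expectation (noise s))" .
  have "(\<Sum>i\<in>dofs. sde.drift i s \<omega> * state i s \<omega>) \<le> 0" for s \<omega>
    unfolding drift_eq using assms(1,2) by (simp add: sum_nonneg)
  then have "0 \<le> expectation (\<lambda>\<omega>. - (\<Sum>i\<in>dofs. sde.drift i s \<omega> * state i s \<omega>))" for s
    by (intro integral_nonneg_AE) simp
  then have D: "D s \<le> 0" for s by (simp add: D_def)
  have "0 \<le> (LINT s:{0..t}|lborel. - D s)"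
    unfolding set_lebesgue_integral_def using D by (intro integral_nonneg_AE) (auto simp: indicator_def)
  moreover have "(LINT s:{0..t}|lborel. - D s) = - (LINT s:{0..t}|lborel. D s)"
    by (simp add: set_lebesgue_integral_def)
  ultimately have "(LINT s:{0..t}|lborel. D s) \<le> 0" by linarith
  then show "expectation energy \<le> energy0 + (LINT s:{0..t}|lborel. expectation (noise s))" using eq by simp
  show "expectation energy = energy0 + (LINT s:{0..t}|lborel. expectation (noise s))" if "\<beta>1 = 0" "\<beta>2 = 0"
  proof -
    have "D s = 0" for s unfolding D_def drift_eq using that by simp
    then show ?thesis using eq by simp
  qed
qed

end

theorem theorem2p2:
  fixes M :: "'w measure" and F :: "real \<Rightarrow> 'w measure" and W :: "real \<Rightarrow> 'w \<Rightarrow> real"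
    and N k :: nat and xs :: "nat \<Rightarrow> real" and \<rho> C \<alpha> \<beta>1 \<beta>2 t :: real
    and f g :: "real \<Rightarrow> real \<Rightarrow> real \<Rightarrow> real \<Rightarrow> real"
    and u0 v0 :: "real \<Rightarrow> real" and u v :: "'w \<Rightarrow> real \<Rightarrow> real \<Rightarrow> real"
  assumes "brownian_motion M F W"
    and "regular_mesh \<rho> N xs"
    and "admissible_coefficients C {xs 0..xs N} f g"
    and "\<beta>1 \<ge> 0" and "\<beta>2 \<ge> 0"
    and "dg_solution M F W N xs k \<alpha> \<beta>1 \<beta>2 f g u0 v0 u v"
    and "t \<ge> 0"
  shows
    "let energy = (\<lambda>\<omega>. (L2_norm N xs (\<lambda>x. u \<omega> x t))\<^sup>2 + (L2_norm N xs (\<lambda>x. v \<omega> x t))\<^sup>2);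
         energy0 = (L2_norm N xs u0)\<^sup>2 + (L2_norm N xs v0)\<^sup>2;
         noise = (\<lambda>s \<omega>. (L2_norm N xs (L2_proj N xs k (\<lambda>x. f x s (u \<omega> x s) (v \<omega> x s))))\<^sup>2
                      + (L2_norm N xs (L2_proj N xs k (\<lambda>x. g x s (u \<omega> x s) (v \<omega> x s))))\<^sup>2)
     in integrable M energy \<and>
        (\<forall>s\<in>{0..t}. integrable M (noise s)) \<and>
        set_integrable lborel {0..t} (\<lambda>s. prob_space.expectation M (noise s)) \<and>
        prob_space.expectation M energy
          \<le> energy0 + (LINT s:{0..t}|lborel. prob_space.expectation M (noise s)) \<and>
        (\<beta>1 = 0 \<and> \<beta>2 = 0 \<longrightarrow>
         prob_space.expectation M energy
          = energy0 + (LINT s:{0..t}|lborel. prob_space.expectation M (noise s)))"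
proof -
  have N: "1 \<le> N" and incr: "\<And>j. j \<in> {1..N} \<Longrightarrow> xs (j - 1) < xs j"
    using assms(2) by (auto simp: regular_mesh_def)
  \<comment> \<open>Bundles the basis properties of one cell, so that bases can be chosen for all
    cells at once.\<close>
  define good where "good j p \<longleftrightarrow> (\<forall>i\<le>k. degree (p i) \<le> k) \<and>
    (\<forall>i\<le>k. \<forall>l\<le>k. poly_inner (xs (j - 1)) (xs j) (p i) (p l) = (if i = l then 1 else 0)) \<and>
    (\<forall>q. degree q \<le> k \<longrightarrow> q = (\<Sum>i\<le>k. smult (poly_inner (xs (j - 1)) (xs j) q (p i)) (p i)))"
    for j and p :: "nat \<Rightarrow> real poly"
  have "\<exists>p. good j p" if "j \<in> {1..N}" for j
    unfolding good_def by (rule orthonormal_polys[OF incr[OF that], of k]) blast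
  then obtain p where good: "\<And>j. j \<in> {1..N} \<Longrightarrow> good j (p j)" by metis
  interpret dg_solution_setting M F W N k xs p \<alpha> \<beta>1 \<beta>2 C f g u0 v0 u v
  proof unfold_locales
    show "q = (\<Sum>i\<le>k. smult (poly_inner (xs (j - 1)) (xs j) q (p j i)) (p j i))"
      if "j \<in> {1..N}" "degree q \<le> k" for j q
      using good[OF that(1)] that(2) unfolding good_def by blast
  qed (use assms N incr good in \<open>auto simp: good_def\<close>)
  show ?thesis
    unfolding Let_def using energy_estimate[OF assms(4,5,7)] by auto
qed

end
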